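(* Let $\xi$ be a subordinator with Laplace exponent $\phi$ and Lévy measure $\pi$. Let $\Phi(q)=\int_0^q\phi(s)\,\mathrm ds$ for $q\ge0$, let $\Phi^{-1}:[0,\infty)\to[0,\infty)$ be its inverse function, and let $\rho(t)=\inf\{r\ge 0:\int_0^r\xi_u\,\mathrm du>t\}$ for $t\ge 0$. Assume that $\phi$ is regularly varying at $0$ with index $\gamma\in(0,1]$, and that the following three conditions hold: $$\int_0^\infty\frac{\pi(\mathrm dx)}{x}=\infty,\qquad \int_1^\infty e^{a_0\,\mathrm{Re}(\Phi(ix))}\,\mathrm dx<\infty\ \text{ for some } a_0>0,\qquad \limsup_{x\to\infty}\mathrm{Re}(\Phi(ix))<0.$$ For $q>0$ define $$b(q):=\frac{\sqrt\pi}{(\gamma+1)\,\Gamma\!\left(\frac{\gamma}{\gamma+1}\right)}\,\phi(q)\,\Phi(q)^{\frac{1}{2(\gamma+1)}-\frac34}$$ (where $\sqrt\pi$ is the square root of the number $\pi$). Then for every $q>0$, $$\mathbb E\left[e^{-q\xi_{\rho(t)}}\right]\ \underset{t\to\infty}{\sim}\ b(q)\,t^{1/4}\,\Phi^{-1}(t^{-1/2})\,e^{-2\sqrt{\Phi(q)t}}.$$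
   Context: A subordinator here is a càdlàg non-decreasing $[0,\infty]$-valued process with stationary independent increments, possibly killed (sent to $\infty$) at rate $\kappa$. The subordinator $\xi$ starts from $\xi_0=0$ and has Laplace exponent $\phi(q)=-\log\mathbb E[e^{-q\xi_1}]=\kappa+cq+\int_0^\infty(1-e^{-qx})\,\pi(\mathrm dx)$, where $\kappa\ge 0$, $c\ge 0$ and $\pi$ is a measure on $(0,\infty)$ with $\int_0^\infty(1\wedge x)\,\pi(\mathrm dx)<\infty$. Standing assumption: $\pi(0,\infty)>0$. The function $\Phi$ is extended to the imaginary axis by $\Phi(ix)=\kappa (ix)+\frac c2(ix)^2+\int_0^\infty\bigl(ix-\frac{1-e^{-ixy}}{y}\bigr)\pi(\mathrm dy)$, so that $\mathrm{Re}(\Phi(ix))=-\frac c2x^2-\int_0^\infty(1-\cos(xy))\frac{\pi(\mathrm dy)}{y}$. A function $f$ is regularly varying at $0$ with index $\alpha\in\mathbb R$ if $\lim_{x\to0}f(\lambda x)/f(x)=\lambda^\alpha$ for all $\lambda>0$ (here regular variation of $\phi$ with index $\gamma>0$ forces $\kappa=0$). $f(t)\sim g(t)$ means $f(t)/g(t)\to1$. *)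

theory Defs
  imports "HOL-Probability.Probability" "HOL-Library.Landau_Symbols"
begin

text \<open>The natural filtration of a process indexed by the nonnegative reals; values of the process at
  negative times are never used.\<close>

definition natural_filtration :: "'a measure \<Rightarrow> (real \<Rightarrow> 'a \<Rightarrow> ennreal) \<Rightarrow> real \<Rightarrow> 'a set set" where
  "natural_filtration M \<xi> s =
     sigma_sets (space M) {\<xi> u -` B \<inter> space M | u B. 0 \<le> u \<and> u \<le> s \<and> B \<in> sets borel}"

text \<open>Possibly killed subordinators started from 0, with \<open>\<infinity>\<close> as cemetery state (absorbing by
  monotonicity). For a killed process, stationarity and independence of the increments mean: for all
  \<open>s\<close> and \<open>t\<close>, under the conditional probability given survival up to time \<open>s\<close> (the measure
  \<open>uniform_measure M {\<xi>\<^sub>s < \<infinity>}\<close>), the increment over \<open>[s, s + t]\<close> is independent of the past up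
  to time \<open>s\<close> and has the same (\<open>[0,\<infinity>]\<close>-valued) law as \<open>\<xi>\<^sub>t\<close> under \<open>M\<close>. Survival is then
  memoryless, so killing happens at an exponential time of some rate \<open>\<kappa> \<ge> 0\<close>; without killing these
  are the usual conditions.\<close>

locale subordinator = prob_space M
  for M :: "'a measure" +
  fixes \<xi> :: "real \<Rightarrow> 'a \<Rightarrow> ennreal"
  assumes measurable_process: "\<And>t. 0 \<le> t \<Longrightarrow> \<xi> t \<in> borel_measurable M"
    and start_zero: "\<And>\<omega>. \<omega> \<in> space M \<Longrightarrow> \<xi> 0 \<omega> = 0"
    and mono_paths: "\<And>\<omega>. \<omega> \<in> space M \<Longrightarrow> mono_on {0..} (\<lambda>t. \<xi> t \<omega>)"
    and right_continuous_paths: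
      "\<And>\<omega> t. \<omega> \<in> space M \<Longrightarrow> 0 \<le> t \<Longrightarrow> ((\<lambda>s. \<xi> s \<omega>) \<longlongrightarrow> \<xi> t \<omega>) (at_right t)"
    and left_limits_paths:
      "\<And>\<omega> t. \<omega> \<in> space M \<Longrightarrow> 0 < t \<Longrightarrow> \<exists>l. ((\<lambda>s. \<xi> s \<omega>) \<longlongrightarrow> l) (at_left t)"
    and stationary_increments:
      "\<And>s t. 0 \<le> s \<Longrightarrow> 0 \<le> t \<Longrightarrow>
        distr (uniform_measure M {\<omega> \<in> space M. \<xi> s \<omega> < \<infinity>}) borel (\<lambda>\<omega>. \<xi> (s + t) \<omega> - \<xi> s \<omega>)
          = distr M borel (\<xi> t)"
    and independent_increments:
      "\<And>s t. 0 \<le> s \<Longrightarrow> 0 \<le> t \<Longrightarrow>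
        prob_space.indep_set (uniform_measure M {\<omega> \<in> space M. \<xi> s \<omega> < \<infinity>})
          (natural_filtration M \<xi> s)
          {(\<lambda>\<omega>. \<xi> (s + t) \<omega> - \<xi> s \<omega>) -` B \<inter> space M | B. B \<in> sets borel}"

text \<open>\<open>e\<^bsup>-qx\<^esup>\<close> for \<open>x \<in> [0,\<infinity>]\<close>, with \<open>e\<^bsup>-q\<infinity>\<^esup> = 0\<close> also for \<open>q = 0\<close>; this is the convention
  under which the Laplace exponent at \<open>0\<close> is the killing rate.\<close>

definition exp_neg_mult :: "real \<Rightarrow> ennreal \<Rightarrow> real" where
  "exp_neg_mult q x = (if x = \<infinity> then 0 else exp (- q * enn2real x))"

definition laplace_exponent :: "'a measure \<Rightarrow> (real \<Rightarrow> 'a \<Rightarrow> ennreal) \<Rightarrow> real \<Rightarrow> real" where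
  "laplace_exponent M \<xi> q = - ln (\<integral>\<omega>. exp_neg_mult q (\<xi> 1 \<omega>) \<partial>M)"

text \<open>\<open>\<phi>\<close> is the Laplace exponent with killing rate \<open>\<kappa>\<close>, drift \<open>c\<close> and Levy measure \<open>\<pi>\<close>. A measure
  on \<open>(0,\<infinity>)\<close> is rendered as a Borel measure on the reals that does not charge \<open>(-\<infinity>,0]\<close>.\<close>

definition levy_khintchine :: "(real \<Rightarrow> real) \<Rightarrow> real \<Rightarrow> real \<Rightarrow> real measure \<Rightarrow> bool" where
  "levy_khintchine \<phi> \<kappa> c \<pi> \<longleftrightarrow>
     0 \<le> \<kappa> \<and> 0 \<le> c \<and>
     sets \<pi> = sets borel \<and> emeasure \<pi> {..0} = 0 \<and>
     (\<integral>\<^sup>+x. ennreal (min 1 x) \<partial>\<pi>) < \<infinity> \<and>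
     (\<forall>q\<ge>0. \<phi> q = \<kappa> + c * q + (\<integral>x. (1 - exp (- q * x)) \<partial>\<pi>))"

text \<open>The value at \<open>ix\<close> of the extension of \<open>\<Phi>\<close> to the imaginary axis.\<close>

definition Phi_imag :: "real \<Rightarrow> real \<Rightarrow> real measure \<Rightarrow> real \<Rightarrow> complex" where
  "Phi_imag \<kappa> c \<pi> x =
     of_real \<kappa> * (\<i> * of_real x) + of_real c / 2 * (\<i> * of_real x)^2
     + (\<integral>y. (\<i> * of_real x - (1 - exp (- \<i> * of_real x * of_real y)) / of_real y) \<partial>\<pi>)"

definition regularly_varying_at_0 :: "(real \<Rightarrow> real) \<Rightarrow> real \<Rightarrow> bool" where
  "regularly_varying_at_0 f \<alpha> \<longleftrightarrow>
     (\<forall>l>0. ((\<lambda>x. f (l * x) / f x) \<longlongrightarrow> l powr \<alpha>) (at_right 0))"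

text \<open>\<open>\<rho>(t)\<close>, with \<open>inf \<emptyset> = \<infinity>\<close>.\<close>

definition rho :: "(real \<Rightarrow> 'a \<Rightarrow> ennreal) \<Rightarrow> real \<Rightarrow> 'a \<Rightarrow> ennreal" where
  "rho \<xi> t \<omega> = Inf {ennreal r | r. 0 \<le> r \<and> (\<integral>\<^sup>+u\<in>{0..r}. \<xi> u \<omega> \<partial>lborel) > ennreal t}"

text \<open>\<open>\<xi>\<^bsub>\<rho>(t)\<^esub>\<close>. If \<open>\<rho>(t) = \<infinity>\<close>, the path is identically \<open>0\<close> by monotonicity, and since
  \<open>enn2real \<infinity> = 0\<close> the value below is \<open>\<xi>\<^sub>0 = 0 = \<xi>\<^bsub>\<infinity>-\<^esub>\<close>.\<close>

definition time_changed :: "(real \<Rightarrow> 'a \<Rightarrow> ennreal) \<Rightarrow> real \<Rightarrow> 'a \<Rightarrow> ennreal" where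
  "time_changed \<xi> t \<omega> = \<xi> (enn2real (rho \<xi> t \<omega>)) \<omega>"

definition b_coeff :: "(real \<Rightarrow> real) \<Rightarrow> (real \<Rightarrow> real) \<Rightarrow> real \<Rightarrow> real \<Rightarrow> real" where
  "b_coeff \<phi> \<Phi> \<gamma> q =
     sqrt pi / ((\<gamma> + 1) * Gamma (\<gamma> / (\<gamma> + 1))) * \<phi> q * \<Phi> q powr (1 / (2 * (\<gamma> + 1)) - 3 / 4)"

end

theory Submission
  imports Defs "HOL-Complex_Analysis.Complex_Analysis" "HOL-Real_Asymp.Real_Asymp"
begin

text \<open>The Laplace transform in \<open>t\<close> of \<open>F(t) = E[exp (- q \<xi>\<^bsub>\<rho>(t)\<^esub>)]\<close> is explicit in terms of \<open>\<Phi>\<close>, and inverting it gives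
  \<open>F(t) = \<phi>(q) \<integral> exp (- r \<Phi>(q) - t / r) \<mu>(dr)\<close>, where \<open>\<mu>\<close> is the positive measure with Laplace transform
  \<open>(\<Phi>\<^sup>-\<^sup>1)'\<close>. Formally \<open>\<mu>\<close> has the density \<open>r \<mapsto> (1 / 2 pi) \<integral> exp (r \<Phi>(ix)) dx\<close>, which is nonnegative as a limit of
  densities of compensated compound Poisson variables at \<open>0\<close>. The integral converges for \<open>r \<ge> a0\<close> only; adding a
  drift \<open>2 \<epsilon>\<close> to \<open>\<phi>\<close> makes it converge for all \<open>r > 0\<close>, and letting \<open>\<epsilon> \<rightarrow> 0\<close> determines \<open>F\<close> up to an
  error \<open>exp (- t / a0)\<close>. By regular variation \<open>\<Phi>(\<lambda> s) / \<Phi>(\<lambda>) \<rightarrow> s\<^sup>\<gamma>\<^sup>+\<^sup>1\<close> on the closed right half-plane, so the density is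
  asymptotic to \<open>\<Phi>\<^sup>-\<^sup>1(1 / r) / ((\<gamma> + 1) \<Gamma>(\<gamma> / (\<gamma> + 1)))\<close>, and Laplace's method at the saddle point
  \<open>r = sqrt (t / \<Phi>(q))\<close> finishes the proof.\<close>

section \<open>Bernstein functions on the right half-plane\<close>

text \<open>The explicit Laplace transform comes from substituting t = A(r), the area under the path
  up to r, which trades dt for X_r dr and asks for E[X_r exp(-q X_r - a A(r))]. That is a
  q-derivative of exp(-(Phi(q + a r) - Phi(q)) / a), itself a limit of products over independent
  increments. Inverting the transform gives only averaged information; pointwise bounds are
  recovered because F and the mixture truncated to r >= a0 are nonincreasing and the latter is
  continuous. The truncation error exp(-t/a0) is negligible against exp(-2 sqrt(Phi(q) t)), so
  nothing about mu near 0 has to be known. The drift 2 epsilon adds epsilon s^2 to Phi, a Gaussian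
  component under which all integrals on the imaginary axis converge absolutely; no process is
  attached to it. The constant in b comes from self-similarity of the limiting stable density, so
  that its Laplace transform at one point determines it; the powers of t and Phi(q) come from the
  width of the saddle and from moving the argument of the inverse function from sqrt(Phi(q) / t) to
  t^(-1/2).\<close>

lemma norm_exp_diff_half_plane:
  fixes s s' :: complex and y :: real
  assumes "0 \<le> Re s" "0 \<le> Re s'" "0 \<le> y"
  shows "norm (exp (- s * of_real y) - exp (- s' * of_real y)) \<le> norm (s - s') * y"
proof -
  have "norm (exp (- s * of_real y) - exp (- s' * of_real y)) \<le> y * norm (s - s')"
  proof (rule field_differentiable_bound)
    show "convex {z::complex. 0 \<le> Re z}"
      using convex_halfspace_Re_ge[of 0] by simp
    show "((\<lambda>s. exp (- s * of_real y)) has_field_derivative - (of_real y) * exp (- z * of_real y)) (at z within {z. 0 \<le> Re z})"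
      if "z \<in> {z. 0 \<le> Re z}" for z
      by (auto intro!: derivative_eq_intros)
    show "norm (- (of_real y) * exp (- z * of_real y)) \<le> y" if "z \<in> {z. 0 \<le> Re z}" for z
      using that assms by (auto simp: norm_mult intro!: mult_left_le)
  qed (use assms in auto)
  then show ?thesis by (simp add: mult.commute)
qed

lemma norm_one_minus_exp_half_plane:
  fixes s :: complex and y :: real
  assumes "0 \<le> Re s" "0 \<le> y"
  shows "norm (1 - exp (- s * of_real y)) \<le> min 2 (norm s * y)"
proof -
  have "norm (1 - exp (- s * of_real y)) \<le> norm (1::complex) + norm (exp (- s * of_real y))"
    by (rule norm_triangle_ineq4)
  also have "\<dots> \<le> 2" using assms by simp
  finally show ?thesis
    using norm_exp_diff_half_plane[of 0 s y] assms by simp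
qed

text \<open>The primitive in \<open>s\<close>, vanishing at \<open>s = 0\<close>, of the integrand
  \<open>1 - exp (- s * y)\<close> of phi. Integrating it against \<open>\<pi>\<close> produces Phi
  on the whole closed half-plane without integrating phi along complex paths.\<close>

definition Phi_ker :: "complex \<Rightarrow> real \<Rightarrow> complex" where
  "Phi_ker s y = s - (1 - exp (- s * of_real y)) / of_real y"

lemma Phi_ker_derivative:
  assumes "y \<noteq> 0"
  shows "((\<lambda>s. Phi_ker s y) has_field_derivative 1 - exp (- s * of_real y)) (at s within S)"
  unfolding Phi_ker_def using assms by (auto intro!: derivative_eq_intros simp: field_simps)

text \<open>Mean value inequality on the half-disc, where the derivative is bounded by
  \<open>2\<close> for large jumps and by \<open>B * y\<close> for small ones. The minimum of the
  two is \<open>\<pi>\<close>-integrable because \<open>min 1 y\<close> is.\<close>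

lemma norm_Phi_ker_diff:
  assumes "0 \<le> Re s" "0 \<le> Re s'" "0 < y" "norm s \<le> B" "norm s' \<le> B"
  shows "norm (Phi_ker s y - Phi_ker s' y) \<le> min 2 (B * y) * norm (s - s')"
proof (rule field_differentiable_bound)
  let ?S = "{z. 0 \<le> Re z} \<inter> cball 0 B"
  show "convex ?S"
    using convex_halfspace_Re_ge[of 0] by (intro convex_Int) auto
  show "((\<lambda>s. Phi_ker s y) has_field_derivative 1 - exp (- z * of_real y)) (at z within ?S)" for z
    using assms by (intro Phi_ker_derivative) auto
  show "norm (1 - exp (- z * of_real y)) \<le> min 2 (B * y)" if "z \<in> ?S" for z
  proof -
    have "norm (1 - exp (- z * of_real y)) \<le> min 2 (norm z * y)"
      using that assms by (intro norm_one_minus_exp_half_plane) auto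
    also have "\<dots> \<le> min 2 (B * y)"
      using that assms by (intro min.mono mult_right_mono) auto
    finally show ?thesis .
  qed
qed (use assms in auto)

lemma norm_Phi_ker_le:
  assumes "0 \<le> Re s" "0 < y"
  shows "norm (Phi_ker s y) \<le> min 2 (norm s * y) * norm s"
  using norm_Phi_ker_diff[of s 0 y "norm s"] assms by (simp add: Phi_ker_def)

lemma Phi_ker_measurable[measurable]: "(\<lambda>y. Phi_ker s y) \<in> borel_measurable borel"
  unfolding Phi_ker_def by measurable

text \<open>Turns the bound \<open>min 2 (norm s * y)\<close> for complex \<open>s\<close> back into
  the real integrand of phi at \<open>norm s\<close>. With exp z >= 1 + z it reduces to min 2 z <= 3
  z / (1 + z), an equality at z = 2.\<close>

lemma min_two_le_one_minus_exp:
  fixes z :: real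
  assumes "0 \<le> z"
  shows "min 2 z \<le> 3 * (1 - exp (- z))"
proof -
  have "exp z \<ge> 1 + z" by (rule exp_ge_add_one_self)
  then have "exp (- z) \<le> 1 / (1 + z)"
    using assms by (simp add: exp_minus field_simps)
  then have "3 * (z / (1 + z)) \<le> 3 * (1 - exp (- z))"
    using assms by (simp add: field_simps)
  moreover have "min 2 z \<le> 3 * (z / (1 + z))"
  proof (cases "z \<le> 2")
    case True
    then have "z * z \<le> 2 * z" using assms by (intro mult_right_mono) auto
    then show ?thesis using assms True by (simp add: field_simps)
  next
    case False
    then show ?thesis by (simp add: field_simps)
  qed
  ultimately show ?thesis by linarith
qed

text \<open>No killing rate, because it vanishes under regular variation, and no process: the locale
  is used a second time with drift \<open>c + 2 * e\<close>, for which no subordinator is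
  constructed. \<open>pos_pi\<close> gives strict positivity of phi away from 0.\<close>

locale levy_data =
  fixes c :: real and \<pi> :: "real measure"
  assumes c_nonneg: "0 \<le> c"
    and sets_pi[measurable_cong]: "sets \<pi> = sets borel"
    and null_pi: "emeasure \<pi> {..0} = 0"
    and min_pi: "(\<integral>\<^sup>+x. ennreal (min 1 x) \<partial>\<pi>) < \<infinity>"
    and pos_pi: "emeasure \<pi> {0<..} > 0"
begin

lemma space_pi[simp]: "space \<pi> = UNIV"
  using sets_eq_imp_space_eq[OF sets_pi] by simp

lemma AE_pos: "AE y in \<pi>. 0 < y"
  by (rule AE_I[where N = "{..0}"]) (auto simp: null_pi sets_pi)

lemma integrable_min: "integrable \<pi> (\<lambda>y. min 1 y)"
proof (rule integrableI_bounded)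
  have "(\<integral>\<^sup>+ x. ennreal (norm (min 1 x)) \<partial>\<pi>) = (\<integral>\<^sup>+x. ennreal (min 1 x) \<partial>\<pi>)"
    by (rule nn_integral_cong_AE) (use AE_pos in eventually_elim, auto)
  then show "(\<integral>\<^sup>+ x. ennreal (norm (min 1 x)) \<partial>\<pi>) < \<infinity>" using min_pi by simp
qed simp

lemma integrable_dominated:
  fixes f :: "real \<Rightarrow> 'b::{banach, second_countable_topology}"
  assumes [measurable]: "f \<in> borel_measurable borel"
    and "\<And>y. 0 < y \<Longrightarrow> norm (f y) \<le> K * min 1 y"
  shows "integrable \<pi> f"
proof (rule Bochner_Integration.integrable_bound)
  show "integrable \<pi> (\<lambda>y. K * min 1 y)"
    using integrable_min by simp
  show "AE y in \<pi>. norm (f y) \<le> norm (K * min 1 y)"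
    using AE_pos by eventually_elim (use assms(2) in force)
qed simp

lemma min_scale: "0 < y \<Longrightarrow> 0 \<le> B \<Longrightarrow> min 2 (B * y) \<le> (2 + B) * min 1 (y::real)"
  by (auto simp: min_def algebra_simps intro: add_nonneg_nonneg mult_left_le)

lemma integrable_one_minus_exp:
  assumes "0 \<le> Re s"
  shows "integrable \<pi> (\<lambda>y. 1 - exp (- s * of_real y))"
proof (rule integrable_dominated[where K = "2 + norm s"])
  fix y :: real assume "0 < y"
  then show "norm (1 - exp (- s * of_real y)) \<le> (2 + norm s) * min 1 y"
    using norm_one_minus_exp_half_plane[of s y] min_scale[of y "norm s"] assms by auto
qed simp

lemma integrable_Phi_ker:
  assumes "0 \<le> Re s"
  shows "integrable \<pi> (Phi_ker s)"
proof (rule integrable_dominated[where K = "(2 + norm s) * norm s"])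
  fix y :: real assume y: "0 < y"
  have "norm (Phi_ker s y) \<le> min 2 (norm s * y) * norm s"
    using assms y by (rule norm_Phi_ker_le)
  also have "\<dots> \<le> ((2 + norm s) * min 1 y) * norm s"
    using y by (intro mult_right_mono min_scale) auto
  finally show "norm (Phi_ker s y) \<le> (2 + norm s) * norm s * min 1 y"
    by (simp add: mult_ac)
qed simp

section \<open>The exponents phi and Phi on the half-plane and on the half-line\<close>

definition cphi :: "complex \<Rightarrow> complex" where
  "cphi s = of_real c * s + (\<integral>y. (1 - exp (- s * of_real y)) \<partial>\<pi>)"

definition cPhi :: "complex \<Rightarrow> complex" where
  "cPhi s = of_real c / 2 * s^2 + (\<integral>y. Phi_ker s y \<partial>\<pi>)"

definition rphi :: "real \<Rightarrow> real" where
  "rphi s = c * s + (\<integral>y. (1 - exp (- s * y)) \<partial>\<pi>)"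

text \<open>Taken as the restriction of \<open>cPhi\<close>, so that the derivative
  \<open>rphi\<close> is inherited from \<open>cPhi_derivative\<close>; agreement with the integral
  of \<open>rphi\<close> is \<open>integral_rphi\<close>.\<close>

definition rPhi :: "real \<Rightarrow> real" where
  "rPhi s = Re (cPhi (of_real s))"

lemma integrable_one_minus_exp_real:
  assumes "0 \<le> s"
  shows "integrable \<pi> (\<lambda>y. 1 - exp (- s * y))"
  using integrable_Re[OF integrable_one_minus_exp[of "of_real s"]] assms
  by (simp add: exp_of_real flip: of_real_mult of_real_minus)

lemma cphi_of_real:
  assumes "0 \<le> s"
  shows "cphi (of_real s) = of_real (rphi s)"
proof -
  have "(\<integral>y. (1 - exp (- of_real s * of_real y)) \<partial>\<pi>) = (\<integral>y. complex_of_real (1 - exp (- s * y)) \<partial>\<pi>)"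
    by (simp add: exp_of_real flip: of_real_mult of_real_minus)
  also have "\<dots> = of_real (\<integral>y. (1 - exp (- s * y)) \<partial>\<pi>)"
    by (rule integral_complex_of_real)
  finally show ?thesis by (simp add: cphi_def rphi_def)
qed

lemma cPhi_of_real:
  assumes "0 \<le> s"
  shows "cPhi (of_real s) = of_real (rPhi s)"
proof -
  have *: "Phi_ker (of_real s) y = complex_of_real (s - (1 - exp (- s * y)) / y)" for y
    by (simp add: Phi_ker_def exp_of_real flip: of_real_mult of_real_minus)
  have "(\<integral>y. Phi_ker (of_real s) y \<partial>\<pi>) = of_real (\<integral>y. s - (1 - exp (- s * y)) / y \<partial>\<pi>)"
    unfolding * by (rule integral_complex_of_real)
  then have "cPhi (of_real s) = of_real (c / 2 * s^2 + (\<integral>y. s - (1 - exp (- s * y)) / y \<partial>\<pi>))"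
    by (simp add: cPhi_def)
  then show ?thesis by (simp add: rPhi_def)
qed

lemma cPhi_0[simp]: "cPhi 0 = 0" and rPhi_0[simp]: "rPhi 0 = 0"
  by (simp_all add: cPhi_def rPhi_def Phi_ker_def)

lemma rphi_0[simp]: "rphi 0 = 0"
  by (simp add: rphi_def)

text \<open>The pointwise bound \<open>min 2 (norm s * y)\<close> is compared with the real
  integrand at \<open>norm s\<close>. This controls the derivative of \<open>cPhi\<close> on discs
  by real quantities, up to the boundary of the half-plane.\<close>

lemma norm_cphi_le:
  assumes "0 \<le> Re s"
  shows "norm (cphi s) \<le> 3 * rphi (norm s)"
proof -
  have int: "integrable \<pi> (\<lambda>y. 1 - exp (- norm s * y))"
    using integrable_one_minus_exp_real[of "norm s"] by simp
  have "norm (\<integral>y. (1 - exp (- s * of_real y)) \<partial>\<pi>) \<le> (\<integral>y. norm (1 - exp (- s * of_real y)) \<partial>\<pi>)"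
    by (rule integral_norm_bound)
  also have "\<dots> \<le> (\<integral>y. 3 * (1 - exp (- norm s * y)) \<partial>\<pi>)"
  proof (rule integral_mono_AE)
    show "integrable \<pi> (\<lambda>y. norm (1 - exp (- s * of_real y)))"
      using integrable_one_minus_exp[OF assms] by (rule integrable_norm)
    show "integrable \<pi> (\<lambda>y. 3 * (1 - exp (- norm s * y)))"
      using int by (rule integrable_mult_right)
    show "AE y in \<pi>. norm (1 - exp (- s * of_real y)) \<le> 3 * (1 - exp (- norm s * y))"
      using AE_pos
    proof eventually_elim
      case (elim y)
      have "norm (1 - exp (- s * of_real y)) \<le> min 2 (norm s * y)"
        using elim assms by (intro norm_one_minus_exp_half_plane) auto
      also have "\<dots> \<le> 3 * (1 - exp (- (norm s * y)))"
        using elim by (intro min_two_le_one_minus_exp) auto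
      finally show ?case by simp
    qed
  qed
  also have "\<dots> = 3 * (\<integral>y. (1 - exp (- norm s * y)) \<partial>\<pi>)" by (rule integral_mult_right_zero)
  finally have "norm (cphi s) \<le> c * norm s + 3 * (\<integral>y. (1 - exp (- norm s * y)) \<partial>\<pi>)"
    unfolding cphi_def using c_nonneg
    by (intro order_trans[OF norm_triangle_ineq] add_mono) (auto simp: norm_mult)
  then show ?thesis
    unfolding rphi_def using c_nonneg mult_nonneg_nonneg[OF c_nonneg norm_ge_zero[of s]]
    by argo
qed

text \<open>Differentiation under the integral sign, with difference quotients dominated through
  \<open>norm_Phi_ker_diff\<close>. The derivative is taken within the closed half-plane, so that
  the imaginary axis and the endpoint 0 of the half-line are included.\<close>

lemma cPhi_derivative:
  assumes "0 \<le> Re s"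
  shows "(cPhi has_field_derivative cphi s) (at s within {z. 0 \<le> Re z})"
proof -
  have "((\<lambda>s. \<integral>y. Phi_ker s y \<partial>\<pi>) has_field_derivative (\<integral>y. (1 - exp (- s * of_real y)) \<partial>\<pi>))
      (at s within {z. 0 \<le> Re z})"
    unfolding has_field_derivative_iff tendsto_at_iff_sequentially
  proof (intro allI impI)
    fix X :: "nat \<Rightarrow> complex"
    assume X: "\<forall>i. X i \<in> {z. 0 \<le> Re z} - {s}" and lim: "X \<longlonglongrightarrow> s"
    \<comment> \<open>A convergent sequence stays in some ball of radius \<open>B\<close>, which
      makes the dominating function \<open>(2 + B) * min 1 y\<close> independent of
      \<open>n\<close>.\<close>
    from lim have "Bseq X" by (intro convergent_imp_Bseq convergentI)
    then obtain B0 where B0: "0 < B0" "\<And>n. norm (X n) \<le> B0" by (auto simp: Bseq_def)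
    define B where "B = max B0 (norm s)"
    have B: "norm (X n) \<le> B" "norm s \<le> B" "0 \<le> B" for n
      using B0(2)[of n] B0(1) by (auto simp: B_def max_def)
    have "(\<lambda>n. \<integral>y. (Phi_ker (X n) y - Phi_ker s y) / (X n - s) \<partial>\<pi>)
        \<longlonglongrightarrow> (\<integral>y. (1 - exp (- s * of_real y)) \<partial>\<pi>)"
    proof (rule integral_dominated_convergence)
      show "integrable \<pi> (\<lambda>y. (2 + B) * min 1 y)" using integrable_min by simp
      show "AE y in \<pi>. (\<lambda>n. (Phi_ker (X n) y - Phi_ker s y) / (X n - s)) \<longlonglongrightarrow> 1 - exp (- s * of_real y)"
        using AE_pos
      proof eventually_elim
        case (elim y)
        then have "((\<lambda>s. Phi_ker s y) has_field_derivative 1 - exp (- s * of_real y)) (at s within {z. 0 \<le> Re z})"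
          by (intro Phi_ker_derivative) auto
        then show ?case
          unfolding has_field_derivative_iff tendsto_at_iff_sequentially using X lim by (auto simp: o_def)
      qed
      show "AE y in \<pi>. norm ((Phi_ker (X n) y - Phi_ker s y) / (X n - s)) \<le> (2 + B) * min 1 y" for n
        using AE_pos
      proof eventually_elim
        case (elim y)
        have "norm (Phi_ker (X n) y - Phi_ker s y) \<le> min 2 (B * y) * norm (X n - s)"
          using X assms elim B by (intro norm_Phi_ker_diff) auto
        moreover have "norm (X n - s) > 0" using X by auto
        ultimately have "norm ((Phi_ker (X n) y - Phi_ker s y) / (X n - s)) \<le> min 2 (B * y)"
          by (simp add: norm_divide divide_le_eq del: min_less_iff_conj min.bounded_iff)
        also have "\<dots> \<le> (2 + B) * min 1 y" using elim B by (intro min_scale) auto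
        finally show ?case .
      qed
    qed measurable
    moreover have "(\<integral>y. (Phi_ker (X n) y - Phi_ker s y) / (X n - s) \<partial>\<pi>)
        = ((\<integral>y. Phi_ker (X n) y \<partial>\<pi>) - (\<integral>y. Phi_ker s y \<partial>\<pi>)) / (X n - s)" for n
      using X assms by (subst Bochner_Integration.integral_diff[symmetric]) (auto intro: integrable_Phi_ker)
    ultimately show "((\<lambda>y. ((\<integral>ya. Phi_ker y ya \<partial>\<pi>) - (\<integral>y. Phi_ker s y \<partial>\<pi>)) / (y - s)) \<circ> X)
        \<longlonglongrightarrow> (\<integral>y. (1 - exp (- s * of_real y)) \<partial>\<pi>)"
      unfolding o_def by (simp only:)
  qed
  then show ?thesis
    unfolding cPhi_def[abs_def] cphi_def
    by (auto intro!: derivative_eq_intros)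
qed

lemma cPhi_derivative_interior:
  assumes "0 < Re s"
  shows "(cPhi has_field_derivative cphi s) (at s)"
proof -
  have "at s within {z. 0 \<le> Re z} = at s"
    using assms open_halfspace_Re_gt[of 0]
    by (intro at_within_nhd[where S = "{z. Re z > 0}"]) auto
  then show ?thesis using cPhi_derivative[of s] assms by simp
qed

lemma holomorphic_cPhi: "cPhi holomorphic_on {z. 0 < Re z}"
  using cPhi_derivative_interior open_halfspace_Re_gt[of 0]
  by (auto simp: holomorphic_on_open)

lemma continuous_cPhi: "continuous_on {z. 0 \<le> Re z} cPhi"
  using cPhi_derivative by (intro DERIV_continuous_on) auto

lemma continuous_cPhi_imag: "continuous_on UNIV (\<lambda>x::real. cPhi (\<i> * of_real x))"
  by (rule continuous_on_compose2[OF continuous_cPhi]) (auto intro!: continuous_intros)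

lemma rPhi_derivative:
  assumes "0 \<le> s"
  shows "(rPhi has_real_derivative rphi s) (at s within {0..})"
proof -
  have "((cPhi \<circ> of_real) has_vector_derivative (1 * cphi (of_real s))) (at s within {0..})"
  proof (rule field_vector_diff_chain_within)
    show "(complex_of_real has_vector_derivative 1) (at s within {0..})"
      using has_vector_derivative_of_real[OF DERIV_ident] by simp
    show "(cPhi has_field_derivative cphi (of_real s)) (at (of_real s) within of_real ` {0..})"
      using cPhi_derivative[of "of_real s"] assms by (rule_tac DERIV_subset) auto
  qed
  then have "((\<lambda>x. Re ((cPhi \<circ> of_real) x)) has_vector_derivative Re (1 * cphi (of_real s))) (at s within {0..})"
    by (rule bounded_linear.has_vector_derivative[OF bounded_linear_Re])
  then show ?thesis
    using assms
    by (simp add: has_real_derivative_iff_has_vector_derivative rPhi_def[abs_def] o_def cphi_of_real)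
qed

lemma integral_rphi:
  assumes "0 \<le> a" "a \<le> b"
  shows "(rphi has_integral (rPhi b - rPhi a)) {a..b}"
proof (rule fundamental_theorem_of_calculus)
  show "(rPhi has_vector_derivative rphi x) (at x within {a..b})" if "x \<in> {a..b}" for x
    using rPhi_derivative[of x] assms that
    by (auto simp: has_real_derivative_iff_has_vector_derivative intro: has_vector_derivative_within_subset)
qed (use assms in auto)

lemma rphi_mono:
  assumes "0 \<le> s" "s \<le> t"
  shows "rphi s \<le> rphi t"
  unfolding rphi_def
proof (intro add_mono mult_left_mono c_nonneg assms integral_mono_AE)
  show "AE y in \<pi>. 1 - exp (- s * y) \<le> 1 - exp (- t * y)"
    using AE_pos by eventually_elim (use assms in \<open>auto intro: mult_right_mono\<close>)
  show "integrable \<pi> (\<lambda>y. 1 - exp (- s * y))" "integrable \<pi> (\<lambda>y. 1 - exp (- t * y))"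
    using assms by (intro integrable_one_minus_exp_real; linarith)+
qed

lemma rphi_pos:
  assumes "0 < s"
  shows "0 < rphi s"
proof -
  have int: "integrable \<pi> (\<lambda>y. 1 - exp (- s * y))"
    using assms by (intro integrable_one_minus_exp_real) auto
  have nn: "AE y in \<pi>. 0 \<le> 1 - exp (- s * y)"
    using AE_pos by eventually_elim (use assms in auto)
  have "(\<integral>y. (1 - exp (- s * y)) \<partial>\<pi>) \<noteq> 0"
  proof
    assume "(\<integral>y. (1 - exp (- s * y)) \<partial>\<pi>) = 0"
    then have "AE y in \<pi>. 1 - exp (- s * y) = 0"
      using integral_nonneg_eq_0_iff_AE[OF int nn] by simp
    then have "AE y in \<pi>. y \<notin> {0<..}"
      by eventually_elim (use assms in auto)
    then have "emeasure \<pi> {0<..} = 0"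
      by (subst (asm) AE_iff_measurable[OF _ refl]) (auto simp: sets_pi greaterThan_def)
    then show False using pos_pi by simp
  qed
  moreover have "0 \<le> (\<integral>y. (1 - exp (- s * y)) \<partial>\<pi>)"
    using nn by (rule integral_nonneg_AE)
  ultimately show ?thesis
    unfolding rphi_def using assms c_nonneg
    by (intro add_nonneg_pos mult_nonneg_nonneg) auto
qed

lemma rphi_nonneg: "0 \<le> s \<Longrightarrow> 0 \<le> rphi s"
  using rphi_pos[of s] by (cases "s = 0") auto

text \<open>Concavity together with \<open>rphi 0 = 0\<close>; for each jump size it is convexity of
  exp between \<open>0\<close> and \<open>- (l * s) * y\<close> with weight
  \<open>1 / l\<close>.\<close>

lemma rphi_scale:
  assumes "1 \<le> l" "0 \<le> s"
  shows "rphi (l * s) \<le> l * rphi s"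
proof -
  have ineq: "1 - exp (- (l * s) * y) \<le> l * (1 - exp (- s * y))" if "0 < y" for y
  proof -
    have "convex_on UNIV (exp :: real \<Rightarrow> real)"
      by (rule f''_ge0_imp_convex[where f' = exp and f'' = exp]) (auto intro!: derivative_eq_intros)
    from convex_onD[OF this, of "1 / l" 0 "- (l * s) * y"] assms
    have "exp ((1 / l) * (- (l * s) * y)) \<le> (1 - 1 / l) + (1 / l) * exp (- (l * s) * y)"
      by simp
    moreover have "(1 / l) * (- (l * s) * y) = - s * y" using assms by simp
    ultimately have "exp (- s * y) \<le> (1 - 1 / l) + (1 / l) * exp (- (l * s) * y)" by metis
    then have "l * exp (- s * y) \<le> l * ((1 - 1 / l) + (1 / l) * exp (- (l * s) * y))"
      using assms by (intro mult_left_mono) auto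
    also have "\<dots> = l - 1 + exp (- (l * s) * y)" using assms by (simp add: distrib_left right_diff_distrib)
    finally show ?thesis by (simp add: right_diff_distrib)
  qed
  have "(\<integral>y. (1 - exp (- (l * s) * y)) \<partial>\<pi>) \<le> (\<integral>y. l * (1 - exp (- s * y)) \<partial>\<pi>)"
  proof (rule integral_mono_AE)
    show "AE y in \<pi>. 1 - exp (- (l * s) * y) \<le> l * (1 - exp (- s * y))"
      using AE_pos by eventually_elim (rule ineq)
    show "integrable \<pi> (\<lambda>y. 1 - exp (- (l * s) * y))"
      using assms by (intro integrable_one_minus_exp_real) auto
    show "integrable \<pi> (\<lambda>y. l * (1 - exp (- s * y)))"
      using assms by (intro integrable_mult_right integrable_one_minus_exp_real) auto
  qed
  also have "\<dots> = l * (\<integral>y. (1 - exp (- s * y)) \<partial>\<pi>)" by (rule integral_mult_right_zero)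
  finally show ?thesis by (simp add: rphi_def algebra_simps)
qed

text \<open>Each jump contributes a nonnegative real part since |exp(-s y)| <= 1. For
  \<open>c > 0\<close> the derivative of \<open>cPhi\<close> thus has positive real part in the open
  half-plane, on which univalence rests.\<close>

lemma Re_cphi_ge:
  assumes "0 \<le> Re s"
  shows "c * Re s \<le> Re (cphi s)"
proof -
  have "Re (\<integral>y. (1 - exp (- s * of_real y)) \<partial>\<pi>) = (\<integral>y. Re (1 - exp (- s * of_real y)) \<partial>\<pi>)"
    by (rule integral_Re[OF integrable_one_minus_exp[OF assms], symmetric])
  also have "\<dots> \<ge> 0"
  proof (rule integral_nonneg_AE, use AE_pos in eventually_elim)
    case (elim y)
    have "Re (exp (- s * of_real y)) \<le> norm (exp (- s * of_real y))" by (rule complex_Re_le_cmod)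
    also have "\<dots> \<le> 1" using assms elim by simp
    finally show ?case by simp
  qed
  finally show ?thesis by (simp add: cphi_def)
qed

text \<open>Minus the real part of Phi at \<open>\<i> * x\<close>, hence the rate in |exp(r
  Phi(ix))| = exp(-r * imag_decay x).\<close>

definition imag_decay :: "real \<Rightarrow> real" where
  "imag_decay x = c / 2 * x^2 + (\<integral>y. (1 - cos (x * y)) / y \<partial>\<pi>)"

lemma Re_Phi_ker_imag: "Re (Phi_ker (\<i> * of_real x) y) = - ((1 - cos (x * y)) / y)"
  by (simp add: Phi_ker_def Re_exp diff_divide_distrib)

lemma integrable_cos: "integrable \<pi> (\<lambda>y. (1 - cos (x * y)) / y)"
  using integrable_minus[OF integrable_Re[OF integrable_Phi_ker[of "\<i> * of_real x"]]]
  unfolding Re_Phi_ker_imag minus_minus by simp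

lemma Re_cPhi_imag: "Re (cPhi (\<i> * of_real x)) = - imag_decay x"
proof -
  have "Re (\<integral>y. Phi_ker (\<i> * of_real x) y \<partial>\<pi>) = (\<integral>y. - ((1 - cos (x * y)) / y) \<partial>\<pi>)"
    using integral_Re[OF integrable_Phi_ker[of "\<i> * of_real x"]]
    unfolding Re_Phi_ker_imag by simp
  then show ?thesis
    by (simp add: cPhi_def imag_decay_def power2_eq_square)
qed

lemma imag_decay_even: "imag_decay (- x) = imag_decay x"
  by (simp add: imag_decay_def)

lemma imag_decay_ge: "c / 2 * x^2 \<le> imag_decay x"
proof -
  have "0 \<le> (\<integral>y. (1 - cos (x * y)) / y \<partial>\<pi>)"
    by (rule integral_nonneg_AE, use AE_pos in eventually_elim) auto
  then show ?thesis by (simp add: imag_decay_def)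
qed

lemma imag_decay_nonneg: "0 \<le> imag_decay x"
  using imag_decay_ge[of x] c_nonneg by (smt (verit) divide_nonneg_nonneg mult_nonneg_nonneg zero_le_power2)

lemma continuous_imag_decay: "continuous_on UNIV imag_decay"
proof -
  have "continuous_on UNIV (\<lambda>x. - Re (cPhi (\<i> * of_real x)))"
    by (intro continuous_intros continuous_cPhi_imag)
  then show ?thesis by (simp add: Re_cPhi_imag)
qed

lemma Phi_imag_eq: "Phi_imag 0 c \<pi> x = cPhi (\<i> * of_real x)"
  by (simp add: Phi_imag_def cPhi_def Phi_ker_def mult_ac)

text \<open>The jump part is at most |s|^2 times the integral of \<open>min (2 / norm s) y\<close>,
  which tends to 0, so it finally stays below half of the quadratic term
  \<open>c / 2 * norm s ^ 2\<close>.\<close>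

lemma norm_cPhi_growth:
  assumes "0 < c"
  shows "\<exists>R>0. \<forall>s. 0 \<le> Re s \<longrightarrow> R \<le> norm s \<longrightarrow> c / 4 * norm s ^ 2 \<le> norm (cPhi s)"
proof -
  have "((\<lambda>r. \<integral>y. min (2 / r) y \<partial>\<pi>) \<longlongrightarrow> (\<integral>y. 0 \<partial>\<pi>)) at_top"
  proof (rule integral_dominated_convergence_at_top)
    show "integrable \<pi> (\<lambda>y. 2 * min 1 y)" using integrable_min by simp
    show "AE y in \<pi>. ((\<lambda>r. min (2 / r) y) \<longlongrightarrow> 0) at_top"
      using AE_pos
    proof eventually_elim
      case (elim y)
      have "((\<lambda>r. min (2 / r) y) \<longlongrightarrow> min 0 y) at_top"
        by (intro tendsto_min tendsto_const) real_asymp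
      then show ?case using elim by simp
    qed
    show "\<forall>\<^sub>F r in at_top. AE y in \<pi>. norm (min (2 / r) y) \<le> 2 * min 1 y"
      using eventually_ge_at_top[of 2]
    proof eventually_elim
      case (elim r)
      then have "2 / r \<le> 1" "0 < 2 / r" by auto
      show ?case
        using AE_pos
      proof eventually_elim
        case (elim y)
        have "norm (min (2 / r) y) = min (2 / r) y" using elim \<open>0 < 2 / r\<close> by simp
        also have "\<dots> \<le> min 1 y" using \<open>2 / r \<le> 1\<close> by (intro min.mono order_refl)
        also have "\<dots> \<le> 2 * min 1 y" using elim by simp
        finally show ?case .
      qed
    qed
  qed auto
  then have "\<forall>\<^sub>F r in at_top. (\<integral>y. min (2 / r) y \<partial>\<pi>) < c / 4"
    using assms by (intro order_tendstoD(2)) auto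
  then obtain R where R: "\<And>r. R \<le> r \<Longrightarrow> (\<integral>y. min (2 / r) y \<partial>\<pi>) < c / 4"
    by (auto simp: eventually_at_top_linorder)
  have "c / 4 * norm s ^ 2 \<le> norm (cPhi s)" if s: "0 \<le> Re s" "max R 2 \<le> norm s" for s
  proof -
    define r where "r = norm s"
    have r: "0 < r" "2 \<le> r" "R \<le> r" using s by (auto simp: r_def)
    have int: "integrable \<pi> (\<lambda>y. min (2 / r) y)"
    proof (rule integrable_dominated[where K = 1])
      fix y :: real assume "0 < y"
      moreover have le: "2 / r \<le> 1" and "0 < 2 / r" using r by auto
      moreover have "min (2 / r) y \<le> min 1 y" using le by (rule min.mono) simp
      ultimately show "norm (min (2 / r) y) \<le> 1 * min 1 y" by simp
    qed simp
    have "norm (\<integral>y. Phi_ker s y \<partial>\<pi>) \<le> (\<integral>y. norm (Phi_ker s y) \<partial>\<pi>)"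
      by (rule integral_norm_bound)
    also have "\<dots> \<le> (\<integral>y. r^2 * min (2 / r) y \<partial>\<pi>)"
    proof (rule integral_mono_AE)
      show "AE y in \<pi>. norm (Phi_ker s y) \<le> r^2 * min (2 / r) y"
        using AE_pos
      proof eventually_elim
        case (elim y)
        have "min 2 (r * y) * r = r^2 * min (2 / r) y"
          using r by (auto simp: min_def field_simps power2_eq_square)
        then show ?case using norm_Phi_ker_le[OF s(1) elim] by (simp add: r_def)
      qed
    qed (use int integrable_Phi_ker[OF s(1)] in auto)
    also have "\<dots> = r^2 * (\<integral>y. min (2 / r) y \<partial>\<pi>)" by simp
    also have "\<dots> \<le> r^2 * (c / 4)"
      using R[OF r(3)] by (intro mult_left_mono) auto
    finally have "norm (\<integral>y. Phi_ker s y \<partial>\<pi>) \<le> r^2 * (c / 4)" .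
    moreover have "norm (of_real c / 2 * s^2) = c / 2 * r^2"
      using c_nonneg by (simp add: norm_mult norm_power r_def norm_divide)
    ultimately show ?thesis
      unfolding cPhi_def r_def[symmetric]
      using norm_diff_ineq[of "of_real c / 2 * s^2" "\<integral>y. Phi_ker s y \<partial>\<pi>"] by argo
  qed
  then show ?thesis by (intro exI[of _ "max R 2"]) auto
qed

end

section \<open>Laplace transform of the inversion integral\<close>

text \<open>Abstract because it serves both \<open>cPhi\<close> with a positive drift and the pure
  power \<open>stab p\<close>. Here \<open>z0\<close> is the preimage of \<open>v\<close>; the
  growth exponent \<open>p > 1\<close> makes the outer sides of the contour negligible.\<close>

locale half_plane_map =
  fixes \<Phi> \<Phi>' :: "complex \<Rightarrow> complex" and v z0 C p R0 :: real
  assumes deriv: "\<And>s. 0 < Re s \<Longrightarrow> (\<Phi> has_field_derivative \<Phi>' s) (at s)"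
    and cont: "continuous_on {s. 0 \<le> Re s} \<Phi>"
    and Re_deriv: "\<And>s. 0 < Re s \<Longrightarrow> 0 < Re (\<Phi>' s)"
    and Re_imag: "\<And>x. Re (\<Phi> (\<i> * of_real x)) \<le> 0"
    and growth: "\<And>s. 0 \<le> Re s \<Longrightarrow> R0 \<le> norm s \<Longrightarrow> C * norm s powr p \<le> norm (of_real v - \<Phi> s)"
    and C_pos: "0 < C" and p_gt: "1 < p" and z0_pos: "0 < z0" and v_pos: "0 < v"
    and Phi_z0: "\<Phi> (of_real z0) = of_real v"
begin

text \<open>Noshiro--Warschawski: the derivative has positive real part on a convex domain.\<close>
lemma half_plane_injective:
  assumes "0 < Re a" "0 < Re b" "\<Phi> a = \<Phi> b"
  shows "a = b"
proof (rule ccontr)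
  assume ab: "a \<noteq> b"
  define g where "g = (\<lambda>t::real. Re (\<Phi> (a + of_real t * (b - a)) / (b - a)))"
  have "g 0 < g 1"
  proof (rule DERIV_pos_imp_increasing[of 0 1 g])
    fix t :: real assume t: "0 \<le> t" "t \<le> 1"
    let ?s = "a + of_real t * (b - a)"
    have "Re ?s = (1 - t) * Re a + t * Re b" by (simp add: algebra_simps)
    also have "\<dots> > 0"
      using assms t by (cases "t = 1") (auto intro!: add_pos_nonneg)
    finally have s: "0 < Re ?s" .
    have "((\<lambda>t::real. a + of_real t * (b - a)) has_vector_derivative (b - a)) (at t)"
      by (auto intro!: derivative_eq_intros)
    from field_vector_diff_chain_at[OF this deriv[OF s]]
    have "((\<lambda>t. \<Phi> (a + of_real t * (b - a))) has_vector_derivative (b - a) * \<Phi>' ?s) (at t)"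
      by (simp add: o_def)
    then have "((\<lambda>t. \<Phi> (a + of_real t * (b - a)) / (b - a)) has_vector_derivative ((b - a) * \<Phi>' ?s) / (b - a)) (at t)"
      by (rule has_vector_derivative_divide)
    then have "(g has_vector_derivative Re (\<Phi>' ?s)) (at t)"
      unfolding g_def using ab
      by (intro bounded_linear.has_vector_derivative[OF bounded_linear_Re]) simp
    then show "\<exists>y. (g has_real_derivative y) (at t) \<and> 0 < y"
      using Re_deriv[OF s] by (auto simp: has_real_derivative_iff_has_vector_derivative)
  qed simp
  moreover have "g 0 = g 1" using assms by (simp add: g_def)
  ultimately show False by simp
qed

text \<open>On the imaginary axis the real part of \<open>\<Phi>\<close> is at most
  \<open>0 < v\<close>, so solutions lie in the open half-plane, where injectivity applies.\<close>

lemma zero_iff: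
  assumes "0 \<le> Re s"
  shows "\<Phi> s = of_real v \<longleftrightarrow> s = of_real z0"
proof
  assume eq: "\<Phi> s = of_real v"
  have "0 < Re s"
  proof (rule ccontr)
    assume "\<not> 0 < Re s"
    then have "s = \<i> * of_real (Im s)" using assms by (intro complex_eqI) auto
    then have "Re (\<Phi> s) \<le> 0" using Re_imag[of "Im s"] by metis
    then show False using eq v_pos by simp
  qed
  then show "s = of_real z0" using half_plane_injective[of s "of_real z0"] eq Phi_z0 z0_pos by simp
qed (use Phi_z0 in simp)

text \<open>The integrand has a single pole in the rectangle \<open>[0, R] x [-R, R]\<close>, at
  \<open>z0\<close> with residue \<open>- 1 / \<Phi>' z0\<close>. The three sides off the imaginary
  axis have total length \<open>4 * R\<close>, and the integrand there is at most
  \<open>1 / (C * R powr p)\<close>.\<close>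

lemma contour_estimate:
  assumes R: "R0 < R" "z0 < R" "0 < R"
  shows "norm (integral {-R..R} (\<lambda>x. 1 / (of_real v - \<Phi> (\<i> * of_real x))) - 2 * pi / \<Phi>' (of_real z0))
      \<le> 4 / C * R powr (1 - p)"
proof -
  define z where "z = complex_of_real z0"
  \<comment> \<open>The difference quotient of \<open>\<Phi>\<close> at \<open>z\<close>, completed
    at \<open>z\<close>, is holomorphic without zeros. So \<open>f w / (w - z)\<close> is the
    integrand with its pole split off, and Cauchy's formula replaces a residue computation.\<close>
  define Q where "Q s = (if s = z then deriv \<Phi> z else (\<Phi> s - \<Phi> z) / (s - z))" for s
  define f where "f s = - 1 / Q s" for s
  have Phi_z: "\<Phi> z = of_real v" by (simp add: z_def Phi_z0)
  have z: "0 < Re z" "z \<noteq> 0" using z0_pos by (auto simp: z_def)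
  have dz: "deriv \<Phi> z = \<Phi>' z" using deriv[OF z(1)] by (rule DERIV_imp_deriv)
  have hol: "\<Phi> holomorphic_on {s. 0 < Re s}"
    using deriv open_halfspace_Re_gt[of 0] by (auto simp: holomorphic_on_open)
  have holQ: "Q holomorphic_on {s. 0 < Re s}"
    unfolding Q_def[abs_def] using hol open_halfspace_Re_gt[of 0] by (intro pole_lemma_open) auto
  have Qnz: "Q s \<noteq> 0" if "0 \<le> Re s" for s
  proof (cases "s = z")
    case True
    then show ?thesis using Re_deriv[OF z(1)] by (auto simp: Q_def dz)
  next
    case False
    then show ?thesis using zero_iff[OF that] by (auto simp: Q_def z_def Phi_z0)
  qed
  \<comment> \<open>Near \<open>z\<close> continuity comes from holomorphy and elsewhere from the
    quotient; the two relatively open sets cover the closed half-plane.\<close>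
  have contQ: "continuous_on {s. 0 \<le> Re s} Q"
  proof -
    have "continuous_on ({s. 0 \<le> Re s} - {z}) (\<lambda>s. (\<Phi> s - \<Phi> z) / (s - z))"
      by (intro continuous_intros continuous_on_subset[OF cont]) auto
    then have 1: "continuous_on ({s. 0 \<le> Re s} - {z}) Q"
      by (rule continuous_on_eq) (auto simp: Q_def)
    have 2: "continuous_on {s. 0 < Re s} Q" using holQ by (rule holomorphic_on_imp_continuous_on)
    have un: "({s. 0 \<le> Re s} - {z}) \<union> {s. 0 < Re s} = {s. 0 \<le> Re s}" using z by auto
    have o1: "openin (top_of_set {s. 0 \<le> Re s}) ({s. 0 \<le> Re s} - {z})"
      by (auto simp: openin_open intro!: exI[of _ "- {z}"])
    have o2: "openin (top_of_set {s. 0 \<le> Re s}) {s. 0 < Re s}"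
      using open_halfspace_Re_gt[of 0] by (auto simp: openin_open intro!: exI[of _ "{s. 0 < Re s}"])
    show ?thesis
      using continuous_on_Un_local_open[of "{s. 0 \<le> Re s} - {z}" "{s. 0 < Re s}" Q] 1 2 o1 o2 unfolding un by blast
  qed
  let ?g = "\<lambda>s. 1 / (of_real v - \<Phi> s)"
  have gf: "f w / (w - z) = ?g w" if "w \<noteq> z" for w
  proof -
    have "Q w = - ((of_real v - \<Phi> w) / (w - z))"
      using that by (simp add: Q_def Phi_z minus_divide_left)
    then have "f w = (w - z) / (of_real v - \<Phi> w)" by (simp only: f_def minus_divide_divide divide_divide_eq_right mult_1_left)
    then show ?thesis using that by simp
  qed
  define a1 where "a1 = Complex 0 (- R)"
  define a2 where "a2 = Complex R (- R)"
  define a3 where "a3 = Complex R R"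
  define a4 where "a4 = Complex 0 R"
  let ?S = "cbox a1 a3"
  have S: "?S = {s. 0 \<le> Re s \<and> Re s \<le> R \<and> - R \<le> Im s \<and> Im s \<le> R}"
    by (auto simp: in_cbox_complex_iff a1_def a3_def)
  have rect: "rectpath a1 a3 = linepath a1 a2 +++ linepath a2 a3 +++ linepath a3 a4 +++ linepath a4 a1"
    by (simp add: rectpath_def Let_def a1_def a2_def a3_def a4_def)
  have zbox: "z \<in> box a1 a3" using R z0_pos by (auto simp: in_box_complex_iff a1_def a3_def z_def)
  \<comment> \<open>The left side of the rectangle lies on the imaginary axis, where
    \<open>\<Phi>\<close> is only known to be continuous; hence the form of Cauchy's formula that
    asks for differentiability in the interior alone.\<close>
  have "((\<lambda>w. f w / (w - z)) has_contour_integral (2 * pi * \<i> * winding_number (rectpath a1 a3) z * f z)) (rectpath a1 a3)"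
  proof (rule Cauchy_integral_formula_weak[where S = ?S and k = "{}"])
    show "continuous_on ?S f"
      unfolding f_def using Qnz S
      by (intro continuous_intros continuous_on_subset[OF contQ]) auto
    show "f field_differentiable at x" if "x \<in> interior ?S - {}" for x
    proof -
      have x: "0 < Re x" using that by (auto simp: in_box_complex_iff a1_def)
      then have "Q field_differentiable at x"
        using holQ open_halfspace_Re_gt[of 0] by (intro holomorphic_on_imp_differentiable_at[of _ "{s. 0 < Re s}"]) auto
      then show ?thesis
        unfolding f_def using Qnz[of x] x by (intro field_differentiable_divide) auto
    qed
    show "path_image (rectpath a1 a3) \<subseteq> ?S - {z}"
      using zbox R path_image_rectpath_cbox_minus_box[of a1 a3]
      by (auto simp: a1_def a3_def)
  qed (use zbox in auto)
  then have "contour_integral (rectpath a1 a3) (\<lambda>w. f w / (w - z)) = 2 * pi * \<i> * f z"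
    using winding_number_rectpath[OF zbox] by (simp add: contour_integral_unique)
  also have "contour_integral (rectpath a1 a3) (\<lambda>w. f w / (w - z)) = contour_integral (rectpath a1 a3) ?g"
    using zbox R path_image_rectpath_cbox_minus_box[of a1 a3]
    by (intro contour_integral_cong gf refl) (auto simp: a1_def a3_def)
  finally have total: "contour_integral (rectpath a1 a3) ?g = - 2 * pi * \<i> / \<Phi>' z"
    by (simp add: f_def Q_def dz)
  have seg: "closed_segment a b \<subseteq> {s. 0 \<le> Re s}" if "a \<in> {s. 0 \<le> Re s}" "b \<in> {s. 0 \<le> Re s}" for a b
    using that convex_halfspace_Re_ge[of 0] by (intro closed_segment_subset) auto
  have int: "?g contour_integrable_on linepath a b" 
    if ab: "a \<in> {s. 0 \<le> Re s}" "b \<in> {s. 0 \<le> Re s}" "z \<notin> closed_segment a b" for a b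
  proof (rule contour_integrable_continuous_linepath)
    have "of_real v - \<Phi> s \<noteq> 0" if "s \<in> closed_segment a b" for s
      using that ab(3) zero_iff[of s] seg[OF ab(1,2)] by (auto simp: z_def)
    then show "continuous_on (closed_segment a b) ?g"
      using seg[OF ab(1,2)] by (intro continuous_intros continuous_on_subset[OF cont]) auto
  qed
  have far: "R \<le> norm s" if "\<bar>Im s\<bar> = R \<or> Re s = R" for s
    using that abs_Im_le_cmod[of s] abs_Re_le_cmod[of s] by linarith
  have segs: "s \<in> closed_segment a1 a2 \<Longrightarrow> \<bar>Im s\<bar> = R" "s \<in> closed_segment a2 a3 \<Longrightarrow> Re s = R"
    "s \<in> closed_segment a3 a4 \<Longrightarrow> \<bar>Im s\<bar> = R" "s \<in> closed_segment a4 a1 \<Longrightarrow> Re s = 0" for s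
    using R by (auto simp: closed_segment_same_Re closed_segment_same_Im a1_def a2_def a3_def a4_def)
  have notin: "z \<notin> closed_segment a1 a2" "z \<notin> closed_segment a2 a3" "z \<notin> closed_segment a3 a4" "z \<notin> closed_segment a4 a1"
  proof -
    have "\<bar>Im z\<bar> \<noteq> R" "Re z \<noteq> R" "Re z \<noteq> 0" using R z0_pos by (simp_all add: z_def)
    then show "z \<notin> closed_segment a1 a2" "z \<notin> closed_segment a2 a3" "z \<notin> closed_segment a3 a4" "z \<notin> closed_segment a4 a1"
      using segs[of z] by blast+
  qed
  have nn: "a1 \<in> {s. 0 \<le> Re s}" "a2 \<in> {s. 0 \<le> Re s}" "a3 \<in> {s. 0 \<le> Re s}" "a4 \<in> {s. 0 \<le> Re s}"
    using R by (auto simp: a1_def a2_def a3_def a4_def)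
  note ints = int[OF nn(1,2) notin(1)] int[OF nn(2,3) notin(2)] int[OF nn(3,4) notin(3)] int[OF nn(4,1) notin(4)]
  have split: "contour_integral (rectpath a1 a3) ?g = contour_integral (linepath a1 a2) ?g + (contour_integral (linepath a2 a3) ?g
     + (contour_integral (linepath a3 a4) ?g + contour_integral (linepath a4 a1) ?g))"
    unfolding rect using ints by (simp add: valid_path_join)
  have bound: "norm (?g s) \<le> 1 / (C * R powr p)" if "R \<le> norm s" "0 \<le> Re s" for s
  proof -
    have 0: "0 < C * R powr p" using C_pos R by simp
    have "C * R powr p \<le> C * norm s powr p"
      using that C_pos R p_gt by (intro mult_left_mono powr_mono2) auto
    also have "C * norm s powr p \<le> norm (of_real v - \<Phi> s)" using that R by (intro growth) auto
    finally have le: "C * R powr p \<le> norm (of_real v - \<Phi> s)" .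
    have "norm (?g s) = 1 / norm (of_real v - \<Phi> s)" by (simp only: norm_divide norm_one)
    also have "\<dots> \<le> 1 / (C * R powr p)" by (rule frac_le) (use 0 le in auto)
    finally show ?thesis .
  qed
  let ?B = "1 / (C * R powr p)"
  have B0: "0 \<le> ?B" using C_pos R by simp
  define I1 I2 I3 where "I1 = contour_integral (linepath a1 a2) ?g" and "I2 = contour_integral (linepath a2 a3) ?g"
    and "I3 = contour_integral (linepath a3 a4) ?g"
  define J where "J = integral {-R..R} (\<lambda>x. ?g (\<i> * of_real x))"
  have len: "norm (a2 - a1) = R" "norm (a3 - a2) = 2 * R" "norm (a4 - a3) = R"
    using R by (auto simp: a1_def a2_def a3_def a4_def cmod_def real_sqrt_mult)
  have "norm I1 \<le> ?B * norm (a2 - a1)"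
    unfolding I1_def by (rule contour_integral_bound_linepath[OF ints(1) B0 bound])
       (use segs(1) far seg[OF nn(1,2)] in blast)+
  moreover have "norm I2 \<le> ?B * norm (a3 - a2)"
    unfolding I2_def by (rule contour_integral_bound_linepath[OF ints(2) B0 bound])
       (use segs(2) far seg[OF nn(2,3)] in blast)+
  moreover have "norm I3 \<le> ?B * norm (a4 - a3)"
    unfolding I3_def by (rule contour_integral_bound_linepath[OF ints(3) B0 bound])
       (use segs(3) far seg[OF nn(3,4)] in blast)+
  ultimately have "norm (I1 + I2 + I3) \<le> ?B * R + ?B * (2 * R) + ?B * R"
    unfolding len by (intro order_trans[OF norm_triangle_ineq[of "I1 + I2" I3]] add_mono order_trans[OF norm_triangle_ineq[of I1 I2]])
  also have "\<dots> = 4 / C * (R / R powr p)" using R C_pos by simp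
  also have "R / R powr p = R powr (1 - p)" using R by (simp add: powr_diff)
  finally have *: "norm (I1 + I2 + I3) \<le> 4 / C * R powr (1 - p)" .
  have last: "contour_integral (linepath a4 a1) ?g = - (\<i> * J)"
  proof -
    have "contour_integral (linepath a1 a4) ?g = \<i> * integral {-R..R} (\<lambda>x. ?g (Complex 0 x))"
      using R by (intro contour_integral_linepath_same_Re) (auto simp: a1_def a4_def)
    moreover have "contour_integral (linepath a4 a1) ?g = - contour_integral (linepath a1 a4) ?g"
      using contour_integral_reversepath[of "linepath a1 a4" ?g] by simp
    moreover have "Complex 0 x = \<i> * of_real x" for x by (simp add: complex_eq_iff)
    ultimately show ?thesis by (simp add: J_def)
  qed
  define w where "w = 2 * pi / \<Phi>' z"
  have "I1 + (I2 + (I3 + - (\<i> * J))) = - (\<i> * w)"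
    using total unfolding split last I1_def[symmetric] I2_def[symmetric] I3_def[symmetric] by (simp add: w_def)
  moreover have "I1 + I2 + I3 = (I1 + (I2 + (I3 + - (\<i> * J)))) + \<i> * J" by simp
  ultimately have "I1 + I2 + I3 = - (\<i> * w) + \<i> * J" by (simp only:)
  then have "\<i> * (J - w) = I1 + I2 + I3" by (simp add: right_diff_distrib)
  then have "norm (\<i> * (J - w)) \<le> 4 / C * R powr (1 - p)" using * by simp
  then show ?thesis by (simp add: norm_mult w_def z_def J_def)
qed

lemma lborel_integral_inverse:
  assumes int: "integrable lborel (\<lambda>x. 1 / (of_real v - \<Phi> (\<i> * of_real x)))"
  shows "(\<integral>x. 1 / (of_real v - \<Phi> (\<i> * of_real x)) \<partial>lborel) = 2 * pi / \<Phi>' (of_real z0)"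
proof -
  let ?g = "\<lambda>x. 1 / (of_real v - \<Phi> (\<i> * of_real x))"
  have "((\<lambda>R. \<integral>x. indicator {-R..R} x *\<^sub>R ?g x \<partial>lborel) \<longlongrightarrow> (\<integral>x. ?g x \<partial>lborel)) at_top"
  proof (rule integral_dominated_convergence_at_top[where w = "\<lambda>x. norm (?g x)"])
    show "AE x in lborel. ((\<lambda>R. indicator {-R..R} x *\<^sub>R ?g x) \<longlongrightarrow> ?g x) at_top"
    proof (rule AE_I2)
      fix x :: real
      have "eventually (\<lambda>R. indicator {-R..R} x *\<^sub>R ?g x = ?g x) at_top"
        using eventually_ge_at_top[of "\<bar>x\<bar>"] by eventually_elim (auto simp: indicator_def)
      then show "((\<lambda>R. indicator {-R..R} x *\<^sub>R ?g x) \<longlongrightarrow> ?g x) at_top"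
        by (rule tendsto_eventually)
    qed
    show "integrable lborel (\<lambda>x. norm (?g x))" using int by (rule integrable_norm)
  qed (use int in \<open>auto simp: indicator_def\<close>)
  moreover have "((\<lambda>R. \<integral>x. indicator {-R..R} x *\<^sub>R ?g x \<partial>lborel) \<longlongrightarrow> 2 * pi / \<Phi>' (of_real z0)) at_top"
  proof (rule Lim_null_comparison[THEN LIM_zero_cancel])
    show "eventually (\<lambda>R. norm ((\<integral>x. indicator {-R..R} x *\<^sub>R ?g x \<partial>lborel) - 2 * pi / \<Phi>' (of_real z0)) \<le> 4 / C * R powr (1 - p)) at_top"
      using eventually_gt_at_top[of "max (max R0 z0) 0"]
    proof eventually_elim
      case (elim R)
      have "set_integrable lborel {-R..R} ?g"
        unfolding set_integrable_def using int by (intro integrable_mult_indicator) auto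
      from set_borel_integral_eq_integral(2)[OF this] contour_estimate[of R] elim
      show ?case by (simp add: set_lebesgue_integral_def)
    qed
    show "((\<lambda>R. 4 / C * R powr (1 - p)) \<longlongrightarrow> 0) at_top"
      using p_gt by real_asymp
  qed
  ultimately show ?thesis by (intro tendsto_unique) auto
qed

end

text \<open>Fourier inversion at the point 0 for the transform exp(r Phi(ix)). The real part makes
  the value real at once. Where the integral diverges the value is 0 by convention, so only values
  at \<open>r\<close> with a convergent integral carry meaning.\<close>

definition dens :: "(complex \<Rightarrow> complex) \<Rightarrow> real \<Rightarrow> real" where
  "dens \<Phi> r = Re (\<integral>x. exp (of_real r * \<Phi> (\<i> * of_real x)) \<partial>lborel) / (2 * pi)"

lemma has_integral_exp_complex:
  assumes "0 < Re w"
  shows "integrable lborel (\<lambda>r. indicator {0<..} r *\<^sub>R exp (- w * of_real r))" (is ?int)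
    and "(\<integral>r. indicator {0<..} r *\<^sub>R exp (- w * of_real r) \<partial>lborel) = 1 / w" (is "?I = _")
    and "(\<integral>r. norm (indicator {0<..} r *\<^sub>R exp (- w * of_real r)) \<partial>lborel) = 1 / Re w" 
proof -
  have real: "set_integrable lborel {0..} (\<lambda>r. exp (- a * r))" "(LINT r:{0..}|lborel. exp (- a * r)) = 1 / a" if "0 < a" for a :: real
  proof -
    have "((\<lambda>r. exp (- a * r)) has_integral 1 / a) {0..}"
      using has_integral_exp_minus_to_infinity[OF that, of 0] by simp
    then have *: "set_integrable lebesgue {0..} (\<lambda>r. exp (- a * r))" "integral {0..} (\<lambda>r. exp (- a * r)) = 1 / a"
      by (auto intro!: nonnegative_absolutely_integrable_1 simp: integral_unique has_integral_integrable)
    from *(1) show 1: "set_integrable lborel {0..} (\<lambda>r. exp (- a * r))"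
      unfolding set_integrable_def by (subst integrable_completion[symmetric]) auto
    show "(LINT r:{0..}|lborel. exp (- a * r)) = 1 / a"
      using set_borel_integral_eq_integral(2)[OF 1] *(2) by simp
  qed
  have AE: "AE r in lborel. r \<noteq> (0::real)" by (rule AE_lborel_singleton)
  have int0: "set_integrable lborel {0..} (\<lambda>r. exp (- w * of_real r))"
    unfolding set_integrable_def
    by (rule Bochner_Integration.integrable_bound[OF real(1)[OF assms, unfolded set_integrable_def]])
       (auto simp: indicator_def)
  have "integrable lborel (\<lambda>r. indicator {0<..} r *\<^sub>R exp (- w * of_real r)) \<longleftrightarrow>
      integrable lborel (\<lambda>r. indicator {0..} r *\<^sub>R exp (- w * of_real r))"
  proof (rule integrable_cong_AE)
    show "AE r in lborel. indicator {0<..} r *\<^sub>R exp (- w * of_real r) = indicator {0..} r *\<^sub>R exp (- w * of_real r)"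
      using AE by eventually_elim (auto simp: indicator_def)
  qed auto
  with int0 show ?int unfolding set_integrable_def by blast
  have "?I = (LINT r:{0..}|lborel. exp (- w * of_real r))"
    unfolding set_lebesgue_integral_def
    by (rule integral_cong_AE) (use AE in \<open>auto simp: indicator_def elim: AE_mp\<close>)
  moreover have "((\<lambda>b. LINT r:{0..b}|lborel. exp (- w * of_real r)) \<longlongrightarrow> (LINT r:{0..}|lborel. exp (- w * of_real r))) at_top"
    using int0 by (intro tendsto_set_lebesgue_integral_at_top) auto
  moreover have "((\<lambda>b. LINT r:{0..b}|lborel. exp (- w * of_real r)) \<longlongrightarrow> 1 / w) at_top"
  proof -
    have ev: "eventually (\<lambda>b. (1 - exp (- w * of_real b)) / w = (LINT r:{0..b}|lborel. exp (- w * of_real r))) at_top"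
      using eventually_ge_at_top[of 0]
    proof eventually_elim
      case (elim b)
      have "((\<lambda>r. exp (- w * of_real r)) has_integral (- exp (- w * of_real b) / w - (- exp (- w * of_real 0) / w))) {0..b}"
      proof (rule fundamental_theorem_of_calculus)
        fix x :: real
        have "((\<lambda>x. - exp (- w * x) / w) has_field_derivative exp (- w * of_real x)) (at (of_real x))"
          using assms by (auto intro!: derivative_eq_intros)
        then show "((\<lambda>r. - exp (- w * of_real r) / w) has_vector_derivative exp (- w * of_real x)) (at x within {0..b})"
          by (rule has_vector_derivative_real_field)
      qed (use elim in auto)
      moreover have "set_integrable lborel {0..b} (\<lambda>r. exp (- w * of_real r))"
        using int0 by (rule set_integrable_subset) auto
      ultimately show ?case
        using assms by (simp add: set_borel_integral_eq_integral(2) integral_unique diff_divide_distrib)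
    qed
    have "((\<lambda>b. exp (- (Re w * b))) \<longlongrightarrow> 0) at_top"
      using assms by real_asymp
    then have "((\<lambda>b. norm (exp (- w * complex_of_real b))) \<longlongrightarrow> 0) at_top"
      by simp
    then have e: "((\<lambda>b. exp (- w * complex_of_real b)) \<longlongrightarrow> 0) at_top"
      by (rule tendsto_norm_zero_cancel)
    have "w \<noteq> 0" using assms by auto
    then have "((\<lambda>b. (1 - exp (- w * complex_of_real b)) / w) \<longlongrightarrow> (1 - 0) / w) at_top"
      by (intro tendsto_divide tendsto_diff tendsto_const e)
    then show ?thesis using ev by (auto dest: Lim_transform_eventually)
  qed
  ultimately show "?I = 1 / w" using tendsto_unique[OF trivial_limit_at_top_linorder] by metis
  have "(\<integral>r. norm (indicator {0<..} r *\<^sub>R exp (- w * of_real r)) \<partial>lborel) = (LINT r:{0..}|lborel. exp (- Re w * r))"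
    unfolding set_lebesgue_integral_def
    by (rule integral_cong_AE) (use AE in \<open>auto simp: indicator_def elim: AE_mp\<close>)
  then show "(\<integral>r. norm (indicator {0<..} r *\<^sub>R exp (- w * of_real r)) \<partial>lborel) = 1 / Re w"
    using real(2)[OF assms] by simp
qed

section \<open>Laplace transform of the density\<close>

context half_plane_map
begin

text \<open>Fubini exchanges \<open>r\<close> and \<open>x\<close>: the inner integral over
  \<open>r\<close> is \<open>1 / (v - \<Phi> (\<i> * x))\<close> and the outer one is the contour
  integral. The L1 norm in \<open>r\<close> is the reciprocal of the real part, whose integrability
  is the hypothesis. The value \<open>1 / \<Phi>' z0\<close> is the derivative of the inverse of
  \<open>\<Phi>\<close> at \<open>v\<close>.\<close>

lemma laplace_dens:
  assumes int: "integrable lborel (\<lambda>x. 1 / (v - Re (\<Phi> (\<i> * of_real x))))"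
  shows "set_integrable lborel {0<..} (\<lambda>r. exp (- v * r) * dens \<Phi> r)"
    and "(LINT r:{0<..}|lborel. exp (- v * r) * dens \<Phi> r) = Re (1 / \<Phi>' (of_real z0))"
proof -
  have "continuous_on UNIV (\<lambda>x::real. \<Phi> (\<i> * of_real x))"
    by (rule continuous_on_compose2[OF cont]) (auto intro!: continuous_intros)
  then have [measurable]: "(\<lambda>x::real. \<Phi> (\<i> * of_real x)) \<in> borel_measurable borel"
    by (rule borel_measurable_continuous_onI)
  define w where "w x = of_real v - \<Phi> (\<i> * of_real x)" for x
  have [measurable]: "w \<in> borel_measurable borel" unfolding w_def[abs_def] by measurable
  have w: "0 < Re (w x)" for x using Re_imag[of x] v_pos by (simp add: w_def)
  define h where "h x r = indicator {0<..} r *\<^sub>R exp (- w x * of_real r)" for x r :: real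
  have [measurable]: "case_prod h \<in> borel_measurable (lborel \<Otimes>\<^sub>M lborel)"
    unfolding h_def[abs_def] by measurable
  have Hint: "integrable (lborel \<Otimes>\<^sub>M lborel) (case_prod h)"
  proof (rule lborel_pair.Fubini_integrable)
    show "integrable lborel (\<lambda>x. \<integral>y. norm (case_prod h (x, y)) \<partial>lborel)"
      using int has_integral_exp_complex(3)[OF w] by (simp add: h_def w_def)
    show "AE x in lborel. integrable lborel (\<lambda>y. case_prod h (x, y))"
      using has_integral_exp_complex(1)[OF w] by (auto simp: h_def)
  qed measurable
  have inner: "(\<integral>x. h x r \<partial>lborel) = indicator {0<..} r *\<^sub>R (of_real (exp (- v * r)) * (\<integral>x. exp (of_real r * \<Phi> (\<i> * of_real x)) \<partial>lborel))" for r
  proof -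
    have "h x r = indicator {0<..} r *\<^sub>R (of_real (exp (- v * r)) * exp (of_real r * \<Phi> (\<i> * of_real x)))" for x
      by (simp add: h_def w_def ring_distribs exp_diff exp_minus exp_add exp_of_real[symmetric] divide_inverse mult_ac
           flip: exp_add exp_of_real)
    then show ?thesis by simp
  qed
  have Re_inner: "Re (\<integral>x. h x r \<partial>lborel) = 2 * pi * (indicator {0<..} r *\<^sub>R (exp (- v * r) * dens \<Phi> r))" for r
    unfolding inner by (simp add: dens_def)
  have int1: "integrable lborel (\<lambda>r. \<integral>x. h x r \<partial>lborel)"
    using lborel_pair.integrable_snd[OF Hint] .
  from integrable_Re[OF this] show "set_integrable lborel {0<..} (\<lambda>r. exp (- v * r) * dens \<Phi> r)"
    unfolding Re_inner set_integrable_def by simp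
  have "2 * pi * (LINT r:{0<..}|lborel. exp (- v * r) * dens \<Phi> r) = (\<integral>r. Re (\<integral>x. h x r \<partial>lborel) \<partial>lborel)"
    unfolding Re_inner set_lebesgue_integral_def by simp
  also have "\<dots> = Re (\<integral>r. (\<integral>x. h x r \<partial>lborel) \<partial>lborel)"
    using int1 by (rule integral_Re)
  also have "(\<integral>r. (\<integral>x. h x r \<partial>lborel) \<partial>lborel) = (\<integral>x. (\<integral>r. h x r \<partial>lborel) \<partial>lborel)"
    by (rule lborel_pair.Fubini_integral[OF Hint])
  also have "\<dots> = (\<integral>x. 1 / w x \<partial>lborel)"
    using has_integral_exp_complex(2)[OF w] by (simp add: h_def)
  also have "\<dots> = 2 * pi / \<Phi>' (of_real z0)"
    unfolding w_def
  proof (rule lborel_integral_inverse)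
    show "integrable lborel (\<lambda>x. 1 / (of_real v - \<Phi> (\<i> * of_real x)))"
    proof (rule Bochner_Integration.integrable_bound[OF int], measurable, rule AE_I2)
      fix x :: real
      have "Re (w x) \<le> norm (w x)" by (rule complex_Re_le_cmod)
      then have "1 / norm (w x) \<le> 1 / Re (w x)" using w[of x] by (intro divide_left_mono mult_pos_pos) auto
      then show "norm (1 / (of_real v - \<Phi> (\<i> * of_real x))) \<le> norm (1 / (v - Re (\<Phi> (\<i> * of_real x))))"
        using w[of x] by (simp add: w_def norm_divide)
    qed
  qed
  also have "Re (2 * pi / \<Phi>' (of_real z0)) = 2 * pi * Re (1 / \<Phi>' (of_real z0))"
    by (simp add: Re_divide)
  finally show "(LINT r:{0<..}|lborel. exp (- v * r) * dens \<Phi> r) = Re (1 / \<Phi>' (of_real z0))"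
    by simp
qed

end

section \<open>Nonnegativity of the density\<close>

lemma integrable_gaussian:
  fixes \<beta> :: real
  assumes "0 < \<beta>"
  shows "integrable lborel (\<lambda>x. exp (- \<beta> * x^2))"
proof -
  define \<sigma> where "\<sigma> = sqrt (1 / (2 * \<beta>))"
  have \<sigma>: "0 < \<sigma>" "\<sigma>^2 = 1 / (2 * \<beta>)" using assms by (auto simp: \<sigma>_def)
  have "integrable lborel (\<lambda>x. sqrt (2 * pi * \<sigma>^2) * normal_density 0 \<sigma> x)"
    using \<sigma> by (intro integrable_mult_right integrable_normal_density) auto
  also have "(\<lambda>x. sqrt (2 * pi * \<sigma>^2) * normal_density 0 \<sigma> x) = (\<lambda>x. exp (- \<beta> * x^2))"
    using \<sigma> assms by (auto simp: normal_density_def fun_eq_iff)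
  finally show ?thesis .
qed

text \<open>Rescaling by \<open>k\<close> turns the integral into a positive multiple of the
  characteristic function of the standard normal law.\<close>

lemma gaussian_fourier_nonneg:
  fixes \<beta> z :: real
  assumes "0 < \<beta>"
  shows "0 \<le> Re (\<integral>x. of_real (exp (- \<beta> * x^2)) * exp (\<i> * of_real (z * x)) \<partial>lborel)"
proof -
  define k where "k = sqrt (1 / (2 * \<beta>))"
  have k: "0 < k" "k^2 = 1 / (2 * \<beta>)" using assms by (auto simp: k_def)
  have sq: "\<beta> * (k * x)^2 = x^2 / 2" for x
    using k assms by (simp add: power_mult_distrib)
  have "(\<integral>x. of_real (exp (- \<beta> * x^2)) * exp (\<i> * of_real (z * x)) \<partial>lborel)
     = k *\<^sub>R (\<integral>x. of_real (exp (- \<beta> * (0 + k * x)^2)) * exp (\<i> * of_real (z * (0 + k * x))) \<partial>lborel)"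
    using lborel_integral_real_affine[of k "\<lambda>x. complex_of_real (exp (- \<beta> * x^2)) * exp (\<i> * of_real (z * x))" 0] k
    by simp
  also have "(\<lambda>x. complex_of_real (exp (- \<beta> * (0 + k * x)^2)) * exp (\<i> * of_real (z * (0 + k * x))))
     = (\<lambda>x. of_real (sqrt (2 * pi)) * (std_normal_density x *\<^sub>R iexp ((z * k) * x)))"
    using sq by (auto simp: std_normal_density_def fun_eq_iff scaleR_conv_of_real mult_ac)
  also have "(\<integral>x. of_real (sqrt (2 * pi)) * (std_normal_density x *\<^sub>R iexp ((z * k) * x)) \<partial>lborel)
     = of_real (sqrt (2 * pi)) * (\<integral>x. std_normal_density x *\<^sub>R iexp ((z * k) * x) \<partial>lborel)"
    by (rule integral_mult_right_zero)
  also have "(\<integral>x. std_normal_density x *\<^sub>R iexp ((z * k) * x) \<partial>lborel) = char std_normal_distribution (z * k)"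
    unfolding char_def by (rule integral_density[symmetric]) auto
  also have "of_real (sqrt (2 * pi)) * char std_normal_distribution (z * k) = of_real (sqrt (2 * pi) * exp (- ((z * k)^2) / 2))"
    by (simp add: char_std_normal_distribution)
  finally show ?thesis using k(1) by simp
qed

text \<open>By Fourier inversion: the distribution with Fourier transform \<open>g\<close>, convolved with a Gaussian, has a
  nonnegative density.\<close>
definition gauss_pos :: "real \<Rightarrow> (real \<Rightarrow> complex) \<Rightarrow> bool" where
  "gauss_pos \<beta> g \<longleftrightarrow> g \<in> borel_measurable borel \<and> (\<exists>B. \<forall>x. norm (g x) \<le> B) \<and>
     (\<forall>z. 0 \<le> Re (\<integral>x. of_real (exp (- \<beta> * x^2)) * exp (\<i> * of_real (z * x)) * g x \<partial>lborel))"

lemma integrable_gaussian_mult: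
  fixes \<beta> z :: real
  assumes "0 < \<beta>" and [measurable]: "g \<in> borel_measurable borel" and "\<And>x. norm (g x) \<le> B"
  shows "integrable lborel (\<lambda>x. of_real (exp (- \<beta> * x^2)) * exp (\<i> * of_real (z * x)) * g x)"
proof (rule Bochner_Integration.integrable_bound)
  show "integrable lborel (\<lambda>x. B * exp (- \<beta> * x^2))"
    using integrable_gaussian[OF assms(1)] by simp
  have "0 \<le> B" using assms(3)[of 0] norm_ge_zero[of "g 0"] by linarith
  then show "AE x in lborel. norm (of_real (exp (- \<beta> * x^2)) * exp (\<i> * of_real (z * x)) * g x) \<le> norm (B * exp (- \<beta> * x^2))"
    using assms(3) by (auto simp: norm_mult mult.commute intro!: mult_right_mono)
qed measurable

lemma gauss_pos_1: "0 < \<beta> \<Longrightarrow> gauss_pos \<beta> (\<lambda>x. 1)"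
  unfolding gauss_pos_def using gaussian_fourier_nonneg by (auto intro!: exI[of _ 1])

lemma gauss_pos_add:
  assumes "0 < \<beta>" "gauss_pos \<beta> f" "gauss_pos \<beta> g"
  shows "gauss_pos \<beta> (\<lambda>x. f x + g x)"
proof -
  from assms obtain A B where f: "f \<in> borel_measurable borel" "\<And>x. norm (f x) \<le> A" 
     "\<And>z. 0 \<le> Re (\<integral>x. of_real (exp (- \<beta> * x^2)) * exp (\<i> * of_real (z * x)) * f x \<partial>lborel)"
   and g: "g \<in> borel_measurable borel" "\<And>x. norm (g x) \<le> B" 
     "\<And>z. 0 \<le> Re (\<integral>x. of_real (exp (- \<beta> * x^2)) * exp (\<i> * of_real (z * x)) * g x \<partial>lborel)"
    by (auto simp: gauss_pos_def)
  have "norm (f x + g x) \<le> A + B" for x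
    using f(2) g(2) by (intro order_trans[OF norm_triangle_ineq] add_mono)
  moreover have "0 \<le> Re (\<integral>x. of_real (exp (- \<beta> * x^2)) * exp (\<i> * of_real (z * x)) * (f x + g x) \<partial>lborel)" for z
    unfolding distrib_left
    unfolding Bochner_Integration.integral_add[OF integrable_gaussian_mult[OF assms(1) f(1,2)]
          integrable_gaussian_mult[OF assms(1) g(1,2)]] plus_complex.simps
    using f(3)[of z] g(3)[of z] by (rule add_nonneg_nonneg)
  ultimately show ?thesis using f(1) g(1) unfolding gauss_pos_def by (auto intro!: exI[of _ "A + B"])
qed

lemma gauss_pos_scale:
  assumes "0 < \<beta>" "gauss_pos \<beta> f" "0 \<le> a"
  shows "gauss_pos \<beta> (\<lambda>x. of_real a * f x)"
proof -
  from assms obtain A where f: "f \<in> borel_measurable borel" "\<And>x. norm (f x) \<le> A" 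
     "\<And>z. 0 \<le> Re (\<integral>x. of_real (exp (- \<beta> * x^2)) * exp (\<i> * of_real (z * x)) * f x \<partial>lborel)"
    by (auto simp: gauss_pos_def)
  have "norm (of_real a * f x) \<le> a * A" for x
    using f(2)[of x] assms by (simp add: norm_mult mult_left_mono)
  moreover have "0 \<le> Re (\<integral>x. of_real (exp (- \<beta> * x^2)) * exp (\<i> * of_real (z * x)) * (of_real a * f x) \<partial>lborel)" for z
  proof -
    have "(\<integral>x. of_real (exp (- \<beta> * x^2)) * exp (\<i> * of_real (z * x)) * (of_real a * f x) \<partial>lborel)
      = (\<integral>x. of_real a * (of_real (exp (- \<beta> * x^2)) * exp (\<i> * of_real (z * x)) * f x) \<partial>lborel)"
      by (simp add: mult_ac)
    also have "\<dots> = of_real a * (\<integral>x. of_real (exp (- \<beta> * x^2)) * exp (\<i> * of_real (z * x)) * f x \<partial>lborel)"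
      by (rule integral_mult_right_zero)
    finally show ?thesis using f(3)[of z] assms by simp
  qed
  ultimately show ?thesis using f(1) unfolding gauss_pos_def by (auto intro!: exI[of _ "a * A"])
qed

text \<open>Multiplying by the Fourier transform of \<open>\<nu>\<close> averages the nonnegative
  function of \<open>z\<close> over shifts: by Fubini, the factor exp(-ixy) only replaces
  \<open>z\<close> by \<open>z - y\<close>.\<close>

lemma gauss_pos_fourier:
  fixes \<nu> :: "real measure"
  assumes \<beta>: "0 < \<beta>" and g: "gauss_pos \<beta> g" and fin: "finite_measure \<nu>" and [measurable_cong]: "sets \<nu> = sets borel"
  shows "gauss_pos \<beta> (\<lambda>x. (\<integral>y. exp (- (\<i> * of_real (x * y))) \<partial>\<nu>) * g x)"
proof -
  interpret finite_measure \<nu> by fact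
  interpret pair_sigma_finite lborel \<nu> ..
  from g obtain B where g[measurable]: "g \<in> borel_measurable borel" and B: "\<And>x. norm (g x) \<le> B" 
     and pos: "\<And>z. 0 \<le> Re (\<integral>x. of_real (exp (- \<beta> * x^2)) * exp (\<i> * of_real (z * x)) * g x \<partial>lborel)"
    by (auto simp: gauss_pos_def)
  have B0: "0 \<le> B" using B[of 0] norm_ge_zero[of "g 0"] by linarith
  have [measurable]: "(\<lambda>(x, y). exp (- (\<i> * complex_of_real (x * y)))) \<in> borel_measurable (lborel \<Otimes>\<^sub>M \<nu>)"
    by measurable
  have meas: "(\<lambda>x. (\<integral>y. exp (- (\<i> * complex_of_real (x * y))) \<partial>\<nu>)) \<in> borel_measurable lborel"
    by measurable
  have bd: "norm (\<integral>y. exp (- (\<i> * complex_of_real (x * y))) \<partial>\<nu>) \<le> measure \<nu> (space \<nu>)" for x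
    by (rule order_trans[OF integral_norm_bound]) simp
  have "norm ((\<integral>y. exp (- (\<i> * of_real (x * y))) \<partial>\<nu>) * g x) \<le> measure \<nu> (space \<nu>) * B" for x
    unfolding norm_mult using bd B B0 by (intro mult_mono) auto
  moreover have "0 \<le> Re (\<integral>x. of_real (exp (- \<beta> * x^2)) * exp (\<i> * of_real (z * x)) * ((\<integral>y. exp (- (\<i> * of_real (x * y))) \<partial>\<nu>) * g x) \<partial>lborel)" for z
  proof -
    define f where "f x y = of_real (exp (- \<beta> * x^2)) * exp (\<i> * of_real (z * x)) * (exp (- (\<i> * of_real (x * y))) * g x)" for x y
    have [measurable]: "case_prod f \<in> borel_measurable (lborel \<Otimes>\<^sub>M \<nu>)" unfolding f_def[abs_def] by measurable
    have nf: "norm (f x y) = exp (- \<beta> * x^2) * norm (g x)" for x y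
      by (simp add: f_def norm_mult)
    have intg: "integrable lborel (\<lambda>x. exp (- \<beta> * x^2) * norm (g x))"
      using integrable_norm[OF integrable_gaussian_mult[OF \<beta> g B, of 0]] by (simp add: norm_mult)
    have int: "integrable (lborel \<Otimes>\<^sub>M \<nu>) (case_prod f)"
    proof (rule Fubini_integrable)
      show "integrable lborel (\<lambda>x. \<integral>y. norm (case_prod f (x, y)) \<partial>\<nu>)"
        using integrable_mult_right[OF intg, of "measure \<nu> (space \<nu>)"] by (simp add: nf mult.assoc)
      show "AE x in lborel. integrable \<nu> (\<lambda>y. case_prod f (x, y))"
      proof (rule AE_I2)
        fix x :: real
        have "integrable \<nu> (\<lambda>y. f x y)"
        proof (rule integrable_const_bound[where B = "exp (- \<beta> * x^2) * norm (g x)"])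
          show "AE y in \<nu>. norm (f x y) \<le> exp (- \<beta> * x^2) * norm (g x)" by (simp only: nf) simp
          show "f x \<in> borel_measurable \<nu>" unfolding f_def by measurable
        qed
        then show "integrable \<nu> (\<lambda>y. case_prod f (x, y))" by simp
      qed
    qed measurable
    have "(\<integral>x. of_real (exp (- \<beta> * x^2)) * exp (\<i> * of_real (z * x)) * ((\<integral>y. exp (- (\<i> * of_real (x * y))) \<partial>\<nu>) * g x) \<partial>lborel)
      = (\<integral>x. (\<integral>y. f x y \<partial>\<nu>) \<partial>lborel)"
      unfolding f_def by simp
    also have "\<dots> = (\<integral>y. (\<integral>x. f x y \<partial>lborel) \<partial>\<nu>)"
      by (rule Fubini_integral[OF int, symmetric])
    also have "Re \<dots> = (\<integral>y. Re (\<integral>x. f x y \<partial>lborel) \<partial>\<nu>)"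
      by (rule integral_Re[symmetric]) (rule integrable_snd[OF int])
    also have "\<dots> \<ge> 0"
    proof (rule Bochner_Integration.integral_nonneg)
      fix y
      have "f x y = of_real (exp (- \<beta> * x^2)) * exp (\<i> * of_real ((z - y) * x)) * g x" for x
        by (simp add: f_def left_diff_distrib right_diff_distrib exp_diff exp_minus divide_inverse mult_ac)
      then show "0 \<le> Re (\<integral>x. f x y \<partial>lborel)" using pos[of "z - y"] by simp
    qed
    finally show ?thesis .
  qed
  ultimately show ?thesis using meas unfolding gauss_pos_def by (auto intro!: exI[of _ "measure \<nu> (space \<nu>) * B"])
qed

text \<open>Partial sums of the exponential series are nonnegative combinations of powers of the
  transform, each \<open>gauss_pos\<close> by induction. The transform is bounded by the total mass
  \<open>m\<close>, so exp(r m) times the Gaussian dominates the limit.\<close>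

lemma gauss_pos_exp_fourier:
  fixes \<nu> :: "real measure"
  assumes \<beta>: "0 < \<beta>" and r: "0 \<le> r" and fin: "finite_measure \<nu>" and [measurable_cong]: "sets \<nu> = sets borel"
  shows "0 \<le> Re (\<integral>x. of_real (exp (- \<beta> * x^2)) * exp (\<i> * of_real (z * x)) * exp (of_real r * (\<integral>y. exp (- (\<i> * of_real (x * y))) \<partial>\<nu>)) \<partial>lborel)"
proof -
  interpret finite_measure \<nu> by fact
  interpret pair_sigma_finite lborel \<nu> ..
  define h where "h x = (\<integral>y. exp (- (\<i> * complex_of_real (x * y))) \<partial>\<nu>)" for x
  define m where "m = measure \<nu> (space \<nu>)"
  have hb: "norm (h x) \<le> m" for x
    unfolding h_def m_def by (rule order_trans[OF integral_norm_bound]) simp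
  have pw: "gauss_pos \<beta> (\<lambda>x. h x ^ k)" for k
  proof (induction k)
    case (Suc k)
    then show ?case using gauss_pos_fourier[OF \<beta> Suc fin assms(4)] by (simp add: h_def)
  qed (use gauss_pos_1[OF \<beta>] in simp)
  define S where "S n x = (\<Sum>k<n. of_real (r ^ k / fact k) * h x ^ k)" for n x
  have S: "gauss_pos \<beta> (S n)" for n
  proof (induction n)
    case 0
    show ?case using gauss_pos_scale[OF \<beta> gauss_pos_1[OF \<beta>], of 0] by (simp add: S_def[abs_def])
  next
    case (Suc n)
    have "gauss_pos \<beta> (\<lambda>x. of_real (r ^ n / fact n) * h x ^ n)"
      using r by (intro gauss_pos_scale[OF \<beta> pw]) auto
    from gauss_pos_add[OF \<beta> Suc this] show ?case by (simp add: S_def[abs_def])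
  qed
  have Slim: "(\<lambda>n. S n x) \<longlonglongrightarrow> exp (of_real r * h x)" for x
    using exp_converges[of "of_real r * h x"]
    by (simp add: sums_def S_def scaleR_conv_of_real power_mult_distrib divide_inverse mult_ac)
  have Sb: "norm (S n x) \<le> exp (r * m)" for n x
  proof -
    have "norm (S n x) \<le> (\<Sum>k<n. norm (of_real (r ^ k / fact k) * h x ^ k))"
      unfolding S_def by (rule norm_sum)
    also have "\<dots> \<le> (\<Sum>k<n. (r * m) ^ k /\<^sub>R fact k)"
    proof (rule sum_mono)
      fix k
      have "norm (h x) ^ k \<le> m ^ k" using hb by (intro power_mono) auto
      then have "(r ^ k / fact k) * norm (h x) ^ k \<le> (r ^ k / fact k) * m ^ k"
        using r by (intro mult_left_mono) auto
      moreover have "norm (of_real (r ^ k / fact k) * h x ^ k) = (r ^ k / fact k) * norm (h x) ^ k"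
        using r by (simp only: norm_mult norm_of_real norm_power) simp
      moreover have "(r * m) ^ k /\<^sub>R fact k = (r ^ k / fact k) * m ^ k"
        by (simp add: power_mult_distrib divide_inverse)
      ultimately show "norm (of_real (r ^ k / fact k) * h x ^ k) \<le> (r * m) ^ k /\<^sub>R fact k" by simp
    qed
    also have "\<dots> \<le> exp (r * m)"
      unfolding exp_def using r order_trans[OF norm_ge_zero hb[of 0]]
      by (intro sum_le_suminf summable_exp_generic) (auto simp: intro!: mult_nonneg_nonneg zero_le_power)
    finally show ?thesis .
  qed
  have [measurable]: "S n \<in> borel_measurable borel" for n using S[of n] by (simp add: gauss_pos_def)
  have [measurable]: "h \<in> borel_measurable borel" using pw[of 1] by (simp add: gauss_pos_def)
  have "(\<lambda>n. \<integral>x. of_real (exp (- \<beta> * x^2)) * exp (\<i> * of_real (z * x)) * S n x \<partial>lborel)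
      \<longlonglongrightarrow> (\<integral>x. of_real (exp (- \<beta> * x^2)) * exp (\<i> * of_real (z * x)) * exp (of_real r * h x) \<partial>lborel)"
  proof (rule integral_dominated_convergence)
    show "integrable lborel (\<lambda>x. exp (- \<beta> * x^2) * exp (r * m))"
      using integrable_gaussian[OF \<beta>] by simp
    show "AE x in lborel. (\<lambda>n. of_real (exp (- \<beta> * x^2)) * exp (\<i> * of_real (z * x)) * S n x)
       \<longlonglongrightarrow> of_real (exp (- \<beta> * x^2)) * exp (\<i> * of_real (z * x)) * exp (of_real r * h x)"
      by (intro AE_I2 tendsto_mult_left Slim)
    show "AE x in lborel. norm (of_real (exp (- \<beta> * x^2)) * exp (\<i> * of_real (z * x)) * S n x) \<le> exp (- \<beta> * x^2) * exp (r * m)" for n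
      using Sb by (auto simp: norm_mult)
  qed measurable
  from tendsto_Re[OF this] show ?thesis
    unfolding h_def[symmetric]
    by (rule LIMSEQ_le_const) (use S in \<open>auto simp: gauss_pos_def\<close>)
qed

section \<open>Nonnegativity for exponents with a Gaussian component\<close>

context levy_data
begin

text \<open>Approximation by compound Poisson exponents; the Gaussian component keeps all integrals absolutely
  convergent.\<close>
lemma dens_nonneg:
  assumes c: "0 < c" and r: "0 < r"
  shows "0 \<le> dens cPhi r"
proof -
  \<comment> \<open>Removing the jumps of size at most 1 / (n + 1) leaves a finite measure even
    after division by \<open>y\<close>.\<close>
  define A where "A n = {inverse (real (Suc n))<..}" for n
  have A[measurable]: "A n \<in> sets borel" for n by (simp add: A_def)
  define K where "K n x = - of_real (c / 2 * x^2) + (\<integral>y. indicator (A n) y *\<^sub>R Phi_ker (\<i> * of_real x) y \<partial>\<pi>)" for n x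
  have intK: "integrable \<pi> (\<lambda>y. indicator (A n) y *\<^sub>R Phi_ker (\<i> * of_real x) y)" for n x
    using integrable_Phi_ker[of "\<i> * of_real x"] by (intro integrable_mult_indicator) (auto simp: sets_pi)
  have cI: "cPhi (\<i> * of_real x) = - of_real (c / 2 * x^2) + (\<integral>y. Phi_ker (\<i> * of_real x) y \<partial>\<pi>)" for x
    by (simp add: cPhi_def power_mult_distrib)
  have Klim: "(\<lambda>n. K n x) \<longlonglongrightarrow> cPhi (\<i> * of_real x)" for x
    unfolding K_def cI
  proof (intro tendsto_add tendsto_const integral_dominated_convergence)
    show "integrable \<pi> (\<lambda>y. norm (Phi_ker (\<i> * of_real x) y))"
      using integrable_Phi_ker[of "\<i> * of_real x"] by (intro integrable_norm) auto
    show "AE y in \<pi>. (\<lambda>n. indicator (A n) y *\<^sub>R Phi_ker (\<i> * of_real x) y) \<longlonglongrightarrow> Phi_ker (\<i> * of_real x) y"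
      using AE_pos
    proof eventually_elim
      case (elim y)
      have "eventually (\<lambda>n. inverse (real (Suc n)) < y) sequentially"
        using LIMSEQ_inverse_real_of_nat elim by (rule order_tendstoD(2))
      then have "eventually (\<lambda>n. indicator (A n) y *\<^sub>R Phi_ker (\<i> * of_real x) y = Phi_ker (\<i> * of_real x) y) sequentially"
        by eventually_elim (auto simp: A_def)
      then show ?case by (rule tendsto_eventually)
    qed
  qed (auto simp: indicator_def)
  have KRe: "Re (K n x) \<le> - (c / 2 * x^2)" for n x
  proof -
    have "Re (\<integral>y. indicator (A n) y *\<^sub>R Phi_ker (\<i> * of_real x) y \<partial>\<pi>) = (\<integral>y. Re (indicator (A n) y *\<^sub>R Phi_ker (\<i> * of_real x) y) \<partial>\<pi>)"
      by (rule integral_Re[OF intK, symmetric])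
    also have "\<dots> \<le> 0"
    proof -
      have "0 \<le> (\<integral>y. - Re (indicator (A n) y *\<^sub>R Phi_ker (\<i> * of_real x) y) \<partial>\<pi>)"
        by (rule integral_nonneg_AE, use AE_pos in eventually_elim) (auto simp: Re_Phi_ker_imag indicator_def)
      then show ?thesis by simp
    qed
    finally show ?thesis by (simp add: K_def)
  qed
  have ex: "\<exists>\<nu> l (m :: real). finite_measure \<nu> \<and> sets \<nu> = sets borel \<and> (\<forall>x. K n x = - of_real (c / 2 * x^2)
      + (\<i> * of_real x * of_real m - of_real l + (\<integral>y. exp (- (\<i> * of_real (x * y))) \<partial>\<nu>)))" for n
  proof -
    \<comment> \<open>As an exponent, Phi has the jump measure \<open>\<pi>(dy) / y\<close>: the
      kernel at \<open>\<i> * x\<close> equals ix - 1/y + exp(-ixy)/y, and the three terms integrate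
      to \<open>\<i> * x * m\<close>, \<open>- l\<close> and the Fourier transform of
      \<open>\<nu>\<close>.\<close>
    define \<nu> where "\<nu> = density \<pi> (\<lambda>y. ennreal (indicator (A n) y / y))"
    define j where "j = inverse (real (Suc n))"
    have j: "0 < j" "j \<le> 1" by (auto simp: j_def inverse_le_1_iff)
    \<comment> \<open>For \<open>j < y\<close> both \<open>1 / y\<close> and \<open>1\<close> are at
      most \<open>min 1 y / j^2\<close>, because \<open>j\<close> is at most 1.\<close>
    have bnd: "indicator (A n) y / y \<le> (1 / j^2) * min 1 y" "indicator (A n) y \<le> (1 / j^2) * min 1 y" "0 \<le> indicator (A n) y / y" if "0 < y" for y
    proof -
      have "indicator (A n) y / y \<le> 1 / j^2 * min 1 y \<and> indicator (A n) y \<le> (1 / j^2) * min 1 y" if "j < y"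
      proof -
        have "j \<le> min 1 y" using j that by simp
        then have "j * j \<le> min 1 y * min 1 y" using j by (intro mult_mono) auto
        also have "\<dots> \<le> min 1 y * y" using \<open>0 < y\<close> by (intro mult_left_mono) auto
        finally have 1: "j^2 \<le> min 1 y * y" by (simp add: power2_eq_square)
        have "j * j \<le> 1 * min 1 y" using j \<open>j \<le> min 1 y\<close> by (intro mult_mono) auto
        then have 2: "j^2 \<le> min 1 y" by (simp add: power2_eq_square)
        have "indicator (A n) y = (1::real)" using that by (simp add: A_def j_def)
        with 1 2 show ?thesis using j \<open>0 < y\<close>
          by (simp add: field_simps del: min_less_iff_conj min.bounded_iff)
      qed
      then show "indicator (A n) y / y \<le> (1 / j^2) * min 1 y" "indicator (A n) y \<le> (1 / j^2) * min 1 y"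
        using \<open>0 < y\<close> by (cases "j < y"; simp add: A_def j_def)+
      show "0 \<le> indicator (A n) y / y" using that by (auto simp: indicator_def)
    qed
    have int1: "integrable \<pi> (\<lambda>y. indicator (A n) y / y)"
      using bnd by (intro integrable_dominated[where K = "1 / j^2"]) auto
    have int2: "integrable \<pi> (\<lambda>y. indicator (A n) y :: real)"
      using bnd by (intro integrable_dominated[where K = "1 / j^2"]) auto
    have pos0: "AE y in \<pi>. 0 \<le> indicator (A n) y / y"
      using AE_pos by eventually_elim (rule bnd)
    have sets_nu: "sets \<nu> = sets borel" by (simp add: \<nu>_def sets_pi)
    have "emeasure \<nu> (space \<nu>) = (\<integral>\<^sup>+y. ennreal (indicator (A n) y / y) \<partial>\<pi>)"
      unfolding \<nu>_def by (subst emeasure_density) (auto simp: sets_pi)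
    also have "\<dots> = ennreal (\<integral>y. indicator (A n) y / y \<partial>\<pi>)"
      using int1 pos0 by (rule nn_integral_eq_integral)
    finally have fin: "finite_measure \<nu>" by (intro finite_measureI) simp
    define l where "l = (\<integral>y. indicator (A n) y / y \<partial>\<pi>)"
    define m :: real where "m = (\<integral>y. indicator (A n) y \<partial>\<pi>)"
    have K_eq: "K n x = - of_real (c / 2 * x^2) + (\<i> * of_real x * of_real m - of_real l + (\<integral>y. exp (- (\<i> * of_real (x * y))) \<partial>\<nu>))" for x
    proof -
      have nu: "(\<integral>y. exp (- (\<i> * of_real (x * y))) \<partial>\<nu>) = (\<integral>y. (indicator (A n) y / y) *\<^sub>R exp (- (\<i> * of_real (x * y))) \<partial>\<pi>)"
        unfolding \<nu>_def using pos0 by (subst integral_density) auto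
      have i3: "integrable \<pi> (\<lambda>y. (indicator (A n) y / y) *\<^sub>R exp (- (\<i> * of_real (x * y))))"
        by (rule Bochner_Integration.integrable_bound[OF int1]) auto
      have "(\<integral>y. indicator (A n) y *\<^sub>R Phi_ker (\<i> * of_real x) y \<partial>\<pi>)
        = (\<integral>y. (\<i> * of_real x * of_real (indicator (A n) y) - of_real (indicator (A n) y / y))
            + (indicator (A n) y / y) *\<^sub>R exp (- (\<i> * of_real (x * y))) \<partial>\<pi>)"
        by (rule Bochner_Integration.integral_cong)
           (auto simp: Phi_ker_def indicator_def scaleR_conv_of_real mult_ac diff_divide_distrib)
      also have "\<dots> = (\<integral>y. \<i> * of_real x * of_real (indicator (A n) y) - of_real (indicator (A n) y / y) \<partial>\<pi>)
          + (\<integral>y. (indicator (A n) y / y) *\<^sub>R exp (- (\<i> * of_real (x * y))) \<partial>\<pi>)"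
        using int1 int2 i3 by (intro Bochner_Integration.integral_add Bochner_Integration.integrable_diff integrable_mult_right integrable_of_real)
      also have "(\<integral>y. \<i> * of_real x * of_real (indicator (A n) y) - complex_of_real (indicator (A n) y / y) \<partial>\<pi>)
          = (\<integral>y. \<i> * of_real x * of_real (indicator (A n) y) \<partial>\<pi>) - (\<integral>y. complex_of_real (indicator (A n) y / y) \<partial>\<pi>)"
        using int1 int2 by (intro Bochner_Integration.integral_diff integrable_mult_right integrable_of_real)
      also have "\<dots> = \<i> * of_real x * of_real m - of_real l"
        unfolding m_def l_def by (simp only: integral_complex_of_real integral_mult_right_zero)
      finally show ?thesis unfolding K_def nu by simp
    qed
    then show ?thesis using fin sets_nu by blast
  qed
  have K_meas[measurable]: "K n \<in> borel_measurable borel" for n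
  proof -
    from ex[of n] obtain \<nu> and l m :: real where fin: "finite_measure \<nu>" and sets_nu[measurable_cong]: "sets \<nu> = sets borel"
      and K_eq: "\<And>x. K n x = - of_real (c / 2 * x^2)
        + (\<i> * of_real x * of_real m - of_real l + (\<integral>y. exp (- (\<i> * of_real (x * y))) \<partial>\<nu>))"
      by auto
    interpret finite_measure \<nu> by fact
    have [measurable]: "(\<lambda>(x, y). exp (- (\<i> * complex_of_real (x * y)))) \<in> borel_measurable (borel \<Otimes>\<^sub>M \<nu>)"
      by measurable
    show ?thesis unfolding K_eq[abs_def] by measurable
  qed
  have pos: "0 \<le> Re (\<integral>x. exp (of_real r * K n x) \<partial>lborel)" for n
  proof -
    from ex[of n] obtain \<nu> and l m :: real where fin: "finite_measure \<nu>" and sets_nu: "sets \<nu> = sets borel"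
      and K_eq: "\<And>x. K n x = - of_real (c / 2 * x^2)
        + (\<i> * of_real x * of_real m - of_real l + (\<integral>y. exp (- (\<i> * of_real (x * y))) \<partial>\<nu>))"
      by auto
    \<comment> \<open>The constant \<open>l\<close> becomes a positive factor, the drift
      \<open>m\<close> a frequency \<open>z = r * m\<close>, and the quadratic term the Gaussian
      with \<open>\<beta> = r * c / 2\<close>.\<close>
    have "exp (of_real r * K n x) = of_real (exp (- r * l)) * (of_real (exp (- (r * c / 2) * x^2)) * exp (\<i> * of_real (r * m * x)) * 
        exp (of_real r * (\<integral>y. exp (- (\<i> * of_real (x * y))) \<partial>\<nu>)))" for x
      unfolding K_eq by (simp add: exp_of_real[symmetric] exp_add[symmetric] algebra_simps)
    then have "(\<integral>x. exp (of_real r * K n x) \<partial>lborel) = of_real (exp (- r * l)) * (\<integral>x. of_real (exp (- (r * c / 2) * x^2)) * exp (\<i> * of_real (r * m * x)) * 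
        exp (of_real r * (\<integral>y. exp (- (\<i> * of_real (x * y))) \<partial>\<nu>)) \<partial>lborel)"
      by simp
    moreover have "0 \<le> Re (\<integral>x. of_real (exp (- (r * c / 2) * x^2)) * exp (\<i> * of_real (r * m * x)) * 
        exp (of_real r * (\<integral>y. exp (- (\<i> * of_real (x * y))) \<partial>\<nu>)) \<partial>lborel)"
      using r c fin sets_nu by (intro gauss_pos_exp_fourier) auto
    ultimately show ?thesis by simp
  qed
  have [measurable]: "(\<lambda>x. cPhi (\<i> * complex_of_real x)) \<in> borel_measurable borel"
    using continuous_cPhi_imag by (rule borel_measurable_continuous_onI)
  have "(\<lambda>n. \<integral>x. exp (of_real r * K n x) \<partial>lborel) \<longlonglongrightarrow> (\<integral>x. exp (of_real r * cPhi (\<i> * of_real x)) \<partial>lborel)"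
  proof (rule integral_dominated_convergence)
    show "integrable lborel (\<lambda>x. exp (- (r * c / 2) * x^2))"
      using r c by (intro integrable_gaussian) auto
    show "AE x in lborel. (\<lambda>n. exp (of_real r * K n x)) \<longlonglongrightarrow> exp (of_real r * cPhi (\<i> * of_real x))"
      by (intro AE_I2 tendsto_exp tendsto_mult_left Klim)
    show "AE x in lborel. norm (exp (of_real r * K n x)) \<le> exp (- (r * c / 2) * x^2)" for n
    proof (rule AE_I2)
      fix x :: real
      have "r * Re (K n x) \<le> r * (- (c / 2 * x^2))" using r KRe by (intro mult_left_mono) auto
      then show "norm (exp (of_real r * K n x)) \<le> exp (- (r * c / 2) * x^2)" by (simp add: algebra_simps)
    qed
  qed measurable
  from tendsto_Re[OF this] have "0 \<le> Re (\<integral>x. exp (of_real r * cPhi (\<i> * of_real x)) \<partial>lborel)"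
    by (rule LIMSEQ_le_const) (use pos in auto)
  then show ?thesis by (simp add: dens_def)
qed

end

section \<open>Increasing paths and their areas\<close>

lemma integrable_on_mono_interval:
  fixes f :: "real \<Rightarrow> real"
  assumes "mono_on {0..} f" "0 \<le> a"
  shows "f integrable_on {a..b}"
  using assms by (intro integrable_on_mono_on) (auto simp: mono_on_def)

text \<open>On each cell the function lies between its endpoint values; with right endpoints
  throughout, the excess over the integral telescopes to
  \<open>h * (f (m * h) - f 0)\<close>.\<close>

lemma mono_riemann_bounds:
  fixes f :: "real \<Rightarrow> real"
  assumes f: "mono_on {0..} f" and h: "0 \<le> h"
  shows "integral {0..real m * h} f \<le> h * (\<Sum>k=1..m. f (real k * h))"
    and "h * (\<Sum>k=1..m. f (real k * h)) \<le> integral {0..real m * h} f + h * (f (real m * h) - f 0)"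
proof -
  have step: "h * f (real k * h) \<le> integral {real k * h..real (Suc k) * h} f"
    "integral {real k * h..real (Suc k) * h} f \<le> h * f (real (Suc k) * h)" for k
  proof -
    have int: "f integrable_on {real k * h..real (Suc k) * h}"
      using f h by (intro integrable_on_mono_interval) auto
    have le: "real k * h \<le> real (Suc k) * h" using h by (intro mult_right_mono) auto
    have "integral {real k * h..real (Suc k) * h} (\<lambda>_. f (real k * h)) \<le> integral {real k * h..real (Suc k) * h} f"
    proof (intro integral_le int)
      fix x assume x: "x \<in> {real k * h..real (Suc k) * h}"
      have "0 \<le> real k * h" using h by simp
      then show "f (real k * h) \<le> f x" using x by (auto intro!: mono_onD[OF f])
    qed auto
    then show "h * f (real k * h) \<le> integral {real k * h..real (Suc k) * h} f"
      using le by (simp add: algebra_simps)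
    have "integral {real k * h..real (Suc k) * h} f \<le> integral {real k * h..real (Suc k) * h} (\<lambda>_. f (real (Suc k) * h))"
    proof (intro integral_le int)
      fix x assume x: "x \<in> {real k * h..real (Suc k) * h}"
      have "0 \<le> real k * h" using h by simp
      then have "0 \<le> x" using x by (auto intro: order_trans)
      then show "f x \<le> f (real (Suc k) * h)" using f x by (auto intro!: mono_onD[OF f])
    qed auto
    then show "integral {real k * h..real (Suc k) * h} f \<le> h * f (real (Suc k) * h)"
      using le by (simp add: algebra_simps)
  qed
  have split: "integral {0..real (Suc k) * h} f = integral {0..real k * h} f + integral {real k * h..real (Suc k) * h} f" for k
  proof -
    have "0 \<le> real k * h" "real k * h \<le> real (Suc k) * h" using h by (auto intro!: mult_right_mono)
    then show ?thesis
      using f by (intro Henstock_Kurzweil_Integration.integral_combine[symmetric] integrable_on_mono_interval) auto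
  qed
  show "integral {0..real m * h} f \<le> h * (\<Sum>k=1..m. f (real k * h))"
  proof (induction m)
    case (Suc m)
    then show ?case using step(2)[of m] by (simp only: split sum.nat_ivl_Suc' ) (simp add: distrib_left)
  qed simp
  show "h * (\<Sum>k=1..m. f (real k * h)) \<le> integral {0..real m * h} f + h * (f (real m * h) - f 0)"
  proof (induction m)
    case (Suc m)
    have "h * (\<Sum>k=1..Suc m. f (real k * h)) = h * f (real (Suc m) * h) + h * (\<Sum>k=1..m. f (real k * h))"
      by (simp add: distrib_left)
    also have "\<dots> \<le> h * f (real (Suc m) * h) + (integral {0..real m * h} f + h * (f (real m * h) - f 0))"
      using Suc by simp
    also have "\<dots> \<le> integral {0..real (Suc m) * h} f + h * (f (real (Suc m) * h) - f 0)"
      using step(1)[of m] by (simp only: split) (simp add: right_diff_distrib)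
    finally show ?case .
  qed simp
qed

lemma mono_riemann_tendsto:
  fixes f :: "real \<Rightarrow> real"
  assumes f: "mono_on {0..} f" and r: "0 \<le> r"
  shows "(\<lambda>n. (r / real (Suc n)) * (\<Sum>k=1..Suc n. f (real k * (r / real (Suc n))))) \<longlonglongrightarrow> integral {0..r} f"
proof (rule tendsto_sandwich)
  have eq: "real (Suc n) * (r / real (Suc n)) = r" for n by simp
  show "eventually (\<lambda>n. integral {0..r} f \<le> (r / real (Suc n)) * (\<Sum>k=1..Suc n. f (real k * (r / real (Suc n))))) sequentially"
    using mono_riemann_bounds(1)[OF f, of "r / real (Suc n)" "Suc n" for n] r unfolding eq by (intro always_eventually) auto
  show "eventually (\<lambda>n. (r / real (Suc n)) * (\<Sum>k=1..Suc n. f (real k * (r / real (Suc n)))) \<le> integral {0..r} f + (r / real (Suc n)) * (f r - f 0)) sequentially"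
    using mono_riemann_bounds(2)[OF f, of "r / real (Suc n)" "Suc n" for n] r unfolding eq by (intro always_eventually) auto
  have "(\<lambda>n. integral {0..r} f + (r / real (Suc n)) * (f r - f 0)) \<longlonglongrightarrow> integral {0..r} f + 0 * (f r - f 0)"
    by (intro tendsto_intros) real_asymp
  then show "(\<lambda>n. integral {0..r} f + (r / real (Suc n)) * (f r - f 0)) \<longlonglongrightarrow> integral {0..r} f" by simp
qed auto

text \<open>The deterministic side of the time change. The point \<open>r0\<close> rules out the
  zero path, whose area never becomes positive.\<close>

locale increasing_path =
  fixes x :: "real \<Rightarrow> real" and r0 :: real
  assumes mono: "mono_on {0..} x" and nonneg: "\<And>r. 0 \<le> r \<Longrightarrow> 0 \<le> x r"
    and pos: "0 \<le> r0" "0 < x r0"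
begin

definition area :: "real \<Rightarrow> real" where "area r = integral {0..r} x"

lemma integrable_x: "0 \<le> a \<Longrightarrow> x integrable_on {a..b}"
  by (rule integrable_on_mono_interval[OF mono])

lemma area_diff: "0 \<le> a \<Longrightarrow> a \<le> b \<Longrightarrow> area b - area a = integral {a..b} x"
  unfolding area_def using Henstock_Kurzweil_Integration.integral_combine[of 0 a b x] integrable_x[of 0 b] by simp

lemma area_diff_ge:
  assumes "0 \<le> a" "a \<le> b"
  shows "(b - a) * x a \<le> area b - area a"
proof -
  have "integral {a..b} (\<lambda>_. x a) \<le> integral {a..b} x"
    using mono assms by (intro integral_le integrable_x) (auto simp: mono_on_def)
  then show ?thesis using assms by (simp add: area_diff)
qed

definition \<sigma> :: real where "\<sigma> = Inf {r. 0 \<le> r \<and> 0 < x r}"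

lemma sigma_nonneg: "0 \<le> \<sigma>"
  unfolding \<sigma>_def using pos by (intro cInf_greatest) auto

lemma before_sigma: "0 \<le> r \<Longrightarrow> r < \<sigma> \<Longrightarrow> x r = 0"
proof (rule ccontr)
  assume r: "0 \<le> r" "r < \<sigma>" "x r \<noteq> 0"
  have "bdd_below {r. 0 \<le> r \<and> 0 < x r}" by (auto intro!: bdd_belowI[of _ 0])
  then have "\<sigma> \<le> r" unfolding \<sigma>_def using r nonneg[of r] by (intro cInf_lower) auto
  then show False using r by simp
qed

lemma after_sigma:
  assumes "\<sigma> < r"
  shows "0 < x r"
proof -
  obtain s where "0 \<le> s" "0 < x s" "s < r"
    using assms pos unfolding \<sigma>_def by (subst (asm) cInf_less_iff) (auto intro!: bdd_belowI[of _ 0])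
  then show ?thesis using mono_onD[OF mono, of s r] by auto
qed

text \<open>\<open>B\<close> extends the area after the first positive time \<open>\<sigma>\<close> to a strictly increasing bijection of the whole line,
  so that the substitution \<open>t = B r\<close> needs no care at the ends.\<close>
definition y :: "real \<Rightarrow> real" where "y r = (if r < \<sigma> then 1 else x r)"
definition B :: "real \<Rightarrow> real" where "B r = (if r < \<sigma> then r - \<sigma> else area r)"

lemma area_sigma: "area \<sigma> = 0"
proof -
  have "integral {0..\<sigma>} x = integral {0..\<sigma>} (\<lambda>_. 0)"
    by (rule integral_spike[of "{\<sigma>}"]) (use before_sigma in auto)
  then show ?thesis by (simp add: area_def)
qed

lemma y_has_integral:
  assumes "a \<le> b"
  shows "(y has_integral (B b - B a)) {a..b}"
proof -
  have 1: "(y has_integral (B b - B a)) {a..b}" if "a \<le> b" "b < \<sigma>" for a b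
  proof -
    have "((\<lambda>_. 1) has_integral (b - a)) {a..b}" using has_integral_const_real[of "1::real" a b] that by simp
    then show ?thesis
      by (rule has_integral_eq_rhs[OF has_integral_eq[rotated]]) (use that in \<open>auto simp: y_def B_def\<close>)
  qed
  have 2: "(y has_integral (B b - B a)) {a..b}" if "a \<le> b" "\<sigma> \<le> a" for a b
  proof -
    have "(x has_integral (area b - area a)) {a..b}"
      using that sigma_nonneg integrable_x[of a b] by (simp add: area_diff integrable_integral)
    then show ?thesis
      by (rule has_integral_eq_rhs[OF has_integral_eq[rotated]]) (use that in \<open>auto simp: y_def B_def\<close>)
  qed
  have 3: "(y has_integral (B \<sigma> - B a)) {a..\<sigma>}" if "a < \<sigma>" for a
  proof -
    have "((\<lambda>_. 1) has_integral (\<sigma> - a)) {a..\<sigma>}" using has_integral_const_real[of "1::real" a \<sigma>] that by simp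
    then have "(y has_integral (\<sigma> - a)) {a..\<sigma>}"
      by (rule has_integral_spike_finite[of "{\<sigma>}", rotated 2]) (auto simp: y_def)
    then show ?thesis using that by (simp add: B_def area_sigma)
  qed
  show ?thesis
  proof (cases "b < \<sigma>")
    case False
    show ?thesis
    proof (cases "a < \<sigma>")
      case True
      have "(y has_integral ((B \<sigma> - B a) + (B b - B \<sigma>))) {a..b}"
        by (rule has_integral_combine[of a \<sigma> b]) (use True False 3 2 in auto)
      then show ?thesis by simp
    qed (use 2 assms in auto)
  qed (use 1 assms in auto)
qed

lemma y_nonneg: "0 \<le> y r"
  using nonneg sigma_nonneg by (auto simp: y_def)

lemma B_strict_mono: "strict_mono B"
proof (rule strict_monoI)
  fix a b :: real assume "a < b"
  \<comment> \<open>The midpoint copes with the change of regime at \<open>\<sigma>\<close>: if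
    \<open>m \<le> \<sigma>\<close>, then \<open>B\<close> has slope 1 on \<open>[a, m]\<close>;
    otherwise the path is already positive at \<open>m\<close> and the area grows on
    \<open>[m, b]\<close>.\<close>
  define m where "m = (a + b) / 2"
  have m: "a < m" "m < b" using \<open>a < b\<close> by (auto simp: m_def)
  show "B a < B b"
  proof (cases "m \<le> \<sigma>")
    case True
    have "0 \<le> B b - B m" using has_integral_nonneg[OF y_has_integral[of m b]] y_nonneg m by auto
    moreover have "B a < B m" using True m by (auto simp: B_def area_sigma)
    ultimately show ?thesis by simp
  next
    case False
    have "0 \<le> B m - B a" using has_integral_nonneg[OF y_has_integral[of a m]] y_nonneg m by auto
    moreover have "(b - m) * x m \<le> area b - area m" using False m sigma_nonneg by (intro area_diff_ge) auto
    moreover have "0 < (b - m) * x m" using False m after_sigma[of m] by simp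
    ultimately show ?thesis using False m by (simp add: B_def)
  qed
qed

lemma B_continuous: "continuous_on UNIV B"
proof -
  have c: "continuous_on {-n..n} B" if "\<sigma> < n" for n
  proof -
    have "continuous_on {-n..n} (\<lambda>r. integral {-n..r} y)"
      using y_has_integral[of "-n" n] that sigma_nonneg
      by (intro indefinite_integral_continuous_1) (auto simp: has_integral_integrable)
    then have "continuous_on {-n..n} (\<lambda>r. B (-n) + integral {-n..r} y)" by (intro continuous_intros)
    then show ?thesis
      by (rule continuous_on_eq) (use integral_unique[OF y_has_integral] in auto)
  qed
  have "isCont B r" for r
  proof (rule continuous_on_interior)
    show "continuous_on {- (\<bar>r\<bar> + \<sigma> + 1)..\<bar>r\<bar> + \<sigma> + 1} B" by (rule c) simp
    show "r \<in> interior {- (\<bar>r\<bar> + \<sigma> + 1)..\<bar>r\<bar> + \<sigma> + 1}" using sigma_nonneg by auto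
  qed
  then show ?thesis by (simp add: continuous_at_imp_continuous_on)
qed

lemma B_surj: "\<exists>r. B r = t"
proof (cases "t < 0")
  case True
  then show ?thesis by (intro exI[of _ "\<sigma> + t"]) (auto simp: B_def)
next
  case False
  define s where "s = max r0 \<sigma>"
  have s: "0 \<le> s" "0 < x s" "\<sigma> \<le> s"
    using pos sigma_nonneg mono_onD[OF mono, of r0 s] by (auto simp: s_def intro: less_le_trans)
  define b where "b = s + t / x s"
  have "t \<le> B b"
  proof -
    have "(b - s) * x s \<le> area b - area s" using s False by (intro area_diff_ge) (auto simp: b_def)
    moreover have "0 \<le> area s"
    proof -
      have "0 \<le> (s - \<sigma>) * x \<sigma>" using s nonneg sigma_nonneg by (intro mult_nonneg_nonneg) auto
      then show ?thesis using area_diff_ge[of \<sigma> s] sigma_nonneg s area_sigma by simp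
    qed
    moreover have "\<sigma> \<le> b" using s False by (auto simp: b_def intro: order_trans)
    ultimately show ?thesis using s by (simp add: B_def b_def)
  qed
  moreover have "B \<sigma> \<le> t" using False by (simp add: B_def area_sigma)
  moreover have "\<sigma> \<le> b" using s False by (auto simp: b_def intro: order_trans)
  moreover have "continuous_on {\<sigma>..b} B" using B_continuous by (rule continuous_on_subset) simp
  ultimately obtain r where "B r = t" using IVT'[of B \<sigma> t b] by metis
  then show ?thesis ..
qed

lemma y_measurable[measurable]: "y \<in> borel_measurable borel"
proof -
  have "mono (\<lambda>r. x (max 0 r))" using mono by (auto simp: mono_on_def mono_def)
  then have [measurable]: "(\<lambda>r. x (max 0 r)) \<in> borel_measurable borel" by (rule borel_measurable_mono)
  have "y = (\<lambda>r. if r < \<sigma> then 1 else x (max 0 r))"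
    using sigma_nonneg by (auto simp: y_def fun_eq_iff max_def)
  then show ?thesis by simp
qed

text \<open>The substitution \<open>t = B r\<close> as an identity of measures, checked on boxes:
  strict monotonicity pulls a box back to an interval, over which \<open>y\<close> integrates to the
  difference of the values of \<open>B\<close>.\<close>

lemma distr_B: "lborel = distr (density lborel (\<lambda>r. ennreal (y r))) borel B"
proof (rule lborel_eqI)
  have [measurable]: "B \<in> borel_measurable borel" using B_continuous by (rule borel_measurable_continuous_onI)
  fix l u :: real assume "\<And>b. b \<in> Basis \<Longrightarrow> l \<bullet> b \<le> u \<bullet> b"
  then have lu: "l \<le> u" by simp
  obtain \<alpha> \<beta> where ab: "B \<alpha> = l" "B \<beta> = u" using B_surj by blast
  have le: "\<alpha> \<le> \<beta>" using lu ab strict_mono_less_eq[OF B_strict_mono, of \<alpha> \<beta>] by simp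
  have "emeasure (distr (density lborel (\<lambda>r. ennreal (y r))) borel B) (box l u)
     = (\<integral>\<^sup>+r. ennreal (y r) * indicator (B -` box l u) r \<partial>lborel)"
  proof -
    have "B -` box l u \<in> sets borel"
      by (rule measurable_sets_borel[of B borel]) auto
    then show ?thesis by (subst emeasure_distr) (auto simp: emeasure_density)
  qed
  also have "B -` box l u = {\<alpha><..<\<beta>}"
    using ab strict_mono_less[OF B_strict_mono] by (auto simp: box_real)
  also have "(\<integral>\<^sup>+r. ennreal (y r) * indicator {\<alpha><..<\<beta>} r \<partial>lborel) = (\<integral>\<^sup>+r. ennreal (y r) * indicator {\<alpha>..\<beta>} r \<partial>lborel)"
  proof (rule nn_integral_cong_AE)
    show "AE r in lborel. ennreal (y r) * indicator {\<alpha><..<\<beta>} r = ennreal (y r) * indicator {\<alpha>..\<beta>} r"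
      using AE_lborel_singleton[of \<alpha>] AE_lborel_singleton[of \<beta>]
      by eventually_elim (auto simp: indicator_def)
  qed
  also have "\<dots> = (\<integral>\<^sup>+r. ennreal (indicator {\<alpha>..\<beta>} r * y r) \<partial>lborel)"
    by (rule nn_integral_cong) (auto simp: indicator_def)
  also have "\<dots> = ennreal (B \<beta> - B \<alpha>)"
    using nn_integral_has_integral_lebesgue[OF _ y_has_integral[OF le]] y_nonneg by simp
  finally show "emeasure (distr (density lborel (\<lambda>r. ennreal (y r))) borel B) (box l u) = (\<Prod>b\<in>Basis. (u - l) \<bullet> b)"
    using ab by simp
qed simp

text \<open>Restriction of \<open>distr_B\<close> to \<open>t \<ge> 0\<close>. The artificial slope
  1 before \<open>\<sigma>\<close> corresponds to \<open>t < 0\<close> and disappears, while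
  \<open>x r = 0\<close> removes the same \<open>r\<close> from the right-hand side.\<close>

lemma nn_integral_time_change:
  fixes f :: "real \<Rightarrow> ennreal"
  assumes [measurable]: "f \<in> borel_measurable borel"
  shows "(\<integral>\<^sup>+t\<in>{0..}. f t \<partial>lborel) = (\<integral>\<^sup>+r\<in>{0..}. f (area r) * ennreal (x r) \<partial>lborel)"
proof -
  have [measurable]: "B \<in> borel_measurable borel" using B_continuous by (rule borel_measurable_continuous_onI)
  have "(\<integral>\<^sup>+t\<in>{0..}. f t \<partial>lborel) = (\<integral>\<^sup>+r. ennreal (y r) * (f (B r) * indicator {0..} (B r)) \<partial>lborel)"
    by (subst distr_B) (simp add: nn_integral_distr nn_integral_density)
  also have "\<dots> = (\<integral>\<^sup>+r\<in>{0..}. f (area r) * ennreal (x r) \<partial>lborel)"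
  proof (rule nn_integral_cong)
    fix r :: real
    have "0 \<le> area r" if "\<sigma> \<le> r"
      using that strict_mono_less_eq[OF B_strict_mono, of \<sigma> r] by (auto simp: B_def area_sigma)
    then show "ennreal (y r) * (f (B r) * indicator {0..} (B r)) = f (area r) * ennreal (x r) * indicator {0..} r"
      using sigma_nonneg before_sigma[of r]
      by (cases "r < \<sigma>") (auto simp: y_def B_def indicator_def mult_ac)
  qed
  finally show ?thesis .
qed

text \<open>Positivity of \<open>x r\<close> puts \<open>r\<close> at or beyond
  \<open>\<sigma>\<close>, where the area is strictly increasing; before \<open>\<sigma>\<close> it
  is flat.\<close>

lemma area_less_iff:
  assumes "0 \<le> r" "0 < x r" "0 \<le> s"
  shows "area r < area s \<longleftrightarrow> r < s"
proof -
  have r: "\<sigma> \<le> r" using before_sigma[of r] assms by force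
  show ?thesis
  proof (cases "\<sigma> \<le> s")
    case True
    then show ?thesis using strict_mono_less[OF B_strict_mono, of r s] r by (simp add: B_def)
  next
    case False
    have "area s = integral {0..s} (\<lambda>_. 0)"
      unfolding area_def using False before_sigma by (intro Henstock_Kurzweil_Integration.integral_cong) auto
    moreover have "0 \<le> area r"
      using r strict_mono_less_eq[OF B_strict_mono, of \<sigma> r] by (auto simp: B_def area_sigma)
    ultimately show ?thesis using False r by simp
  qed
qed

end

section \<open>Subordinators and their time change\<close>

lemma Int_stable_vimage: "Int_stable {f -` A \<inter> S | A. A \<in> sets N}"
  unfolding Int_stable_def
proof safe
  fix A B assume "A \<in> sets N" "B \<in> sets N"
  then show "\<exists>C. f -` A \<inter> S \<inter> (f -` B \<inter> S) = f -` C \<inter> S \<and> C \<in> sets N"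
    by (intro exI[of _ "A \<inter> B"]) auto
qed

text \<open>Conditioning on a sure event does nothing, which turns the conditional increment
  properties of \<open>subordinator\<close> into unconditional ones once survival is almost
  sure.\<close>

lemma (in prob_space) uniform_measure_AE:
  assumes [measurable]: "A \<in> events" and "AE \<omega> in M. \<omega> \<in> A"
  shows "uniform_measure M A = M"
proof (rule measure_eqI)
  fix B assume "B \<in> sets (uniform_measure M A)"
  then have [measurable]: "B \<in> events" by simp
  have "emeasure M A = 1" using assms by (simp add: emeasure_eq_1_AE)
  moreover have "emeasure M (A \<inter> B) = emeasure M B"
    using assms(2) by (intro emeasure_eq_AE) auto
  ultimately show "emeasure (uniform_measure M A) B = emeasure M B" by (simp add: divide_ennreal_def)
qed simp

lemma exp_neg_mult_measurable[measurable]: "exp_neg_mult q \<in> borel_measurable borel"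
  unfolding exp_neg_mult_def[abs_def] by measurable

lemma exp_neg_mult_bounds: "0 \<le> q \<Longrightarrow> 0 \<le> exp_neg_mult q x \<and> exp_neg_mult q x \<le> 1"
  by (simp add: exp_neg_mult_def)

section \<open>Laplace transforms of a subordinator without killing\<close>

locale unkilled_subordinator = subordinator +
  fixes \<phi> :: "real \<Rightarrow> real"
  assumes phi_exponent: "\<And>s. 0 \<le> s \<Longrightarrow> \<phi> s = laplace_exponent M \<xi> s"
    and AE_finite_1: "AE \<omega> in M. \<xi> 1 \<omega> < \<infinity>"
begin

definition X :: "real \<Rightarrow> 'a \<Rightarrow> real" where "X t \<omega> = enn2real (\<xi> t \<omega>)"

lemma X_nonneg[simp]: "0 \<le> X t \<omega>" by (simp add: X_def)

lemma measurable_X[measurable]: "0 \<le> t \<Longrightarrow> X t \<in> borel_measurable M"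
  unfolding X_def[abs_def] using measurable_process[of t] by measurable

lemma xi_mono: "\<omega> \<in> space M \<Longrightarrow> 0 \<le> s \<Longrightarrow> s \<le> t \<Longrightarrow> \<xi> s \<omega> \<le> \<xi> t \<omega>"
  using mono_paths[of \<omega>] by (auto simp: mono_on_def)

lemma uniform_eq:
  assumes "0 \<le> s" "AE \<omega> in M. \<xi> s \<omega> < \<infinity>"
  shows "uniform_measure M {\<omega> \<in> space M. \<xi> s \<omega> < \<infinity>} = M"
  using assms measurable_process[of s] by (intro uniform_measure_AE) auto

text \<open>Induction over unit increments, each distributed as \<open>\<xi> 1\<close>. In
  \<open>ennreal\<close> the difference of \<open>\<infinity>\<close> and a finite number is
  \<open>\<infinity>\<close>, so a finite increment forces a finite new value.\<close>

lemma AE_finite_nat: "AE \<omega> in M. \<xi> (real n) \<omega> < \<infinity>"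
proof (induction n)
  case 0
  then show ?case using start_zero by (auto intro!: AE_I2)
next
  case (Suc n)
  have [measurable]: "\<xi> (real n) \<in> borel_measurable M" "\<xi> (real n + 1) \<in> borel_measurable M" "\<xi> 1 \<in> borel_measurable M"
    by (auto intro!: measurable_process)
  have d: "distr M borel (\<lambda>\<omega>. \<xi> (real n + 1) \<omega> - \<xi> (real n) \<omega>) = distr M borel (\<xi> 1)"
    using stationary_increments[of "real n" 1] uniform_eq[OF _ Suc] by simp
  have "AE x in distr M borel (\<xi> 1). x < \<infinity>"
    using AE_finite_1 by (subst AE_distr_iff) auto
  then have "AE \<omega> in M. \<xi> (real n + 1) \<omega> - \<xi> (real n) \<omega> < \<infinity>"
    unfolding d[symmetric] by (subst (asm) AE_distr_iff) auto
  with Suc AE_space show ?case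
  proof eventually_elim
    case (elim \<omega>)
    then show ?case
      using xi_mono[of \<omega> "real n" "real n + 1"]
      by (auto simp: add.commute less_top[symmetric] ennreal_minus_eq_top)
  qed
qed

lemma AE_finite: "AE \<omega> in M. \<forall>t\<ge>0. \<xi> t \<omega> < \<infinity>"
proof -
  have "AE \<omega> in M. \<forall>n. \<xi> (real n) \<omega> < \<infinity>"
    unfolding AE_all_countable using AE_finite_nat by blast
  with AE_space show ?thesis
  proof eventually_elim
    case (elim \<omega>)
    show ?case
    proof (intro allI impI)
      fix t :: real assume "0 \<le> t"
      moreover obtain n where "t \<le> real n" using real_arch_simple by blast
      ultimately have "\<xi> t \<omega> \<le> \<xi> (real n) \<omega>" using elim by (intro xi_mono) auto
      also have "\<dots> < \<infinity>" using elim by blast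
      finally show "\<xi> t \<omega> < \<infinity>" .
    qed
  qed
qed

lemma uniform_eq': "0 \<le> s \<Longrightarrow> uniform_measure M {\<omega> \<in> space M. \<xi> s \<omega> < \<infinity>} = M"
  using AE_finite by (intro uniform_eq) auto

definition past :: "real \<Rightarrow> 'a measure" where
  "past s = sigma (space M) (natural_filtration M \<xi> s)"

lemma natural_filtration_events: "natural_filtration M \<xi> s \<subseteq> events"
  unfolding natural_filtration_def
proof (rule sets.sigma_sets_subset)
  show "{\<xi> u -` B \<inter> space M |u B. 0 \<le> u \<and> u \<le> s \<and> B \<in> sets borel} \<subseteq> events"
    using measurable_process by (auto intro: measurable_sets)
qed

lemma past_sets: "sets (past s) = natural_filtration M \<xi> s"
  unfolding past_def natural_filtration_def
  by (subst sets_measure_of) (auto dest!: sigma_sets_into_sp[rotated] intro!: sigma_sets_sigma_sets_eq)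

lemma past_space: "space (past s) = space M"
  unfolding past_def by (intro space_measure_of) (auto dest: subsetD[OF natural_filtration_events] sets.sets_into_space)

lemma measurable_past: "0 \<le> u \<Longrightarrow> u \<le> s \<Longrightarrow> \<xi> u \<in> borel_measurable (past s)"
  unfolding measurable_def past_sets past_space natural_filtration_def
  by (auto intro!: sigma_sets.Basic)

lemma measurable_past_X: "0 \<le> u \<Longrightarrow> u \<le> s \<Longrightarrow> X u \<in> borel_measurable (past s)"
  unfolding X_def[abs_def] using measurable_past[of u s] by measurable

lemma past_measurable_M: "Z \<in> borel_measurable (past s) \<Longrightarrow> Z \<in> borel_measurable M"
  using natural_filtration_events by (auto simp: measurable_def past_sets past_space)

lemma expectation_increment:
  fixes Z :: "'a \<Rightarrow> real" and g :: "ennreal \<Rightarrow> real"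
  assumes s: "0 \<le> s" "0 \<le> t" and Z: "Z \<in> borel_measurable (past s)" "\<And>\<omega>. 0 \<le> Z \<omega>" "\<And>\<omega>. Z \<omega> \<le> 1"
    and g[measurable]: "g \<in> borel_measurable borel" "\<And>x. 0 \<le> g x" "\<And>x. g x \<le> 1"
  shows "expectation (\<lambda>\<omega>. Z \<omega> * g (\<xi> (s + t) \<omega> - \<xi> s \<omega>)) = expectation Z * expectation (\<lambda>\<omega>. g (\<xi> t \<omega>))"
proof -
  define D where "D \<omega> = \<xi> (s + t) \<omega> - \<xi> s \<omega>" for \<omega>
  have [measurable]: "\<xi> s \<in> borel_measurable M" "\<xi> (s + t) \<in> borel_measurable M" "\<xi> t \<in> borel_measurable M"
    using s by (auto intro!: measurable_process)
  have [measurable]: "D \<in> borel_measurable M" unfolding D_def[abs_def] by measurable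
  have Zm[measurable]: "Z \<in> borel_measurable M" using Z(1) by (rule past_measurable_M)
  have ind: "indep_set (natural_filtration M \<xi> s) {D -` B \<inter> space M | B. B \<in> sets borel}"
    using independent_increments[OF s] uniform_eq'[OF s(1)] by (simp add: D_def[abs_def])
  have "indep_set (sigma_sets (space M) {Z -` A \<inter> space M | A. A \<in> sets borel})
     (sigma_sets (space M) {(\<lambda>\<omega>. g (D \<omega>)) -` A \<inter> space M | A. A \<in> sets borel})"
  proof (rule indep_set_sigma_sets)
    have "{Z -` A \<inter> space M | A. A \<in> sets borel} \<subseteq> natural_filtration M \<xi> s"
      using measurable_sets[OF Z(1)] by (auto simp: past_sets past_space)
    moreover have "{(\<lambda>\<omega>. g (D \<omega>)) -` A \<inter> space M | A. A \<in> sets borel} \<subseteq> {D -` B \<inter> space M | B. B \<in> sets borel}"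
    proof safe
      fix A :: "real set" assume "A \<in> sets borel"
      then have "g -` A \<in> sets borel" by (rule measurable_sets_borel[OF g(1)])
      then show "\<exists>B. (\<lambda>\<omega>. g (D \<omega>)) -` A \<inter> space M = D -` B \<inter> space M \<and> B \<in> sets borel"
        by (intro exI[of _ "g -` A"]) auto
    qed
    ultimately show "indep_set {Z -` A \<inter> space M | A. A \<in> sets borel} {(\<lambda>\<omega>. g (D \<omega>)) -` A \<inter> space M | A. A \<in> sets borel}"
      using ind unfolding indep_set_def by (elim indep_sets_mono_sets) (auto split: bool.splits)
  qed (rule Int_stable_vimage)+
  then have iv: "indep_var borel Z borel (\<lambda>\<omega>. g (D \<omega>))"
    unfolding indep_var_eq by auto
  have "expectation (\<lambda>\<omega>. Z \<omega> * g (D \<omega>)) = expectation Z * expectation (\<lambda>\<omega>. g (D \<omega>))"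
  proof (rule indep_var_lebesgue_integral[OF iv])
    show "integrable M Z" using Z by (intro integrable_const_bound[where B = 1]) auto
    show "integrable M (\<lambda>\<omega>. g (D \<omega>))" using g by (intro integrable_const_bound[where B = 1]) auto
  qed
  also have "expectation (\<lambda>\<omega>. g (D \<omega>)) = integral\<^sup>L (distr M borel D) g"
    by (subst integral_distr) auto
  also have "distr M borel D = distr M borel (\<xi> t)"
    using stationary_increments[OF s] uniform_eq'[OF s(1)] by (simp add: D_def[abs_def])
  also have "integral\<^sup>L (distr M borel (\<xi> t)) g = expectation (\<lambda>\<omega>. g (\<xi> t \<omega>))"
    by (subst integral_distr) auto
  finally show ?thesis by (simp add: D_def)
qed

definition L :: "real \<Rightarrow> real \<Rightarrow> real" where "L q t = expectation (\<lambda>\<omega>. exp (- q * X t \<omega>))"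

lemma expectation_increment_exp:
  assumes s: "0 \<le> s" "0 \<le> t" "0 \<le> q" and Z: "Z \<in> borel_measurable (past s)" "\<And>\<omega>. 0 \<le> Z \<omega>" "\<And>\<omega>. Z \<omega> \<le> 1"
  shows "expectation (\<lambda>\<omega>. Z \<omega> * exp (- q * (X (s + t) \<omega> - X s \<omega>))) = expectation Z * L q t"
proof -
  have [measurable]: "Z \<in> borel_measurable M" using Z(1) by (rule past_measurable_M)
  have [measurable]: "\<xi> s \<in> borel_measurable M" "\<xi> (s + t) \<in> borel_measurable M"
    using s by (auto intro!: measurable_process)
  have "expectation (\<lambda>\<omega>. Z \<omega> * exp (- q * (X (s + t) \<omega> - X s \<omega>)))
      = expectation (\<lambda>\<omega>. Z \<omega> * exp (- q * enn2real (\<xi> (s + t) \<omega> - \<xi> s \<omega>)))"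
  proof (rule integral_cong_AE)
    show "AE \<omega> in M. Z \<omega> * exp (- q * (X (s + t) \<omega> - X s \<omega>)) = Z \<omega> * exp (- q * enn2real (\<xi> (s + t) \<omega> - \<xi> s \<omega>))"
      using AE_finite AE_space
    proof eventually_elim
      case (elim \<omega>)
      then have "\<xi> s \<omega> < \<infinity>" "\<xi> (s + t) \<omega> < \<infinity>" "\<xi> s \<omega> \<le> \<xi> (s + t) \<omega>" using s by (auto intro: xi_mono)
      then show ?case
        by (cases "\<xi> s \<omega>"; cases "\<xi> (s + t) \<omega>") (auto simp: X_def ennreal_minus)
    qed
  qed (use s in \<open>auto intro!: borel_measurable_times borel_measurable_exp borel_measurable_diff measurable_X\<close>)
  also have "\<dots> = expectation Z * expectation (\<lambda>\<omega>. exp (- q * enn2real (\<xi> t \<omega>)))"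
    using s Z by (intro expectation_increment[where g = "\<lambda>x. exp (- q * enn2real x)"]) auto
  finally show ?thesis by (simp add: L_def X_def)
qed

lemma integrable_exp_X: "0 \<le> t \<Longrightarrow> 0 \<le> q \<Longrightarrow> integrable M (\<lambda>\<omega>. exp (- q * X t \<omega>))"
  by (intro integrable_const_bound[where B = 1]) auto

lemma L_add:
  assumes "0 \<le> s" "0 \<le> t" "0 \<le> q"
  shows "L q (s + t) = L q s * L q t"
proof -
  have "(\<lambda>\<omega>. exp (- q * X s \<omega>)) \<in> borel_measurable (past s)"
    using measurable_past_X[of s s] assms by measurable
  from expectation_increment_exp[OF assms this] assms
  have "expectation (\<lambda>\<omega>. exp (- q * X s \<omega>) * exp (- q * (X (s + t) \<omega> - X s \<omega>))) = L q s * L q t"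
    by (simp add: L_def)
  also have "(\<lambda>\<omega>. exp (- q * X s \<omega>) * exp (- q * (X (s + t) \<omega> - X s \<omega>))) = (\<lambda>\<omega>. exp (- q * X (s + t) \<omega>))"
    by (simp add: exp_add[symmetric] algebra_simps)
  finally show ?thesis by (simp add: L_def)
qed

lemma L_1: 
  assumes "0 \<le> q"
  shows "L q 1 = exp (- \<phi> q)"
proof -
  have "expectation (\<lambda>\<omega>. exp_neg_mult q (\<xi> 1 \<omega>)) = L q 1"
    unfolding L_def
  proof (rule integral_cong_AE)
    have [measurable]: "\<xi> 1 \<in> borel_measurable M" by (rule measurable_process) simp
    show "(\<lambda>\<omega>. exp_neg_mult q (\<xi> 1 \<omega>)) \<in> borel_measurable M" unfolding exp_neg_mult_def by measurable
    show "(\<lambda>\<omega>. exp (- q * X 1 \<omega>)) \<in> borel_measurable M" unfolding X_def by measurable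
    show "AE \<omega> in M. exp_neg_mult q (\<xi> 1 \<omega>) = exp (- q * X 1 \<omega>)"
      using AE_finite_1 by eventually_elim (simp add: exp_neg_mult_def X_def less_top[symmetric])
  qed
  moreover have "0 < L q 1"
  proof -
    have "L q 1 \<noteq> 0"
    proof
      assume "L q 1 = 0"
      then have "AE \<omega> in M. exp (- q * X 1 \<omega>) = 0"
        unfolding L_def using integrable_exp_X[of 1 q] assms
        by (subst (asm) integral_nonneg_eq_0_iff_AE) auto
      then show False by simp
    qed
    moreover have "0 \<le> L q 1" by (simp add: L_def)
    ultimately show ?thesis by simp
  qed
  ultimately show ?thesis using phi_exponent[OF assms] by (simp add: laplace_exponent_def)
qed

lemma L_antimono:
  assumes "0 \<le> s" "s \<le> t" "0 \<le> q"
  shows "L q t \<le> L q s"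
  unfolding L_def
proof (rule integral_mono_AE)
  show "AE \<omega> in M. exp (- q * X t \<omega>) \<le> exp (- q * X s \<omega>)"
    using AE_finite AE_space
  proof eventually_elim
    case (elim \<omega>)
    then have "X s \<omega> \<le> X t \<omega>"
      using assms unfolding X_def by (intro enn2real_mono xi_mono) auto
    then show ?case using assms by (simp add: mult_left_mono)
  qed
qed (use assms integrable_exp_X in auto)

text \<open>Cauchy's functional equation for the multiplicative function \<open>L q\<close>:
  \<open>L_add\<close> fixes it at rational times, and monotonicity in \<open>t\<close> squeezes the
  other times between floor(tN)/N and (floor(tN) + 1)/N with N = n + 1.\<close>

lemma L_eq:
  assumes "0 \<le> t" "0 \<le> q"
  shows "L q t = exp (- (t * \<phi> q))"
proof -
  have L0: "L q 0 = 1" using start_zero by (simp add: L_def X_def prob_space cong: Bochner_Integration.integral_cong)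
  have pow: "L q (real n * s) = L q s ^ n" if "0 \<le> s" for n s
  proof (induction n)
    case (Suc n)
    have "L q (real (Suc n) * s) = L q (s + real n * s)" by (simp add: algebra_simps)
    also have "\<dots> = L q s * L q (real n * s)" using that assms by (intro L_add) auto
    finally show ?case using Suc by simp
  qed (simp add: L0)
  have pos: "0 \<le> L q s" for s by (simp add: L_def)
  have rat': "L q (real k / real N) = exp (- (real k / real N * \<phi> q))" if N: "0 < N" for k N
  proof -
    have "L q (real N * (1 / real N)) = L q (1 / real N) ^ N" by (rule pow) simp
    then have "L q (1 / real N) ^ N = exp (- \<phi> q)" using L_1[OF assms(2)] N by simp
    also have "- \<phi> q = real N * (- \<phi> q / real N)" using N by simp
    also have "exp \<dots> = exp (- \<phi> q / real N) ^ N" by (rule exp_of_nat_mult)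
    finally have "L q (1 / real N) = exp (- \<phi> q / real N)"
      by (rule power_eq_imp_eq_base) (use pos N in auto)
    moreover have "L q (real k * (1 / real N)) = L q (1 / real N) ^ k" by (rule pow) simp
    ultimately have "L q (real k / real N) = exp (- \<phi> q / real N) ^ k" by simp
    also have "\<dots> = exp (real k * (- \<phi> q / real N))" by (rule exp_of_nat_mult[symmetric])
    finally show ?thesis by simp
  qed
  have rat: "L q (real k / real (Suc n)) = exp (- (real k / real (Suc n) * \<phi> q))" for k n
    by (rule rat') simp
  define k where "k n = nat \<lfloor>t * real (Suc n)\<rfloor>" for n
  have k: "real (k n) / real (Suc n) \<le> t" "t \<le> real (Suc (k n)) / real (Suc n)" for n
  proof -
    have *: "real (k n) = of_int \<lfloor>t * real (Suc n)\<rfloor>" using assms by (simp add: k_def)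
    have "real (Suc (k n)) = real (k n) + 1" by simp
    with * have "real (k n) \<le> t * real (Suc n)" "t * real (Suc n) \<le> real (Suc (k n))"
      by linarith+
    then show "real (k n) / real (Suc n) \<le> t" "t \<le> real (Suc (k n)) / real (Suc n)"
      by (simp_all only: divide_le_eq le_divide_eq of_nat_0_less_iff zero_less_Suc if_True)
  qed
  have lim1: "(\<lambda>n. real (k n) / real (Suc n)) \<longlonglongrightarrow> t"
  proof (rule tendsto_sandwich)
    show "eventually (\<lambda>n. t - 1 / real (Suc n) \<le> real (k n) / real (Suc n)) sequentially"
      using k(2) by (intro always_eventually) (simp add: add_divide_distrib algebra_simps)
    show "(\<lambda>n. t - 1 / real (Suc n)) \<longlonglongrightarrow> t" by real_asymp
  qed (use k in auto)
  have lim2: "(\<lambda>n. real (Suc (k n)) / real (Suc n)) \<longlonglongrightarrow> t"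
  proof -
    have "(\<lambda>n. real (k n) / real (Suc n) + 1 / real (Suc n)) \<longlonglongrightarrow> t + 0"
      by (intro tendsto_add lim1) real_asymp
    then show ?thesis by (simp add: add_divide_distrib add.commute)
  qed
  have "exp (- (t * \<phi> q)) \<le> L q t"
  proof (rule LIMSEQ_le_const2)
    show "(\<lambda>n. exp (- (real (Suc (k n)) / real (Suc n) * \<phi> q))) \<longlonglongrightarrow> exp (- (t * \<phi> q))"
      by (intro tendsto_intros lim2)
    show "\<exists>N. \<forall>n\<ge>N. exp (- (real (Suc (k n)) / real (Suc n) * \<phi> q)) \<le> L q t"
      using L_antimono[OF assms(1) k(2) assms(2)] unfolding rat by auto
  qed
  moreover have "L q t \<le> exp (- (t * \<phi> q))"
  proof (rule LIMSEQ_le_const)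
    show "(\<lambda>n. exp (- (real (k n) / real (Suc n) * \<phi> q))) \<longlonglongrightarrow> exp (- (t * \<phi> q))"
      by (intro tendsto_intros lim1)
    show "\<exists>N. \<forall>n\<ge>N. L q t \<le> exp (- (real (k n) / real (Suc n) * \<phi> q))"
      using L_antimono[OF _ k(1) assms(2)] unfolding rat by auto
  qed
  ultimately show ?thesis by simp
qed

text \<open>The last increment is peeled off: it carries the weight \<open>q + a * h\<close>, from
  the end value and from the last summand together. It contributes exp(-h phi(q + a h)) and leaves
  the case \<open>n\<close> with \<open>q + a * h\<close> in place of \<open>q\<close>.\<close>

lemma riemann_expectation:
  assumes "0 \<le> h" "0 \<le> a" "0 \<le> q"
  shows "expectation (\<lambda>\<omega>. exp (- q * X (real n * h) \<omega> - a * (h * (\<Sum>k=1..n. X (real k * h) \<omega>))))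
     = exp (- (h * (\<Sum>k=1..n. \<phi> (q + a * (real k * h)))))"
  using assms(3)
proof (induction n arbitrary: q)
  case 0
  then show ?case using start_zero by (simp add: X_def prob_space cong: Bochner_Integration.integral_cong)
next
  case (Suc n)
  define q' where "q' = q + a * h"
  have q': "0 \<le> q'" using Suc assms by (auto simp: q'_def)
  define Z where "Z \<omega> = exp (- q' * X (real n * h) \<omega> - a * (h * (\<Sum>k=1..n. X (real k * h) \<omega>)))" for \<omega>
  have Zm: "Z \<in> borel_measurable (past (real n * h))"
  proof -
    have [measurable]: "X (real k * h) \<in> borel_measurable (past (real n * h))" if "k \<le> n" for k
      using assms that by (intro measurable_past_X) (auto intro: mult_right_mono)
    have "(\<lambda>\<omega>. \<Sum>k=1..n. X (real k * h) \<omega>) \<in> borel_measurable (past (real n * h))"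
      by (intro borel_measurable_sum) auto
    then show ?thesis unfolding Z_def[abs_def]
      by (intro borel_measurable_exp[THEN measurable_compose[rotated]] borel_measurable_diff borel_measurable_times borel_measurable_const) auto
  qed
  have Zb: "0 \<le> Z \<omega>" "Z \<omega> \<le> 1" for \<omega>
  proof -
    have "0 \<le> q' * X (real n * h) \<omega>" "0 \<le> a * (h * (\<Sum>k=1..n. X (real k * h) \<omega>))"
      using q' assms by (auto intro!: mult_nonneg_nonneg sum_nonneg)
    then show "0 \<le> Z \<omega>" "Z \<omega> \<le> 1" by (auto simp: Z_def)
  qed
  have "expectation (\<lambda>\<omega>. exp (- q * X (real (Suc n) * h) \<omega> - a * (h * (\<Sum>k=1..Suc n. X (real k * h) \<omega>))))
    = expectation (\<lambda>\<omega>. Z \<omega> * exp (- q' * (X (real n * h + h) \<omega> - X (real n * h) \<omega>)))"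
    by (rule Bochner_Integration.integral_cong[OF refl])
       (simp add: Z_def q'_def exp_add[symmetric] algebra_simps)
  also have "\<dots> = expectation Z * L q' h"
    using assms q' by (intro expectation_increment_exp Zm Zb) auto
  also have "expectation Z = exp (- (h * (\<Sum>k=1..n. \<phi> (q' + a * (real k * h)))))"
    unfolding Z_def using Suc.IH[OF q'] .
  also have "L q' h = exp (- (h * \<phi> q'))" using assms q' by (intro L_eq) auto
  also have "exp (- (h * (\<Sum>k=1..n. \<phi> (q' + a * (real k * h))))) * exp (- (h * \<phi> q'))
     = exp (- (h * (\<phi> q' + (\<Sum>k=1..n. \<phi> (q' + a * (real k * h))))))"
    by (simp add: exp_add[symmetric] algebra_simps)
  also have "\<phi> q' + (\<Sum>k=1..n. \<phi> (q' + a * (real k * h))) = (\<Sum>k=1..Suc n. \<phi> (q + a * (real k * h)))"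
  proof -
    have "(\<Sum>k=1..Suc n. \<phi> (q + a * (real k * h))) = \<phi> (q + a * (real 1 * h)) + (\<Sum>k=Suc 1..Suc n. \<phi> (q + a * (real k * h)))"
      by (rule sum.atLeast_Suc_atMost) simp
    also have "(\<Sum>k=Suc 1..Suc n. \<phi> (q + a * (real k * h))) = (\<Sum>k=1..n. \<phi> (q + a * (real (Suc k) * h)))"
      by (rule sum.shift_bounds_cl_Suc_ivl)
    finally show ?thesis by (simp add: q'_def algebra_simps)
  qed
  finally show ?case .
qed

end

context levy_data
begin

lemma rPhi_derivative_interior:
  assumes "0 < s"
  shows "(rPhi has_real_derivative rphi s) (at s)"
  using rPhi_derivative[of s] assms at_within_interior[of s "{0..}"] by simp

lemma integral_rphi_affine:
  assumes "0 \<le> q" "0 < a" "0 \<le> r"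
  shows "integral {0..r} (\<lambda>u. rphi (q + a * u)) = (rPhi (q + a * r) - rPhi q) / a"
proof (rule integral_unique)
  have "((\<lambda>u. rphi (q + a * u)) has_integral (rPhi (q + a * r) / a - rPhi (q + a * 0) / a)) {0..r}"
  proof (rule fundamental_theorem_of_calculus)
    fix u assume u: "u \<in> {0..r}"
    have 1: "(rPhi has_field_derivative rphi (q + a * u)) (at (q + a * u) within (\<lambda>u. q + a * u) ` {0..r})"
      using assms u by (intro DERIV_subset[OF rPhi_derivative]) auto
    have 2: "((\<lambda>u. q + a * u) has_field_derivative a) (at u within {0..r})"
      by (auto intro!: derivative_eq_intros)
    have "((\<lambda>u. rPhi (q + a * u) / a) has_field_derivative rphi (q + a * u) * a / a) (at u within {0..r})"
      using DERIV_image_chain[OF 1 2] by (intro DERIV_cdivide) (simp add: o_def)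
    then show "((\<lambda>u. rPhi (q + a * u) / a) has_vector_derivative rphi (q + a * u)) (at u within {0..r})"
      using assms by (simp add: has_real_derivative_iff_has_vector_derivative)
  qed (use assms in auto)
  then show "((\<lambda>u. rphi (q + a * u)) has_integral (rPhi (q + a * r) - rPhi q) / a) {0..r}"
    by (simp add: diff_divide_distrib)
qed

end

section \<open>Laplace transform in t of the time-changed process\<close>

locale levy_subordinator = unkilled_subordinator M \<xi> \<phi> + levy_data c \<pi>
  for M :: "'a measure" and \<xi> :: "real \<Rightarrow> 'a \<Rightarrow> ennreal" and \<phi> :: "real \<Rightarrow> real" and c :: real and \<pi> :: "real measure" +
  assumes phi_eq: "\<And>s. 0 \<le> s \<Longrightarrow> \<phi> s = rphi s"
begin

text \<open>Right continuity allows evaluation at grid times slightly to the right of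
  \<open>r\<close>; each approximation is measurable since it uses countably many sections.
  \<open>max 0 r\<close> extends the process to all real times.\<close>

lemma measurable_joint[measurable]: "(\<lambda>(r, \<omega>). \<xi> (max 0 r) \<omega>) \<in> borel_measurable (borel \<Otimes>\<^sub>M M)"
proof (rule borel_measurable_LIMSEQ_order)
  define k where "k n r = nat \<lfloor>max 0 r * real (Suc n)\<rfloor>" for n and r :: real
  \<comment> \<open>\<open>Suc j\<close> makes the grid time strictly larger than
    \<open>max 0 r\<close>, as convergence along \<open>at_right\<close> requires.\<close>
  define u where "u n j = real (Suc j) / real (Suc n)" for n j :: nat
  show "(\<lambda>(r, \<omega>). \<xi> (u n (k n r)) \<omega>) \<in> borel_measurable (borel \<Otimes>\<^sub>M M)" for n
  proof -
    have "(\<lambda>p. (\<lambda>j p. \<xi> (u n j) (snd p)) (k n (fst p)) p) \<in> borel_measurable (borel \<Otimes>\<^sub>M M)"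
    proof (rule measurable_compose_countable)
      fix j
      have [measurable]: "\<xi> (u n j) \<in> borel_measurable M" by (rule measurable_process) (simp add: u_def)
      show "(\<lambda>p. \<xi> (u n j) (snd p)) \<in> borel_measurable (borel \<Otimes>\<^sub>M M)" by measurable
    next
      show "(\<lambda>p. k n (fst p)) \<in> measurable (borel \<Otimes>\<^sub>M M) (count_space UNIV)"
        unfolding k_def by measurable
    qed
    then show ?thesis by (simp add: case_prod_beta')
  qed
  fix p :: "real \<times> 'a" assume "p \<in> space (borel \<Otimes>\<^sub>M M)"
  then obtain r \<omega> where p: "p = (r, \<omega>)" "\<omega> \<in> space M" by (auto simp: space_pair_measure)
  define t where "t = max 0 r"
  have gt: "t < u n (k n r)" and le: "u n (k n r) \<le> t + 1 / real (Suc n)" for n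
  proof -
    have *: "real (k n r) = of_int \<lfloor>t * real (Suc n)\<rfloor>" by (simp add: k_def t_def)
    have "real (Suc (k n r)) = real (k n r) + 1" by simp
    with * have 1: "t * real (Suc n) < real (Suc (k n r))" and 2: "real (Suc (k n r)) \<le> t * real (Suc n) + 1"
      by linarith+
    show "t < u n (k n r)" using 1 by (simp only: u_def less_divide_eq) simp
    have "u n (k n r) \<le> (t * real (Suc n) + 1) / real (Suc n)"
      unfolding u_def using 2 by (rule divide_right_mono) simp
    also have "\<dots> = t + 1 / real (Suc n)" by (simp add: add_divide_distrib)
    finally show "u n (k n r) \<le> t + 1 / real (Suc n)" .
  qed
  have lim: "(\<lambda>n. u n (k n r)) \<longlonglongrightarrow> t"
  proof (rule tendsto_sandwich[where f = "\<lambda>_. t" and h = "\<lambda>n. t + 1 / real (Suc n)"])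
    show "(\<lambda>n. t + 1 / real (Suc n)) \<longlonglongrightarrow> t" by real_asymp
    show "\<forall>\<^sub>F n in sequentially. t \<le> u n (k n r)" using gt by (intro always_eventually allI less_imp_le)
    show "\<forall>\<^sub>F n in sequentially. u n (k n r) \<le> t + 1 / real (Suc n)" using le by (intro always_eventually allI)
  qed simp
  have "filterlim (\<lambda>n. u n (k n r)) (at_right t) sequentially"
    unfolding filterlim_at using lim gt by (auto intro!: always_eventually)
  from filterlim_compose[OF right_continuous_paths[OF p(2), of t] this]
  show "(\<lambda>n. case p of (r, \<omega>) \<Rightarrow> \<xi> (u n (k n r)) \<omega>) \<longlonglongrightarrow> (case p of (r, \<omega>) \<Rightarrow> \<xi> (max 0 r) \<omega>)"
    by (simp add: p t_def)
qed

definition U :: "real \<Rightarrow> 'a \<Rightarrow> ennreal" where "U r \<omega> = (\<integral>\<^sup>+u\<in>{0..r}. \<xi> u \<omega> \<partial>lborel)"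
definition AR :: "real \<Rightarrow> 'a \<Rightarrow> real" where "AR r \<omega> = enn2real (U r \<omega>)"

lemma measurable_U[measurable]: "(\<lambda>(r, \<omega>). U r \<omega>) \<in> borel_measurable (borel \<Otimes>\<^sub>M M)"
proof -
  have "(\<lambda>(r, \<omega>). \<integral>\<^sup>+u. (if 0 \<le> u \<and> u \<le> r then (case (u, \<omega>) of (u, \<omega>) \<Rightarrow> \<xi> (max 0 u) \<omega>) else 0) \<partial>lborel) \<in> borel_measurable (borel \<Otimes>\<^sub>M M)"
    by measurable
  also have "(\<lambda>(r, \<omega>). \<integral>\<^sup>+u. (if 0 \<le> u \<and> u \<le> r then (case (u, \<omega>) of (u, \<omega>) \<Rightarrow> \<xi> (max 0 u) \<omega>) else 0) \<partial>lborel) = (\<lambda>(r, \<omega>). U r \<omega>)"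
    by (auto simp: U_def fun_eq_iff indicator_def intro!: nn_integral_cong)
  finally show ?thesis .
qed

lemma measurable_AR[measurable]: "(\<lambda>(r, \<omega>). AR r \<omega>) \<in> borel_measurable (borel \<Otimes>\<^sub>M M)"
  unfolding AR_def by measurable

definition good :: "'a \<Rightarrow> bool" where
  "good \<omega> \<longleftrightarrow> \<omega> \<in> space M \<and> (\<forall>t\<ge>0. \<xi> t \<omega> < \<infinity>) \<and> (\<exists>r0\<ge>0. 0 < X r0 \<omega>)"

text \<open>The paths vanishing at all integer times have probability at most E[exp(-X_n)] = exp(-n
  phi(1)) for every \<open>n\<close>, and \<open>\<phi> 1 > 0\<close>.\<close>

lemma AE_good: "AE \<omega> in M. good \<omega>"
proof -
  define E where "E = {\<omega> \<in> space M. \<forall>n::nat. X (real n) \<omega> = 0}"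
  have [measurable]: "X (real n) \<in> borel_measurable M" for n by simp
  have E[measurable]: "E \<in> events" unfolding E_def by measurable
  have le: "prob E \<le> exp (- (real n * \<phi> 1))" for n
  proof -
    have "prob E = expectation (indicator E)" by simp
    also have "\<dots> \<le> L 1 (real n)"
      unfolding L_def
    proof (rule integral_mono)
      show "integrable M (\<lambda>\<omega>. exp (- 1 * X (real n) \<omega>))" by (rule integrable_exp_X) auto
      show "indicator E \<omega> \<le> exp (- 1 * X (real n) \<omega>)" for \<omega>
        by (auto simp: E_def indicator_def)
      show "integrable M (indicator E :: 'a \<Rightarrow> real)"
        using integrable_real_indicator[OF E] emeasure_finite[of E] by (simp add: less_top[symmetric])
    qed
    finally show ?thesis using L_eq[of "real n" 1] by simp
  qed
  have "0 < \<phi> 1" using phi_eq[of 1] rphi_pos[of 1] by simp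
  then have "(\<lambda>n. exp (- (real n * \<phi> 1))) \<longlonglongrightarrow> 0" by real_asymp
  then have "prob E \<le> 0" by (rule LIMSEQ_le_const) (use le in auto)
  then have "prob E = 0" using measure_nonneg[of M E] by linarith
  then have "AE \<omega> in M. \<omega> \<notin> E" using prob_eq_0[OF E] by simp
  with AE_finite AE_space show ?thesis
  proof eventually_elim
    case (elim \<omega>)
    then obtain n :: nat where "X (real n) \<omega> \<noteq> 0" by (auto simp: E_def)
    then have "0 < X (real n) \<omega>" using X_nonneg[of "real n" \<omega>] by linarith
    then show ?case using elim by (auto simp: good_def intro!: exI[of _ "real n"])
  qed
qed

lemma X_mono_good: "good \<omega> \<Longrightarrow> mono_on {0..} (\<lambda>t. X t \<omega>)"
  unfolding X_def by (auto simp: good_def mono_on_def intro!: enn2real_mono xi_mono)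

lemma xi_good: "good \<omega> \<Longrightarrow> 0 \<le> t \<Longrightarrow> \<xi> t \<omega> = ennreal (X t \<omega>)"
  by (auto simp: good_def X_def less_top[symmetric])

lemma path_good: "good \<omega> \<Longrightarrow> \<exists>r0. increasing_path (\<lambda>t. X t \<omega>) r0"
  using X_mono_good by (auto simp: good_def increasing_path_def)

lemma U_good:
  assumes "good \<omega>" "0 \<le> r"
  shows "U r \<omega> = ennreal (integral {0..r} (\<lambda>t. X t \<omega>))"
proof -
  have int: "((\<lambda>t. X t \<omega>) has_integral integral {0..r} (\<lambda>t. X t \<omega>)) {0..r}"
    using integrable_on_mono_interval[OF X_mono_good[OF assms(1)], of 0 r] by (simp add: integrable_integral)
  have "U r \<omega> = (\<integral>\<^sup>+u. ennreal (indicator {0..r} u * X u \<omega>) \<partial>lborel)"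
    unfolding U_def by (rule nn_integral_cong) (auto simp: indicator_def xi_good[OF assms(1)])
  also have "\<dots> = ennreal (integral {0..r} (\<lambda>t. X t \<omega>))"
    by (rule nn_integral_has_integral_lebesgue[OF _ int]) simp
  finally show ?thesis .
qed

lemma AR_good: "good \<omega> \<Longrightarrow> 0 \<le> r \<Longrightarrow> AR r \<omega> = integral {0..r} (\<lambda>t. X t \<omega>)"
  using U_good[of \<omega> r] by (auto simp: AR_def integral_nonneg integrable_on_mono_interval[OF X_mono_good])

lemma AR_nonneg[simp]: "0 \<le> AR r \<omega>" by (simp add: AR_def)

text \<open>Limit of \<open>riemann_expectation\<close> with mesh \<open>r / (n + 1)\<close>: the
  Riemann sums of phi(q + a u) over \<open>[0, r]\<close> converge to (Phi(q + a r) - Phi(q)) /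
  a.\<close>

lemma expectation_exp_AR:
  assumes "0 \<le> r" "0 < a" "0 \<le> q"
  shows "expectation (\<lambda>\<omega>. exp (- q * X r \<omega> - a * AR r \<omega>)) = exp (- ((rPhi (q + a * r) - rPhi q) / a))"
proof -
  define h where "h n = r / real (Suc n)" for n
  have h: "0 \<le> h n" "real (Suc n) * h n = r" for n using assms by (auto simp: h_def)
  have [measurable]: "X r \<in> borel_measurable M" using assms by simp
  have [measurable]: "X (real k * h n) \<in> borel_measurable M" for k n
    using h by (intro measurable_X mult_nonneg_nonneg) auto
  have "(\<lambda>n. expectation (\<lambda>\<omega>. exp (- q * X r \<omega> - a * (h n * (\<Sum>k=1..Suc n. X (real k * h n) \<omega>)))))
     \<longlonglongrightarrow> expectation (\<lambda>\<omega>. exp (- q * X r \<omega> - a * AR r \<omega>))"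
  proof (rule integral_dominated_convergence)
    show "AE \<omega> in M. (\<lambda>n. exp (- q * X r \<omega> - a * (h n * (\<Sum>k=1..Suc n. X (real k * h n) \<omega>))))
       \<longlonglongrightarrow> exp (- q * X r \<omega> - a * AR r \<omega>)"
      using AE_good
    proof eventually_elim
      case (elim \<omega>)
      show ?case
        unfolding AR_good[OF elim assms(1)] h_def
        by (intro tendsto_exp tendsto_diff tendsto_const tendsto_mult_left mono_riemann_tendsto X_mono_good elim assms(1))
    qed
    show "AE \<omega> in M. norm (exp (- q * X r \<omega> - a * (h n * (\<Sum>k=1..Suc n. X (real k * h n) \<omega>)))) \<le> 1" for n
    proof (rule AE_I2)
      fix \<omega>
      have "0 \<le> (\<Sum>k=1..Suc n. X (real k * h n) \<omega>)" by (rule sum_nonneg) simp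
      then have "0 \<le> q * X r \<omega>" "0 \<le> a * (h n * (\<Sum>k=1..Suc n. X (real k * h n) \<omega>))"
        using assms h(1) by (intro mult_nonneg_nonneg; simp)+
      then show "norm (exp (- q * X r \<omega> - a * (h n * (\<Sum>k=1..Suc n. X (real k * h n) \<omega>)))) \<le> 1" by simp
    qed
    show "(\<lambda>\<omega>. exp (- q * X r \<omega> - a * (h n * (\<Sum>k=1..Suc n. X (real k * h n) \<omega>)))) \<in> borel_measurable M" for n
      by measurable
  qed auto
  moreover have "expectation (\<lambda>\<omega>. exp (- q * X r \<omega> - a * (h n * (\<Sum>k=1..Suc n. X (real k * h n) \<omega>))))
      = exp (- (h n * (\<Sum>k=1..Suc n. \<phi> (q + a * (real k * h n)))))" for n
    using riemann_expectation[of "h n" a q "Suc n"] assms h by (simp only: h)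
  moreover have "(\<lambda>n. exp (- (h n * (\<Sum>k=1..Suc n. \<phi> (q + a * (real k * h n)))))) \<longlonglongrightarrow> exp (- ((rPhi (q + a * r) - rPhi q) / a))"
  proof -
    have "mono_on {0..} (\<lambda>u. rphi (q + a * u))"
      using assms by (auto simp: mono_on_def intro!: rphi_mono)
    from mono_riemann_tendsto[OF this assms(1)]
    have "(\<lambda>n. h n * (\<Sum>k=1..Suc n. rphi (q + a * (real k * h n)))) \<longlonglongrightarrow> (rPhi (q + a * r) - rPhi q) / a"
      unfolding h_def integral_rphi_affine[OF assms(3,2,1)] .
    moreover have "(\<Sum>k=1..Suc n. rphi (q + a * (real k * h n))) = (\<Sum>k=1..Suc n. \<phi> (q + a * (real k * h n)))" for n
      using assms h(1)[of n] by (intro sum.cong refl phi_eq[symmetric]) auto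
    ultimately show ?thesis by (intro tendsto_exp tendsto_minus) simp
  qed
  ultimately show ?thesis by (simp only:) (rule LIMSEQ_unique)
qed

text \<open>Differentiation of \<open>expectation_exp_AR\<close> in \<open>q\<close>, along the
  increments \<open>1 / (n + 1)\<close>; the bound \<open>x * exp (- q * x) \<le> 1 / q\<close>
  dominates the difference quotients.\<close>

lemma expectation_X_exp_AR:
  assumes "0 \<le> r" "0 < a" "0 < q"
  shows "integrable M (\<lambda>\<omega>. exp (- q * X r \<omega> - a * AR r \<omega>) * X r \<omega>)"
    and "expectation (\<lambda>\<omega>. exp (- q * X r \<omega> - a * AR r \<omega>) * X r \<omega>)
     = (rphi (q + a * r) - rphi q) / a * exp (- ((rPhi (q + a * r) - rPhi q) / a))"
proof -
  define g where "g q = exp (- ((rPhi (q + a * r) - rPhi q) / a))" for q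
  define d where "d n = 1 / real (Suc n)" for n
  have d: "0 < d n" for n by (simp add: d_def)
  have dlim: "d \<longlonglongrightarrow> 0" unfolding d_def by real_asymp
  have d_at: "filterlim d (at 0) sequentially"
  proof -
    have "d n \<noteq> 0" for n using d[of n] by linarith
    then show ?thesis using dlim by (simp add: filterlim_at)
  qed
  have [measurable]: "X r \<in> borel_measurable M" using assms by simp
  have bound: "x * exp (- q * x) \<le> 1 / q" if "0 \<le> x" for x
  proof -
    have "q * x \<le> exp (q * x)" using exp_ge_add_one_self[of "q * x"] by linarith
    then show ?thesis using assms by (simp add: exp_minus field_simps)
  qed
  have bound': "norm (exp (- q * X r \<omega> - a * AR r \<omega>) * X r \<omega>) \<le> 1 / q" for \<omega>
  proof -
    have "exp (- q * X r \<omega> - a * AR r \<omega>) * X r \<omega> \<le> exp (- q * X r \<omega>) * X r \<omega>"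
      using assms by (intro mult_right_mono) auto
    then show ?thesis using bound[of "X r \<omega>"] by (simp add: mult.commute)
  qed
  show int: "integrable M (\<lambda>\<omega>. exp (- q * X r \<omega> - a * AR r \<omega>) * X r \<omega>)"
    using bound' by (intro integrable_const_bound[where B = "1 / q"]) auto
  have inte: "integrable M (\<lambda>\<omega>. exp (- p * X r \<omega> - a * AR r \<omega>))" if "0 \<le> p" for p
  proof (rule integrable_const_bound[where B = 1])
    show "AE \<omega> in M. norm (exp (- p * X r \<omega> - a * AR r \<omega>)) \<le> 1"
    proof (rule AE_I2)
      fix \<omega>
      have "0 \<le> p * X r \<omega>" "0 \<le> a * AR r \<omega>" using that assms by auto
      then show "norm (exp (- p * X r \<omega> - a * AR r \<omega>)) \<le> 1" by simp
    qed
  qed measurable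
  have lim1: "(\<lambda>n. expectation (\<lambda>\<omega>. (exp (- q * X r \<omega> - a * AR r \<omega>) - exp (- (q + d n) * X r \<omega> - a * AR r \<omega>)) / d n))
     \<longlonglongrightarrow> expectation (\<lambda>\<omega>. exp (- q * X r \<omega> - a * AR r \<omega>) * X r \<omega>)"
  proof (rule integral_dominated_convergence)
    have eq: "(exp (- q * X r \<omega> - a * AR r \<omega>) - exp (- (q + d n) * X r \<omega> - a * AR r \<omega>)) / d n
        = exp (- q * X r \<omega> - a * AR r \<omega>) * ((1 - exp (- (d n * X r \<omega>))) / d n)" for n \<omega>
    proof -
      have "- (q + d n) * X r \<omega> - a * AR r \<omega> = (- q * X r \<omega> - a * AR r \<omega>) + - (d n * X r \<omega>)"
        by (simp add: algebra_simps)
      then have "exp (- (q + d n) * X r \<omega> - a * AR r \<omega>) = exp (- q * X r \<omega> - a * AR r \<omega>) * exp (- (d n * X r \<omega>))"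
        by (simp only: exp_add)
      then show ?thesis by (simp add: right_diff_distrib)
    qed
    show "AE \<omega> in M. (\<lambda>n. (exp (- q * X r \<omega> - a * AR r \<omega>) - exp (- (q + d n) * X r \<omega> - a * AR r \<omega>)) / d n)
       \<longlonglongrightarrow> exp (- q * X r \<omega> - a * AR r \<omega>) * X r \<omega>"
    proof (rule AE_I2)
      fix \<omega>
      have "((\<lambda>h. exp (- (h * X r \<omega>))) has_real_derivative - X r \<omega>) (at 0)"
        by (auto intro!: derivative_eq_intros)
      then have "((\<lambda>h. (exp (- (h * X r \<omega>)) - exp (- (0 * X r \<omega>))) / (h - 0)) \<longlongrightarrow> - X r \<omega>) (at 0)"
        by (simp add: has_field_derivative_iff)
      from filterlim_compose[OF this d_at] have "(\<lambda>n. (exp (- (d n * X r \<omega>)) - exp (- (0 * X r \<omega>))) / (d n - 0)) \<longlonglongrightarrow> - X r \<omega>" .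
      from tendsto_minus[OF this] have "(\<lambda>n. (1 - exp (- (d n * X r \<omega>))) / d n) \<longlonglongrightarrow> X r \<omega>"
        by (simp only: minus_divide_left minus_diff_eq mult_zero_left minus_zero exp_zero diff_zero minus_minus)
      then show "(\<lambda>n. (exp (- q * X r \<omega> - a * AR r \<omega>) - exp (- (q + d n) * X r \<omega> - a * AR r \<omega>)) / d n)
       \<longlonglongrightarrow> exp (- q * X r \<omega> - a * AR r \<omega>) * X r \<omega>"
        unfolding eq by (rule tendsto_mult_left)
    qed
    show "AE \<omega> in M. norm ((exp (- q * X r \<omega> - a * AR r \<omega>) - exp (- (q + d n) * X r \<omega> - a * AR r \<omega>)) / d n) \<le> 1 / q" for n
    proof (rule AE_I2)
      fix \<omega>
      have "1 - exp (- (d n * X r \<omega>)) \<le> d n * X r \<omega>" using exp_ge_add_one_self[of "- (d n * X r \<omega>)"] by linarith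
      then have "(1 - exp (- (d n * X r \<omega>))) / d n \<le> X r \<omega>" using d[of n] by (simp add: divide_le_eq mult.commute)
      moreover have "0 \<le> (1 - exp (- (d n * X r \<omega>))) / d n" using d[of n] by simp
      ultimately have "norm (exp (- q * X r \<omega> - a * AR r \<omega>) * ((1 - exp (- (d n * X r \<omega>))) / d n))
         \<le> norm (exp (- q * X r \<omega> - a * AR r \<omega>) * X r \<omega>)"
        unfolding norm_mult by (intro mult_left_mono) auto
      then show "norm ((exp (- q * X r \<omega> - a * AR r \<omega>) - exp (- (q + d n) * X r \<omega> - a * AR r \<omega>)) / d n) \<le> 1 / q"
        unfolding eq using bound'[of \<omega>] by linarith
    qed
  qed auto
  have eqn: "expectation (\<lambda>\<omega>. (exp (- q * X r \<omega> - a * AR r \<omega>) - exp (- (q + d n) * X r \<omega> - a * AR r \<omega>)) / d n)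
     = (g q - g (q + d n)) / d n" for n
  proof -
    have q: "0 \<le> q" "0 \<le> q + d n" using assms d[of n] by auto
    show ?thesis
      unfolding integral_divide_zero Bochner_Integration.integral_diff[OF inte[OF q(1)] inte[OF q(2)]]
        expectation_exp_AR[OF assms(1,2) q(1)] expectation_exp_AR[OF assms(1,2) q(2)] g_def ..
  qed
  have lim2: "(\<lambda>n. (g q - g (q + d n)) / d n) \<longlonglongrightarrow> (rphi (q + a * r) - rphi q) / a * g q"
  proof -
    have pos: "0 < q + a * r" using assms by (simp add: add_pos_nonneg)
    have c: "((\<lambda>q. rPhi (q + a * r)) has_real_derivative rphi (q + a * r) * 1) (at q)"
    proof (rule DERIV_chain2[where f = rPhi and g = "\<lambda>q. q + a * r", OF rPhi_derivative_interior[OF pos]])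
      show "((\<lambda>q. q + a * r) has_real_derivative 1) (at q)"
        using DERIV_add[OF DERIV_ident DERIV_const] by simp
    qed
    have "(g has_real_derivative - ((rphi (q + a * r) - rphi q) / a * g q)) (at q)"
    proof -
      have "((\<lambda>q. - ((rPhi (q + a * r) - rPhi q) / a)) has_real_derivative - ((rphi (q + a * r) * 1 - rphi q) / a)) (at q)"
        by (intro DERIV_minus DERIV_cdivide DERIV_diff c rPhi_derivative_interior assms)
      from DERIV_fun_exp[OF this] show ?thesis
        unfolding g_def by (rule DERIV_cong) simp
    qed
    then have "((\<lambda>h. (g (q + h) - g q) / h) \<longlongrightarrow> - ((rphi (q + a * r) - rphi q) / a * g q)) (at 0)"
      by (simp add: DERIV_def)
    from filterlim_compose[OF this d_at] have "(\<lambda>n. (g (q + d n) - g q) / d n) \<longlonglongrightarrow> - ((rphi (q + a * r) - rphi q) / a * g q)" .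
    from tendsto_minus[OF this] show ?thesis by (simp only: minus_divide_left minus_diff_eq minus_minus)
  qed
  from LIMSEQ_unique[OF lim1[unfolded eqn] lim2]
  show "expectation (\<lambda>\<omega>. exp (- q * X r \<omega> - a * AR r \<omega>) * X r \<omega>)
     = (rphi (q + a * r) - rphi q) / a * exp (- ((rPhi (q + a * r) - rPhi q) / a))"
    by (simp only: g_def)
qed

text \<open>The area is nondecreasing in \<open>r\<close>, so the infimum may run over nonnegative
  rationals and is a countable infimum of measurable functions; a rational within \<open>e\<close>
  of a real candidate costs at most \<open>e\<close>.\<close>

lemma rho_measurable[measurable]: "(\<lambda>(t, \<omega>). rho \<xi> t \<omega>) \<in> borel_measurable (borel \<Otimes>\<^sub>M M)"
proof -
  let ?D = "{s \<in> \<rat>. 0 \<le> s} :: real set"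
  have cD: "countable ?D" using countable_rat by (rule countable_subset[rotated]) auto
  have [measurable]: "U s \<in> borel_measurable M" for s
    using measurable_compose[OF measurable_Pair1'[of s borel M] measurable_U] by simp
  have "(\<lambda>p. INF s\<in>?D. (if U s (snd p) > ennreal (fst p) then ennreal s else \<infinity>)) \<in> borel_measurable (borel \<Otimes>\<^sub>M M)"
    using cD by (intro borel_measurable_INF) measurable
  moreover have eq: "(case p of (t, \<omega>) \<Rightarrow> rho \<xi> t \<omega>) = (INF s\<in>?D. (if U s (snd p) > ennreal (fst p) then ennreal s else \<infinity>))" for p
  proof -
    obtain t \<omega> where p: "p = (t, \<omega>)" by (cases p)
    have U_mono: "U s \<omega> \<le> U s' \<omega>" if "s \<le> s'" for s s'
      unfolding U_def using that by (intro nn_integral_mono) (auto simp: indicator_def)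
    have "rho \<xi> t \<omega> = (INF s\<in>?D. (if U s \<omega> > ennreal t then ennreal s else \<infinity>))"
    proof (rule antisym)
      show "rho \<xi> t \<omega> \<le> (INF s\<in>?D. (if U s \<omega> > ennreal t then ennreal s else \<infinity>))"
        unfolding rho_def by (rule INF_greatest) (auto simp: U_def intro!: Inf_lower)
      show "(INF s\<in>?D. (if U s \<omega> > ennreal t then ennreal s else \<infinity>)) \<le> rho \<xi> t \<omega>"
        unfolding rho_def
      proof (rule Inf_greatest)
        fix z assume "z \<in> {ennreal r |r. 0 \<le> r \<and> ennreal t < (\<integral>\<^sup>+u\<in>{0..r}. \<xi> u \<omega> \<partial>lborel)}"
        then obtain r where r: "z = ennreal r" "0 \<le> r" "ennreal t < U r \<omega>" by (auto simp: U_def)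
        show "(INF s\<in>?D. (if U s \<omega> > ennreal t then ennreal s else \<infinity>)) \<le> z"
        proof (rule ennreal_le_epsilon)
          fix e :: real assume "0 < e"
          then obtain s where s: "s \<in> \<rat>" "r < s" "s < r + e" using Rats_dense_in_real[of r "r + e"] by auto
          then have "(INF s\<in>?D. (if U s \<omega> > ennreal t then ennreal s else \<infinity>)) \<le> (if U s \<omega> > ennreal t then ennreal s else \<infinity>)"
            using r by (intro INF_lower) auto
          also have "\<dots> = ennreal s" using r(3) U_mono[of r s] s by auto
          also have "\<dots> \<le> z + ennreal e" using s r \<open>0 < e\<close> by (simp add: ennreal_plus[symmetric] ennreal_leI del: ennreal_plus)
          finally show "(INF s\<in>?D. (if U s \<omega> > ennreal t then ennreal s else \<infinity>)) \<le> z + ennreal e" .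
        qed
      qed
    qed
    then show ?thesis by (simp add: p)
  qed
  ultimately show ?thesis by (simp only: eq[abs_def])
qed

lemma time_changed_measurable[measurable]: "(\<lambda>(t, \<omega>). time_changed \<xi> t \<omega>) \<in> borel_measurable (borel \<Otimes>\<^sub>M M)"
proof -
  have "(\<lambda>p. (\<lambda>(r, \<omega>). \<xi> (max 0 r) \<omega>) (enn2real (rho \<xi> (fst p) (snd p)), snd p)) \<in> borel_measurable (borel \<Otimes>\<^sub>M M)"
    using rho_measurable by measurable
  then show ?thesis by (simp add: time_changed_def case_prod_beta')
qed

definition F :: "real \<Rightarrow> real \<Rightarrow> real" where "F q t = (\<integral>\<omega>. exp_neg_mult q (time_changed \<xi> t \<omega>) \<partial>M)"

lemma F_measurable[measurable]: "F q \<in> borel_measurable borel"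
proof -
  have "(\<lambda>t. \<integral>\<omega>. (\<lambda>(t, \<omega>). exp_neg_mult q (time_changed \<xi> t \<omega>)) (t, \<omega>) \<partial>M) \<in> borel_measurable borel"
    by measurable
  then show ?thesis by (simp add: F_def[abs_def])
qed

lemma integrable_F: "0 \<le> q \<Longrightarrow> integrable M (\<lambda>\<omega>. exp_neg_mult q (time_changed \<xi> t \<omega>))"
  using exp_neg_mult_bounds by (intro integrable_const_bound[where B = 1]) auto

lemma F_bounds:
  assumes "0 \<le> q"
  shows "0 \<le> F q t" "F q t \<le> 1"
proof -
  show "0 \<le> F q t" unfolding F_def using exp_neg_mult_bounds[OF assms] by (intro Bochner_Integration.integral_nonneg) auto
  have "F q t \<le> (\<integral>\<omega>. 1 \<partial>M)"
    unfolding F_def using exp_neg_mult_bounds[OF assms] integrable_F[OF assms] by (intro integral_mono) auto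
  then show "F q t \<le> 1" by (simp add: prob_space)
qed

lemma rho_good_finite:
  assumes "good \<omega>"
  shows "rho \<xi> t \<omega> < \<infinity>"
proof -
  obtain r0 where "increasing_path (\<lambda>t. X t \<omega>) r0" using path_good[OF assms] by blast
  then interpret p: increasing_path "\<lambda>t. X t \<omega>" r0 .
  define s where "s = r0 + (\<bar>t\<bar> + 1) / X r0 \<omega>"
  have "(s - r0) * X r0 \<omega> \<le> p.area s - p.area r0"
    using p.pos by (intro p.area_diff_ge) (auto simp: s_def)
  moreover have "0 \<le> p.area r0" unfolding p.area_def by (auto intro!: integral_nonneg p.integrable_x)
  ultimately have "t < p.area s" "0 < p.area s" "0 \<le> s" using p.pos by (auto simp: s_def)
  then have "rho \<xi> t \<omega> \<le> ennreal s"
    unfolding rho_def using U_good[OF assms \<open>0 \<le> s\<close>]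
    by (intro Inf_lower) (auto simp: U_def p.area_def intro!: exI[of _ s] ennreal_lessI)
  also have "\<dots> < \<infinity>" by simp
  finally show ?thesis .
qed

text \<open>A larger level is passed later and the path is nondecreasing. This monotonicity is what
  converts averaged information on \<open>F\<close> into pointwise bounds.\<close>

lemma F_antimono:
  assumes "0 \<le> q" "s \<le> t"
  shows "F q t \<le> F q s"
  unfolding F_def
proof (rule integral_mono_AE)
  show "AE \<omega> in M. exp_neg_mult q (time_changed \<xi> t \<omega>) \<le> exp_neg_mult q (time_changed \<xi> s \<omega>)"
    using AE_good
  proof eventually_elim
    case (elim \<omega>)
    have "rho \<xi> s \<omega> \<le> rho \<xi> t \<omega>"
      unfolding rho_def using assms(2) by (intro Inf_superset_mono) (auto intro: le_less_trans ennreal_leI)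
    then have "enn2real (rho \<xi> s \<omega>) \<le> enn2real (rho \<xi> t \<omega>)"
      using rho_good_finite[OF elim] by (intro enn2real_mono) auto
    then have "X (enn2real (rho \<xi> s \<omega>)) \<omega> \<le> X (enn2real (rho \<xi> t \<omega>)) \<omega>"
      using mono_onD[OF X_mono_good[OF elim]] by simp
    then show ?case
      using elim assms(1) unfolding time_changed_def by (simp add: xi_good exp_neg_mult_def mult_left_mono)
  qed
qed (use integrable_F assms in auto)

text \<open>When \<open>X r > 0\<close> the area exceeds its value at \<open>r\<close> at every
  later time, so \<open>rho\<close> inverts it exactly. Times with \<open>X r = 0\<close> have no
  weight in the substitution dt = X_r dr.\<close>

lemma time_changed_area:
  assumes "good \<omega>" "0 \<le> r" "0 < X r \<omega>"
  shows "time_changed \<xi> (AR r \<omega>) \<omega> = ennreal (X r \<omega>)"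
proof -
  obtain r0 where "increasing_path (\<lambda>t. X t \<omega>) r0" using path_good[OF assms(1)] by blast
  then interpret p: increasing_path "\<lambda>t. X t \<omega>" r0 .
  have area: "p.area s = AR s \<omega>" if "0 \<le> s" for s using AR_good[OF assms(1) that] by (simp add: p.area_def)
  have iff: "ennreal (AR r \<omega>) < (\<integral>\<^sup>+u\<in>{0..s}. \<xi> u \<omega> \<partial>lborel) \<longleftrightarrow> r < s" if "0 \<le> s" for s
  proof -
    have "(\<integral>\<^sup>+u\<in>{0..s}. \<xi> u \<omega> \<partial>lborel) = ennreal (AR s \<omega>)"
      using U_good[OF assms(1) that] AR_good[OF assms(1) that] by (simp add: U_def)
    then show ?thesis
      using p.area_less_iff[OF assms(2,3) that] area[OF that] area[OF assms(2)] by (simp add: ennreal_less_iff)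
  qed
  have "rho \<xi> (AR r \<omega>) \<omega> = ennreal r"
  proof (rule antisym)
    show "rho \<xi> (AR r \<omega>) \<omega> \<le> ennreal r"
    proof (rule ennreal_le_epsilon)
      fix e :: real assume "0 < e"
      then have "rho \<xi> (AR r \<omega>) \<omega> \<le> ennreal (r + e)"
        unfolding rho_def using iff[of "r + e"] assms(2) by (intro Inf_lower) (auto intro!: exI[of _ "r + e"])
      then show "rho \<xi> (AR r \<omega>) \<omega> \<le> ennreal r + ennreal e"
        using assms(2) \<open>0 < e\<close> by (simp add: ennreal_plus[symmetric] del: ennreal_plus)
    qed
    show "ennreal r \<le> rho \<xi> (AR r \<omega>) \<omega>"
      unfolding rho_def using iff by (intro Inf_greatest) (auto intro!: ennreal_leI)
  qed
  then show ?thesis using assms by (simp add: time_changed_def xi_good)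
qed

text \<open>Fubini, then path by path the substitution t = A(r), then Fubini back; the inner
  expectation is \<open>expectation_X_exp_AR\<close>. Extended integrals of nonnegative functions
  avoid integrability conditions.\<close>

lemma laplace_F:
  assumes "0 < a" "0 < q"
  shows "(\<integral>\<^sup>+t\<in>{0..}. ennreal (exp (- a * t) * F q t) \<partial>lborel)
    = (\<integral>\<^sup>+r\<in>{0..}. ennreal ((rphi (q + a * r) - rphi q) / a * exp (- ((rPhi (q + a * r) - rPhi q) / a))) \<partial>lborel)"
proof -
  interpret P: pair_sigma_finite lborel M ..
  have bd: "0 \<le> exp_neg_mult q x" for x using exp_neg_mult_bounds[of q x] assms by simp
  have "(\<integral>\<^sup>+t\<in>{0..}. ennreal (exp (- a * t) * F q t) \<partial>lborel)
     = (\<integral>\<^sup>+t. (\<integral>\<^sup>+\<omega>. ennreal (exp (- a * t) * exp_neg_mult q (time_changed \<xi> t \<omega>)) * indicator {0..} t \<partial>M) \<partial>lborel)"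
  proof (rule nn_integral_cong)
    fix t :: real
    have "ennreal (exp (- a * t) * F q t) = (\<integral>\<^sup>+\<omega>. ennreal (exp (- a * t) * exp_neg_mult q (time_changed \<xi> t \<omega>)) \<partial>M)"
      using integrable_F[of q t] assms bd
      by (subst nn_integral_eq_integral) (auto simp: F_def)
    then show "ennreal (exp (- a * t) * F q t) * indicator {0..} t
      = (\<integral>\<^sup>+\<omega>. ennreal (exp (- a * t) * exp_neg_mult q (time_changed \<xi> t \<omega>)) * indicator {0..} t \<partial>M)"
      by (simp add: nn_integral_multc)
  qed
  also have "\<dots> = (\<integral>\<^sup>+\<omega>. (\<integral>\<^sup>+t. ennreal (exp (- a * t) * exp_neg_mult q (time_changed \<xi> t \<omega>)) * indicator {0..} t \<partial>lborel) \<partial>M)"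
  proof (rule P.Fubini'[symmetric])
    have [measurable]: "(\<lambda>p. time_changed \<xi> (fst p) (snd p)) \<in> borel_measurable (borel \<Otimes>\<^sub>M M)"
      using time_changed_measurable by (simp add: case_prod_beta')
    show "(\<lambda>(t, \<omega>). ennreal (exp (- a * t) * exp_neg_mult q (time_changed \<xi> t \<omega>)) * indicator {0..} t) \<in> borel_measurable (lborel \<Otimes>\<^sub>M M)"
      by measurable
  qed
  also have "\<dots> = (\<integral>\<^sup>+\<omega>. (\<integral>\<^sup>+r. ennreal (exp (- q * X r \<omega> - a * AR r \<omega>) * X r \<omega>) * indicator {0..} r \<partial>lborel) \<partial>M)"
  proof (rule nn_integral_cong_AE)
    show "AE \<omega> in M. (\<integral>\<^sup>+t. ennreal (exp (- a * t) * exp_neg_mult q (time_changed \<xi> t \<omega>)) * indicator {0..} t \<partial>lborel)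
       = (\<integral>\<^sup>+r. ennreal (exp (- q * X r \<omega> - a * AR r \<omega>) * X r \<omega>) * indicator {0..} r \<partial>lborel)"
      using AE_good
    proof eventually_elim
      case (elim \<omega>)
      obtain r0 where "increasing_path (\<lambda>t. X t \<omega>) r0" using path_good[OF elim] by blast
      then interpret p: increasing_path "\<lambda>t. X t \<omega>" r0 .
      have "\<omega> \<in> space M" using elim by (simp add: good_def)
      then have [measurable]: "(\<lambda>t. time_changed \<xi> t \<omega>) \<in> borel_measurable borel"
        using measurable_compose[OF measurable_Pair2'[of \<omega> M borel] time_changed_measurable] by simp
      have "(\<integral>\<^sup>+t. ennreal (exp (- a * t) * exp_neg_mult q (time_changed \<xi> t \<omega>)) * indicator {0..} t \<partial>lborel)
        = (\<integral>\<^sup>+r\<in>{0..}. ennreal (exp (- a * p.area r) * exp_neg_mult q (time_changed \<xi> (p.area r) \<omega>)) * ennreal (X r \<omega>) \<partial>lborel)"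
        by (rule p.nn_integral_time_change) measurable
      also have "\<dots> = (\<integral>\<^sup>+r. ennreal (exp (- q * X r \<omega> - a * AR r \<omega>) * X r \<omega>) * indicator {0..} r \<partial>lborel)"
      proof (rule nn_integral_cong)
        fix r :: real
        show "ennreal (exp (- a * p.area r) * exp_neg_mult q (time_changed \<xi> (p.area r) \<omega>)) * ennreal (X r \<omega>) * indicator {0..} r
          = ennreal (exp (- q * X r \<omega> - a * AR r \<omega>) * X r \<omega>) * indicator {0..} r"
        proof (cases "0 \<le> r \<and> 0 < X r \<omega>")
          case True
          then have "p.area r = AR r \<omega>" using AR_good[OF elim] by (simp add: p.area_def)
          moreover have "exp_neg_mult q (time_changed \<xi> (AR r \<omega>) \<omega>) = exp (- q * X r \<omega>)"
            using time_changed_area[OF elim, of r] True by (simp add: exp_neg_mult_def)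
          moreover have "exp (- q * X r \<omega> - a * AR r \<omega>) = exp (- a * AR r \<omega>) * exp (- q * X r \<omega>)"
            unfolding exp_add[symmetric] by (rule arg_cong[where f = exp]) simp
          ultimately show ?thesis
            by (simp only:) (simp only: ennreal_mult[symmetric] exp_ge_zero mult_nonneg_nonneg X_nonneg)
        next
          case False
          then have "\<not> 0 \<le> r \<or> X r \<omega> = 0" using X_nonneg[of r \<omega>] by linarith
          then show ?thesis by auto
        qed
      qed
      finally show ?case .
    qed
  qed
  \<comment> \<open>\<open>max 0 r\<close> keeps the integrand jointly measurable, as
    \<open>\<xi>\<close> is controlled at nonnegative times only.\<close>
  also have "\<dots> = (\<integral>\<^sup>+r. (\<integral>\<^sup>+\<omega>. ennreal (exp (- q * X (max 0 r) \<omega> - a * AR r \<omega>) * X (max 0 r) \<omega>) * indicator {0..} r \<partial>M) \<partial>lborel)"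
  proof -
    have [measurable]: "(\<lambda>p. AR (fst p) (snd p)) \<in> borel_measurable (borel \<Otimes>\<^sub>M M)"
      "(\<lambda>p. \<xi> (max 0 (fst p)) (snd p)) \<in> borel_measurable (borel \<Otimes>\<^sub>M M)"
      using measurable_AR measurable_joint by (simp_all add: case_prod_beta')
    have "(\<integral>\<^sup>+\<omega>. (\<integral>\<^sup>+r. ennreal (exp (- q * X r \<omega> - a * AR r \<omega>) * X r \<omega>) * indicator {0..} r \<partial>lborel) \<partial>M)
      = (\<integral>\<^sup>+\<omega>. (\<integral>\<^sup>+r. ennreal (exp (- q * X (max 0 r) \<omega> - a * AR r \<omega>) * X (max 0 r) \<omega>) * indicator {0..} r \<partial>lborel) \<partial>M)"
      by (intro nn_integral_cong) (auto simp: indicator_def max_def)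
    also have "\<dots> = (\<integral>\<^sup>+r. (\<integral>\<^sup>+\<omega>. ennreal (exp (- q * X (max 0 r) \<omega> - a * AR r \<omega>) * X (max 0 r) \<omega>) * indicator {0..} r \<partial>M) \<partial>lborel)"
    proof (rule P.Fubini')
      show "(\<lambda>(r, \<omega>). ennreal (exp (- q * X (max 0 r) \<omega> - a * AR r \<omega>) * X (max 0 r) \<omega>) * indicator {0..} r) \<in> borel_measurable (lborel \<Otimes>\<^sub>M M)"
        unfolding X_def by measurable
    qed
    finally show ?thesis .
  qed
  also have "\<dots> = (\<integral>\<^sup>+r\<in>{0..}. ennreal ((rphi (q + a * r) - rphi q) / a * exp (- ((rPhi (q + a * r) - rPhi q) / a))) \<partial>lborel)"
  proof (rule nn_integral_cong)
    fix r :: real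
    show "(\<integral>\<^sup>+\<omega>. ennreal (exp (- q * X (max 0 r) \<omega> - a * AR r \<omega>) * X (max 0 r) \<omega>) * indicator {0..} r \<partial>M)
      = ennreal ((rphi (q + a * r) - rphi q) / a * exp (- ((rPhi (q + a * r) - rPhi q) / a))) * indicator {0..} r"
    proof (cases "0 \<le> r")
      case True
      then show ?thesis
        using expectation_X_exp_AR[OF True assms]
        by (simp add: nn_integral_eq_integral max_def)
    qed simp
  qed
  finally show ?thesis .
qed

end

section \<open>The mixture representation\<close>

lemma integrable_power_decay:
  fixes f :: "real \<Rightarrow> 'b::{banach, second_countable_topology}"
  assumes [measurable]: "f \<in> borel_measurable borel" and "1 < p"
    and K: "\<And>x. norm (f x) \<le> K" "\<And>x. 1 \<le> \<bar>x\<bar> \<Longrightarrow> norm (f x) \<le> K * \<bar>x\<bar> powr - p"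
  shows "integrable lborel f"
proof -
  have "((\<lambda>x. x powr - p) has_integral - (1 powr (- p + 1)) / (- p + 1)) {1..}"
    using assms(2) by (intro has_integral_powr_to_inf) auto
  then have "set_integrable lebesgue {1..} (\<lambda>x::real. x powr - p)"
    by (intro nonnegative_absolutely_integrable_1) (auto simp: has_integral_integrable)
  then have i1: "integrable lborel (\<lambda>x::real. indicator {1..} x * x powr - p)"
    unfolding set_integrable_def by (subst (asm) integrable_completion) auto
  then have i2: "integrable lborel (\<lambda>x::real. indicator {1..} (- x) * (- x) powr - p)"
    using lborel_integrable_real_affine[OF i1, of "-1" 0] by simp
  have i3: "integrable lborel (indicator {-1..1} :: real \<Rightarrow> real)"
    by (rule integrable_real_indicator) auto
  have i: "integrable lborel (\<lambda>x. K * (indicator {-1..1} x + (indicator {1..} x * x powr - p + indicator {1..} (- x) * (- x) powr - p)))"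
    by (intro integrable_mult_right Bochner_Integration.integrable_add i1 i2 i3)
  have K0: "0 \<le> K" using K(1)[of 0] norm_ge_zero[of "f 0"] by linarith
  show ?thesis
  proof (rule Bochner_Integration.integrable_bound[OF i], measurable, rule AE_I2)
    fix x :: real
    have "norm (f x) \<le> K * (indicator {-1..1} x + (indicator {1..} x * x powr - p + indicator {1..} (- x) * (- x) powr - p))"
    proof (cases "\<bar>x\<bar> \<le> 1")
      case True
      have "K * 1 \<le> K * (indicator {-1..1} x + (indicator {1..} x * x powr - p + indicator {1..} (- x) * (- x) powr - p))"
        using True K0 by (intro mult_left_mono) (auto simp: indicator_def)
      then show ?thesis using K(1)[of x] by simp
    next
      case False
      then show ?thesis using K(2)[of x] by (cases "0 \<le> x") (auto simp: indicator_def)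
    qed
    then show "norm (f x) \<le> norm (K * (indicator {-1..1} x + (indicator {1..} x * x powr - p + indicator {1..} (- x) * (- x) powr - p)))"
      by simp
  qed
qed

context levy_data
begin

lemma rPhi_mono: "0 \<le> s \<Longrightarrow> s \<le> t \<Longrightarrow> rPhi s \<le> rPhi t"
  using integral_rphi[of s t] has_integral_nonneg[of rphi "rPhi t - rPhi s" "{s..t}"] rphi_nonneg by auto

lemma rPhi_diff_ge:
  assumes "0 \<le> s" "s \<le> t"
  shows "(t - s) * rphi s \<le> rPhi t - rPhi s"
proof -
  have "((\<lambda>_. rphi s) has_integral ((t - s) * rphi s)) {s..t}"
    using has_integral_const_real[of "rphi s" s t] assms by simp
  then show ?thesis
    using integral_rphi[OF assms] by (rule has_integral_le) (use assms rphi_mono in auto)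
qed

lemma rPhi_pos: "0 < s \<Longrightarrow> 0 < rPhi s"
proof -
  assume "0 < s"
  then have "0 < (s - s / 2) * rphi (s / 2)" using rphi_pos[of "s / 2"] by (intro mult_pos_pos) auto
  then show ?thesis
    using rPhi_diff_ge[of "s / 2" s] rPhi_mono[of 0 "s / 2"] \<open>0 < s\<close> by simp
qed

lemma rphi_measurable[measurable (raw)]:
  assumes "f \<in> borel_measurable N"
  shows "(\<lambda>x. rphi (max 0 (f x))) \<in> borel_measurable N"
proof (rule measurable_compose[OF assms])
  show "(\<lambda>w. rphi (max 0 w)) \<in> borel_measurable borel"
    by (rule borel_measurable_mono) (auto simp: mono_def intro!: rphi_mono)
qed

lemma rPhi_measurable[measurable (raw)]:
  assumes "f \<in> borel_measurable N"
  shows "(\<lambda>x. rPhi (max 0 (f x))) \<in> borel_measurable N"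
proof (rule measurable_compose[OF assms])
  show "(\<lambda>w. rPhi (max 0 w)) \<in> borel_measurable borel"
    by (rule borel_measurable_mono) (auto simp: mono_def intro!: rPhi_mono)
qed

lemma rPhi_derivative_pos:
  assumes "0 < s"
  shows "(rPhi has_real_derivative rphi s) (at s)"
  using rPhi_derivative[of s] assms at_within_interior[of s "{0..}"] by simp

text \<open>The integrand is the derivative of -exp(-(Phi(q + a w) - Phi(q)) k) / (a k). Phi grows
  at least linearly with slope \<open>rphi q\<close> beyond \<open>q\<close>, which removes the
  boundary term at infinity.\<close>

lemma nn_integral_rphi_exp:
  assumes "0 < q" "0 < a" "0 < k"
  shows "(\<integral>\<^sup>+w. ennreal (rphi (q + a * w) * exp (- ((rPhi (q + a * w) - rPhi q) * k))) * indicator {0..} w \<partial>lborel) = ennreal (1 / (a * k))"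
proof -
  define f where "f w = rphi (max 0 (q + a * w)) * exp (- ((rPhi (max 0 (q + a * w)) - rPhi q) * k))" for w
  have "(\<integral>\<^sup>+w. ennreal (f w) * indicator {0..} w \<partial>lborel) = ennreal (0 - (- exp (- ((rPhi (q + a * 0) - rPhi q) * k)) / (a * k)))"
  proof (rule nn_integral_FTC_atLeast)
    show "f \<in> borel_measurable borel" unfolding f_def[abs_def] by measurable
    fix w :: real assume w: "0 \<le> w"
    have pos: "0 < q + a * w" using assms w by (simp add: add_pos_nonneg)
    have "((\<lambda>w. q + a * w) has_real_derivative a) (at w)"
      by (auto intro!: derivative_eq_intros)
    from DERIV_chain2[OF rPhi_derivative_pos[OF pos] this]
    have "((\<lambda>w. - ((rPhi (q + a * w) - rPhi q) * k)) has_real_derivative - ((rphi (q + a * w) * a - 0) * k)) (at w)"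
      by (intro DERIV_minus DERIV_cmult_right DERIV_diff DERIV_const)
    from DERIV_cdivide[OF DERIV_minus[OF DERIV_fun_exp[OF this]], of "a * k"]
    show "((\<lambda>w. - exp (- ((rPhi (q + a * w) - rPhi q) * k)) / (a * k)) has_real_derivative f w) (at w)"
      by (rule DERIV_cong) (use assms pos in \<open>simp add: f_def max_def\<close>)
    show "0 \<le> f w" using pos by (simp add: f_def rphi_nonneg)
  next
    have lim: "((\<lambda>w. exp (- (a * w * rphi q * k))) \<longlongrightarrow> 0) at_top"
    proof -
      define b where "b = a * rphi q * k"
      have "0 < b" using assms rphi_pos by (simp add: b_def)
      then have "((\<lambda>w. exp (- (b * w))) \<longlongrightarrow> 0) at_top" by real_asymp
      then show ?thesis by (simp add: b_def mult_ac)
    qed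
    have "((\<lambda>w. exp (- ((rPhi (q + a * w) - rPhi q) * k))) \<longlongrightarrow> 0) at_top"
    proof (rule tendsto_sandwich[OF _ _ tendsto_const lim])
      show "\<forall>\<^sub>F w in at_top. exp (- ((rPhi (q + a * w) - rPhi q) * k)) \<le> exp (- (a * w * rphi q * k))"
        using eventually_ge_at_top[of 0]
      proof eventually_elim
        case (elim w)
        then have "a * w * rphi q \<le> rPhi (q + a * w) - rPhi q" using rPhi_diff_ge[of q "q + a * w"] assms by simp
        then show ?case using assms by (simp add: mult_right_mono)
      qed
    qed simp
    from tendsto_divide[OF tendsto_minus[OF this] tendsto_const, of "a * k"] assms
    show "((\<lambda>w. - exp (- ((rPhi (q + a * w) - rPhi q) * k)) / (a * k)) \<longlongrightarrow> 0) at_top" by simp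
  qed
  also have "(\<integral>\<^sup>+w. ennreal (f w) * indicator {0..} w \<partial>lborel)
    = (\<integral>\<^sup>+w. ennreal (rphi (q + a * w) * exp (- ((rPhi (q + a * w) - rPhi q) * k))) * indicator {0..} w \<partial>lborel)"
    using assms by (intro nn_integral_cong) (auto simp: f_def indicator_def max_def mult_nonneg_nonneg add_nonneg_nonneg)
  finally show ?thesis using assms by simp
qed

text \<open>The identity below determines the Laplace transform of \<open>t \<mapsto> E[exp (- q \<xi>\<^bsub>\<rho>(t)\<^esub>)]\<close> through \<open>lapN q a\<close>, in which only
  the values of \<open>\<Phi>\<close> on the positive half-line occur. This makes the passage to the limit in \<open>c\<close> possible.\<close>
definition lapN :: "real \<Rightarrow> real \<Rightarrow> ennreal" where
  "lapN q a = (\<integral>\<^sup>+w. ennreal (exp (- ((rPhi (q + a * w) - rPhi q) / a))) * indicator {0..} w \<partial>lborel)"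

text \<open>Adding \<open>rphi q\<close> back completes the integrand to
  \<open>rphi (q + a * w)\<close> times the exponential, whose integral is 1 by
  \<open>nn_integral_rphi_exp\<close> with \<open>k = 1 / a\<close>. Written as a sum, the identity
  makes sense in \<open>ennreal\<close> before \<open>lapN q a\<close> is known to be
  finite.\<close>

lemma laplace_identity:
  assumes "0 < q" "0 < a"
  shows "ennreal a * (\<integral>\<^sup>+r\<in>{0..}. ennreal ((rphi (q + a * r) - rphi q) / a * exp (- ((rPhi (q + a * r) - rPhi q) / a))) \<partial>lborel)
    + ennreal (rphi q) * lapN q a = 1"
proof -
  define e where "e w = exp (- ((rPhi (max 0 (q + a * w)) - rPhi q) / a))" for w
  define d where "d w = (rphi (max 0 (q + a * w)) - rphi q) / a" for w
  have [measurable]: "e \<in> borel_measurable borel" "d \<in> borel_measurable borel" 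
    unfolding e_def[abs_def] d_def[abs_def] by measurable
  have eq: "max 0 (q + a * w) = q + a * w" if "0 \<le> w" for w using assms that by (simp add: max_def)
  have d: "0 \<le> d w" if "0 \<le> w" for w
    using assms that by (auto simp: d_def eq intro!: divide_nonneg_pos rphi_mono)
  have A: "(\<integral>\<^sup>+r\<in>{0..}. ennreal ((rphi (q + a * r) - rphi q) / a * exp (- ((rPhi (q + a * r) - rPhi q) / a))) \<partial>lborel)
      = (\<integral>\<^sup>+r. ennreal (d r * e r) * indicator {0..} r \<partial>lborel)"
  proof (rule nn_integral_cong)
    fix r :: real
    show "ennreal ((rphi (q + a * r) - rphi q) / a * exp (- ((rPhi (q + a * r) - rPhi q) / a))) * indicator {0..} r
      = ennreal (d r * e r) * indicator {0..} r"
      by (cases "0 \<le> r") (simp_all add: d_def e_def eq)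
  qed
  have B: "lapN q a = (\<integral>\<^sup>+r. ennreal (e r) * indicator {0..} r \<partial>lborel)"
    unfolding lapN_def
  proof (rule nn_integral_cong)
    fix r :: real
    show "ennreal (exp (- ((rPhi (q + a * r) - rPhi q) / a))) * indicator {0..} r = ennreal (e r) * indicator {0..} r"
      by (cases "0 \<le> r") (simp_all add: e_def eq)
  qed
  have "ennreal a * (\<integral>\<^sup>+r\<in>{0..}. ennreal ((rphi (q + a * r) - rphi q) / a * exp (- ((rPhi (q + a * r) - rPhi q) / a))) \<partial>lborel)
      + ennreal (rphi q) * lapN q a
    = (\<integral>\<^sup>+r. ennreal a * (ennreal (d r * e r) * indicator {0..} r) \<partial>lborel) + (\<integral>\<^sup>+r. ennreal (rphi q) * (ennreal (e r) * indicator {0..} r) \<partial>lborel)"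
    unfolding A B by (simp add: nn_integral_cmult)
  also have "\<dots>
    = (\<integral>\<^sup>+r. ennreal a * (ennreal (d r * e r) * indicator {0..} r) + ennreal (rphi q) * (ennreal (e r) * indicator {0..} r) \<partial>lborel)"
    by (rule nn_integral_add[symmetric]) measurable
  also have "\<dots> = (\<integral>\<^sup>+w. ennreal (rphi (q + a * w) * exp (- ((rPhi (q + a * w) - rPhi q) * (1 / a)))) * indicator {0..} w \<partial>lborel)"
  proof (rule nn_integral_cong)
    fix w :: real
    show "ennreal a * (ennreal (d w * e w) * indicator {0..} w) + ennreal (rphi q) * (ennreal (e w) * indicator {0..} w)
      = ennreal (rphi (q + a * w) * exp (- ((rPhi (q + a * w) - rPhi q) * (1 / a)))) * indicator {0..} w"
    proof (cases "0 \<le> w")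
      case True
      have ew: "0 \<le> e w" by (simp add: e_def)
      have "ennreal a * ennreal (d w * e w) + ennreal (rphi q) * ennreal (e w) = ennreal (a * (d w * e w) + rphi q * e w)"
        using assms d[OF True] ew rphi_nonneg[of q]
        by (simp add: ennreal_mult[symmetric] ennreal_plus[symmetric] del: ennreal_plus)
      also have "a * (d w * e w) + rphi q * e w = rphi (q + a * w) * exp (- ((rPhi (q + a * w) - rPhi q) * (1 / a)))"
        using assms by (simp add: d_def e_def eq[OF True] left_diff_distrib)
      finally show ?thesis using True by simp
    qed simp
  qed
  also have "\<dots> = ennreal (1 / (a * (1 / a)))" using assms by (intro nn_integral_rphi_exp) auto
  finally show ?thesis using assms by simp
qed

text \<open>Instance of \<open>laplace_dens\<close> at \<open>v = rPhi q\<close> and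
  \<open>z0 = q\<close>, with quadratic growth and quadratic decay supplied by the positive drift;
  \<open>1 / rphi q\<close> is the derivative of the inverse of Phi at \<open>v\<close>.\<close>

lemma dens_laplace:
  assumes "0 < c" "0 < q"
  shows "(\<integral>\<^sup>+r. ennreal (exp (- (rPhi q * r)) * dens cPhi r) * indicator {0<..} r \<partial>lborel) = ennreal (1 / rphi q)"
proof -
  define v where "v = rPhi q"
  have v: "0 < v" using rPhi_pos assms by (simp add: v_def)
  obtain R where R: "0 < R" "\<And>s. 0 \<le> Re s \<Longrightarrow> R \<le> norm s \<Longrightarrow> c / 4 * norm s ^ 2 \<le> norm (cPhi s)"
    using norm_cPhi_growth[OF assms(1)] by blast
  \<comment> \<open>Beyond \<open>sqrt (8 * v / c)\<close> the constant \<open>v\<close> is at most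
    \<open>c / 8 * norm s ^ 2\<close>, half of the growth bound, so the constant
    \<open>c / 8\<close> is left for \<open>v - cPhi s\<close>.\<close>
  define R0 where "R0 = max R (sqrt (8 * v / c))"
  interpret H: half_plane_map cPhi cphi v q "c / 8" 2 R0
  proof
    show "(cPhi has_field_derivative cphi s) (at s)" if "0 < Re s" for s by (rule cPhi_derivative_interior[OF that])
    show "continuous_on {s. 0 \<le> Re s} cPhi" by (rule continuous_cPhi)
    show "0 < Re (cphi s)" if "0 < Re s" for s
      using Re_cphi_ge[of s] that mult_pos_pos[OF assms(1) that] by simp
    show "Re (cPhi (\<i> * of_real x)) \<le> 0" for x
      using imag_decay_nonneg[of x] by (simp add: Re_cPhi_imag)
    show "c / 8 * norm s powr 2 \<le> norm (of_real v - cPhi s)" if s: "0 \<le> Re s" "R0 \<le> norm s" for s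
    proof -
      have n: "R \<le> norm s" "sqrt (8 * v / c) \<le> norm s" "0 < norm s" using s R(1) by (auto simp: R0_def)
      have "8 * v / c \<le> norm s ^ 2"
        using n(2) by (rule sqrt_le_D)
      then have "v \<le> c / 8 * norm s ^ 2" using assms(1) by (simp add: field_simps)
      moreover have "c / 4 * norm s ^ 2 \<le> norm (cPhi s)" using R(2) s(1) n(1) by auto
      moreover have "norm (cPhi s) - norm (complex_of_real v) \<le> norm (of_real v - cPhi s)"
        using norm_triangle_ineq2[of "cPhi s" "of_real v"] by (simp add: norm_minus_commute)
      ultimately show ?thesis using v n(3) by simp
    qed
    show "cPhi (of_real q) = of_real v" using assms by (simp add: cPhi_of_real v_def)
  qed (use assms v in auto)
  have [measurable]: "imag_decay \<in> borel_measurable borel"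
    using continuous_imag_decay by (rule borel_measurable_continuous_onI)
  have "integrable lborel (\<lambda>x. 1 / (v + imag_decay x))"
  proof (rule integrable_power_decay[where p = 2 and K = "max (1 / v) (2 / c)"])
    fix x :: real
    have pos: "0 < v + imag_decay x" using v imag_decay_nonneg[of x] by linarith
    have "1 / (v + imag_decay x) \<le> 1 / v" by (rule frac_le) (use v imag_decay_nonneg[of x] in auto)
    then show "norm (1 / (v + imag_decay x)) \<le> max (1 / v) (2 / c)" using pos by simp
    show "norm (1 / (v + imag_decay x)) \<le> max (1 / v) (2 / c) * \<bar>x\<bar> powr - 2" if "1 \<le> \<bar>x\<bar>"
    proof -
      have "0 < c / 2 * x^2" using assms that by auto
      moreover have "c / 2 * x^2 \<le> v + imag_decay x" using imag_decay_ge[of x] v by linarith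
      ultimately have "1 / (v + imag_decay x) \<le> 1 / (c / 2 * x^2)" by (intro frac_le) auto
      also have "1 / (c / 2 * x^2) = (2 / c) * (1 / x^2)" by simp
      also have "(2 / c) * (1 / x^2) = (2 / c) * \<bar>x\<bar> powr - 2"
        using that by (subst powr_minus_divide, subst powr_numeral) auto
      also have "\<dots> \<le> max (1 / v) (2 / c) * \<bar>x\<bar> powr - 2" by (intro mult_right_mono) auto
      finally show ?thesis using pos by simp
    qed
  qed auto
  then have int: "integrable lborel (\<lambda>x. 1 / (v - Re (cPhi (\<i> * of_real x))))" by (simp add: Re_cPhi_imag)
  have "(\<integral>\<^sup>+r. ennreal (exp (- (rPhi q * r)) * dens cPhi r) * indicator {0<..} r \<partial>lborel)
     = (\<integral>\<^sup>+r. ennreal (indicator {0<..} r *\<^sub>R (exp (- v * r) * dens cPhi r)) \<partial>lborel)"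
    by (intro nn_integral_cong) (auto simp: indicator_def v_def)
  also have "\<dots> = ennreal (LINT r:{0<..}|lborel. exp (- v * r) * dens cPhi r)"
    unfolding set_lebesgue_integral_def
  proof (rule nn_integral_eq_integral)
    show "integrable lborel (\<lambda>r. indicator {0<..} r *\<^sub>R (exp (- v * r) * dens cPhi r))"
      using H.laplace_dens(1)[OF int] unfolding set_integrable_def .
    show "AE r in lborel. 0 \<le> indicator {0<..} r *\<^sub>R (exp (- v * r) * dens cPhi r)"
      using dens_nonneg[OF assms(1)] by (intro AE_I2) (simp add: indicator_def)
  qed
  also have "\<dots> = ennreal (1 / rphi q)"
  proof -
    have "1 / cphi (of_real q) = complex_of_real (1 / rphi q)" using assms by (simp add: cphi_of_real)
    then show ?thesis using H.laplace_dens(2)[OF int] by (simp only: Re_complex_of_real)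
  qed
  finally show ?thesis .
qed

lemma dens_measurable[measurable]: "dens cPhi \<in> borel_measurable borel"
proof -
  have [measurable]: "(\<lambda>x. cPhi (\<i> * complex_of_real x)) \<in> borel_measurable borel"
    using continuous_cPhi_imag by (rule borel_measurable_continuous_onI)
  show ?thesis unfolding dens_def[abs_def] by measurable
qed

text \<open>For \<open>c > 0\<close> this is \<open>E[exp (- q \<xi>\<^bsub>\<rho>(t)\<^esub>)]\<close>; for \<open>c = 0\<close> the density need not exist for small \<open>r\<close>, whence the
  regularisation \<open>c + 2 \<epsilon>\<close> below.\<close>
definition Fe :: "real \<Rightarrow> real \<Rightarrow> ennreal" where
  "Fe q t = ennreal (rphi q) * (\<integral>\<^sup>+r. ennreal (exp (- (rPhi q * r) - t / r) * dens cPhi r) * indicator {0<..} r \<partial>lborel)"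

lemma nn_integral_exp_Ici:
  assumes "0 < (b::real)"
  shows "(\<integral>\<^sup>+t. ennreal (exp (- b * t)) * indicator {0..} t \<partial>lborel) = ennreal (1 / b)"
proof -
  have "(\<integral>\<^sup>+t. ennreal (exp (- b * t)) * indicator {0..} t \<partial>lborel) = ennreal (0 - (- exp (- b * 0) / b))"
  proof (rule nn_integral_FTC_atLeast)
    have "((\<lambda>t. exp (- b * t)) \<longlongrightarrow> 0) at_top" using assms by real_asymp
    from tendsto_divide[OF tendsto_minus[OF this] tendsto_const, of b] assms
    show "((\<lambda>t. - exp (- b * t) / b) \<longlongrightarrow> 0) at_top" by simp
    show "((\<lambda>t. - exp (- b * t) / b) has_real_derivative exp (- b * t)) (at t)" for t
      using assms by (auto intro!: derivative_eq_intros)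
  qed auto
  then show ?thesis by simp
qed

text \<open>Puts the mixture into the form of \<open>laplace_identity\<close>. The integral in
  \<open>t\<close> turns exp(-t/r) into 1/(a + 1/r), \<open>lapN\<close> becomes the mixture of 1/(1
  + a r), and a/(a + 1/r) + 1/(1 + a r) = 1.\<close>

lemma laplace_Fe:
  assumes "0 < c" "0 < q" "0 < a"
  shows "ennreal a * (\<integral>\<^sup>+t. ennreal (exp (- a * t)) * Fe q t * indicator {0..} t \<partial>lborel) + ennreal (rphi q) * lapN q a = 1"
proof -
  define p where "p r = dens cPhi r" for r
  have [measurable]: "p \<in> borel_measurable borel" unfolding p_def[abs_def] by measurable
  have p0: "0 \<le> p r" if "0 < r" for r using dens_nonneg[OF assms(1) that] by (simp add: p_def)
  define m where "m r = ennreal (exp (- (rPhi q * r)) * p r) * indicator {0<..} r" for r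
  have [measurable]: "m \<in> borel_measurable borel" unfolding m_def[abs_def] by measurable
  have phq: "0 < rphi q" using assms rphi_pos by simp
  have "(\<integral>\<^sup>+t. ennreal (exp (- a * t)) * Fe q t * indicator {0..} t \<partial>lborel)
    = (\<integral>\<^sup>+t. (\<integral>\<^sup>+r. ennreal (rphi q) * (m r * (ennreal (exp (- (a + 1 / r) * t)) * indicator {0..} t)) \<partial>lborel) \<partial>lborel)"
  proof (rule nn_integral_cong)
    fix t :: real
    have "ennreal (exp (- a * t)) * Fe q t * indicator {0..} t = ennreal (rphi q) * (ennreal (exp (- a * t)) * indicator {0..} t) *
       (\<integral>\<^sup>+r. ennreal (exp (- (rPhi q * r) - t / r) * p r) * indicator {0<..} r \<partial>lborel)"
      by (simp add: Fe_def p_def mult_ac)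
    also have "\<dots> = (\<integral>\<^sup>+r. ennreal (rphi q) * (ennreal (exp (- a * t)) * indicator {0..} t) *
       (ennreal (exp (- (rPhi q * r) - t / r) * p r) * indicator {0<..} r) \<partial>lborel)"
      by (rule nn_integral_cmult[symmetric]) measurable
    also have "\<dots> = (\<integral>\<^sup>+r. ennreal (rphi q) * (m r * (ennreal (exp (- (a + 1 / r) * t)) * indicator {0..} t)) \<partial>lborel)"
    proof (rule nn_integral_cong)
      fix r :: real
      show "ennreal (rphi q) * (ennreal (exp (- a * t)) * indicator {0..} t) * (ennreal (exp (- (rPhi q * r) - t / r) * p r) * indicator {0<..} r)
        = ennreal (rphi q) * (m r * (ennreal (exp (- (a + 1 / r) * t)) * indicator {0..} t))"
      proof (cases "0 < r")
        case True
        have "exp (- a * t) * (exp (- (rPhi q * r) - t / r) * p r) = exp (- (rPhi q * r)) * p r * exp (- (a + 1 / r) * t)"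
        proof -
          have "exp (- a * t) * exp (- (rPhi q * r) - t / r) = exp (- (rPhi q * r)) * exp (- (a + 1 / r) * t)"
            unfolding exp_add[symmetric] by (rule arg_cong[where f = exp]) (simp add: algebra_simps)
          then show ?thesis by (simp only: mult.assoc[symmetric]) (simp only: mult_ac)
        qed
        then have "ennreal (exp (- a * t)) * ennreal (exp (- (rPhi q * r) - t / r) * p r) = ennreal (exp (- (rPhi q * r)) * p r) * ennreal (exp (- (a + 1 / r) * t))"
          using p0[OF True] by (simp add: ennreal_mult[symmetric])
        then show ?thesis using True by (simp add: m_def mult_ac indicator_def)
      qed (simp add: m_def)
    qed
    finally show "ennreal (exp (- a * t)) * Fe q t * indicator {0..} t = (\<integral>\<^sup>+r. ennreal (rphi q) * (m r * (ennreal (exp (- (a + 1 / r) * t)) * indicator {0..} t)) \<partial>lborel)" .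
  qed
  also have "\<dots> = (\<integral>\<^sup>+r. (\<integral>\<^sup>+t. ennreal (rphi q) * (m r * (ennreal (exp (- (a + 1 / r) * t)) * indicator {0..} t)) \<partial>lborel) \<partial>lborel)"
    by (rule lborel_pair.Fubini') measurable
  also have "\<dots> = (\<integral>\<^sup>+r. ennreal (rphi q) * (m r * ennreal (1 / (a + 1 / r))) \<partial>lborel)"
  proof (rule nn_integral_cong)
    fix r :: real
    show "(\<integral>\<^sup>+t. ennreal (rphi q) * (m r * (ennreal (exp (- (a + 1 / r) * t)) * indicator {0..} t)) \<partial>lborel) = ennreal (rphi q) * (m r * ennreal (1 / (a + 1 / r)))"
    proof (cases "0 < r")
      case True
      then have "0 < a + 1 / r" using assms by (simp add: add_pos_pos)
      from nn_integral_exp_Ici[OF this] show ?thesis by (simp add: nn_integral_cmult)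
    qed (simp add: m_def)
  qed
  finally have 1: "(\<integral>\<^sup>+t. ennreal (exp (- a * t)) * Fe q t * indicator {0..} t \<partial>lborel) = (\<integral>\<^sup>+r. ennreal (rphi q) * (m r * ennreal (1 / (a + 1 / r))) \<partial>lborel)" .
  \<comment> \<open>Inserts the factor 1, written as \<open>rphi s\<close> times the Laplace
    transform of the density at \<open>rPhi s\<close> with \<open>s = q + a * w\<close>; the
    integral over \<open>w\<close> can then be done exactly for each \<open>r\<close>.\<close>
  have "lapN q a = (\<integral>\<^sup>+w. (\<integral>\<^sup>+r. m r * (ennreal (rphi (max 0 (q + a * w)) * exp (- ((rPhi (max 0 (q + a * w)) - rPhi q) * (1 / a + r)))) * indicator {0..} w) \<partial>lborel) \<partial>lborel)"
    unfolding lapN_def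
  proof (rule nn_integral_cong)
    fix w :: real
    show "ennreal (exp (- ((rPhi (q + a * w) - rPhi q) / a))) * indicator {0..} w
      = (\<integral>\<^sup>+r. m r * (ennreal (rphi (max 0 (q + a * w)) * exp (- ((rPhi (max 0 (q + a * w)) - rPhi q) * (1 / a + r)))) * indicator {0..} w) \<partial>lborel)"
    proof (cases "0 \<le> w")
      case True
      define s where "s = q + a * w"
      have s: "0 < s" "max 0 s = s" using assms True by (auto simp: s_def add_pos_nonneg)
      define E where "E = exp (- ((rPhi s - rPhi q) / a))"
      have "(\<integral>\<^sup>+r. m r * (ennreal (rphi s * exp (- ((rPhi s - rPhi q) * (1 / a + r)))) * indicator {0..} w) \<partial>lborel)
        = (\<integral>\<^sup>+r. ennreal (rphi s * E) * (ennreal (exp (- (rPhi s * r)) * dens cPhi r) * indicator {0<..} r) \<partial>lborel)"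
      proof (rule nn_integral_cong)
        fix r :: real
        show "m r * (ennreal (rphi s * exp (- ((rPhi s - rPhi q) * (1 / a + r)))) * indicator {0..} w) = ennreal (rphi s * E) * (ennreal (exp (- (rPhi s * r)) * dens cPhi r) * indicator {0<..} r)"
        proof (cases "0 < r")
          case r: True
          have *: "exp (- (rPhi q * r)) * exp (- ((rPhi s - rPhi q) * (1 / a + r))) = E * exp (- (rPhi s * r))"
            unfolding E_def exp_add[symmetric] by (rule arg_cong[where f = exp]) (simp add: algebra_simps diff_divide_distrib)
          have "(exp (- (rPhi q * r)) * p r) * (rphi s * exp (- ((rPhi s - rPhi q) * (1 / a + r)))) = (rphi s * E) * (exp (- (rPhi s * r)) * p r)"
          proof -
            have "(exp (- (rPhi q * r)) * p r) * (rphi s * exp (- ((rPhi s - rPhi q) * (1 / a + r))))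
              = (exp (- (rPhi q * r)) * exp (- ((rPhi s - rPhi q) * (1 / a + r)))) * (p r * rphi s)"
              by (simp only: mult_ac)
            then show ?thesis unfolding * by (simp only: mult_ac)
          qed
          then have "ennreal (exp (- (rPhi q * r)) * p r) * ennreal (rphi s * exp (- ((rPhi s - rPhi q) * (1 / a + r)))) = ennreal (rphi s * E) * ennreal (exp (- (rPhi s * r)) * p r)"
            using p0[OF r] rphi_pos[OF s(1)] by (subst (1 2) ennreal_mult[symmetric]) (auto simp: E_def)
          then show ?thesis using r True by (simp add: m_def p_def)
        qed (simp add: m_def)
      qed
      also have "\<dots> = ennreal (rphi s * E) * ennreal (1 / rphi s)"
        unfolding dens_laplace[OF assms(1) s(1), symmetric] by (rule nn_integral_cmult) measurable
      also have "\<dots> = ennreal E" using rphi_pos[OF s(1)] by (subst ennreal_mult[symmetric]) (auto simp: E_def)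
      finally show ?thesis using True s(2) by (simp add: s_def E_def)
    qed simp
  qed
  also have "\<dots> = (\<integral>\<^sup>+r. (\<integral>\<^sup>+w. m r * (ennreal (rphi (max 0 (q + a * w)) * exp (- ((rPhi (max 0 (q + a * w)) - rPhi q) * (1 / a + r)))) * indicator {0..} w) \<partial>lborel) \<partial>lborel)"
    by (rule lborel_pair.Fubini') measurable
  also have "\<dots> = (\<integral>\<^sup>+r. m r * ennreal (1 / (a * (1 / a + r))) \<partial>lborel)"
  proof (rule nn_integral_cong)
    fix r :: real
    show "(\<integral>\<^sup>+w. m r * (ennreal (rphi (max 0 (q + a * w)) * exp (- ((rPhi (max 0 (q + a * w)) - rPhi q) * (1 / a + r)))) * indicator {0..} w) \<partial>lborel) = m r * ennreal (1 / (a * (1 / a + r)))"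
    proof (cases "0 < r")
      case True
      then have k: "0 < 1 / a + r" using assms by (simp add: add_pos_pos)
      have "(\<integral>\<^sup>+w. m r * (ennreal (rphi (max 0 (q + a * w)) * exp (- ((rPhi (max 0 (q + a * w)) - rPhi q) * (1 / a + r)))) * indicator {0..} w) \<partial>lborel)
        = m r * (\<integral>\<^sup>+w. (ennreal (rphi (max 0 (q + a * w)) * exp (- ((rPhi (max 0 (q + a * w)) - rPhi q) * (1 / a + r)))) * indicator {0..} w) \<partial>lborel)"
        by (rule nn_integral_cmult) measurable
      also have "(\<integral>\<^sup>+w. (ennreal (rphi (max 0 (q + a * w)) * exp (- ((rPhi (max 0 (q + a * w)) - rPhi q) * (1 / a + r)))) * indicator {0..} w) \<partial>lborel)
        = (\<integral>\<^sup>+w. (ennreal (rphi (q + a * w) * exp (- ((rPhi (q + a * w) - rPhi q) * (1 / a + r)))) * indicator {0..} w) \<partial>lborel)"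
        using assms by (intro nn_integral_cong) (auto simp: indicator_def max_def add_nonneg_nonneg)
      also have "\<dots> = ennreal (1 / (a * (1 / a + r)))" by (rule nn_integral_rphi_exp[OF assms(2,3) k])
      finally show ?thesis .
    qed (simp add: m_def)
  qed
  finally have 2: "lapN q a = (\<integral>\<^sup>+r. m r * ennreal (1 / (a * (1 / a + r))) \<partial>lborel)" .
  have "ennreal a * (\<integral>\<^sup>+t. ennreal (exp (- a * t)) * Fe q t * indicator {0..} t \<partial>lborel) + ennreal (rphi q) * lapN q a
    = (\<integral>\<^sup>+r. ennreal a * (ennreal (rphi q) * (m r * ennreal (1 / (a + 1 / r)))) + ennreal (rphi q) * (m r * ennreal (1 / (a * (1 / a + r)))) \<partial>lborel)"
    unfolding 1 2 by (simp add: nn_integral_add nn_integral_cmult)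
  also have "\<dots> = (\<integral>\<^sup>+r. ennreal (rphi q) * m r \<partial>lborel)"
  proof (rule nn_integral_cong)
    fix r :: real
    show "ennreal a * (ennreal (rphi q) * (m r * ennreal (1 / (a + 1 / r)))) + ennreal (rphi q) * (m r * ennreal (1 / (a * (1 / a + r)))) = ennreal (rphi q) * m r"
    proof (cases "0 < r")
      case True
      then have pos: "0 < a + 1 / r" "0 < a * (1 / a + r)" using assms by (simp_all add: add_pos_pos)
      have "a * (1 / (a + 1 / r)) + 1 / (a * (1 / a + r)) = 1"
      proof -
        define u where "u = 1 + a * r"
        have u: "0 < u" using True assms by (simp add: u_def add_pos_pos)
        have e1: "a + 1 / r = u / r" and e2: "a * (1 / a + r) = u"
          using True assms by (simp_all add: u_def field_simps)
        have "a * (1 / (a + 1 / r)) + 1 / (a * (1 / a + r)) = (a * r + 1) / u"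
          unfolding e1 e2 by (simp add: add_divide_distrib)
        then show ?thesis using u by (simp add: u_def add.commute)
      qed
      then have "ennreal a * ennreal (1 / (a + 1 / r)) + ennreal (1 / (a * (1 / a + r))) = 1"
        using assms pos by (simp add: ennreal_mult[symmetric] ennreal_plus[symmetric] del: ennreal_plus)
      then have "ennreal (rphi q) * m r * (ennreal a * ennreal (1 / (a + 1 / r)) + ennreal (1 / (a * (1 / a + r)))) = ennreal (rphi q) * m r" by simp
      then show ?thesis by (simp add: distrib_left mult_ac)
    qed (simp add: m_def)
  qed
  also have "\<dots> = ennreal (rphi q) * ennreal (1 / rphi q)"
    unfolding dens_laplace[OF assms(1,2), symmetric] m_def p_def by (rule nn_integral_cmult) measurable
  also have "\<dots> = 1" using phq by (simp add: ennreal_mult[symmetric])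
  finally show ?thesis .
qed

end

text \<open>With x = exp(-t) the hypothesis says that integrals of monomials in x against exp(-t) u
  dt vanish in the limit, and polynomials are dense in C[0,1]. The extra factor exp(-t) makes the
  approximation error uniform in \<open>n\<close> and shifts the degree \<open>i\<close> to the
  transform parameter \<open>Suc i\<close>, which is never 0.\<close>

lemma laplace_weierstrass:
  fixes u :: "nat \<Rightarrow> real \<Rightarrow> real" and g :: "real \<Rightarrow> real"
  assumes u[measurable]: "\<And>n. u n \<in> borel_measurable borel" and b: "\<And>n t. 0 \<le> t \<Longrightarrow> \<bar>u n t\<bar> \<le> 1"
    and lap: "\<And>k::nat. 0 < k \<Longrightarrow> (\<lambda>n. LINT t:{0..}|lborel. exp (- (real k * t)) * u n t) \<longlonglongrightarrow> 0"
    and g: "continuous_on {0..1} g" and gm[measurable]: "g \<in> borel_measurable borel"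
  shows "(\<lambda>n. LINT t:{0..}|lborel. g (exp (- t)) * exp (- t) * u n t) \<longlonglongrightarrow> 0"
proof (rule LIMSEQ_I)
  fix \<delta> :: real assume \<delta>: "0 < \<delta>"
  obtain P where P: "real_polynomial_function P" "\<And>x. x \<in> {0..1} \<Longrightarrow> \<bar>g x - P x\<bar> < \<delta> / 2"
    using Stone_Weierstrass_real_polynomial_function[of "{0..1::real}" g "\<delta> / 2"] g \<delta> by auto
  obtain a N where aN: "P = (\<lambda>x. \<Sum>i\<le>N. a i * x ^ i)" using P(1) by (auto simp: real_polynomial_function_iff_sum)
  have exp_int: "set_integrable lborel {0..} (\<lambda>t. exp (- (1 * t)) :: real)" and exp_val: "(LINT t:{0..}|lborel. exp (- (1 * t)) :: real) = 1"
  proof -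
    have "((\<lambda>t::real. exp (- 1 * t)) has_integral exp (- 1 * 0) / 1) {0..}"
      by (rule has_integral_exp_minus_to_infinity) simp
    then have h: "((\<lambda>t::real. exp (- (1 * t))) has_integral 1) {0..}" by simp
    then have "set_integrable lebesgue {0..} (\<lambda>t::real. exp (- (1 * t)))"
      by (intro nonnegative_absolutely_integrable_1) (auto simp: has_integral_integrable)
    then show 1: "set_integrable lborel {0..} (\<lambda>t. exp (- (1 * t)) :: real)"
      unfolding set_integrable_def by (subst (asm) integrable_completion) auto
    show "(LINT t:{0..}|lborel. exp (- (1 * t)) :: real) = 1"
      using set_borel_integral_eq_integral(2)[OF 1] h by (simp add: integral_unique)
  qed
  have int: "set_integrable lborel {0..} (\<lambda>t. k t * exp (- t) * u n t)"
    if [measurable]: "k \<in> borel_measurable borel" and "\<And>t. 0 \<le> t \<Longrightarrow> \<bar>k t\<bar> \<le> K" for k K n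
    unfolding set_integrable_def
  proof (rule Bochner_Integration.integrable_bound)
    show "integrable lborel (\<lambda>t. K * (indicator {0..} t *\<^sub>R exp (- (1 * t))))"
      using exp_int unfolding set_integrable_def by (rule integrable_mult_right)
    show "AE t in lborel. norm (indicator {0..} t *\<^sub>R (k t * exp (- t) * u n t)) \<le> norm (K * (indicator {0..} t *\<^sub>R exp (- (1 * t))))"
    proof (rule AE_I2)
      fix t :: real
      show "norm (indicator {0..} t *\<^sub>R (k t * exp (- t) * u n t)) \<le> norm (K * (indicator {0..} t *\<^sub>R exp (- (1 * t))))"
      proof (cases "0 \<le> t")
        case True
        have "0 \<le> K" using that(2)[OF True] by linarith
        have "\<bar>k t\<bar> * \<bar>u n t\<bar> \<le> K * 1" using that(2)[OF True] b[OF True] by (intro mult_mono) auto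
        then have "\<bar>k t\<bar> * \<bar>u n t\<bar> * exp (- t) \<le> K * exp (- t)" by (intro mult_right_mono) auto
        then show ?thesis using True \<open>0 \<le> K\<close> by (simp add: abs_mult mult_ac)
      qed simp
    qed
  qed measurable
  have e01: "0 \<le> exp (- t)" "exp (- t) \<le> 1" if "0 \<le> t" for t :: real using that by auto
  have Pm[measurable]: "P \<in> borel_measurable borel" unfolding aN by measurable
  have split: "(LINT t:{0..}|lborel. g (exp (- t)) * exp (- t) * u n t)
     = (LINT t:{0..}|lborel. (g (exp (- t)) - P (exp (- t))) * exp (- t) * u n t) + (\<Sum>i\<le>N. a i * (LINT t:{0..}|lborel. exp (- (real (Suc i) * t)) * u n t))" for n
  proof -
    have i1: "set_integrable lborel {0..} (\<lambda>t. (g (exp (- t)) - P (exp (- t))) * exp (- t) * u n t)"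
      using P(2) e01 by (intro int[where K = "\<delta> / 2"]) (auto simp: less_imp_le)
    have i2: "set_integrable lborel {0..} (\<lambda>t. a i * (exp (- (real (Suc i) * t)) * u n t))" for i
    proof -
      have "set_integrable lborel {0..} (\<lambda>t. exp (- (real i * t)) * exp (- t) * u n t)"
        by (intro int[where K = 1]) auto
      also have "(\<lambda>t. exp (- (real i * t)) * exp (- t) * u n t) = (\<lambda>t. exp (- (real (Suc i) * t)) * u n t)"
        by (simp add: exp_add[symmetric] algebra_simps)
      finally show ?thesis by (rule set_integrable_mult_right) 
    qed
    have i3: "set_integrable lborel {0..} (\<lambda>t. \<Sum>i\<le>N. a i * (exp (- (real (Suc i) * t)) * u n t))"
      using i2 unfolding set_integrable_def scaleR_sum_right by (intro Bochner_Integration.integrable_sum) auto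
    have "(LINT t:{0..}|lborel. g (exp (- t)) * exp (- t) * u n t)
      = (LINT t:{0..}|lborel. (g (exp (- t)) - P (exp (- t))) * exp (- t) * u n t + (\<Sum>i\<le>N. a i * (exp (- (real (Suc i) * t)) * u n t)))"
    proof (rule set_lebesgue_integral_cong, simp, intro allI impI)
      fix t :: real
      have "P (exp (- t)) * exp (- t) * u n t = (\<Sum>i\<le>N. a i * (exp (- (real (Suc i) * t)) * u n t))"
        unfolding aN sum_distrib_right
      proof (rule sum.cong[OF refl])
        fix i
        have "exp (- t) ^ i * exp (- t) = exp (- t) ^ Suc i" by simp
        also have "\<dots> = exp (- (real (Suc i) * t))" by (subst exp_of_nat_mult[symmetric]) simp
        finally show "a i * exp (- t) ^ i * exp (- t) * u n t = a i * (exp (- (real (Suc i) * t)) * u n t)"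
          by (simp only: mult.assoc[symmetric]) (simp only: mult.assoc)
      qed
      then show "g (exp (- t)) * exp (- t) * u n t = (g (exp (- t)) - P (exp (- t))) * exp (- t) * u n t + (\<Sum>i\<le>N. a i * (exp (- (real (Suc i) * t)) * u n t))"
        by (simp only: left_diff_distrib)
    qed
    also have "\<dots> = (LINT t:{0..}|lborel. (g (exp (- t)) - P (exp (- t))) * exp (- t) * u n t) + (LINT t:{0..}|lborel. \<Sum>i\<le>N. a i * (exp (- (real (Suc i) * t)) * u n t))"
      by (rule set_integral_add(2)[OF i1 i3])
    also have "(LINT t:{0..}|lborel. \<Sum>i\<le>N. a i * (exp (- (real (Suc i) * t)) * u n t)) = (\<Sum>i\<le>N. LINT t:{0..}|lborel. a i * (exp (- (real (Suc i) * t)) * u n t))"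
      using i2 unfolding set_integrable_def set_lebesgue_integral_def scaleR_sum_right
      by (intro Bochner_Integration.integral_sum) auto
    finally show ?thesis by simp
  qed
  have small: "norm (LINT t:{0..}|lborel. (g (exp (- t)) - P (exp (- t))) * exp (- t) * u n t) \<le> \<delta> / 2" for n
  proof -
    have "norm (LINT t:{0..}|lborel. (g (exp (- t)) - P (exp (- t))) * exp (- t) * u n t) \<le> (\<integral>t. \<delta> / 2 * (indicator {0..} t *\<^sub>R exp (- (1 * t))) \<partial>lborel)"
      unfolding set_lebesgue_integral_def
    proof (rule order_trans[OF integral_norm_bound], rule integral_mono)
      show "integrable lborel (\<lambda>t. norm (indicator {0..} t *\<^sub>R ((g (exp (- t)) - P (exp (- t))) * exp (- t) * u n t)))"
        using int[of "\<lambda>t. g (exp (- t)) - P (exp (- t))" "\<delta> / 2" n] P(2) e01 unfolding set_integrable_def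
        by (intro integrable_norm) (auto simp: less_imp_le)
      show "integrable lborel (\<lambda>t. \<delta> / 2 * (indicator {0..} t *\<^sub>R exp (- (1 * t))))"
        using exp_int unfolding set_integrable_def by (rule integrable_mult_right)
      fix t :: real
      show "norm (indicator {0..} t *\<^sub>R ((g (exp (- t)) - P (exp (- t))) * exp (- t) * u n t)) \<le> \<delta> / 2 * (indicator {0..} t *\<^sub>R exp (- (1 * t)))"
      proof (cases "0 \<le> t")
        case True
        have "\<bar>g (exp (- t)) - P (exp (- t))\<bar> * \<bar>u n t\<bar> \<le> \<delta> / 2 * 1"
          using P(2)[of "exp (- t)"] e01[OF True] b[OF True] \<delta> by (intro mult_mono) auto
        then have "\<bar>g (exp (- t)) - P (exp (- t))\<bar> * \<bar>u n t\<bar> * exp (- t) \<le> \<delta> / 2 * exp (- t)" by (intro mult_right_mono) auto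
        then show ?thesis using True by (simp add: abs_mult mult_ac)
      qed simp
    qed
    also have "\<dots> = \<delta> / 2" using exp_val unfolding set_lebesgue_integral_def integral_mult_right_zero by simp
    finally show ?thesis .
  qed
  have "(\<lambda>n. \<Sum>i\<le>N. a i * (LINT t:{0..}|lborel. exp (- (real (Suc i) * t)) * u n t)) \<longlonglongrightarrow> (\<Sum>i\<le>N. a i * 0)"
    by (intro tendsto_sum tendsto_mult_left lap) simp
  then have "(\<lambda>n. \<Sum>i\<le>N. a i * (LINT t:{0..}|lborel. exp (- (real (Suc i) * t)) * u n t)) \<longlonglongrightarrow> 0" by simp
  from LIMSEQ_D[OF this, of "\<delta> / 2"] \<delta>
  obtain n0 where n0: "\<And>n. n0 \<le> n \<Longrightarrow> norm (\<Sum>i\<le>N. a i * (LINT t:{0..}|lborel. exp (- (real (Suc i) * t)) * u n t)) < \<delta> / 2"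
    by auto
  show "\<exists>no. \<forall>n\<ge>no. norm ((LINT t:{0..}|lborel. g (exp (- t)) * exp (- t) * u n t) - 0) < \<delta>"
  proof (intro exI allI impI)
    fix n assume "n0 \<le> n"
    have "norm (LINT t:{0..}|lborel. g (exp (- t)) * exp (- t) * u n t) \<le> \<delta> / 2 + norm (\<Sum>i\<le>N. a i * (LINT t:{0..}|lborel. exp (- (real (Suc i) * t)) * u n t))"
      unfolding split by (rule order_trans[OF norm_triangle_ineq]) (use small in simp)
    also have "\<dots> < \<delta>" using n0[OF \<open>n0 \<le> n\<close>] by linarith
    finally show "norm ((LINT t:{0..}|lborel. g (exp (- t)) * exp (- t) * u n t) - 0) < \<delta>" by simp
  qed
qed

section \<open>Regularisation by a small drift, uniformly for r >= a0\<close>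

locale levy_decay = levy_data +
  fixes a0 :: real
  assumes a0_pos: "0 < a0" and int_decay: "integrable lborel (\<lambda>x. exp (- (a0 * imag_decay x)))"
begin

text \<open>Raising the drift of phi by \<open>2 * e\<close> adds \<open>e * s^2\<close> to Phi,
  hence \<open>- e * x^2\<close> to its real part at \<open>\<i> * x\<close>: only extra
  decay.\<close>

abbreviation Phi_shift :: "real \<Rightarrow> complex \<Rightarrow> complex" where "Phi_shift e \<equiv> levy_data.cPhi (c + 2 * e) \<pi>"

lemma levy_data_shift: "0 \<le> e \<Longrightarrow> levy_data (c + 2 * e) \<pi>"
  using c_nonneg sets_pi null_pi min_pi pos_pi by unfold_locales auto

lemma Phi_shift: "0 \<le> e \<Longrightarrow> Phi_shift e s = cPhi s + of_real e * s^2"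
  using levy_data.cPhi_def[OF levy_data_shift] by (simp add: cPhi_def add_divide_distrib distrib_right)

lemma rPhi_shift: "0 \<le> e \<Longrightarrow> levy_data.rPhi (c + 2 * e) \<pi> s = rPhi s + e * s^2"
  using levy_data.rPhi_def[OF levy_data_shift] by (simp add: rPhi_def Phi_shift power2_eq_square)

lemma rphi_shift: "0 \<le> e \<Longrightarrow> levy_data.rphi (c + 2 * e) \<pi> s = rphi s + 2 * e * s"
  using levy_data.rphi_def[OF levy_data_shift] by (simp add: rphi_def algebra_simps)

lemma measurable_cPhi_imag[measurable]: "(\<lambda>x. cPhi (\<i> * complex_of_real x)) \<in> borel_measurable borel"
  using continuous_cPhi_imag by (rule borel_measurable_continuous_onI)

lemma norm_exp_shift:
  assumes "0 \<le> e" "a0 \<le> r"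
  shows "norm (exp (of_real r * Phi_shift e (\<i> * of_real x))) \<le> exp (- (a0 * imag_decay x))"
proof -
  have "0 \<le> r * (e * x^2)" using assms a0_pos by (intro mult_nonneg_nonneg) auto
  moreover have "a0 * imag_decay x \<le> r * imag_decay x" using assms imag_decay_nonneg by (intro mult_right_mono) auto
  moreover have "Re (of_real r * Phi_shift e (\<i> * of_real x)) = - (r * imag_decay x) - r * (e * x^2)"
    unfolding Phi_shift[OF assms(1)] by (simp add: Re_cPhi_imag power_mult_distrib right_diff_distrib)
  ultimately show ?thesis unfolding norm_exp_eq_Re by simp
qed

definition dens_bd :: real where "dens_bd = (\<integral>x. exp (- (a0 * imag_decay x)) \<partial>lborel) / (2 * pi)"

lemma dens_bound:
  assumes "0 \<le> e" "a0 \<le> r"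
  shows "\<bar>dens (Phi_shift e) r\<bar> \<le> dens_bd"
proof -
  have [measurable]: "(\<lambda>x. Phi_shift e (\<i> * complex_of_real x)) \<in> borel_measurable borel"
    unfolding Phi_shift[OF assms(1)] by measurable
  have "\<bar>Re (\<integral>x. exp (of_real r * Phi_shift e (\<i> * of_real x)) \<partial>lborel)\<bar> \<le> norm (\<integral>x. exp (of_real r * Phi_shift e (\<i> * of_real x)) \<partial>lborel)"
    by (rule abs_Re_le_cmod)
  also have "\<dots> \<le> (\<integral>x. norm (exp (of_real r * Phi_shift e (\<i> * of_real x))) \<partial>lborel)"
    by (rule integral_norm_bound)
  also have "\<dots> \<le> (\<integral>x. exp (- (a0 * imag_decay x)) \<partial>lborel)"
  proof (rule integral_mono)
    show "integrable lborel (\<lambda>x. norm (exp (of_real r * Phi_shift e (\<i> * of_real x))))"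
      by (rule Bochner_Integration.integrable_bound[OF int_decay]) (use norm_exp_shift[OF assms] in auto)
  qed (use int_decay norm_exp_shift[OF assms] in auto)
  finally show ?thesis by (simp add: dens_def dens_bd_def divide_right_mono)
qed

lemma dens_shift_tendsto:
  assumes e: "e \<longlonglongrightarrow> 0" "\<And>n. 0 \<le> e n" and r: "a0 \<le> r"
  shows "(\<lambda>n. dens (Phi_shift (e n)) r) \<longlonglongrightarrow> dens cPhi r"
proof -
  have [measurable]: "(\<lambda>x. Phi_shift (e n) (\<i> * complex_of_real x)) \<in> borel_measurable borel" for n
    unfolding Phi_shift[OF e(2)] by measurable
  have "(\<lambda>n. \<integral>x. exp (of_real r * Phi_shift (e n) (\<i> * of_real x)) \<partial>lborel) \<longlonglongrightarrow> (\<integral>x. exp (of_real r * cPhi (\<i> * of_real x)) \<partial>lborel)"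
  proof (rule integral_dominated_convergence[OF _ _ int_decay])
    show "AE x in lborel. (\<lambda>n. exp (of_real r * Phi_shift (e n) (\<i> * of_real x))) \<longlonglongrightarrow> exp (of_real r * cPhi (\<i> * of_real x))"
    proof (rule AE_I2)
      fix x :: real
      have "(\<lambda>n. cPhi (\<i> * of_real x) + of_real (e n) * (\<i> * of_real x)^2) \<longlonglongrightarrow> cPhi (\<i> * of_real x) + of_real 0 * (\<i> * of_real x)^2"
        by (intro tendsto_add tendsto_const tendsto_mult_right tendsto_of_real e)
      then have "(\<lambda>n. Phi_shift (e n) (\<i> * of_real x)) \<longlonglongrightarrow> cPhi (\<i> * of_real x)"
        by (simp add: Phi_shift[OF e(2)])
      then show "(\<lambda>n. exp (of_real r * Phi_shift (e n) (\<i> * of_real x))) \<longlonglongrightarrow> exp (of_real r * cPhi (\<i> * of_real x))"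
        by (intro tendsto_exp tendsto_mult_left)
    qed
  qed (use norm_exp_shift[OF e(2) r] in auto)
  then show ?thesis unfolding dens_def by (intro tendsto_divide tendsto_Re tendsto_const) auto
qed

text \<open>The drift \<open>c + 2 * e\<close> is positive, so \<open>dens_nonneg\<close> applies to
  the shifted exponents, and the sign survives the limit in \<open>e\<close>; this includes
  \<open>c = 0\<close>.\<close>

lemma dens_nonneg_a0:
  assumes "a0 \<le> r"
  shows "0 \<le> dens cPhi r"
proof -
  define e where "e n = 1 / real (Suc n)" for n
  have "(\<lambda>n. dens (Phi_shift (e n)) r) \<longlonglongrightarrow> dens cPhi r"
    by (rule dens_shift_tendsto[OF _ _ assms]) (unfold e_def, real_asymp, simp)
  moreover have "0 \<le> dens (Phi_shift (e n)) r" for n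
    using levy_data.dens_nonneg[OF levy_data_shift[of "e n"]] c_nonneg assms a0_pos by (simp add: e_def add_nonneg_pos)
  ultimately show ?thesis by (intro LIMSEQ_le_const) auto
qed

lemma dens_le: "a0 \<le> r \<Longrightarrow> dens cPhi r \<le> dens_bd"
  using dens_bound[of 0 r] dens_nonneg_a0[of r] by simp

lemma dens_bd_nonneg: "0 \<le> dens_bd"
  using dens_bound[of 0 a0] by linarith

text \<open>The part of the mixture over \<open>r \<ge> a0\<close>; the rest of the mass contributes at most \<open>exp (- t / a0)\<close>.\<close>
definition G :: "real \<Rightarrow> real \<Rightarrow> real" where
  "G q t = rphi q * (LINT r:{a0..}|lborel. exp (- (rPhi q * r) - t / r) * dens cPhi r)"

lemma integrable_exp_a0:
  assumes "0 < b"
  shows "set_integrable lborel {a0..} (\<lambda>r. exp (- (b * r)))"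
proof -
  have "((\<lambda>r. exp (- b * r)) has_integral exp (- b * a0) / b) {a0..}"
    by (rule has_integral_exp_minus_to_infinity[OF assms])
  then have "set_integrable lebesgue {a0..} (\<lambda>r. exp (- (b * r)))"
    by (intro nonnegative_absolutely_integrable_1) (auto simp: has_integral_integrable)
  then show ?thesis
    unfolding set_integrable_def by (subst (asm) integrable_completion) auto
qed

lemma exp_div_le:
  assumes "b \<le> b'" "0 \<le> t" "a0 \<le> r"
  shows "exp (- (b' * r) - t / r) \<le> exp (- (b * r))"
proof -
  have "0 \<le> t / r" "b * r \<le> b' * r" using assms a0_pos by (auto intro!: divide_nonneg_pos mult_right_mono)
  then show ?thesis by simp
qed

text \<open>One dominated convergence statement for two uses: \<open>b\<close> and \<open>d\<close>
  vary in the regularisation, \<open>s\<close> varies for continuity of \<open>G\<close> in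
  \<open>t\<close>.\<close>

lemma tendsto_G_general:
  fixes b s :: "nat \<Rightarrow> real" and d :: "nat \<Rightarrow> real \<Rightarrow> real"
  assumes b: "b \<longlonglongrightarrow> B" "\<And>n. B \<le> b n" "0 < B" and s: "s \<longlonglongrightarrow> t" "\<And>n. 0 \<le> s n"
    and d: "\<And>r. a0 \<le> r \<Longrightarrow> (\<lambda>n. d n r) \<longlonglongrightarrow> D r" "\<And>n r. a0 \<le> r \<Longrightarrow> \<bar>d n r\<bar> \<le> dens_bd"
    and [measurable]: "\<And>n. d n \<in> borel_measurable borel" "D \<in> borel_measurable borel"
  shows "(\<lambda>n. LINT r:{a0..}|lborel. exp (- (b n * r) - s n / r) * d n r) \<longlonglongrightarrow> (LINT r:{a0..}|lborel. exp (- (B * r) - t / r) * D r)"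
  unfolding set_lebesgue_integral_def
proof (rule integral_dominated_convergence)
  show "integrable lborel (\<lambda>r. dens_bd * (indicator {a0..} r *\<^sub>R exp (- (B * r))))"
    using integrable_exp_a0[OF b(3)] unfolding set_integrable_def by (rule integrable_mult_right)
  show "AE r in lborel. (\<lambda>n. indicator {a0..} r *\<^sub>R (exp (- (b n * r) - s n / r) * d n r)) \<longlonglongrightarrow> indicator {a0..} r *\<^sub>R (exp (- (B * r) - t / r) * D r)"
  proof (rule AE_I2)
    fix r :: real
    show "(\<lambda>n. indicator {a0..} r *\<^sub>R (exp (- (b n * r) - s n / r) * d n r)) \<longlonglongrightarrow> indicator {a0..} r *\<^sub>R (exp (- (B * r) - t / r) * D r)"
    proof (cases "a0 \<le> r")
      case True
      then have "r \<noteq> 0" using a0_pos by simp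
      then show ?thesis
        by (intro tendsto_scaleR tendsto_const tendsto_mult tendsto_exp tendsto_diff tendsto_minus tendsto_mult_right tendsto_divide b s d True)
    qed simp
  qed
  show "AE r in lborel. norm (indicator {a0..} r *\<^sub>R (exp (- (b n * r) - s n / r) * d n r)) \<le> dens_bd * (indicator {a0..} r *\<^sub>R exp (- (B * r)))" for n
  proof (rule AE_I2)
    fix r :: real
    show "norm (indicator {a0..} r *\<^sub>R (exp (- (b n * r) - s n / r) * d n r)) \<le> dens_bd * (indicator {a0..} r *\<^sub>R exp (- (B * r)))"
    proof (cases "a0 \<le> r")
      case True
      have "exp (- (b n * r) - s n / r) * \<bar>d n r\<bar> \<le> exp (- (B * r)) * dens_bd"
        using d(2)[OF True] exp_div_le[OF b(2) s(2) True] by (intro mult_mono) auto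
      then show ?thesis using True by (simp add: abs_mult mult.commute)
    qed simp
  qed
qed measurable

lemma set_integrable_G:
  fixes d :: "real \<Rightarrow> real"
  assumes "0 < B" "0 \<le> t" and d: "\<And>r. a0 \<le> r \<Longrightarrow> \<bar>d r\<bar> \<le> dens_bd" and [measurable]: "d \<in> borel_measurable borel"
  shows "set_integrable lborel {a0..} (\<lambda>r. exp (- (B * r) - t / r) * d r)"
  unfolding set_integrable_def
proof (rule Bochner_Integration.integrable_bound)
  show "integrable lborel (\<lambda>r. dens_bd * (indicator {a0..} r *\<^sub>R exp (- (B * r))))"
    using integrable_exp_a0[OF assms(1)] unfolding set_integrable_def by (rule integrable_mult_right)
  show "AE r in lborel. norm (indicator {a0..} r *\<^sub>R (exp (- (B * r) - t / r) * d r)) \<le> norm (dens_bd * (indicator {a0..} r *\<^sub>R exp (- (B * r))))"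
  proof (rule AE_I2)
    fix r :: real
    show "norm (indicator {a0..} r *\<^sub>R (exp (- (B * r) - t / r) * d r)) \<le> norm (dens_bd * (indicator {a0..} r *\<^sub>R exp (- (B * r))))"
    proof (cases "a0 \<le> r")
      case True
      have "exp (- (B * r) - t / r) * \<bar>d r\<bar> \<le> exp (- (B * r)) * dens_bd"
        using d(1)[OF True] exp_div_le[OF order_refl assms(2) True] by (intro mult_mono) auto
      then show ?thesis using True dens_bd_nonneg by (simp add: abs_mult mult.commute)
    qed simp
  qed
qed measurable

lemma G_antimono:
  assumes "0 < q" "0 \<le> s" "s \<le> t"
  shows "G q t \<le> G q s"
proof -
  have bd: "\<bar>dens cPhi r\<bar> \<le> dens_bd" if "a0 \<le> r" for r using dens_nonneg_a0[OF that] dens_le[OF that] by simp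
  have "(LINT r:{a0..}|lborel. exp (- (rPhi q * r) - t / r) * dens cPhi r) \<le> (LINT r:{a0..}|lborel. exp (- (rPhi q * r) - s / r) * dens cPhi r)"
  proof (rule set_integral_mono)
    show "exp (- (rPhi q * r) - t / r) * dens cPhi r \<le> exp (- (rPhi q * r) - s / r) * dens cPhi r" if "r \<in> {a0..}" for r
      using that assms dens_nonneg_a0[of r] a0_pos by (intro mult_right_mono) (auto simp: divide_right_mono)
  qed (use assms bd rPhi_pos in \<open>auto intro!: set_integrable_G\<close>)
  then show ?thesis unfolding G_def using rphi_nonneg assms by (intro mult_left_mono) auto
qed

lemma G_tendsto:
  assumes "0 < q" "s \<longlonglongrightarrow> t" "\<And>n. 0 \<le> s n"
  shows "(\<lambda>n. G q (s n)) \<longlonglongrightarrow> G q t"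
  unfolding G_def
proof (intro tendsto_mult_left tendsto_G_general assms tendsto_const order_refl)
  show "0 < rPhi q" using rPhi_pos assms by simp
  show "\<bar>dens cPhi r\<bar> \<le> dens_bd" if "a0 \<le> r" for r using dens_nonneg_a0[OF that] dens_le[OF that] by simp
qed auto

lemma G_measurable[measurable]: "(\<lambda>t. G q t) \<in> borel_measurable borel"
  unfolding G_def set_lebesgue_integral_def by measurable

end

text \<open>Passage from the \<open>ennreal\<close> identity to reals. Finiteness of
  \<open>N\<close> is read off the identity itself, since its right-hand side is 1 and
  \<open>k > 0\<close>; it later provides the integrable majorant in
  \<open>lapN_tendsto\<close>.\<close>

lemma laplace_real_of_nn:
  fixes f :: "real \<Rightarrow> real"
  assumes [measurable]: "f \<in> borel_measurable borel" and f: "\<And>t. 0 \<le> t \<Longrightarrow> 0 \<le> f t \<and> f t \<le> 1" and a: "0 < a" and k: "0 < k"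
    and id: "ennreal a * (\<integral>\<^sup>+t. ennreal (exp (- a * t) * f t) * indicator {0..} t \<partial>lborel) + ennreal k * N = 1"
  shows "N < \<infinity>" "a * (LINT t:{0..}|lborel. exp (- (a * t)) * f t) = 1 - k * enn2real N"
    "set_integrable lborel {0..} (\<lambda>t. exp (- (a * t)) * f t)"
proof -
  have "ennreal k * N \<le> 1" unfolding id[symmetric] by simp
  then have "ennreal k * N < top" by (rule le_less_trans) (rule ennreal_one_less_top)
  then show N: "N < \<infinity>" using k by (cases "N = top") (auto simp: ennreal_mult_top less_top)
  have "((\<lambda>t. exp (- a * t)) has_integral exp (- a * 0) / a) {0..}"
    using a by (rule has_integral_exp_minus_to_infinity)
  then have "set_integrable lebesgue {0..} (\<lambda>t. exp (- (a * t)))"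
    by (intro nonnegative_absolutely_integrable_1) (auto simp: has_integral_integrable)
  then have ei: "integrable lborel (\<lambda>t. indicator {0..} t *\<^sub>R exp (- (a * t)))"
    unfolding set_integrable_def by (subst (asm) integrable_completion) auto
  show int: "set_integrable lborel {0..} (\<lambda>t. exp (- (a * t)) * f t)"
    unfolding set_integrable_def
    by (rule Bochner_Integration.integrable_bound[OF ei]) (use f in \<open>auto simp: indicator_def abs_mult intro!: mult_left_le\<close>)
  define I where "I = (LINT t:{0..}|lborel. exp (- (a * t)) * f t)"
  have "(\<integral>\<^sup>+t. ennreal (exp (- a * t) * f t) * indicator {0..} t \<partial>lborel) = (\<integral>\<^sup>+t. ennreal (indicator {0..} t *\<^sub>R (exp (- (a * t)) * f t)) \<partial>lborel)"
    by (rule nn_integral_cong) (auto simp: indicator_def)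
  also have "\<dots> = ennreal I"
    unfolding I_def set_lebesgue_integral_def
    using int f unfolding set_integrable_def by (intro nn_integral_eq_integral) (auto simp: indicator_def)
  finally have "ennreal a * ennreal I + ennreal k * N = 1" using id by simp
  moreover have I0: "0 \<le> I" unfolding I_def set_lebesgue_integral_def
    using f by (intro Bochner_Integration.integral_nonneg) (auto simp: indicator_def)
  moreover have "N = ennreal (enn2real N)" using N by (simp add: less_top)
  ultimately have "ennreal (a * I + k * enn2real N) = 1"
    using a k by (simp add: ennreal_mult ennreal_plus)
  then have "a * I + k * enn2real N = 1" by (simp add: ennreal_eq_1)
  then show "a * (LINT t:{0..}|lborel. exp (- (a * t)) * f t) = 1 - k * enn2real N" by (simp add: I_def)
qed

section \<open>Convergence of the regularised mixtures and comparison with F\<close>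

context levy_decay
begin

context
  fixes q :: real and e :: "nat \<Rightarrow> real" and B ph :: "nat \<Rightarrow> real" and p :: "nat \<Rightarrow> real \<Rightarrow> real" and f Gn :: "nat \<Rightarrow> real \<Rightarrow> real"
  assumes q: "0 < q"
  defines "e \<equiv> \<lambda>n. 1 / real (Suc n)"
  defines "B \<equiv> \<lambda>n. rPhi q + e n * q^2" and "ph \<equiv> \<lambda>n. rphi q + 2 * e n * q"
    and "p \<equiv> \<lambda>n. dens (Phi_shift (e n))"
    and "f \<equiv> \<lambda>n t. enn2real (levy_data.Fe (c + 2 * e n) \<pi> q t)"
    and "Gn \<equiv> \<lambda>n t. ph n * (LINT r:{a0..}|lborel. exp (- (B n * r) - t / r) * p n r)"
begin

lemma e_facts: "0 < e n" "e \<longlonglongrightarrow> 0"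
  unfolding e_def by (simp, real_asymp)

lemma shift_data: "levy_data (c + 2 * e n) \<pi>"
  using e_facts(1)[of n] by (intro levy_data_shift) simp

lemma shift_pos: "0 < c + 2 * e n"
  using c_nonneg e_facts(1)[of n] by simp

lemma B_facts: "rPhi q \<le> B n" "0 < B n" "B \<longlonglongrightarrow> rPhi q"
proof -
  show "rPhi q \<le> B n" using e_facts(1)[of n] by (simp add: B_def)
  then show "0 < B n" using rPhi_pos[OF q] by simp
  have "B \<longlonglongrightarrow> rPhi q + 0 * q^2" unfolding B_def by (intro tendsto_add tendsto_const tendsto_mult_right e_facts)
  then show "B \<longlonglongrightarrow> rPhi q" by simp
qed

lemma ph_facts: "0 < ph n" "ph \<longlonglongrightarrow> rphi q"
proof -
  show "0 < ph n" using e_facts(1)[of n] rphi_pos[OF q] q by (simp add: ph_def add_pos_pos)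
  have "ph \<longlonglongrightarrow> rphi q + 2 * 0 * q" unfolding ph_def by (intro tendsto_add tendsto_const tendsto_mult_right tendsto_mult_left e_facts)
  then show "ph \<longlonglongrightarrow> rphi q" by simp
qed

lemma p_meas[measurable]: "p n \<in> borel_measurable borel"
  unfolding p_def by (rule levy_data.dens_measurable[OF shift_data])

lemma p_nonneg: "0 < r \<Longrightarrow> 0 \<le> p n r"
  unfolding p_def by (rule levy_data.dens_nonneg[OF shift_data shift_pos])

lemma p_bound: "a0 \<le> r \<Longrightarrow> \<bar>p n r\<bar> \<le> dens_bd"
  unfolding p_def using e_facts(1)[of n] by (intro dens_bound) auto

lemma p_tendsto: "a0 \<le> r \<Longrightarrow> (\<lambda>n. p n r) \<longlonglongrightarrow> dens cPhi r"
  unfolding p_def using e_facts by (intro dens_shift_tendsto) (auto simp: less_imp_le)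

lemma p_laplace: "(\<integral>\<^sup>+r. ennreal (exp (- (B n * r)) * p n r) * indicator {0<..} r \<partial>lborel) = ennreal (1 / ph n)"
  using levy_data.dens_laplace[OF shift_data shift_pos q, of n] e_facts(1)[of n]
  by (simp add: rPhi_shift rphi_shift B_def ph_def p_def)

lemma Fe_eq: "levy_data.Fe (c + 2 * e n) \<pi> q t = ennreal (ph n) * (\<integral>\<^sup>+r. ennreal (exp (- (B n * r) - t / r) * p n r) * indicator {0<..} r \<partial>lborel)"
  using levy_data.Fe_def[OF shift_data, of n q t] e_facts(1)[of n]
  by (simp add: rPhi_shift rphi_shift B_def ph_def p_def)

lemma Fe_measurable[measurable]: "(\<lambda>t. levy_data.Fe (c + 2 * e n) \<pi> q t) \<in> borel_measurable borel"
  unfolding Fe_eq by measurable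

lemma f_meas[measurable]: "f n \<in> borel_measurable borel"
  unfolding f_def by measurable

lemma Fe_le_1:
  assumes "0 \<le> t"
  shows "levy_data.Fe (c + 2 * e n) \<pi> q t \<le> 1"
proof -
  have "(\<integral>\<^sup>+r. ennreal (exp (- (B n * r) - t / r) * p n r) * indicator {0<..} r \<partial>lborel) \<le> ennreal (1 / ph n)"
    unfolding p_laplace[symmetric]
  proof (rule nn_integral_mono)
    fix r :: real
    show "ennreal (exp (- (B n * r) - t / r) * p n r) * indicator {0<..} r \<le> ennreal (exp (- (B n * r)) * p n r) * indicator {0<..} r"
      using assms p_nonneg[of r n] by (cases "0 < r") (auto intro!: ennreal_leI mult_right_mono)
  qed
  then have "levy_data.Fe (c + 2 * e n) \<pi> q t \<le> ennreal (ph n) * ennreal (1 / ph n)"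
    unfolding Fe_eq by (intro mult_left_mono) auto
  also have "\<dots> = 1" using ph_facts(1)[of n] by (simp add: ennreal_mult[symmetric])
  finally show ?thesis .
qed

lemma Fe_f: "0 \<le> t \<Longrightarrow> levy_data.Fe (c + 2 * e n) \<pi> q t = ennreal (f n t)"
  using Fe_le_1[of t n] unfolding f_def by (simp add: less_top order_le_less_trans[OF _ ennreal_one_less_top])

lemma f_bounds: "0 \<le> t \<Longrightarrow> 0 \<le> f n t \<and> f n t \<le> 1"
proof
  assume t: "0 \<le> t"
  show "0 \<le> f n t" by (simp add: f_def)
  have "ennreal (f n t) \<le> 1" using Fe_le_1[OF t] unfolding Fe_f[OF t] .
  then show "f n t \<le> 1" by (simp only: ennreal_le_1)
qed

lemma Gn_nn:
  assumes "0 \<le> t"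
  shows "ennreal (Gn n t) = ennreal (ph n) * (\<integral>\<^sup>+r. ennreal (exp (- (B n * r) - t / r) * p n r) * indicator {a0..} r \<partial>lborel)"
proof -
  have int: "set_integrable lborel {a0..} (\<lambda>r. exp (- (B n * r) - t / r) * p n r)"
    using p_bound assms B_facts(2) by (intro set_integrable_G) auto
  have "(\<integral>\<^sup>+r. ennreal (exp (- (B n * r) - t / r) * p n r) * indicator {a0..} r \<partial>lborel) = (\<integral>\<^sup>+r. ennreal (indicator {a0..} r *\<^sub>R (exp (- (B n * r) - t / r) * p n r)) \<partial>lborel)"
    by (rule nn_integral_cong) (auto simp: indicator_def)
  also have "\<dots> = ennreal (LINT r:{a0..}|lborel. exp (- (B n * r) - t / r) * p n r)"
    unfolding set_lebesgue_integral_def using int p_nonneg a0_pos unfolding set_integrable_def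
    by (intro nn_integral_eq_integral) (auto simp: indicator_def)
  finally show ?thesis unfolding Gn_def using ph_facts(1)[of n] by (simp add: ennreal_mult')
qed

lemma Gn_nonneg: "0 \<le> t \<Longrightarrow> 0 \<le> Gn n t"
  unfolding Gn_def set_lebesgue_integral_def using ph_facts(1)[of n] p_nonneg a0_pos
  by (intro mult_nonneg_nonneg Bochner_Integration.integral_nonneg) (auto simp: indicator_def)

text \<open>For \<open>r < a0\<close> the factor exp(-t/r) is at most exp(-t/a0), and what remains
  has total mass at most 1, because the weights integrate to \<open>1 / ph n\<close> by
  \<open>p_laplace\<close>.\<close>

lemma f_sandwich:
  assumes "0 \<le> t"
  shows "Gn n t \<le> f n t" "f n t \<le> Gn n t + exp (- (t / a0))"
proof -
  have split: "(\<integral>\<^sup>+r. ennreal (exp (- (B n * r) - t / r) * p n r) * indicator {0<..} r \<partial>lborel)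
     = (\<integral>\<^sup>+r. ennreal (exp (- (B n * r) - t / r) * p n r) * indicator {a0..} r \<partial>lborel)
      + (\<integral>\<^sup>+r. ennreal (exp (- (B n * r) - t / r) * p n r) * indicator {0<..<a0} r \<partial>lborel)"
    using a0_pos by (subst nn_integral_add[symmetric]) (auto intro!: nn_integral_cong simp: indicator_def)
  have low: "(\<integral>\<^sup>+r. ennreal (exp (- (B n * r) - t / r) * p n r) * indicator {0<..<a0} r \<partial>lborel) \<le> ennreal (exp (- (t / a0))) * ennreal (1 / ph n)"
  proof -
    have "(\<integral>\<^sup>+r. ennreal (exp (- (B n * r) - t / r) * p n r) * indicator {0<..<a0} r \<partial>lborel)
       \<le> (\<integral>\<^sup>+r. ennreal (exp (- (t / a0))) * (ennreal (exp (- (B n * r)) * p n r) * indicator {0<..} r) \<partial>lborel)"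
    proof (rule nn_integral_mono)
      fix r :: real
      show "ennreal (exp (- (B n * r) - t / r) * p n r) * indicator {0<..<a0} r \<le> ennreal (exp (- (t / a0))) * (ennreal (exp (- (B n * r)) * p n r) * indicator {0<..} r)"
      proof (cases "0 < r \<and> r < a0")
        case True
        have "t / a0 \<le> t / r" using True assms by (intro divide_left_mono mult_pos_pos) auto
        then have "exp (- (B n * r) - t / r) \<le> exp (- (t / a0)) * exp (- (B n * r))"
          unfolding exp_add[symmetric] by simp
        then have "exp (- (B n * r) - t / r) * p n r \<le> exp (- (t / a0)) * (exp (- (B n * r)) * p n r)"
          using p_nonneg[of r n] True by (simp only: mult.assoc[symmetric]) (intro mult_right_mono, auto)
        then show ?thesis using True p_nonneg[of r n] by (simp add: ennreal_mult[symmetric] ennreal_leI)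
      qed auto
    qed
    also have "\<dots> = ennreal (exp (- (t / a0))) * ennreal (1 / ph n)"
      unfolding p_laplace[of n, symmetric] by (rule nn_integral_cmult) measurable
    finally show ?thesis .
  qed
  have 1: "ennreal (f n t) = ennreal (Gn n t) + ennreal (ph n) * (\<integral>\<^sup>+r. ennreal (exp (- (B n * r) - t / r) * p n r) * indicator {0<..<a0} r \<partial>lborel)"
    unfolding Fe_f[OF assms, symmetric] Fe_eq split Gn_nn[OF assms] by (rule distrib_left)
  then have "ennreal (Gn n t) \<le> ennreal (f n t)" by simp
  then show "Gn n t \<le> f n t" using f_bounds[OF assms] by (simp add: ennreal_le_iff)
  have "ennreal (ph n) * (\<integral>\<^sup>+r. ennreal (exp (- (B n * r) - t / r) * p n r) * indicator {0<..<a0} r \<partial>lborel) \<le> ennreal (ph n) * (ennreal (exp (- (t / a0))) * ennreal (1 / ph n))"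
    using low by (intro mult_left_mono) auto
  also have "\<dots> = ennreal (exp (- (t / a0)))"
    using ph_facts(1)[of n] by (simp add: ennreal_mult[symmetric])
  finally have "ennreal (f n t) \<le> ennreal (Gn n t) + ennreal (exp (- (t / a0)))"
    unfolding 1 by (intro add_left_mono)
  also have "\<dots> = ennreal (Gn n t + exp (- (t / a0)))" using Gn_nonneg[OF assms] by simp
  finally show "f n t \<le> Gn n t + exp (- (t / a0))"
    by (rule ennreal_le_iff[THEN iffD1, rotated]) (intro add_nonneg_nonneg Gn_nonneg assms exp_ge_zero)
qed

lemma Gn_tendsto: "0 \<le> t \<Longrightarrow> (\<lambda>n. Gn n t) \<longlonglongrightarrow> G q t"
  unfolding Gn_def G_def
  by (intro tendsto_mult ph_facts tendsto_G_general B_facts rPhi_pos q tendsto_const p_tendsto p_bound) auto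

lemma Gn_measurable[measurable]: "(\<lambda>t. Gn n t) \<in> borel_measurable borel"
  unfolding Gn_def set_lebesgue_integral_def by measurable

lemma Gn_le_1: "0 \<le> t \<Longrightarrow> Gn n t \<le> 1"
  using f_sandwich(1)[of t n] f_bounds[of t n] by linarith

lemma G_bounds: "0 \<le> t \<Longrightarrow> 0 \<le> G q t \<and> G q t \<le> 1"
  using LIMSEQ_le_const[OF Gn_tendsto[of t], of 0] LIMSEQ_le_const2[OF Gn_tendsto[of t], of 1] Gn_nonneg[of t] Gn_le_1[of t] by auto

text \<open>The additional term of the exponent is nonnegative, so the integrand at
  \<open>e = 0\<close> dominates all others.\<close>

lemma lapN_tendsto:
  assumes a: "0 < a" and fin: "lapN q a < \<infinity>"
  shows "(\<lambda>n. levy_data.lapN (c + 2 * e n) \<pi> q a) \<longlonglongrightarrow> lapN q a"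
proof -
  define D where "D w = (rPhi (max 0 (q + a * w)) - rPhi q) / a" for w
  define S where "S w = ((q + a * w)^2 - q^2) / a" for w
  have [measurable]: "D \<in> borel_measurable borel" "S \<in> borel_measurable borel" unfolding D_def[abs_def] S_def[abs_def] by measurable
  have max: "max 0 (q + a * w) = q + a * w" if "0 \<le> w" for w using q a that by (simp add: max_def)
  have S: "0 \<le> S w" if "0 \<le> w" for w
    using q a that by (auto simp: S_def intro!: divide_nonneg_pos power_mono)
  have eq: "levy_data.lapN (c + 2 * e n) \<pi> q a = (\<integral>\<^sup>+w. ennreal (exp (- (D w + e n * S w))) * indicator {0..} w \<partial>lborel)" for n
    unfolding levy_data.lapN_def[OF shift_data]
  proof (rule nn_integral_cong)
    fix w :: real
    have "(rPhi (q + a * w) + e n * (q + a * w)^2 - (rPhi q + e n * q^2)) / a = D w + e n * S w" if "0 \<le> w"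
      unfolding D_def S_def max[OF that] by (simp add: diff_divide_distrib add_divide_distrib right_diff_distrib)
    then show "ennreal (exp (- ((levy_data.rPhi (c + 2 * e n) \<pi> (q + a * w) - levy_data.rPhi (c + 2 * e n) \<pi> q) / a))) * indicator {0..} w
      = ennreal (exp (- (D w + e n * S w))) * indicator {0..} w"
      using e_facts(1)[of n] by (cases "0 \<le> w") (simp_all add: rPhi_shift)
  qed
  have eq0: "lapN q a = (\<integral>\<^sup>+w. ennreal (exp (- D w)) * indicator {0..} w \<partial>lborel)"
    unfolding lapN_def
  proof (rule nn_integral_cong)
    fix w :: real
    show "ennreal (exp (- ((rPhi (q + a * w) - rPhi q) / a))) * indicator {0..} w = ennreal (exp (- D w)) * indicator {0..} w"
      by (cases "0 \<le> w") (simp_all add: D_def max)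
  qed
  show ?thesis
    unfolding eq eq0
  proof (rule nn_integral_dominated_convergence)
    show "(\<integral>\<^sup>+w. ennreal (exp (- D w)) * indicator {0..} w \<partial>lborel) < \<infinity>" using fin eq0 by simp
    show "AE w in lborel. ennreal (exp (- (D w + e n * S w))) * indicator {0..} w \<le> ennreal (exp (- D w)) * indicator {0..} w" for n
    proof (rule AE_I2)
      fix w :: real
      show "ennreal (exp (- (D w + e n * S w))) * indicator {0..} w \<le> ennreal (exp (- D w)) * indicator {0..} w"
        using S[of w] e_facts(1)[of n] by (cases "0 \<le> w") (auto intro!: ennreal_leI)
    qed
    show "AE w in lborel. (\<lambda>n. ennreal (exp (- (D w + e n * S w))) * indicator {0..} w) \<longlonglongrightarrow> ennreal (exp (- D w)) * indicator {0..} w"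
    proof (rule AE_I2)
      fix w :: real
      have "(\<lambda>n. exp (- (D w + e n * S w))) \<longlonglongrightarrow> exp (- (D w + 0 * S w))"
        by (intro tendsto_exp tendsto_minus tendsto_add tendsto_const tendsto_mult_right e_facts)
      then have "(\<lambda>n. exp (- (D w + e n * S w))) \<longlonglongrightarrow> exp (- D w)" by simp
      then show "(\<lambda>n. ennreal (exp (- (D w + e n * S w))) * indicator {0..} w) \<longlonglongrightarrow> ennreal (exp (- D w)) * indicator {0..} w"
        by (cases "0 \<le> w") (auto intro!: tendsto_ennrealI)
    qed
  qed measurable
qed

text \<open>Convergence of all Laplace transforms gives, via \<open>laplace_weierstrass\<close>,
  convergence of integrals against bumps supported in \<open>[t, t + h]\<close>. There
  \<open>f_sandwich\<close> passes to the limit, and monotonicity of \<open>F\<close> and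
  \<open>G\<close> replaces averages by end values: \<open>G q (t + h) \<le> F t\<close> and
  \<open>F (t + h) \<le> G q t + exp (- (t / a0))\<close>. Then \<open>h\<close> tends to 0.\<close>

lemma laplace_sandwich:
  assumes [measurable]: "F \<in> borel_measurable borel" and F: "\<And>t. 0 \<le> t \<Longrightarrow> 0 \<le> F t \<and> F t \<le> 1"
    and F_anti: "\<And>s t. 0 \<le> s \<Longrightarrow> s \<le> t \<Longrightarrow> F t \<le> F s"
    and lap: "\<And>a. 0 < a \<Longrightarrow> ennreal a * (\<integral>\<^sup>+t. ennreal (exp (- a * t) * F t) * indicator {0..} t \<partial>lborel) + ennreal (rphi q) * lapN q a = 1"
    and t: "0 < t"
  shows "G q t \<le> F t" "F t \<le> G q t + exp (- (t / a0))"
proof -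
  have conv: "(\<lambda>n. LINT t:{0..}|lborel. exp (- (a * t)) * (f n t - F t)) \<longlonglongrightarrow> 0" if a: "0 < a" for a
  proof -
    note FF = laplace_real_of_nn[of F, OF _ F a rphi_pos[OF q] lap[OF a]]
    have lapn: "ennreal a * (\<integral>\<^sup>+t. ennreal (exp (- a * t) * f n t) * indicator {0..} t \<partial>lborel) + ennreal (ph n) * levy_data.lapN (c + 2 * e n) \<pi> q a = 1" for n
    proof -
      have "(\<integral>\<^sup>+t. ennreal (exp (- a * t) * f n t) * indicator {0..} t \<partial>lborel) = (\<integral>\<^sup>+t. ennreal (exp (- a * t)) * levy_data.Fe (c + 2 * e n) \<pi> q t * indicator {0..} t \<partial>lborel)"
      proof (rule nn_integral_cong)
        fix t :: real
        show "ennreal (exp (- a * t) * f n t) * indicator {0..} t = ennreal (exp (- a * t)) * levy_data.Fe (c + 2 * e n) \<pi> q t * indicator {0..} t"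
          using f_bounds[of t n] by (cases "0 \<le> t") (auto simp: Fe_f ennreal_mult)
      qed
      then show ?thesis
        using levy_data.laplace_Fe[OF shift_data shift_pos q a, of n] e_facts(1)[of n]
        by (simp add: rphi_shift ph_def)
    qed
    note fn = laplace_real_of_nn[of "f n" for n, OF _ f_bounds a ph_facts(1) lapn]
    have "(\<lambda>n. enn2real (levy_data.lapN (c + 2 * e n) \<pi> q a)) \<longlonglongrightarrow> enn2real (lapN q a)"
      using lapN_tendsto[OF a FF(1)] FF(1) by (intro tendsto_enn2real) auto
    then have "(\<lambda>n. 1 - ph n * enn2real (levy_data.lapN (c + 2 * e n) \<pi> q a)) \<longlonglongrightarrow> 1 - rphi q * enn2real (lapN q a)"
      by (intro tendsto_diff tendsto_const tendsto_mult ph_facts)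
    then have "(\<lambda>n. a * (LINT t:{0..}|lborel. exp (- (a * t)) * f n t)) \<longlonglongrightarrow> a * (LINT t:{0..}|lborel. exp (- (a * t)) * F t)"
      using fn(2) FF(2) by simp
    from tendsto_mult_left[OF this, of "1 / a"] a
    have "(\<lambda>n. LINT t:{0..}|lborel. exp (- (a * t)) * f n t) \<longlonglongrightarrow> (LINT t:{0..}|lborel. exp (- (a * t)) * F t)" by simp
    from tendsto_diff[OF this tendsto_const[of "LINT t:{0..}|lborel. exp (- (a * t)) * F t"]]
    have "(\<lambda>n. (LINT t:{0..}|lborel. exp (- (a * t)) * f n t) - (LINT t:{0..}|lborel. exp (- (a * t)) * F t)) \<longlonglongrightarrow> 0" by simp
    moreover have "(LINT t:{0..}|lborel. exp (- (a * t)) * f n t) - (LINT t:{0..}|lborel. exp (- (a * t)) * F t) = (LINT t:{0..}|lborel. exp (- (a * t)) * (f n t - F t))" for n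
      using fn(3)[of n] FF(3) by (subst set_integral_diff(2)[symmetric]) (auto simp: right_diff_distrib)
    ultimately show ?thesis by simp
  qed
  have main: "G q (t + h) \<le> F t \<and> F (t + h) \<le> G q t + exp (- (t / a0))" if t: "0 \<le> t" and h: "0 < h" for t h
  proof -
    \<comment> \<open>A tent in the variable exp(-s), vanishing outside
      \<open>[exp (- (t + h)), exp (- t)]\<close>; thus \<open>w\<close> is a bump of the form that
      \<open>laplace_weierstrass\<close> handles, positive inside the interval.\<close>
    define g where "g x = max 0 (min (x - exp (- (t + h))) (exp (- t) - x))" for x :: real
    define w where "w s = g (exp (- s)) * exp (- s)" for s
    have [measurable]: "g \<in> borel_measurable borel" "w \<in> borel_measurable borel" unfolding w_def[abs_def] g_def[abs_def] by measurable
    have gc: "continuous_on {0..1} g" unfolding g_def by (intro continuous_intros)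
    have w0: "0 \<le> w s" for s by (simp add: w_def g_def)
    have w_supp: "w s = 0" if "s \<notin> {t..t + h}" for s
    proof -
      have "s < t \<or> t + h < s" using that by auto
      then have "exp (- t) \<le> exp (- s) \<or> exp (- s) \<le> exp (- (t + h))" by auto
      then have "min (exp (- s) - exp (- (t + h))) (exp (- t) - exp (- s)) \<le> 0"
        by (auto simp: min_le_iff_disj)
      then show ?thesis by (simp only: w_def g_def max_absorb1 mult_zero_left)
    qed
    have w1: "w s \<le> 1" if "0 \<le> s" for s
    proof -
      have "exp (- s) \<le> 1" "0 < exp (- (t + h))" using that by simp_all
      then have "exp (- s) - exp (- (t + h)) \<le> 1" by linarith
      then have "g (exp (- s)) \<le> 1" unfolding g_def by (rule max.boundedI[OF zero_le_one min.coboundedI1])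
      then have "g (exp (- s)) * exp (- s) \<le> 1 * 1" using that by (intro mult_mono) auto
      then show ?thesis by (simp add: w_def)
    qed
    have wpos: "0 < w s" if "s \<in> {t<..<t + h}" for s using that by (auto simp: w_def g_def)
    have bnd_int: "integrable lborel (\<lambda>s. w s * k s)" if [measurable]: "k \<in> borel_measurable borel" and k: "\<And>s. 0 \<le> s \<Longrightarrow> \<bar>k s\<bar> \<le> K" for k K
    proof (rule Bochner_Integration.integrable_bound)
      show "integrable lborel (\<lambda>s. K * indicator {t..t + h} s)"
        by (intro integrable_mult_right integrable_real_indicator) (use h in simp_all)
      show "(\<lambda>s. w s * k s) \<in> borel_measurable lborel" by measurable
      show "AE s in lborel. norm (w s * k s) \<le> norm (K * indicator {t..t + h} s)"
      proof (rule AE_I2)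
        fix s :: real
        show "norm (w s * k s) \<le> norm (K * indicator {t..t + h} s)"
        proof (cases "s \<in> {t..t + h}")
          case True
          then have "0 \<le> s" using t by simp
          have "w s * \<bar>k s\<bar> \<le> 1 * K" using w1[OF \<open>0 \<le> s\<close>] k[OF \<open>0 \<le> s\<close>] by (intro mult_mono) auto
          then show ?thesis using True w0[of s] by (simp add: abs_mult)
        qed (simp add: w_supp)
      qed
    qed
    have wmono: "w s * x \<le> w s * y" if "s \<in> {t..t + h} \<Longrightarrow> x \<le> y" for s x y
    proof (cases "s \<in> {t..t + h}")
      case True
      then show ?thesis using that w0 by (intro mult_left_mono) auto
    next
      case False
      show ?thesis unfolding w_supp[OF False] by simp
    qed
    define W where "W = (\<integral>s. w s \<partial>lborel)"
    have Wint: "integrable lborel w" using bnd_int[of "\<lambda>_. 1" 1] by simp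
    have W: "0 < W"
    proof -
      have "W \<noteq> 0"
      proof
        assume "W = 0"
        then have "AE s in lborel. w s = 0"
          using integral_nonneg_eq_0_iff_AE[OF Wint] w0 by (simp add: W_def)
        then have "AE s in lborel. s \<notin> {t<..<t + h}" by eventually_elim (use wpos in force)
        then have "{t<..<t + h} \<in> null_sets lborel" by (subst AE_iff_null_sets) auto
        then have "emeasure lborel {t<..<t + h} = 0" by (rule null_setsD1)
        then show False using h by simp
      qed
      moreover have "0 \<le> W" unfolding W_def using w0 by (intro Bochner_Integration.integral_nonneg)
      ultimately show ?thesis by simp
    qed
    have lint: "(LINT s:{0..}|lborel. g (exp (- s)) * exp (- s) * k s) = (\<integral>s. w s * k s \<partial>lborel)" for k
      unfolding set_lebesgue_integral_def
    proof (rule Bochner_Integration.integral_cong[OF refl])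
      fix s :: real
      show "indicator {0..} s *\<^sub>R (g (exp (- s)) * exp (- s) * k s) = w s * k s"
      proof (cases "0 \<le> s")
        case True
        then show ?thesis by (simp add: w_def)
      next
        case False
        then have "w s = 0" using t by (intro w_supp) auto
        then show ?thesis using False by simp
      qed
    qed
    have fint: "integrable lborel (\<lambda>s. w s * f n s)" for n using f_bounds by (intro bnd_int[where K = 1]) auto
    have Fint: "integrable lborel (\<lambda>s. w s * F s)" using F by (intro bnd_int[where K = 1]) auto
    have "(\<lambda>n. LINT s:{0..}|lborel. g (exp (- s)) * exp (- s) * (f n s - F s)) \<longlonglongrightarrow> 0"
    proof (rule laplace_weierstrass)
      show "\<bar>f n s - F s\<bar> \<le> 1" if "0 \<le> s" for n s using f_bounds[OF that, of n] F[OF that] by auto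
      show "(\<lambda>n. LINT t:{0..}|lborel. exp (- (real k * t)) * (f n t - F t)) \<longlonglongrightarrow> 0" if "0 < k" for k
        using conv[of "real k"] that by simp
    qed (use gc in auto)
    then have "(\<lambda>n. (\<integral>s. w s * f n s \<partial>lborel) - (\<integral>s. w s * F s \<partial>lborel)) \<longlonglongrightarrow> 0"
      unfolding lint unfolding right_diff_distrib Bochner_Integration.integral_diff[OF fint Fint] .
    then have flim: "(\<lambda>n. \<integral>s. w s * f n s \<partial>lborel) \<longlonglongrightarrow> (\<integral>s. w s * F s \<partial>lborel)"
      by (rule LIM_zero_cancel)
    have Gnint: "integrable lborel (\<lambda>s. w s * Gn n s)" for n using Gn_nonneg Gn_le_1 by (intro bnd_int[where K = 1]) auto
    have Gint: "integrable lborel (\<lambda>s. w s * G q s)" using G_bounds by (intro bnd_int[where K = 1]) auto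
    have Glim: "(\<lambda>n. \<integral>s. w s * Gn n s \<partial>lborel) \<longlonglongrightarrow> (\<integral>s. w s * G q s \<partial>lborel)"
    proof (rule integral_dominated_convergence[OF _ _ Wint])
      show "AE s in lborel. (\<lambda>n. w s * Gn n s) \<longlonglongrightarrow> w s * G q s"
      proof (rule AE_I2)
        fix s :: real
        show "(\<lambda>n. w s * Gn n s) \<longlonglongrightarrow> w s * G q s"
        proof (cases "0 \<le> s")
          case True
          then show ?thesis by (intro tendsto_mult_left Gn_tendsto)
        next
          case False
          then have "w s = 0" using t by (intro w_supp) auto
          then show ?thesis by simp
        qed
      qed
      show "AE s in lborel. norm (w s * Gn n s) \<le> w s" for n
      proof (rule AE_I2)
        fix s :: real
        show "norm (w s * Gn n s) \<le> w s"
        proof (cases "0 \<le> s")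
          case True
          have "\<bar>Gn n s\<bar> \<le> 1" using Gn_nonneg[OF True, of n] Gn_le_1[OF True, of n] by simp
          then have "w s * \<bar>Gn n s\<bar> \<le> w s * 1" using w0 by (intro mult_left_mono)
          then show ?thesis using w0[of s] by (simp add: abs_mult)
        next
          case False
          then have "w s = 0" using t by (intro w_supp) auto
          then show ?thesis by simp
        qed
      qed
    qed measurable
    have "(\<integral>s. w s * G q s \<partial>lborel) \<le> (\<integral>s. w s * F s \<partial>lborel)"
    proof (rule LIMSEQ_le[OF Glim flim])
      have "(\<integral>s. w s * Gn n s \<partial>lborel) \<le> (\<integral>s. w s * f n s \<partial>lborel)" for n
      proof (rule integral_mono[OF Gnint fint])
        fix s :: real
        show "w s * Gn n s \<le> w s * f n s"
          by (rule wmono, rule f_sandwich(1)) (use t in simp)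
      qed
      then show "\<exists>N. \<forall>n\<ge>N. (\<integral>s. w s * Gn n s \<partial>lborel) \<le> (\<integral>s. w s * f n s \<partial>lborel)" by blast
    qed
    moreover have "(\<integral>s. w s * F s \<partial>lborel) \<le> (\<integral>s. w s * F t \<partial>lborel)"
    proof (rule integral_mono[OF Fint])
      fix s :: real
      show "w s * F s \<le> w s * F t"
        by (rule wmono, rule F_anti) (use t in auto)
    qed (intro integrable_mult_left Wint)
    moreover have "(\<integral>s. w s * G q (t + h) \<partial>lborel) \<le> (\<integral>s. w s * G q s \<partial>lborel)"
    proof (rule integral_mono[OF _ Gint])
      fix s :: real
      show "w s * G q (t + h) \<le> w s * G q s"
        by (rule wmono, rule G_antimono[OF q]) (use t in auto)
    qed (intro integrable_mult_left Wint)
    ultimately have 1: "W * G q (t + h) \<le> W * F t" by (simp add: W_def)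
    have "(\<integral>s. w s * F s \<partial>lborel) \<le> (\<integral>s. w s * G q s \<partial>lborel) + W * exp (- (t / a0))"
    proof (rule LIMSEQ_le[OF flim tendsto_add[OF Glim tendsto_const]])
      have "(\<integral>s. w s * f n s \<partial>lborel) \<le> (\<integral>s. w s * Gn n s + w s * exp (- (t / a0)) \<partial>lborel)" for n
      proof (rule integral_mono[OF fint])
        fix s :: real
        show "w s * f n s \<le> w s * Gn n s + w s * exp (- (t / a0))"
        proof (cases "s \<in> {t..t + h}")
          case True
          then have "0 \<le> s" "t / a0 \<le> s / a0" using t a0_pos by (auto intro: divide_right_mono)
          then have "exp (- (s / a0)) \<le> exp (- (t / a0))" by simp
          then have "f n s \<le> Gn n s + exp (- (t / a0))" using f_sandwich(2)[OF \<open>0 \<le> s\<close>, of n] by linarith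
          then show ?thesis unfolding distrib_left[symmetric] using w0 by (intro mult_left_mono)
        qed (simp add: w_supp)
      qed (intro Bochner_Integration.integrable_add Gnint integrable_mult_left Wint)
      then show "\<exists>N. \<forall>n\<ge>N. (\<integral>s. w s * f n s \<partial>lborel) \<le> (\<integral>s. w s * Gn n s \<partial>lborel) + W * exp (- (t / a0))"
        unfolding W_def integral_mult_left_zero[symmetric] Bochner_Integration.integral_add[OF Gnint integrable_mult_left[OF Wint], symmetric]
        by blast
    qed
    moreover have "(\<integral>s. w s * F (t + h) \<partial>lborel) \<le> (\<integral>s. w s * F s \<partial>lborel)"
    proof (rule integral_mono[OF _ Fint])
      fix s :: real
      show "w s * F (t + h) \<le> w s * F s"
        by (rule wmono, rule F_anti) (use t in auto)
    qed (intro integrable_mult_left Wint)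
    moreover have "(\<integral>s. w s * G q s \<partial>lborel) \<le> (\<integral>s. w s * G q t \<partial>lborel)"
    proof (rule integral_mono[OF Gint])
      fix s :: real
      show "w s * G q s \<le> w s * G q t"
        by (rule wmono, rule G_antimono[OF q]) (use t in auto)
    qed (intro integrable_mult_left Wint)
    ultimately have "W * F (t + h) \<le> W * G q t + W * exp (- (t / a0))" by (simp add: W_def)
    then have 2: "W * F (t + h) \<le> W * (G q t + exp (- (t / a0)))" by (simp add: distrib_left)
    show ?thesis using mult_le_cancel_left_pos[OF W] 1 2 by blast
  qed
  \<comment> \<open>The lower bound is used with \<open>G\<close> at \<open>t + t * e n\<close>, the
    upper one with \<open>G\<close> at \<open>t - t * e n\<close>. In both cases \<open>F\<close>
    stays at \<open>t\<close> and only the argument of the continuous \<open>G\<close>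
    moves.\<close>
  have up: "(\<lambda>n. t + t * e n) \<longlonglongrightarrow> t" and dn: "(\<lambda>n. t - t * e n) \<longlonglongrightarrow> t"
    using tendsto_add[OF tendsto_const[of t] tendsto_mult_left[OF e_facts(2), of t]]
      tendsto_diff[OF tendsto_const[of t] tendsto_mult_left[OF e_facts(2), of t]] by simp_all
  have e1: "e n \<le> 1" for n by (simp add: e_def)
  have te: "0 < t * e n" "t * e n \<le> t" for n using t e_facts(1)[of n] e1[of n] by auto
  show "G q t \<le> F t"
  proof (rule LIMSEQ_le_const2)
    show "(\<lambda>n. G q (t + t * e n)) \<longlonglongrightarrow> G q t"
      by (rule G_tendsto[OF q up]) (use te t in \<open>simp add: add_nonneg_nonneg less_imp_le\<close>)
    show "\<exists>N. \<forall>n\<ge>N. G q (t + t * e n) \<le> F t" using main[of t] te t by auto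
  qed
  show "F t \<le> G q t + exp (- (t / a0))"
  proof (rule LIMSEQ_le_const)
    have "(\<lambda>n. G q (t - t * e n)) \<longlonglongrightarrow> G q t"
      by (rule G_tendsto[OF q dn]) (use te in simp)
    then show "(\<lambda>n. G q (t - t * e n) + exp (- ((t - t * e n) / a0))) \<longlonglongrightarrow> G q t + exp (- (t / a0))"
      using a0_pos by (intro tendsto_add tendsto_exp tendsto_minus tendsto_divide dn tendsto_const) auto
    show "\<exists>N. \<forall>n\<ge>N. F t \<le> G q (t - t * e n) + exp (- ((t - t * e n) / a0))"
    proof (intro exI allI impI)
      fix n
      show "F t \<le> G q (t - t * e n) + exp (- ((t - t * e n) / a0))"
        using main[of "t - t * e n" "t * e n"] te[of n] by simp
    qed
  qed
qed

end

end

section \<open>Regular variation of the exponent\<close>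

lemma not_LIMSEQ_subseq:
  fixes X :: "nat \<Rightarrow> 'a::metric_space"
  assumes "\<not> X \<longlonglongrightarrow> L"
  obtains e r where "0 < e" "strict_mono (r :: nat \<Rightarrow> nat)" "\<And>n. e \<le> dist (X (r n)) L"
proof -
  from assms obtain e where e: "0 < e" "\<And>N. \<exists>n\<ge>N. e \<le> dist (X n) L"
    by (auto simp: lim_sequentially not_less)
  have "infinite {n. e \<le> dist (X n) L}"
    unfolding infinite_nat_iff_unbounded_le using e(2) by auto
  from infinite_enumerate[OF this] show ?thesis using that e(1) by auto
qed

text \<open>The principal power function, the limit of the rescaled Phi for
  \<open>p = \<gamma> + 1\<close>. For \<open>1 < p \<le> 2\<close>, exp(r * stab p (ix)) is the
  Fourier transform of a completely asymmetric stable law, Gaussian for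
  \<open>p = 2\<close>.\<close>

definition stab :: "real \<Rightarrow> complex \<Rightarrow> complex" where
  "stab p s = (if s = 0 then 0 else s powr (of_real p))"

lemma stab_holomorphic: "stab p holomorphic_on {s. 0 < Re s}"
proof -
  have "(\<lambda>s. s powr (of_real p)) holomorphic_on {s. 0 < Re s}"
    by (intro holomorphic_intros) (auto simp: complex_nonpos_Reals_iff)
  then show ?thesis by (rule holomorphic_transform) (auto simp: stab_def)
qed

lemma stab_of_real: "0 < x \<Longrightarrow> stab p (of_real x) = of_real (x powr p)"
  by (simp add: stab_def powr_of_real[symmetric] less_imp_le)

lemma continuous_stab: "s \<noteq> 0 \<Longrightarrow> 0 \<le> Re s \<Longrightarrow> isCont (stab p) s"
proof -
  assume s: "s \<noteq> 0" "0 \<le> Re s"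
  then have "s \<notin> \<real>\<^sub>\<le>\<^sub>0" by (auto simp: complex_nonpos_Reals_iff complex_eq_iff)
  then have "isCont (\<lambda>s. s powr (of_real p)) s" by (intro continuous_intros) auto
  moreover have "eventually (\<lambda>s. s powr (of_real p) = stab p s) (nhds s)"
    using eventually_nhds_in_open[of "- {0}" s] s by (auto elim!: eventually_mono simp: stab_def open_delete)
  ultimately show ?thesis by (rule isCont_cong[THEN iffD1, rotated])
qed

lemma norm_stab: "norm (stab p s) = norm s powr p"
  by (simp add: stab_def norm_powr_real_powr')

lemma stab_imag:
  fixes y :: real
  assumes False: "y \<noteq> 0"
  shows "stab p (\<i> * of_real y) = exp (of_real p * (of_real (ln \<bar>y\<bar>) + \<i> * of_real (sgn y * pi / 2)))"
proof -
  define z where "z = Complex (ln \<bar>y\<bar>) (sgn y * pi / 2)"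
  have sc: "sin (sgn y * pi / 2) = sgn y" "cos (sgn y * pi / 2) = 0"
    using False by (cases "0 < y"; simp add: sgn_if)+
  have "exp z = \<i> * of_real y"
  proof -
    have "\<bar>y\<bar> * sgn y = y" by (simp add: sgn_if abs_if)
    moreover have "exp (ln \<bar>y\<bar>) = \<bar>y\<bar>" using False by (intro exp_ln) simp
    moreover have "Re (exp z) = exp (ln \<bar>y\<bar>) * cos (sgn y * pi / 2)" "Im (exp z) = exp (ln \<bar>y\<bar>) * sin (sgn y * pi / 2)"
      by (simp_all add: z_def Re_exp Im_exp)
    ultimately have "Re (exp z) = 0" "Im (exp z) = y" unfolding sc by simp_all
    then show ?thesis by (intro complex_eqI) simp_all
  qed
  moreover have "- pi < Im z" "Im z \<le> pi"
    using pi_gt_zero by (auto simp: z_def sgn_if)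
  ultimately have "Ln (\<i> * of_real y) = z" using Ln_exp[of z] by simp
  also have "z = of_real (ln \<bar>y\<bar>) + \<i> * of_real (sgn y * pi / 2)"
    by (simp add: z_def complex_eq_iff)
  finally have "Ln (\<i> * of_real y) = of_real (ln \<bar>y\<bar>) + \<i> * of_real (sgn y * pi / 2)" .
  then show ?thesis using False by (simp add: stab_def powr_def)
qed

lemma Re_stab_imag:
  fixes y :: real
  shows "Re (stab p (\<i> * of_real y)) = (if y = 0 then 0 else \<bar>y\<bar> powr p * cos (p * pi / 2))"
proof (cases "y = 0")
  case False
  then have "stab p (\<i> * of_real y) = exp (of_real p * (of_real (ln \<bar>y\<bar>) + \<i> * of_real (sgn y * pi / 2)))"
    by (rule stab_imag)
  also have "\<dots> = exp (Complex (p * ln \<bar>y\<bar>) (p * (sgn y * pi / 2)))"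
    by (rule arg_cong[where f = exp]) (simp add: complex_eq_iff)
  also have "Re \<dots> = exp (p * ln \<bar>y\<bar>) * cos (p * (sgn y * pi / 2))" by (simp add: Re_exp)
  also have "cos (p * (sgn y * pi / 2)) = cos (p * pi / 2)" using False by (cases "0 < y") (auto simp: sgn_if)
  finally show ?thesis using False by (simp add: powr_def)
qed (simp add: stab_def)

section \<open>Rescaled exponents near 0\<close>

locale levy_rv = levy_data +
  fixes \<gamma> :: real
  assumes gamma: "0 < \<gamma>" "\<gamma> \<le> 1"
    and rv: "\<And>l. 0 < l \<Longrightarrow> ((\<lambda>x. rphi (l * x) / rphi x) \<longlongrightarrow> l powr \<gamma>) (at_right 0)"
begin

text \<open>Half of the interval suffices: the integral over \<open>[x / 2, x]\<close> is at least
  \<open>(x / 2) * rphi (x / 2)\<close>, and \<open>rphi (x / 2)\<close> is at least half of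
  \<open>rphi x\<close>. This lets \<open>rPhi l\<close> take the place of \<open>l * rphi l\<close>
  as a normalisation.\<close>

lemma rphi_le_rPhi:
  assumes "0 < x"
  shows "x * rphi x \<le> 4 * rPhi x"
proof -
  have "rphi (2 * (x / 2)) \<le> 2 * rphi (x / 2)" using assms by (intro rphi_scale) auto
  then have 1: "rphi x \<le> 2 * rphi (x / 2)" by simp
  have "((\<lambda>_. rphi (x / 2)) has_integral ((x - x / 2) * rphi (x / 2))) {x / 2..x}"
    using has_integral_const_real[of "rphi (x / 2)" "x / 2" x] assms by simp
  from has_integral_le[OF this integral_rphi[of "x / 2" x]] rphi_mono assms
  have 2: "(x / 2) * rphi (x / 2) \<le> rPhi x - rPhi (x / 2)" by simp
  have 3: "0 \<le> rPhi (x / 2)"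
    using integral_rphi[of 0 "x / 2"] has_integral_nonneg[of rphi _ "{0..x / 2}"] rphi_nonneg assms by fastforce
  have "x * rphi x \<le> x * (2 * rphi (x / 2))" using 1 assms by (intro mult_left_mono) auto
  also have "\<dots> \<le> 4 * rPhi x" using 2 3 by simp
  finally show ?thesis .
qed

text \<open>Equicontinuity of the rescaled functions, up to and including the imaginary axis. The
  constant 12 is 3 from \<open>norm_cphi_le\<close> times 4 from \<open>rphi_le_rPhi\<close>; the
  factor \<open>R\<close> comes from \<open>rphi_scale\<close>.\<close>

lemma cPhi_lipschitz:
  assumes "0 \<le> Re s" "0 \<le> Re s'" "norm s \<le> R" "norm s' \<le> R" "0 < l" "1 \<le> R"
  shows "norm (cPhi (of_real l * s) - cPhi (of_real l * s')) \<le> 12 * R * norm (s - s') * rPhi l"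
proof -
  have "norm (cPhi (of_real l * s) - cPhi (of_real l * s')) \<le> 3 * rphi (R * l) * norm (of_real l * s - of_real l * s')"
  proof (rule field_differentiable_bound)
    let ?S = "{z. 0 \<le> Re z} \<inter> cball 0 (R * l)"
    show "convex ?S" using convex_halfspace_Re_ge[of 0] by (intro convex_Int) auto
    fix z assume z: "z \<in> ?S"
    show "(cPhi has_field_derivative cphi z) (at z within ?S)"
      using z by (intro DERIV_subset[OF cPhi_derivative]) auto
    have "norm (cphi z) \<le> 3 * rphi (norm z)" using z by (intro norm_cphi_le) auto
    also have "\<dots> \<le> 3 * rphi (R * l)" using z rphi_mono[of "norm z" "R * l"] by simp
    finally show "norm (cphi z) \<le> 3 * rphi (R * l)" .
  qed (use assms in \<open>auto simp: norm_mult mult.commute[of R] intro!: mult_left_mono\<close>)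
  also have "norm (of_real l * s - of_real l * s') = l * norm (s - s')"
    using assms by (simp add: right_diff_distrib[symmetric] norm_mult)
  also have "3 * rphi (R * l) * (l * norm (s - s')) \<le> 3 * (R * rphi l) * (l * norm (s - s'))"
    using rphi_scale[of R l] assms by (intro mult_right_mono) auto
  also have "\<dots> = 3 * R * norm (s - s') * (l * rphi l)" by simp
  also have "\<dots> \<le> 3 * R * norm (s - s') * (4 * rPhi l)"
    using rphi_le_rPhi assms by (intro mult_left_mono) auto
  finally show ?thesis by simp
qed

context
  fixes lam :: "nat \<Rightarrow> real"
  assumes lam_pos: "\<And>n. 0 < lam n" and lam_0: "lam \<longlonglongrightarrow> 0"
begin

lemma lam_filter: "filterlim lam (at_right 0) sequentially"
proof -
  have "lam n \<noteq> 0" for n using lam_pos[of n] by linarith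
  then show ?thesis using lam_0 lam_pos by (simp add: filterlim_at)
qed

lemma rphi_ratio: "0 < l \<Longrightarrow> (\<lambda>n. rphi (l * lam n) / rphi (lam n)) \<longlonglongrightarrow> l powr \<gamma>"
  using filterlim_compose[OF rv lam_filter] .

text \<open>The direct half of Karamata's theorem: regular variation is integrated over
  \<open>[0, s]\<close>, the ratio being dominated by the constant \<open>max 1 s\<close> thanks to
  monotonicity and concavity.\<close>

lemma rPhi_ratio_aux:
  assumes s: "0 < s"
  shows "(\<lambda>n. rPhi (s * lam n) / (lam n * rphi (lam n))) \<longlonglongrightarrow> s powr (\<gamma> + 1) / (\<gamma> + 1)"
proof -
  define M where "M = max 1 s"
  have intn: "((\<lambda>x. rphi (lam n * x) / rphi (lam n)) has_integral (rPhi (s * lam n) / (lam n * rphi (lam n)))) {0..s}" for n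
  proof -
    have "mono_on {0..} (\<lambda>u. rphi (0 + lam n * u))"
      using lam_pos[of n] by (auto simp: mono_on_def intro!: rphi_mono)
    then have "(\<lambda>u. rphi (0 + lam n * u)) integrable_on {0..s}" by (rule integrable_on_mono_interval) simp
    then have "((\<lambda>x. rphi (0 + lam n * x)) has_integral ((rPhi (0 + lam n * s) - rPhi 0) / lam n)) {0..s}"
      using integral_rphi_affine[of 0 "lam n" s] lam_pos[of n] s by (metis integrable_integral less_imp_le order_refl)
    then have "((\<lambda>x. rphi (lam n * x)) has_integral (rPhi (s * lam n) / lam n)) {0..s}"
      by (simp add: mult.commute)
    from has_integral_divide[OF this, of "rphi (lam n)"] show ?thesis by simp
  qed
  have "(\<lambda>n. integral {0..s} (\<lambda>x. rphi (lam n * x) / rphi (lam n))) \<longlonglongrightarrow> integral {0..s} (\<lambda>x. x powr \<gamma>)"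
  proof (rule dominated_convergence(2))
    show "(\<lambda>x. rphi (lam n * x) / rphi (lam n)) integrable_on {0..s}" for n using intn by (rule has_integral_integrable)
    show "(\<lambda>x. M) integrable_on {0..s}" by (rule integrable_continuous_interval) (rule continuous_on_const)
    show "norm (rphi (lam n * x) / rphi (lam n)) \<le> M" if "x \<in> {0..s}" for n x
    proof -
      have "rphi (lam n * x) \<le> rphi (M * lam n)"
      proof (rule rphi_mono)
        show "0 \<le> lam n * x" using that lam_pos[of n] by simp
        have "lam n * x \<le> lam n * M" using that lam_pos[of n] by (intro mult_left_mono) (auto simp: M_def)
        then show "lam n * x \<le> M * lam n" by (simp add: mult.commute)
      qed
      also have "\<dots> \<le> M * rphi (lam n)" using lam_pos[of n] by (intro rphi_scale) (auto simp: M_def)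
      finally show ?thesis using that rphi_pos[OF lam_pos[of n]] rphi_nonneg[of "lam n * x"] lam_pos[of n]
        by (simp add: divide_le_eq)
    qed
    show "(\<lambda>n. rphi (lam n * x) / rphi (lam n)) \<longlonglongrightarrow> x powr \<gamma>" if "x \<in> {0..s}" for x
      using rphi_ratio[of x] that by (cases "x = 0") (auto simp: mult.commute)
  qed
  also have "integral {0..s} (\<lambda>x. x powr \<gamma>) = s powr (\<gamma> + 1) / (\<gamma> + 1)"
    using has_integral_powr_from_0[of \<gamma> s] gamma s by (simp add: integral_unique)
  finally show ?thesis unfolding integral_unique[OF intn] .
qed

lemma rPhi_ratio:
  assumes s: "0 < s"
  shows "(\<lambda>n. rPhi (s * lam n) / rPhi (lam n)) \<longlonglongrightarrow> s powr (\<gamma> + 1)"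
proof -
  have lim: "(\<lambda>n. (rPhi (s * lam n) / (lam n * rphi (lam n))) / (rPhi (1 * lam n) / (lam n * rphi (lam n))))
     \<longlonglongrightarrow> (s powr (\<gamma> + 1) / (\<gamma> + 1)) / (1 powr (\<gamma> + 1) / (\<gamma> + 1))"
    using gamma by (intro tendsto_divide rPhi_ratio_aux s) auto
  have eq: "(rPhi (s * lam n) / (lam n * rphi (lam n))) / (rPhi (1 * lam n) / (lam n * rphi (lam n))) = rPhi (s * lam n) / rPhi (lam n)" for n
  proof -
    have "lam n * rphi (lam n) \<noteq> 0" using lam_pos[of n] rphi_pos[OF lam_pos[of n]] by simp
    then show ?thesis by simp
  qed
  from lim have "(\<lambda>n. rPhi (s * lam n) / rPhi (lam n)) \<longlonglongrightarrow> (s powr (\<gamma> + 1) / (\<gamma> + 1)) / (1 powr (\<gamma> + 1) / (\<gamma> + 1))"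
    unfolding eq .
  then show ?thesis using gamma by simp
qed

definition fn :: "nat \<Rightarrow> complex \<Rightarrow> complex" where
  "fn n s = cPhi (of_real (lam n) * s) / of_real (rPhi (lam n))"

lemma fn_lipschitz:
  assumes "0 \<le> Re s" "0 \<le> Re s'" "norm s \<le> R" "norm s' \<le> R" "1 \<le> R"
  shows "norm (fn n s - fn n s') \<le> 12 * R * norm (s - s')"
proof -
  have p: "0 < rPhi (lam n)" by (rule rPhi_pos[OF lam_pos])
  have "norm (fn n s - fn n s') = norm (cPhi (of_real (lam n) * s) - cPhi (of_real (lam n) * s')) / rPhi (lam n)"
    using p by (simp add: fn_def diff_divide_distrib[symmetric] norm_divide)
  also have "\<dots> \<le> 12 * R * norm (s - s')"
    using cPhi_lipschitz[OF assms(1-4) lam_pos[of n] assms(5)] p by (simp add: divide_le_eq)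
  finally show ?thesis .
qed

lemma fn_bound:
  assumes "0 \<le> Re s" "norm s \<le> R" "1 \<le> R"
  shows "norm (fn n s) \<le> 12 * R * R"
proof -
  have "norm (fn n s - fn n 0) \<le> 12 * R * norm (s - 0)" using assms by (intro fn_lipschitz) auto
  also have "\<dots> \<le> 12 * R * R" using assms by (intro mult_left_mono) auto
  finally show ?thesis by (simp add: fn_def)
qed

lemma fn_holomorphic: "fn n holomorphic_on {s. 0 < Re s}"
proof -
  have "(cPhi \<circ> (\<lambda>s. of_real (lam n) * s)) holomorphic_on {s. 0 < Re s}"
    by (rule holomorphic_on_compose_gen[OF _ holomorphic_cPhi]) (use lam_pos in \<open>auto intro!: holomorphic_intros\<close>)
  then show ?thesis
    unfolding fn_def[abs_def] o_def using rPhi_pos[OF lam_pos[of n]] by (intro holomorphic_intros) auto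
qed

lemma fn_of_real:
  assumes "0 < x"
  shows "(\<lambda>n. fn n (of_real x)) \<longlonglongrightarrow> stab (\<gamma> + 1) (of_real x)"
proof -
  have "fn n (of_real x) = of_real (rPhi (x * lam n) / rPhi (lam n))" for n
    using cPhi_of_real[of "lam n * x"] assms lam_pos[of n] by (simp add: fn_def mult.commute)
  then show ?thesis unfolding stab_of_real[OF assms] by (simp only:) (intro tendsto_of_real rPhi_ratio assms)
qed

text \<open>Vitali's argument: by Montel's theorem every subsequence has a locally uniformly convergent
  subsequence, whose limit is determined by its values on the positive half-line.\<close>
lemma fn_tendsto_interior:
  assumes s: "0 < Re s"
  shows "(\<lambda>n. fn n s) \<longlonglongrightarrow> stab (\<gamma> + 1) s"
proof (rule ccontr)
  assume "\<not> ?thesis"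
  then obtain e r where e: "0 < e" and r: "strict_mono (r :: nat \<Rightarrow> nat)" and er: "\<And>n. e \<le> dist (fn (r n) s) (stab (\<gamma> + 1) s)"
    by (rule not_LIMSEQ_subseq) blast
  let ?S = "{s::complex. 0 < Re s}"
  obtain g k where g: "g holomorphic_on ?S" and k: "strict_mono (k :: nat \<Rightarrow> nat)"
     and lim: "\<And>x. x \<in> ?S \<Longrightarrow> (\<lambda>n. fn (r (k n)) x) \<longlonglongrightarrow> g x"
  proof (rule Montel[of ?S "range fn" "\<lambda>n. fn (r n)"])
    show "open ?S" using open_halfspace_Re_gt[of 0] by simp
    show "h holomorphic_on ?S" if "h \<in> range fn" for h using that fn_holomorphic by auto
    show "\<exists>B. \<forall>h\<in>range fn. \<forall>z\<in>K. norm (h z) \<le> B" if K: "compact K" "K \<subseteq> ?S" for K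
    proof -
      obtain R0 where R0: "\<And>z. z \<in> K \<Longrightarrow> norm z \<le> R0" using compact_imp_bounded[OF K(1)] by (auto simp: bounded_iff)
      have "norm (fn n z) \<le> 12 * max 1 R0 * max 1 R0" if "z \<in> K" for n z
        using that K(2) R0[OF that] by (intro fn_bound) (auto simp: max_def)
      then show ?thesis by blast
    qed
  qed (auto intro: that)
  have gs: "g s - stab (\<gamma> + 1) s = 0"
  proof (rule analytic_continuation[where f = "\<lambda>s. g s - stab (\<gamma> + 1) s" and S = ?S and U = "of_real ` {0<..}" and \<xi> = 1])
    show "(\<lambda>s. g s - stab (\<gamma> + 1) s) holomorphic_on ?S" by (intro holomorphic_intros g stab_holomorphic)
    show "open ?S" using open_halfspace_Re_gt[of 0] by simp
    show "connected ?S" using convex_halfspace_Re_gt[of 0] by (intro convex_connected) simp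
    show "of_real ` {0<..} \<subseteq> ?S" "1 \<in> ?S" "s \<in> ?S" using s by auto
    show "(1::complex) islimpt of_real ` {0<..}"
    proof -
      have "(\<lambda>n. 1 + 1 / real (Suc n)) \<longlonglongrightarrow> 1" by real_asymp
      then have "(\<lambda>n. complex_of_real (1 + 1 / real (Suc n))) \<longlonglongrightarrow> of_real 1" by (rule tendsto_of_real)
      then have lim1: "(\<lambda>n. complex_of_real (1 + 1 / real (Suc n))) \<longlonglongrightarrow> 1" by simp
      have mem: "complex_of_real (1 + 1 / real (Suc n)) \<in> of_real ` {0<..} - {1}" for n
      proof -
        have p: "0 < 1 / real (Suc n)" by simp
        have "complex_of_real (1 + 1 / real (Suc n)) \<noteq> of_real 1"
          unfolding of_real_eq_iff using p by linarith
        moreover have "1 + 1 / real (Suc n) \<in> {0<..}" using p unfolding greaterThan_iff by linarith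
        ultimately show ?thesis by (metis DiffI imageI of_real_1 singletonD)
      qed
      show ?thesis unfolding islimpt_sequential
        by (rule exI[of _ "\<lambda>n. complex_of_real (1 + 1 / real (Suc n))"]) (intro conjI allI mem lim1)
    qed
    show "g z - stab (\<gamma> + 1) z = 0" if "z \<in> of_real ` {0<..}" for z
    proof -
      from that obtain x where x: "z = of_real x" "0 < x" by auto
      have "(\<lambda>n. fn (r (k n)) z) \<longlonglongrightarrow> stab (\<gamma> + 1) z"
        using LIMSEQ_subseq_LIMSEQ[OF fn_of_real[OF x(2)] strict_mono_o[OF r k]] by (simp add: o_def x(1))
      moreover have "(\<lambda>n. fn (r (k n)) z) \<longlonglongrightarrow> g z" using x by (intro lim) auto
      ultimately show ?thesis using LIMSEQ_unique by auto
    qed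
  qed
  have "(\<lambda>n. dist (fn (r (k n)) s) (stab (\<gamma> + 1) s)) \<longlonglongrightarrow> dist (g s) (stab (\<gamma> + 1) s)"
    using s by (intro tendsto_dist lim tendsto_const) auto
  then have "e \<le> dist (g s) (stab (\<gamma> + 1) s)"
    by (rule LIMSEQ_le_const) (use er in auto)
  then show False using gs e by simp
qed

text \<open>Montel's theorem reaches only the open half-plane. Boundary points are compared with
  points slightly to their right, the Lipschitz bound being uniform in \<open>n\<close> and the
  limit continuous.\<close>

lemma fn_tendsto:
  assumes s: "0 \<le> Re s"
  shows "(\<lambda>n. fn n s) \<longlonglongrightarrow> stab (\<gamma> + 1) s"
proof (cases "s = 0")
  case True
  then show ?thesis by (simp add: fn_def stab_def)
next
  case False
  define R where "R = norm s + 1"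
  have R: "1 \<le> R" by (simp add: R_def)
  show ?thesis
  proof (rule LIMSEQ_I)
    fix e :: real assume e: "0 < e"
    from continuous_stab[OF False s, of "\<gamma> + 1"] e
    obtain d where d: "0 < d" "\<And>z. dist z s < d \<Longrightarrow> dist (stab (\<gamma> + 1) z) (stab (\<gamma> + 1) s) < e / 3"
      unfolding continuous_at_eps_delta by (metis divide_pos_pos zero_less_numeral)
    \<comment> \<open>Below the continuity radius \<open>d\<close>, and small enough for the
      Lipschitz error \<open>12 * R * h\<close> to be at most \<open>e / 3\<close>;
      \<open>h \<le> 1\<close> keeps \<open>z\<close> in the ball of radius
      \<open>R\<close>.\<close>
    define h where "h = min (min (d / 2) 1) (e / (36 * R))"
    have h: "0 < h" "h < d" "h \<le> 1" "12 * R * h \<le> e / 3"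
    proof -
      show "0 < h" using d e R by (simp add: h_def)
      show "h < d" using d by (simp add: h_def min_def)
      show "h \<le> 1" by (simp add: h_def)
      have "12 * R * h \<le> 12 * R * (e / (36 * R))" using R by (intro mult_left_mono) (auto simp: h_def)
      then show "12 * R * h \<le> e / 3" using R by simp
    qed
    define z where "z = s + of_real h"
    have z: "0 < Re z" "dist z s = h" "norm z \<le> R"
    proof -
      show "0 < Re z" "dist z s = h" using s h by (auto simp: z_def dist_norm)
      have "norm z \<le> norm s + h" unfolding z_def using norm_triangle_ineq[of s "of_real h"] h by simp
      then show "norm z \<le> R" using h by (simp add: R_def)
    qed
    obtain N where N: "\<And>n. N \<le> n \<Longrightarrow> norm (fn n z - stab (\<gamma> + 1) z) < e / 3"
      using LIMSEQ_D[OF fn_tendsto_interior[OF z(1)], of "e / 3"] e by auto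
    show "\<exists>no. \<forall>n\<ge>no. norm (fn n s - stab (\<gamma> + 1) s) < e"
    proof (intro exI allI impI)
      fix n assume "N \<le> n"
      have 1: "norm (fn n s - fn n z) \<le> 12 * R * norm (s - z)"
        using s z R by (intro fn_lipschitz) (auto simp: R_def)
      have 2: "norm (s - z) = h" using h by (simp add: z_def)
      have 3: "norm (stab (\<gamma> + 1) z - stab (\<gamma> + 1) s) < e / 3" using d(2)[of z] z h by (simp add: dist_norm)
      have "fn n s - stab (\<gamma> + 1) s = (fn n s - fn n z) + ((fn n z - stab (\<gamma> + 1) z) + (stab (\<gamma> + 1) z - stab (\<gamma> + 1) s))" by simp
      also have "norm \<dots> \<le> norm (fn n s - fn n z) + (norm (fn n z - stab (\<gamma> + 1) z) + norm (stab (\<gamma> + 1) z - stab (\<gamma> + 1) s))"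
        by (intro order_trans[OF norm_triangle_ineq] add_left_mono norm_triangle_ineq)
      finally show "norm (fn n s - stab (\<gamma> + 1) s) < e"
        using 1[unfolded 2] 3 N[OF \<open>N \<le> n\<close>] h(4) by linarith
    qed
  qed
qed

end

end

section \<open>Asymptotics of the density\<close>

lemma integrable_exp_abs:
  fixes \<kappa> :: real
  assumes kx: "0 < \<kappa>"
  shows "integrable lborel (\<lambda>y. exp (- (\<kappa> * \<bar>y\<bar>)))"
proof (rule integrable_power_decay[where p = 2 and K = "max 1 (2 / \<kappa>^2)"])
  fix y :: real
  show "norm (exp (- (\<kappa> * \<bar>y\<bar>))) \<le> max 1 (2 / \<kappa>^2)" using kx by (simp add: le_max_iff_disj)
  assume y: "1 \<le> \<bar>y\<bar>"
  define z where "z = \<kappa> * \<bar>y\<bar>"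
  have z: "0 < z" using kx y by (simp add: z_def)
  have "z^2 / 2 \<le> exp z" using exp_lower_Taylor_quadratic[of z] z by simp
  then have "1 / exp z \<le> 1 / (z^2 / 2)" using z by (intro frac_le) auto
  also have "\<dots> = (2 / \<kappa>^2) * \<bar>y\<bar> powr - 2"
    using y by (simp add: z_def power_mult_distrib powr_minus_divide)
  also have "\<dots> \<le> max 1 (2 / \<kappa>^2) * \<bar>y\<bar> powr - 2" by (intro mult_right_mono) auto
  finally show "norm (exp (- (\<kappa> * \<bar>y\<bar>))) \<le> max 1 (2 / \<kappa>^2) * \<bar>y\<bar> powr - 2"
    by (simp add: z_def exp_minus inverse_eq_divide)
qed auto

lemma continuous_on_stab:
  assumes "0 < p"
  shows "continuous_on {s. 0 \<le> Re s} (stab p)"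
proof (intro continuous_at_imp_continuous_on ballI)
  fix s :: complex assume s: "s \<in> {s. 0 \<le> Re s}"
  show "isCont (stab p) s"
  proof (cases "s = 0")
    case True
    have n0: "((\<lambda>s::complex. norm s) \<longlongrightarrow> 0) (at 0)"
      by (rule tendsto_norm_zero[OF tendsto_ident_at])
    have "((\<lambda>s::complex. norm s powr p) \<longlongrightarrow> 0 powr p) (at 0)"
      using assms by (intro tendsto_powr'[OF n0 tendsto_const]) auto
    then have "((\<lambda>s. norm (stab p s)) \<longlongrightarrow> 0) (at 0)" by (simp add: norm_stab)
    then have "(stab p \<longlongrightarrow> 0) (at 0)" by (rule tendsto_norm_zero_cancel)
    then show ?thesis using True by (simp add: isCont_def stab_def)
  qed (use s continuous_stab in auto)
qed

text \<open>Self-similarity, \<open>dens (stab p) r = r powr (- 1 / p) * D\<close>, leaves the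
  single unknown \<open>D\<close>. The Laplace transform at \<open>v = 1\<close> is
  \<open>D * Gamma (1 - 1 / p)\<close> on the one hand and, by \<open>laplace_dens\<close>, the
  derivative \<open>1 / p\<close> of the inverse power on the other.\<close>

lemma stab_constant:
  assumes p: "1 < p" "p \<le> 2"
  shows "dens (stab p) 1 = 1 / (p * Gamma (1 - 1 / p))"
proof -
  define k where "k = - cos (p * pi / 2)"
  have k: "0 < k"
  proof -
    have "cos ((p - 1) * pi / 2 + pi / 2) = - sin ((p - 1) * pi / 2)" by (simp add: cos_add)
    moreover have "(p - 1) * pi / 2 + pi / 2 = p * pi / 2" by (simp add: algebra_simps add_divide_distrib diff_divide_distrib)
    moreover have "0 < sin ((p - 1) * pi / 2)"
    proof (rule sin_gt_zero)
      show "0 < (p - 1) * pi / 2" using p by simp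
      have "(p - 1) * pi \<le> 1 * pi" using p by (intro mult_right_mono) auto
      then show "(p - 1) * pi / 2 < pi" using pi_gt_zero by linarith
    qed
    ultimately show ?thesis by (simp add: k_def)
  qed
  have Re: "Re (stab p (\<i> * of_real y)) = - (k * \<bar>y\<bar> powr p)" for y :: real
    by (simp add: Re_stab_imag k_def)
  define d where "d s = of_real p * s powr (of_real p - 1)" for s :: complex
  interpret H: half_plane_map "stab p" d 1 1 "1 / 2" p 2
  proof
    show "(stab p has_field_derivative d s) (at s)" if s: "0 < Re s" for s
    proof (rule has_field_derivative_transform_within_open)
      show "((\<lambda>s. s powr (of_real p)) has_field_derivative d s) (at s)"
        unfolding d_def using s by (intro has_field_derivative_powr) (auto simp: complex_nonpos_Reals_iff)
      show "open {s. 0 < Re s}" using open_halfspace_Re_gt[of 0] by simp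
      show "s \<in> {s. 0 < Re s}" using s by simp
      show "z powr of_real p = stab p z" if "z \<in> {s. 0 < Re s}" for z using that by (auto simp: stab_def)
    qed
    show "continuous_on {s. 0 \<le> Re s} (stab p)" using p by (intro continuous_on_stab) auto
    show "0 < Re (d s)" if s: "0 < Re s" for s
    proof -
      have s0: "s \<noteq> 0" using s by auto
      have im: "\<bar>Im (Ln s)\<bar> < pi / 2" using Re_Ln_pos_lt[OF s0] s by simp
      have "d s = of_real p * exp (of_real (p - 1) * Ln s)" using s0 by (simp add: d_def powr_def)
      also have "Re \<dots> = p * (exp ((p - 1) * Re (Ln s)) * cos ((p - 1) * Im (Ln s)))"
        by (simp add: Re_exp del: Re_Ln)
      also have "\<dots> > 0"
      proof -
        \<comment> \<open>Since \<open>p - 1 \<le> 1\<close>, the argument of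
          \<open>s powr (p - 1)\<close> is no larger than that of \<open>s\<close> in absolute value
          and stays below \<open>pi / 2\<close>.\<close>
        have "\<bar>(p - 1) * Im (Ln s)\<bar> \<le> 1 * \<bar>Im (Ln s)\<bar>"
          unfolding abs_mult using p by (intro mult_right_mono) auto
        then have "0 < cos ((p - 1) * Im (Ln s))" using im by (intro cos_gt_zero_pi) auto
        then show ?thesis using p by simp
      qed
      finally show ?thesis .
    qed
    show "Re (stab p (\<i> * of_real x)) \<le> 0" for x using k by (simp add: Re)
    show "1 / 2 * norm s powr p \<le> norm (of_real 1 - stab p s)" if "0 \<le> Re s" "2 \<le> norm s" for s
    proof -
      have "2 powr 1 \<le> norm s powr 1" using that by simp
      also have "\<dots> \<le> norm s powr p" using that p by (intro powr_mono) auto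
      finally have "2 \<le> norm s powr p" by simp
      moreover have "norm (stab p s) - norm (1::complex) \<le> norm (stab p s - 1)" by (rule norm_triangle_ineq2)
      ultimately show ?thesis by (simp add: norm_stab norm_minus_commute)
    qed
    show "stab p (of_real 1) = of_real 1" by (simp add: stab_def)
  qed (use p in auto)
  have "integrable lborel (\<lambda>x. 1 / (1 + k * \<bar>x\<bar> powr p))"
  proof (rule integrable_power_decay[where p = p and K = "max 1 (1 / k)"])
    fix x :: real
    have pos: "0 < 1 + k * \<bar>x\<bar> powr p" using k by (intro add_pos_nonneg mult_nonneg_nonneg) auto
    have "1 / (1 + k * \<bar>x\<bar> powr p) \<le> 1 / 1" by (rule frac_le) (use k in auto)
    then show "norm (1 / (1 + k * \<bar>x\<bar> powr p)) \<le> max 1 (1 / k)" using pos by (simp add: le_max_iff_disj)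
    show "norm (1 / (1 + k * \<bar>x\<bar> powr p)) \<le> max 1 (1 / k) * \<bar>x\<bar> powr - p" if x: "1 \<le> \<bar>x\<bar>"
    proof -
      have "1 / (1 + k * \<bar>x\<bar> powr p) \<le> 1 / (k * \<bar>x\<bar> powr p)"
        using k x by (intro frac_le) auto
      also have "\<dots> = (1 / k) * \<bar>x\<bar> powr - p" by (simp add: powr_minus_divide)
      also have "\<dots> \<le> max 1 (1 / k) * \<bar>x\<bar> powr - p" by (intro mult_right_mono) auto
      finally show ?thesis using pos by simp
    qed
  qed (use p in auto)
  then have int: "integrable lborel (\<lambda>x. 1 / (1 - Re (stab p (\<i> * of_real x))))" by (simp add: Re)
  define D where "D = dens (stab p) 1"
  have scale: "dens (stab p) r = r powr (- 1 / p) * D" if r: "0 < r" for r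
  proof -
    \<comment> \<open>Chosen with \<open>r * a powr p = 1\<close>, so that the substitution
      \<open>x = a * y\<close> absorbs the factor \<open>r\<close>.\<close>
    define a where "a = r powr (- 1 / p)"
    have a: "0 < a" using r by (simp add: a_def)
    have lna: "p * ln a = - ln r" using p r by (simp add: a_def ln_powr)
    have st: "of_real r * stab p (\<i> * of_real (a * y)) = stab p (\<i> * of_real y)" for y :: real
    proof (cases "y = 0")
      case False
      have "stab p (\<i> * of_real (a * y)) = exp (of_real p * (of_real (ln \<bar>a * y\<bar>) + \<i> * of_real (sgn (a * y) * pi / 2)))"
        using False a by (intro stab_imag) auto
      also have "ln \<bar>a * y\<bar> = ln a + ln \<bar>y\<bar>" using False a by (simp add: abs_mult ln_mult)
      also have "sgn (a * y) = sgn y" using a by (simp add: sgn_mult)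
      also have "of_real p * (of_real (ln a + ln \<bar>y\<bar>) + \<i> * of_real (sgn y * pi / 2)) = of_real (p * ln a) + of_real p * (of_real (ln \<bar>y\<bar>) + \<i> * of_real (sgn y * pi / 2))"
        by (simp add: distrib_left)
      also have "exp \<dots> = exp (of_real (- ln r)) * stab p (\<i> * of_real y)"
        unfolding exp_add lna stab_imag[OF False] ..
      also have "exp (of_real (- ln r)) = complex_of_real (inverse r)"
        unfolding exp_of_real using r by (simp add: exp_minus)
      finally show ?thesis using r by simp
    qed (simp add: stab_def)
    have "(\<integral>x. exp (of_real r * stab p (\<i> * of_real x)) \<partial>lborel) = \<bar>a\<bar> *\<^sub>R (\<integral>y. exp (of_real r * stab p (\<i> * of_real (0 + a * y))) \<partial>lborel)"
      using a by (intro lborel_integral_real_affine) auto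
    also have "\<dots> = a *\<^sub>R (\<integral>y. exp (of_real 1 * stab p (\<i> * of_real y)) \<partial>lborel)"
      using a by (simp only: st add_0 abs_of_pos) simp
    finally show ?thesis by (simp add: dens_def D_def a_def)
  qed
  have L: "set_integrable lborel {0<..} (\<lambda>r. exp (- 1 * r) * dens (stab p) r)" "(LINT r:{0<..}|lborel. exp (- 1 * r) * dens (stab p) r) = Re (1 / d (of_real 1))"
    using H.laplace_dens[OF int] .
  have "((\<lambda>t. D * (t powr ((1 - 1 / p) - 1) / exp t)) has_integral D * Gamma (1 - 1 / p)) {0..}"
    using p by (intro has_integral_mult_right Gamma_integral_real) auto
  then have "((\<lambda>t. D * (t powr ((1 - 1 / p) - 1) / exp t)) has_integral D * Gamma (1 - 1 / p)) {0<..}"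
  proof (rule has_integral_spike_set_eq[THEN iffD1, rotated 2])
    show "negligible {x \<in> {0..} - {0<..}. D * (x powr (1 - 1 / p - 1) / exp x) \<noteq> 0}"
      by (rule negligible_subset[of "{0}"]) auto
    show "negligible {x \<in> {0<..} - {0..}. D * (x powr (1 - 1 / p - 1) / exp x) \<noteq> 0}"
      by (rule negligible_subset[of "{0}"]) auto
  qed
  moreover have "D * (t powr ((1 - 1 / p) - 1) / exp t) = exp (- 1 * t) * dens (stab p) t" if "t \<in> {0<..}" for t
    using that scale[of t] by (simp add: exp_minus divide_inverse)
  ultimately have "((\<lambda>t. exp (- 1 * t) * dens (stab p) t) has_integral D * Gamma (1 - 1 / p)) {0<..}"
    by (rule has_integral_eq[rotated])
  then have "(LINT r:{0<..}|lborel. exp (- 1 * r) * dens (stab p) r) = D * Gamma (1 - 1 / p)"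
    using set_borel_integral_eq_integral(2)[OF L(1)] by (simp add: integral_unique)
  moreover have "Re (1 / d (of_real 1)) = 1 / p"
  proof -
    have "1 / d (of_real 1) = complex_of_real (1 / p)" by (simp add: d_def)
    then show ?thesis by (simp only: Re_complex_of_real)
  qed
  ultimately have "D * Gamma (1 - 1 / p) = 1 / p" using L(2) by simp
  moreover have "0 < Gamma (1 - 1 / p)" using p by (intro Gamma_real_pos) simp
  ultimately have "D = 1 / p / Gamma (1 - 1 / p)" by (metis less_irrefl nonzero_eq_divide_eq)
  then show ?thesis by (simp only: D_def divide_divide_eq_left)
qed

text \<open>\<open>tail\<close> restates the limsup condition as a positive lower bound for the
  decay at infinity.\<close>

locale levy_asymp = levy_rv c \<pi> \<gamma> + levy_decay c \<pi> a0 for c \<pi> \<gamma> a0 +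
  assumes tail: "\<exists>\<eta>>0. \<exists>X. \<forall>x\<ge>X. \<eta> \<le> imag_decay x"
begin

lemma rPhi_le:
  assumes "0 \<le> x"
  shows "rPhi x \<le> x * rphi x"
proof -
  have "((\<lambda>_. rphi x) has_integral (x * rphi x)) {0..x}"
    using has_integral_const_real[of "rphi x" 0 x] assms by simp
  from has_integral_le[OF integral_rphi[of 0 x] this] rphi_mono assms show ?thesis by simp
qed

lemma rPhi_superlinear:
  assumes "0 < x" "1 \<le> y"
  shows "y * rPhi x \<le> rPhi (y * x)"
proof -
  have "x \<le> y * x" using assms by simp
  then have "(y * x - x) * rphi x \<le> rPhi (y * x) - rPhi x" using assms by (intro rPhi_diff_ge) auto
  moreover have "(y - 1) * rPhi x \<le> (y - 1) * (x * rphi x)"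
    using rPhi_le[of x] assms by (intro mult_left_mono) auto
  ultimately show ?thesis by (simp add: algebra_simps)
qed

text \<open>A zero at \<open>x\<close> means no drift and \<open>cos (x * y) = 1\<close> for almost
  every jump, so \<open>\<pi>\<close> sits on a lattice. The decay then vanishes at all multiples of
  \<open>x\<close>, in contradiction to \<open>tail\<close>.\<close>

lemma imag_decay_pos:
  assumes x: "0 < x"
  shows "0 < imag_decay x"
proof (rule ccontr)
  assume "\<not> 0 < imag_decay x"
  then have 0: "imag_decay x = 0" using imag_decay_nonneg[of x] by simp
  have nn: "0 \<le> (\<integral>y. (1 - cos (x * y)) / y \<partial>\<pi>)"
    by (rule integral_nonneg_AE, use AE_pos in eventually_elim) auto
  have cn: "0 \<le> c / 2 * x^2" using c_nonneg by simp
  have c0: "c = 0" and I0: "(\<integral>y. (1 - cos (x * y)) / y \<partial>\<pi>) = 0"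
  proof -
    have "c / 2 * x^2 = 0" using 0 nn cn unfolding imag_decay_def by linarith
    then show "c = 0" using x by simp
    show "(\<integral>y. (1 - cos (x * y)) / y \<partial>\<pi>) = 0" using 0 nn cn unfolding imag_decay_def by linarith
  qed
  have "AE y in \<pi>. 0 \<le> (1 - cos (x * y)) / y" using AE_pos by eventually_elim auto
  then have "AE y in \<pi>. (1 - cos (x * y)) / y = 0"
    using integral_nonneg_eq_0_iff_AE[OF integrable_cos[of x]] I0 by simp
  then have AE1: "AE y in \<pi>. cos (x * y) = 1"
    using AE_pos by eventually_elim auto
  have cosk: "cos (real k * t) = 1" if "cos t = 1" for k and t :: real
  proof (induction k)
    case (Suc k)
    have "sin t = 0" using that sin_cos_squared_add[of t] by simp
    then show ?case using Suc that by (simp add: distrib_right cos_add)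
  qed simp
  have z: "imag_decay (real k * x) = 0" for k
  proof -
    have "(\<integral>y. (1 - cos (real k * x * y)) / y \<partial>\<pi>) = (\<integral>y. (0::real) \<partial>\<pi>)"
    proof (rule integral_cong_AE)
      show "AE y in \<pi>. (1 - cos (real k * x * y)) / y = 0"
        using AE1 by eventually_elim (use cosk in \<open>simp add: mult.assoc\<close>)
    qed auto
    then have "(\<integral>y. (1 - cos (real k * x * y)) / y \<partial>\<pi>) = 0" by simp
    moreover have "c / 2 * (real k * x)^2 = 0" using c0 by simp
    ultimately show ?thesis unfolding imag_decay_def by linarith
  qed
  obtain \<eta> X where eX: "0 < \<eta>" "\<And>x. X \<le> x \<Longrightarrow> \<eta> \<le> imag_decay x" using tail by auto
  obtain k :: nat where "X / x < real k" using reals_Archimedean2 by blast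
  then have "X \<le> real k * x" using x by (simp add: divide_less_eq less_imp_le)
  from eX(2)[OF this] z[of k] eX(1) show False by simp
qed

lemma tail_bound:
  assumes x0: "0 < x0"
  shows "\<exists>\<eta>>0. \<forall>x\<ge>x0. \<eta> \<le> imag_decay x"
proof -
  obtain \<eta> X where eX: "0 < \<eta>" "\<And>x. X \<le> x \<Longrightarrow> \<eta> \<le> imag_decay x" using tail by auto
  define Y where "Y = max X x0"
  have "compact {x0..Y}" "{x0..Y} \<noteq> {}" by (auto simp: Y_def)
  then obtain m where m: "m \<in> {x0..Y}" "\<And>x. x \<in> {x0..Y} \<Longrightarrow> imag_decay m \<le> imag_decay x"
    using continuous_attains_inf[of "{x0..Y}" imag_decay] continuous_on_subset[OF continuous_imag_decay] by blast
  have "0 < imag_decay m" using m(1) x0 by (intro imag_decay_pos) auto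
  moreover have "min \<eta> (imag_decay m) \<le> imag_decay x" if "x0 \<le> x" for x
    using eX(2)[of x] m(2)[of x] that by (cases "x \<le> Y") (auto simp: Y_def min_le_iff_disj)
  ultimately show ?thesis using eX(1) by (intro exI[of _ "min \<eta> (imag_decay m)"]) auto
qed

text \<open>By \<open>fn_tendsto\<close> at \<open>\<i>\<close>, Re Phi(i x) / Phi(x) tends to
  cos((gamma + 1) pi / 2) as x tends to 0, which is negative because
  \<open>0 < \<gamma> \<le> 1\<close>; half of its modulus survives near 0. As the convergence is
  sequential, the bound is obtained by contradiction.\<close>

lemma imag_decay_lower: "\<exists>\<kappa>>0. \<exists>x0>0. \<forall>x. 0 < x \<longrightarrow> x \<le> x0 \<longrightarrow> \<kappa> * rPhi x \<le> imag_decay x"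
proof -
  define k where "k = - cos ((\<gamma> + 1) * pi / 2)"
  have k: "0 < k"
  proof -
    have "(\<gamma> + 1) * pi / 2 = \<gamma> * pi / 2 + pi / 2" by (simp add: distrib_right add_divide_distrib)
    moreover have "cos (\<gamma> * pi / 2 + pi / 2) = - sin (\<gamma> * pi / 2)" by (simp add: cos_add)
    ultimately have "k = sin (\<gamma> * pi / 2)" by (simp only: k_def minus_minus)
    moreover have "0 < sin (\<gamma> * pi / 2)"
    proof (rule sin_gt_zero)
      show "0 < \<gamma> * pi / 2" using gamma by simp
      have "\<gamma> * pi \<le> 1 * pi" using gamma by (intro mult_right_mono) auto
      then show "\<gamma> * pi / 2 < pi" using pi_gt_zero by linarith
    qed
    ultimately show ?thesis by simp
  qed
  have "\<exists>x0>0. \<forall>x. 0 < x \<longrightarrow> x \<le> x0 \<longrightarrow> (k / 2) * rPhi x \<le> imag_decay x"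
  proof (rule ccontr)
    assume "\<not> ?thesis"
    then have *: "0 < x0 \<Longrightarrow> \<exists>x. 0 < x \<and> x \<le> x0 \<and> imag_decay x < (k / 2) * rPhi x" for x0
      by (meson not_le)
    have "\<forall>n. \<exists>x. 0 < x \<and> x \<le> 1 / real (Suc n) \<and> imag_decay x < (k / 2) * rPhi x"
      by (intro allI *) simp
    then obtain lam where lam: "\<And>n. 0 < lam n" "\<And>n. lam n \<le> 1 / real (Suc n)" "\<And>n. imag_decay (lam n) < (k / 2) * rPhi (lam n)"
      by metis
    have l0: "lam \<longlonglongrightarrow> 0"
    proof (rule tendsto_sandwich[where f = "\<lambda>_. 0" and h = "\<lambda>n. 1 / real (Suc n)"])
      show "(\<lambda>n. 1 / real (Suc n)) \<longlonglongrightarrow> 0" by real_asymp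
      show "\<forall>\<^sub>F n in sequentially. 0 \<le> lam n" using lam(1) by (intro always_eventually allI less_imp_le)
      show "\<forall>\<^sub>F n in sequentially. lam n \<le> 1 / real (Suc n)" using lam(2) by (intro always_eventually allI)
    qed simp
    have "(\<lambda>n. Re (fn lam n \<i>)) \<longlonglongrightarrow> Re (stab (\<gamma> + 1) \<i>)"
      by (intro tendsto_Re fn_tendsto lam l0) simp
    moreover have "Re (stab (\<gamma> + 1) \<i>) = - k" using Re_stab_imag[of "\<gamma> + 1" 1] by (simp add: k_def)
    moreover have "- (k / 2) \<le> Re (fn lam n \<i>)" for n
    proof -
      have "Re (fn lam n \<i>) = Re (cPhi (\<i> * of_real (lam n))) / rPhi (lam n)"
        unfolding fn_def[OF lam(1) l0] by (simp add: mult.commute Re_divide_of_real)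
      also have "\<dots> = - (imag_decay (lam n) / rPhi (lam n))" by (simp add: Re_cPhi_imag)
      finally show ?thesis using lam(3)[of n] rPhi_pos[OF lam(1)[of n]] by (simp add: divide_le_eq)
    qed
    ultimately have "- (k / 2) \<le> - k" using LIMSEQ_le_const by fastforce
    then show False using k by simp
  qed
  then show ?thesis using k by (intro exI[of _ "k / 2"]) auto
qed

text \<open>The substitution \<open>x = lam n * y\<close>, with the scale fixed by
  \<open>rPhi (lam n) * R n = 1\<close>, turns the exponent into \<open>fn\<close> at
  \<open>\<i> * y\<close>, which converges to \<open>stab\<close>. Only
  \<open>\<bar>x\<bar> \<le> x0\<close> contributes: farther out the integrand is exponentially
  small in \<open>R n\<close>.\<close>

lemma dens_asymp:
  fixes R lam :: "nat \<Rightarrow> real"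
  assumes R: "filterlim R at_top sequentially" and lam: "\<And>n. 0 < lam n" "lam \<longlonglongrightarrow> 0"
    and inv: "\<And>n. rPhi (lam n) * R n = 1"
  shows "(\<lambda>n. dens cPhi (R n) / lam n) \<longlonglongrightarrow> dens (stab (\<gamma> + 1)) 1"
proof -
  obtain \<kappa> x0 where kx: "0 < \<kappa>" "0 < x0" "\<And>x. 0 < x \<Longrightarrow> x \<le> x0 \<Longrightarrow> \<kappa> * rPhi x \<le> imag_decay x"
    using imag_decay_lower by auto
  obtain \<eta> where eta: "0 < \<eta>" "\<And>x. x0 \<le> x \<Longrightarrow> \<eta> \<le> imag_decay x" using tail_bound[OF kx(2)] by auto
  have Rpos: "0 < R n" for n
  proof -
    have "0 < rPhi (lam n)" by (rule rPhi_pos[OF lam(1)])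
    moreover have "0 < rPhi (lam n) * R n" by (simp add: inv)
    ultimately show ?thesis by (simp add: zero_less_mult_iff)
  qed
  define E where "E n x = exp (of_real (R n) * cPhi (\<i> * of_real x))" for n and x :: real
  have [measurable]: "E n \<in> borel_measurable borel" for n unfolding E_def by measurable
  have nE: "norm (E n x) = exp (- (R n * imag_decay x))" for n x by (simp add: E_def Re_cPhi_imag)
  define C where "C = (\<integral>x. exp (- (a0 * imag_decay x)) \<partial>lborel)"
  define I1 where "I1 n = (\<integral>x. indicator {-x0..x0} x *\<^sub>R E n x \<partial>lborel)" for n
  define I2 where "I2 n = (\<integral>x. indicator (- {-x0..x0}) x *\<^sub>R E n x \<partial>lborel)" for n
  have Eint: "integrable lborel (E n)" if "a0 \<le> R n" for n
  proof (rule Bochner_Integration.integrable_bound[OF int_decay])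
    show "AE x in lborel. norm (E n x) \<le> norm (exp (- (a0 * imag_decay x)))"
      using that imag_decay_nonneg by (intro AE_I2) (simp add: nE mult_right_mono)
  qed simp
  have split: "dens cPhi (R n) / lam n = Re (I1 n / of_real (lam n)) / (2 * pi) + Re (I2 n / of_real (lam n)) / (2 * pi)" if "a0 \<le> R n" for n
  proof -
    have "(\<integral>x. E n x \<partial>lborel) = (\<integral>x. indicator {-x0..x0} x *\<^sub>R E n x + indicator (- {-x0..x0}) x *\<^sub>R E n x \<partial>lborel)"
      by (rule Bochner_Integration.integral_cong) (auto simp: indicator_def)
    also have "\<dots> = I1 n + I2 n"
      unfolding I1_def I2_def using Eint[OF that]
      by (intro Bochner_Integration.integral_add integrable_mult_indicator) auto
    finally have "dens cPhi (R n) = Re (I1 n + I2 n) / (2 * pi)" by (simp add: dens_def E_def)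
    then show ?thesis using lam(1)[of n] by (simp add: Re_divide_of_real add_divide_distrib mult.commute)
  qed
  have lim1: "(\<lambda>n. I1 n / of_real (lam n)) \<longlonglongrightarrow> (\<integral>y. exp (stab (\<gamma> + 1) (\<i> * of_real y)) \<partial>lborel)"
  proof -
    have "I1 n / of_real (lam n) = (\<integral>y. indicator {-x0..x0} (lam n * y) *\<^sub>R E n (lam n * y) \<partial>lborel)" for n
    proof -
      have "I1 n = \<bar>lam n\<bar> *\<^sub>R (\<integral>y. indicator {-x0..x0} (0 + lam n * y) *\<^sub>R E n (0 + lam n * y) \<partial>lborel)"
        unfolding I1_def using lam(1)[of n] by (intro lborel_integral_real_affine) auto
      then show ?thesis using lam(1)[of n] by (simp add: scaleR_conv_of_real)
    qed
    moreover have "(\<lambda>n. \<integral>y. indicator {-x0..x0} (lam n * y) *\<^sub>R E n (lam n * y) \<partial>lborel) \<longlonglongrightarrow> (\<integral>y. exp (stab (\<gamma> + 1) (\<i> * of_real y)) \<partial>lborel)"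
    proof (rule integral_dominated_convergence[where w = "\<lambda>y. exp \<kappa> * exp (- (\<kappa> * \<bar>y\<bar>))"])
      have stab_cont: "continuous_on UNIV (\<lambda>y::real. stab (\<gamma> + 1) (\<i> * of_real y))"
        by (rule continuous_on_compose2[OF continuous_on_stab[of "\<gamma> + 1"]]) (use gamma in \<open>auto intro!: continuous_intros\<close>)
      then have [measurable]: "(\<lambda>y::real. stab (\<gamma> + 1) (\<i> * of_real y)) \<in> borel_measurable borel"
        by (rule borel_measurable_continuous_onI)
      show "(\<lambda>y. exp (stab (\<gamma> + 1) (\<i> * complex_of_real y))) \<in> borel_measurable lborel" by measurable
      show "(\<lambda>y. indicator {-x0..x0} (lam n * y) *\<^sub>R E n (lam n * y)) \<in> borel_measurable lborel" for n by measurable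
      show "integrable lborel (\<lambda>y. exp \<kappa> * exp (- (\<kappa> * \<bar>y\<bar>)))"
        by (intro integrable_mult_right integrable_exp_abs kx(1))
      show "AE y in lborel. (\<lambda>n. indicator {-x0..x0} (lam n * y) *\<^sub>R E n (lam n * y)) \<longlonglongrightarrow> exp (stab (\<gamma> + 1) (\<i> * of_real y))"
      proof (rule AE_I2)
        fix y :: real
        have e1: "E n (lam n * y) = exp (fn lam n (\<i> * of_real y))" for n
        proof -
          have "of_real (R n) = 1 / complex_of_real (rPhi (lam n))"
          proof -
            have "R n = 1 / rPhi (lam n)" using inv[of n] rPhi_pos[OF lam(1)[of n]] by (simp add: field_simps)
            then show ?thesis by simp
          qed
          then show ?thesis unfolding E_def fn_def[OF lam] by (simp add: mult_ac)
        qed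
        have l1: "(\<lambda>n. E n (lam n * y)) \<longlonglongrightarrow> exp (stab (\<gamma> + 1) (\<i> * of_real y))"
          unfolding e1 by (intro tendsto_exp fn_tendsto lam) simp
        have "(\<lambda>n. lam n * y) \<longlonglongrightarrow> 0 * y" by (intro tendsto_mult_right lam)
        then have "(\<lambda>n. \<bar>lam n * y\<bar>) \<longlonglongrightarrow> 0" using tendsto_rabs by fastforce
        then have "eventually (\<lambda>n. \<bar>lam n * y\<bar> < x0) sequentially" using kx(2) by (rule order_tendstoD)
        then have "eventually (\<lambda>n. E n (lam n * y) = indicator {-x0..x0} (lam n * y) *\<^sub>R E n (lam n * y)) sequentially"
          by eventually_elim (auto simp: indicator_def)
        from Lim_transform_eventually[OF l1 this]
        show "(\<lambda>n. indicator {-x0..x0} (lam n * y) *\<^sub>R E n (lam n * y)) \<longlonglongrightarrow> exp (stab (\<gamma> + 1) (\<i> * of_real y))" .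
      qed
      show "AE y in lborel. norm (indicator {-x0..x0} (lam n * y) *\<^sub>R E n (lam n * y)) \<le> exp \<kappa> * exp (- (\<kappa> * \<bar>y\<bar>))" for n
      proof (rule AE_I2)
        fix y :: real
        show "norm (indicator {-x0..x0} (lam n * y) *\<^sub>R E n (lam n * y)) \<le> exp \<kappa> * exp (- (\<kappa> * \<bar>y\<bar>))"
        proof (cases "lam n * y \<in> {-x0..x0}")
          case True
          have ab: "lam n * \<bar>y\<bar> \<le> x0" using True lam(1)[of n] by (cases "0 \<le> y") (auto simp: abs_real_def)
          have ev: "imag_decay (lam n * y) = imag_decay (\<bar>y\<bar> * lam n)"
            using imag_decay_even[of "lam n * y"] by (cases "0 \<le> y") (auto simp: abs_real_def mult.commute)
          \<comment> \<open>For \<open>\<bar>y\<bar> \<ge> 1\<close> superlinearity of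
            \<open>rPhi\<close> gives decay linear in \<open>\<bar>y\<bar>\<close>. Subtracting 1
            makes the bound trivial for smaller \<open>y\<close>, at the price of the factor
            \<open>exp \<kappa>\<close>.\<close>
          have "\<kappa> * (\<bar>y\<bar> - 1) \<le> R n * imag_decay (lam n * y)"
          proof (cases "1 \<le> \<bar>y\<bar>")
            case y: True
            have "\<bar>y\<bar> * rPhi (lam n) \<le> rPhi (\<bar>y\<bar> * lam n)" using rPhi_superlinear[OF lam(1) y] .
            then have "R n * (\<kappa> * (\<bar>y\<bar> * rPhi (lam n))) \<le> R n * (\<kappa> * rPhi (\<bar>y\<bar> * lam n))"
              using kx(1) Rpos[of n] by (intro mult_left_mono) auto
            also have "\<dots> \<le> R n * imag_decay (\<bar>y\<bar> * lam n)"
              using kx(3)[of "\<bar>y\<bar> * lam n"] ab y lam(1)[of n] Rpos[of n] by (intro mult_left_mono) (auto simp: mult.commute)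
            also have "R n * (\<kappa> * (\<bar>y\<bar> * rPhi (lam n))) = \<kappa> * \<bar>y\<bar> * (rPhi (lam n) * R n)" by (simp add: mult_ac)
            finally have "\<kappa> * \<bar>y\<bar> \<le> R n * imag_decay (lam n * y)" unfolding inv ev by simp
            then show ?thesis using kx(1) by (simp add: right_diff_distrib)
          next
            case False
            then have "\<kappa> * (\<bar>y\<bar> - 1) \<le> 0" using kx(1) by (simp add: mult_nonneg_nonpos)
            also have "0 \<le> R n * imag_decay (lam n * y)" using Rpos[of n] imag_decay_nonneg by simp
            finally show ?thesis .
          qed
          then have "exp (- (R n * imag_decay (lam n * y))) \<le> exp (\<kappa> + - (\<kappa> * \<bar>y\<bar>))" by (simp add: right_diff_distrib)
          then show ?thesis using True unfolding exp_add by (simp add: nE)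
        qed simp
      qed
    qed
    ultimately show ?thesis by simp
  qed
  \<comment> \<open>Keeping \<open>a0\<close> of the exponent for integrability leaves the factor
    exp(-(R n - a0) eta), while \<open>1 / lam n\<close> grows at most like
    \<open>rphi 1 * R n\<close>.\<close>
  have lim2: "(\<lambda>n. I2 n / of_real (lam n)) \<longlonglongrightarrow> 0"
  proof (rule tendsto_norm_zero_cancel, rule tendsto_sandwich[where f = "\<lambda>_. 0" and h = "\<lambda>n. rphi 1 * C * (R n * exp (- ((R n - a0) * \<eta>)))"])
    have "((\<lambda>r. r * exp (- ((r - a0) * \<eta>))) \<longlongrightarrow> 0) at_top" using eta(1) by real_asymp
    from filterlim_compose[OF this R] have "(\<lambda>n. R n * exp (- ((R n - a0) * \<eta>))) \<longlonglongrightarrow> 0" .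
    from tendsto_mult_left[OF this, of "rphi 1 * C"]
    show "(\<lambda>n. rphi 1 * C * (R n * exp (- ((R n - a0) * \<eta>)))) \<longlonglongrightarrow> 0" by simp
    have ev: "eventually (\<lambda>n. a0 \<le> R n) sequentially" using R by (simp add: filterlim_at_top)
    have ev2: "eventually (\<lambda>n. lam n < 1) sequentially" using lam(2) by (rule order_tendstoD) simp
    show "eventually (\<lambda>n. norm (I2 n / of_real (lam n)) \<le> rphi 1 * C * (R n * exp (- ((R n - a0) * \<eta>)))) sequentially"
      using ev ev2
    proof eventually_elim
      case (elim n)
      have "norm (I2 n) \<le> (\<integral>x. norm (indicator (- {-x0..x0}) x *\<^sub>R E n x) \<partial>lborel)"
        unfolding I2_def by (rule integral_norm_bound)
      also have "\<dots> \<le> (\<integral>x. exp (- ((R n - a0) * \<eta>)) * exp (- (a0 * imag_decay x)) \<partial>lborel)"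
      proof (rule integral_mono)
        show "integrable lborel (\<lambda>x. norm (indicator (- {-x0..x0}) x *\<^sub>R E n x))"
          using Eint[OF elim(1)] by (intro integrable_norm integrable_mult_indicator) auto
        show "integrable lborel (\<lambda>x. exp (- ((R n - a0) * \<eta>)) * exp (- (a0 * imag_decay x)))"
          by (intro integrable_mult_right int_decay)
        fix x :: real
        show "norm (indicator (- {-x0..x0}) x *\<^sub>R E n x) \<le> exp (- ((R n - a0) * \<eta>)) * exp (- (a0 * imag_decay x))"
        proof (cases "x \<in> {-x0..x0}")
          case False
          have "\<eta> \<le> imag_decay \<bar>x\<bar>" using False by (intro eta(2)) auto
          then have "\<eta> \<le> imag_decay x" using imag_decay_even[of x] by (cases "0 \<le> x") auto
          then have "(R n - a0) * \<eta> \<le> (R n - a0) * imag_decay x" using elim(1) by (intro mult_left_mono) auto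
          then have "- (R n * imag_decay x) \<le> - ((R n - a0) * \<eta>) + - (a0 * imag_decay x)" by (simp add: left_diff_distrib)
          then have "exp (- (R n * imag_decay x)) \<le> exp (- ((R n - a0) * \<eta>) + - (a0 * imag_decay x))" by simp
          then show ?thesis using False unfolding exp_add by (simp add: nE)
        qed simp
      qed
      also have "\<dots> = exp (- ((R n - a0) * \<eta>)) * C" unfolding C_def by (rule integral_mult_right_zero)
      finally have b: "norm (I2 n) \<le> exp (- ((R n - a0) * \<eta>)) * C" .
      have "1 = rPhi (lam n) * R n" by (simp add: inv)
      also have "\<dots> \<le> (lam n * rphi (lam n)) * R n" using rPhi_le[of "lam n"] lam(1)[of n] Rpos[of n] by (intro mult_right_mono) auto
      also have "\<dots> \<le> (lam n * rphi 1) * R n" using rphi_mono[of "lam n" 1] lam(1)[of n] elim(2) Rpos[of n] by (intro mult_right_mono mult_left_mono) auto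
      finally have "1 / lam n \<le> rphi 1 * R n" using lam(1)[of n] by (simp add: divide_le_eq mult_ac)
      moreover have "0 \<le> exp (- ((R n - a0) * \<eta>)) * C" using b norm_ge_zero[of "I2 n"] by linarith
      ultimately have "norm (I2 n) * (1 / lam n) \<le> (exp (- ((R n - a0) * \<eta>)) * C) * (rphi 1 * R n)"
        using b lam(1)[of n] by (intro mult_mono) auto
      then show ?case using lam(1)[of n] by (simp add: norm_divide mult_ac)
    qed
  qed auto
  have "(\<lambda>n. Re (I1 n / of_real (lam n)) / (2 * pi) + Re (I2 n / of_real (lam n)) / (2 * pi)) \<longlonglongrightarrow>
      Re (\<integral>y. exp (stab (\<gamma> + 1) (\<i> * of_real y)) \<partial>lborel) / (2 * pi) + Re 0 / (2 * pi)"
    by (intro tendsto_add tendsto_divide tendsto_Re lim1 lim2 tendsto_const) auto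
  then have L: "(\<lambda>n. Re (I1 n / of_real (lam n)) / (2 * pi) + Re (I2 n / of_real (lam n)) / (2 * pi)) \<longlonglongrightarrow> dens (stab (\<gamma> + 1)) 1"
    by (simp add: dens_def)
  have "eventually (\<lambda>n. a0 \<le> R n) sequentially" using R by (simp add: filterlim_at_top)
  then have "eventually (\<lambda>n. Re (I1 n / of_real (lam n)) / (2 * pi) + Re (I2 n / of_real (lam n)) / (2 * pi) = dens cPhi (R n) / lam n) sequentially"
    by eventually_elim (simp only: split)
  from Lim_transform_eventually[OF L this] show ?thesis .
qed

end

section \<open>Laplace's method\<close>

lemma tendsto_at_top_pos_sequentially:
  fixes f :: "real \<Rightarrow> 'b::first_countable_topology"
  assumes "\<And>X. (\<And>n. 0 < X n) \<Longrightarrow> filterlim X at_top sequentially \<Longrightarrow> (\<lambda>n. f (X n)) \<longlonglongrightarrow> L"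
  shows "(f \<longlongrightarrow> L) at_top"
proof (rule tendsto_at_topI_sequentially)
  fix X :: "nat \<Rightarrow> real" assume X: "filterlim X at_top sequentially"
  define Y where "Y n = max (X n) 1" for n
  have ev: "eventually (\<lambda>n. X n = Y n) sequentially"
    using X by (auto simp: filterlim_at_top Y_def max_def elim!: allE[of _ 1] eventually_mono)
  have "filterlim Y at_top sequentially" by (rule filterlim_cong[OF refl refl ev, THEN iffD1, OF X])
  moreover have "0 < Y n" for n by (simp add: Y_def)
  ultimately have lim: "(\<lambda>n. f (Y n)) \<longlonglongrightarrow> L" by (intro assms)
  from ev have "eventually (\<lambda>n. f (Y n) = f (X n)) sequentially" by eventually_elim simp
  with lim show "(\<lambda>n. f (X n)) \<longlonglongrightarrow> L" by (rule Lim_transform_eventually)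
qed

lemma gaussian_integral: "(\<integral>x. exp (- (x^2)) \<partial>lborel) = sqrt pi"
proof -
  define \<sigma> where "\<sigma> = sqrt (1 / 2 :: real)"
  have s: "0 < \<sigma>" "\<sigma>^2 = 1 / 2" by (auto simp: \<sigma>_def)
  have "(\<integral>x. normal_density 0 \<sigma> x \<partial>lborel) = 1" using s by (intro integral_normal_density)
  moreover have "normal_density 0 \<sigma> x = exp (- (x^2)) / sqrt pi" for x
    unfolding normal_density_def s(2) by simp
  ultimately show ?thesis by simp
qed

text \<open>An integrable majorant uniform in \<open>s\<close>. Half of the exponent absorbs the
  singularity of \<open>1 / z\<close>: for \<open>z < 1 / 2\<close> necessarily
  \<open>\<bar>w\<bar> \<ge> 1 / 2\<close>, and exp(-1/(8z)) / z is at most 8. The other half uses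
  \<open>z \<le> 1 + \<bar>w\<bar>\<close> and gives exponential decay in
  \<open>\<bar>w\<bar>\<close>.\<close>

lemma laplace_kernel_bound:
  fixes w z s :: real
  assumes s: "1 \<le> s" and z: "z = 1 + w / s" "0 < z"
  shows "max 1 (1 / z) * exp (- (w^2 / z)) \<le> 8 * exp (1 / 4) * exp (- (1 / 4 * \<bar>w\<bar>))"
proof -
  have ws: "\<bar>w / s\<bar> \<le> \<bar>w\<bar>"
  proof -
    have "\<bar>w\<bar> / s \<le> \<bar>w\<bar> / 1" using s by (intro divide_left_mono) auto
    then show ?thesis using s by (simp add: abs_divide)
  qed
  have zle: "z \<le> 1 + \<bar>w\<bar>" using ws z by linarith
  have A: "max 1 (1 / z) * exp (- (w^2 / (2 * z))) \<le> 8"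
  proof (cases "1 / 2 \<le> z")
    case True
    have "1 / z \<le> 1 / (1 / 2)" by (rule frac_le) (use True in auto)
    then have "max 1 (1 / z) * exp (- (w^2 / (2 * z))) \<le> 2 * 1" using z by (intro mult_mono) auto
    then show ?thesis by simp
  next
    case False
    have "1 / 2 \<le> \<bar>w / s\<bar>" using False z by linarith
    then have "1 / 2 \<le> \<bar>w\<bar>" using ws by linarith
    then have "(1 / 2)^2 \<le> \<bar>w\<bar>^2" by (intro power_mono) auto
    then have w2: "1 / 4 \<le> w^2" by (simp add: power2_eq_square)
    define x where "x = 1 / (8 * z)"
    have "x = (1 / 4) / (2 * z)" by (simp add: x_def)
    also have "\<dots> \<le> w^2 / (2 * z)" using w2 z by (intro divide_right_mono) auto
    finally have "exp (- (w^2 / (2 * z))) \<le> exp (- x)" by simp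
    moreover have "1 \<le> 1 / z" using False z(2) by (simp add: le_divide_eq)
    moreover have "1 / z = 8 * x" by (simp add: x_def)
    moreover have x0: "0 < x" using z by (simp add: x_def)
    moreover have "x * exp (- x) \<le> 1"
    proof -
      have "x \<le> exp x" using exp_ge_add_one_self[of x] by linarith
      then show ?thesis by (simp add: exp_minus field_simps)
    qed
    ultimately have "max 1 (1 / z) * exp (- (w^2 / (2 * z))) \<le> 8 * x * exp (- x)" by (simp add: max_absorb2)
    also have "\<dots> \<le> 8" using \<open>x * exp (- x) \<le> 1\<close> by simp
    finally show ?thesis .
  qed
  have B: "\<bar>w\<bar> / 4 - 1 / 4 \<le> w^2 / (2 * z)"
  proof -
    have "\<bar>w\<bar> / 4 - 1 / 4 \<le> w^2 / (2 * (1 + \<bar>w\<bar>))"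
    proof -
      have "(\<bar>w\<bar> - 1) * (1 + \<bar>w\<bar>) \<le> 2 * w^2" by (simp add: algebra_simps power2_eq_square[symmetric])
      moreover have "0 < 1 + \<bar>w\<bar>" by linarith
      ultimately have "(\<bar>w\<bar> - 1) \<le> 2 * w^2 / (1 + \<bar>w\<bar>)" by (simp only: pos_le_divide_eq)
      then show ?thesis by (simp add: field_simps)
    qed
    also have "\<dots> \<le> w^2 / (2 * z)" using zle z by (intro divide_left_mono) auto
    finally show ?thesis .
  qed
  have "- (w^2 / z) = - (w^2 / (2 * z)) + - (w^2 / (2 * z))" by simp
  then have "exp (- (w^2 / z)) = exp (- (w^2 / (2 * z))) * exp (- (w^2 / (2 * z)))" by (simp only: exp_add)
  then have "max 1 (1 / z) * exp (- (w^2 / z)) = (max 1 (1 / z) * exp (- (w^2 / (2 * z)))) * exp (- (w^2 / (2 * z)))"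
    by (simp only: mult.assoc)
  also have "\<dots> \<le> 8 * exp (1 / 4 + - (1 / 4 * \<bar>w\<bar>))"
    using A B by (intro mult_mono) auto
  finally show ?thesis by (simp only: exp_add mult.assoc)
qed

section \<open>The inverse of Phi and the saddle point\<close>

context levy_asymp
begin

definition psi :: "real \<Rightarrow> real" where "psi v = inv_into {0..} rPhi v"

lemma rPhi_strict_mono:
  assumes "0 \<le> s" "s < t"
  shows "rPhi s < rPhi t"
proof -
  define m where "m = (s + t) / 2"
  have m: "s < m" "m < t" "0 < m" using assms by (auto simp: m_def)
  have "(t - m) * rphi m \<le> rPhi t - rPhi m" using m by (intro rPhi_diff_ge) auto
  moreover have "0 < (t - m) * rphi m" using m rphi_pos[of m] by simp
  moreover have "rPhi s \<le> rPhi m" using m assms by (intro rPhi_mono) auto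
  ultimately show ?thesis by linarith
qed

lemma rPhi_surj:
  assumes "0 \<le> v"
  shows "\<exists>x\<ge>0. rPhi x = v"
proof -
  define b where "b = 1 + v / rPhi 1"
  have r1: "0 < rPhi 1" by (rule rPhi_pos) simp
  have b: "1 \<le> b" using assms r1 by (simp add: b_def)
  have "v \<le> b * rPhi 1" using r1 by (simp add: b_def distrib_right)
  also have "\<dots> \<le> rPhi (b * 1)" using b by (intro rPhi_superlinear) auto
  finally have "v \<le> rPhi b" by simp
  moreover have "continuous_on {0..b} rPhi"
    by (rule continuous_on_subset[OF DERIV_continuous_on[OF rPhi_derivative]]) auto
  ultimately obtain x where "0 \<le> x" "rPhi x = v" using IVT'[of rPhi 0 v b] assms b by auto
  then show ?thesis by blast
qed

lemma psi_facts:
  assumes "0 \<le> v"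
  shows "0 \<le> psi v" "rPhi (psi v) = v"
proof -
  have "v \<in> rPhi ` {0..}" using rPhi_surj[OF assms] by force
  then show "0 \<le> psi v" "rPhi (psi v) = v"
    unfolding psi_def using inv_into_into[of v rPhi "{0..}"] f_inv_into_f[of v rPhi "{0..}"] by auto
qed

lemma psi_pos: "0 < v \<Longrightarrow> 0 < psi v"
  using psi_facts[of v] by (cases "psi v = 0") auto

lemma psi_less_iff:
  assumes "0 \<le> v" "0 \<le> x"
  shows "psi v < x \<longleftrightarrow> v < rPhi x" "x < psi v \<longleftrightarrow> rPhi x < v"
proof -
  have a: "rPhi (psi v) = v" "0 \<le> psi v" using psi_facts[OF assms(1)] by auto
  show "psi v < x \<longleftrightarrow> v < rPhi x"
    using rPhi_strict_mono[OF a(2), of x] rPhi_mono[OF assms(2), of "psi v"] a by (cases "psi v < x") auto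
  show "x < psi v \<longleftrightarrow> rPhi x < v"
    using rPhi_strict_mono[OF assms(2), of "psi v"] rPhi_mono[OF a(2), of x] a by (cases "x < psi v") auto
qed

lemma psi_mono:
  assumes "0 \<le> v" "v \<le> w"
  shows "psi v \<le> psi w"
  using psi_less_iff(1)[of w "psi v"] psi_facts[of v] assms by (cases "psi w < psi v") auto

text \<open>The inverse of a convex function vanishing at 0; convexity is used in the form of
  \<open>rPhi_superlinear\<close> with factor \<open>w / v\<close>.\<close>

lemma psi_concave:
  assumes "0 < v" "v \<le> w"
  shows "(v / w) * psi w \<le> psi v"
proof -
  have w: "0 < psi w" using assms by (intro psi_pos) auto
  have x: "0 < (v / w) * psi w" using assms w by simp
  have "(w / v) * rPhi ((v / w) * psi w) \<le> rPhi ((w / v) * ((v / w) * psi w))"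
    using x assms by (intro rPhi_superlinear) auto
  also have "(w / v) * ((v / w) * psi w) = psi w" using assms by simp
  also have "rPhi (psi w) = w" using assms by (intro psi_facts) auto
  finally have "rPhi ((v / w) * psi w) \<le> v" using assms by (simp add: field_simps)
  then show ?thesis using psi_less_iff(1)[of v "(v / w) * psi w"] x assms by (cases "psi v < (v / w) * psi w") auto
qed

lemma psi_tendsto_0:
  assumes "v \<longlonglongrightarrow> 0" "\<And>n. 0 < v n"
  shows "(\<lambda>n. psi (v n)) \<longlonglongrightarrow> 0"
proof (rule order_tendstoI)
  fix a :: real assume "a < 0"
  then have "a < psi (v n)" for n using psi_pos[OF assms(2)[of n]] by linarith
  then show "eventually (\<lambda>n. a < psi (v n)) sequentially" by simp
next
  fix a :: real assume a: "0 < a"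
  then have "eventually (\<lambda>n. v n < rPhi a) sequentially" using assms(1) rPhi_pos by (intro order_tendstoD) auto
  then show "eventually (\<lambda>n. psi (v n) < a) sequentially"
    by eventually_elim (use psi_less_iff(1) assms(2) a in \<open>auto simp: less_imp_le\<close>)
qed

text \<open>Regular variation passes to the inverse: comparing \<open>psi (l * v n)\<close> with
  \<open>a * lam n\<close> amounts to comparing \<open>l\<close> with rPhi(a lam n) / rPhi(lam n),
  whose limit is \<open>a powr (\<gamma> + 1)\<close>.\<close>

lemma psi_rv:
  assumes v: "v \<longlonglongrightarrow> 0" "\<And>n. 0 < v n" and l: "0 < l"
  shows "(\<lambda>n. psi (l * v n) / psi (v n)) \<longlonglongrightarrow> l powr (1 / (\<gamma> + 1))"
proof -
  define m where "m = l powr (1 / (\<gamma> + 1))"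
  have m: "0 < m" "m powr (\<gamma> + 1) = l" using l gamma by (auto simp: m_def powr_powr)
  define lam where "lam n = psi (v n)" for n
  have lam: "\<And>n. 0 < lam n" "lam \<longlonglongrightarrow> 0"
    unfolding lam_def by (intro psi_pos v) (intro psi_tendsto_0 v)
  have rl: "rPhi (lam n) = v n" for n unfolding lam_def using v(2)[of n] by (intro psi_facts) simp
  have lv: "0 \<le> l * v n" for n using l v(2)[of n] by simp
  have "(\<lambda>n. psi (l * v n) / lam n) \<longlonglongrightarrow> m"
  proof (rule order_tendstoI)
    fix a assume a: "a < m"
    show "eventually (\<lambda>n. a < psi (l * v n) / lam n) sequentially"
    proof (cases "a \<le> 0")
      case True
      have "a < psi (l * v n) / lam n" for n
        using True divide_pos_pos[OF psi_pos lam(1)[of n], of "l * v n"] l v(2)[of n] by simp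
      then show ?thesis by simp
    next
      case False
      have "a powr (\<gamma> + 1) < l" unfolding m(2)[symmetric] using False a gamma by (intro powr_less_mono2) auto
      then have "eventually (\<lambda>n. rPhi (a * lam n) / rPhi (lam n) < l) sequentially"
        using rPhi_ratio[OF lam, of a] False by (intro order_tendstoD) auto
      then show ?thesis
      proof eventually_elim
        case (elim n)
        then have "rPhi (a * lam n) < l * v n" using v(2)[of n] by (simp add: rl divide_less_eq)
        then have "a * lam n < psi (l * v n)" using psi_less_iff(2)[OF lv[of n], of "a * lam n"] False lam(1)[of n] by simp
        then show ?case using lam(1)[of n] by (simp add: less_divide_eq)
      qed
    qed
  next
    fix a assume a: "m < a"
    then have a0: "0 < a" using m by simp
    have "l < a powr (\<gamma> + 1)" unfolding m(2)[symmetric] using m a gamma by (intro powr_less_mono2) auto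
    then have "eventually (\<lambda>n. l < rPhi (a * lam n) / rPhi (lam n)) sequentially"
      using rPhi_ratio[OF lam, of a] a0 by (intro order_tendstoD) auto
    then show "eventually (\<lambda>n. psi (l * v n) / lam n < a) sequentially"
    proof eventually_elim
      case (elim n)
      then have "l * v n < rPhi (a * lam n)" using v(2)[of n] by (simp add: rl less_divide_eq)
      then have "psi (l * v n) < a * lam n" using psi_less_iff(1)[OF lv[of n], of "a * lam n"] a0 lam(1)[of n] by simp
      then show ?case using lam(1)[of n] by (simp add: divide_less_eq)
    qed
  qed
  then show ?thesis by (simp only: lam_def m_def)
qed

definition D :: "real \<Rightarrow> real" where "D r = dens cPhi r / psi (1 / r)"

lemma D_tendsto: "(D \<longlongrightarrow> dens (stab (\<gamma> + 1)) 1) at_top"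
proof (rule tendsto_at_top_pos_sequentially)
  fix X :: "nat \<Rightarrow> real" assume X: "\<And>n. 0 < X n" "filterlim X at_top sequentially"
  have v: "(\<lambda>n. 1 / X n) \<longlonglongrightarrow> 0" using X(2) by (intro real_tendsto_divide_at_top[OF tendsto_const])
  have "(\<lambda>n. dens cPhi (X n) / psi (1 / X n)) \<longlonglongrightarrow> dens (stab (\<gamma> + 1)) 1"
  proof (rule dens_asymp[OF X(2)])
    show "0 < psi (1 / X n)" for n using X(1) by (intro psi_pos) simp
    show "(\<lambda>n. psi (1 / X n)) \<longlonglongrightarrow> 0" using v X(1) by (intro psi_tendsto_0) auto
    show "rPhi (psi (1 / X n)) * X n = 1" for n using psi_facts(2)[of "1 / X n"] X(1)[of n] by simp
  qed
  then show "(\<lambda>n. D (X n)) \<longlonglongrightarrow> dens (stab (\<gamma> + 1)) 1" by (simp add: D_def)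
qed

text \<open>Near infinity \<open>D\<close> converges; on the remaining interval
  \<open>[a0, r2]\<close> the density is at most \<open>dens_bd\<close> and
  \<open>psi (1 / r)\<close> is bounded below by monotonicity.\<close>

lemma D_bounded: "\<exists>D1. \<forall>r\<ge>a0. 0 \<le> D r \<and> D r \<le> D1"
proof -
  define K where "K = dens (stab (\<gamma> + 1)) 1"
  have "eventually (\<lambda>r. D r < K + 1) at_top" using D_tendsto unfolding K_def by (rule order_tendstoD) simp
  then obtain r1 where r1: "\<And>r. r1 \<le> r \<Longrightarrow> D r < K + 1" by (auto simp: eventually_at_top_linorder)
  define r2 where "r2 = max r1 a0"
  have r2: "0 < r2" using a0_pos by (simp add: r2_def)
  have "0 \<le> D r \<and> D r \<le> max (K + 1) (dens_bd / psi (1 / r2))" if r: "a0 \<le> r" for r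
  proof
    have rp: "0 < r" using r a0_pos by simp
    then have pr: "0 < psi (1 / r)" by (intro psi_pos) simp
    show "0 \<le> D r" unfolding D_def using dens_nonneg_a0[OF r] pr by simp
    show "D r \<le> max (K + 1) (dens_bd / psi (1 / r2))"
    proof (cases "r \<le> r2")
      case True
      have "psi (1 / r2) \<le> psi (1 / r)" using True rp r2 by (intro psi_mono divide_left_mono) auto
      moreover have "0 < psi (1 / r2)" using r2 by (intro psi_pos) simp
      ultimately have "D r \<le> dens_bd / psi (1 / r2)"
        unfolding D_def using dens_le[OF r] dens_bd_nonneg by (intro frac_le) auto
      then show ?thesis by simp
    next
      case False
      then have "D r < K + 1" by (intro r1) (simp add: r2_def)
      then show ?thesis by simp
    qed
  qed
  then show ?thesis by blast
qed

text \<open>Monotonicity and concavity of the inverse. The bounds serve twice, as the majorant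
  \<open>max 1 (1 / z)\<close> and as a squeeze when \<open>z\<close> tends to 1.\<close>

lemma psi_ratio_bounds:
  assumes "0 < R" "0 < z"
  shows "psi (1 / (R * z)) / psi (1 / R) \<le> max 1 (1 / z)" "min 1 (1 / z) \<le> psi (1 / (R * z)) / psi (1 / R)"
proof -
  have p: "0 < psi (1 / R)" "0 < psi (1 / (R * z))" using assms by (auto intro!: psi_pos)
  have "psi (1 / (R * z)) / psi (1 / R) \<le> max 1 (1 / z) \<and> min 1 (1 / z) \<le> psi (1 / (R * z)) / psi (1 / R)"
  proof (cases "1 \<le> z")
    case True
    have le: "1 / (R * z) \<le> 1 / R" using True assms by (simp add: field_simps)
    have "psi (1 / (R * z)) \<le> psi (1 / R)" using le assms by (intro psi_mono) auto
    moreover have "(1 / (R * z)) / (1 / R) * psi (1 / R) \<le> psi (1 / (R * z))" using le assms by (intro psi_concave) auto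
    moreover have "(1 / (R * z)) / (1 / R) = 1 / z" using assms by simp
    ultimately have "psi (1 / (R * z)) / psi (1 / R) \<le> 1" "1 / z \<le> psi (1 / (R * z)) / psi (1 / R)"
      using p by (simp_all add: divide_le_eq le_divide_eq)
    then show ?thesis by (simp add: le_max_iff_disj min_le_iff_disj)
  next
    case False
    have le: "1 / R \<le> 1 / (R * z)" using False assms by (simp add: field_simps)
    have "psi (1 / R) \<le> psi (1 / (R * z))" using le assms by (intro psi_mono) auto
    moreover have "(1 / R) / (1 / (R * z)) * psi (1 / (R * z)) \<le> psi (1 / R)" using le assms by (intro psi_concave) auto
    moreover have "(1 / R) / (1 / (R * z)) = z" using assms by simp
    ultimately have "1 \<le> psi (1 / (R * z)) / psi (1 / R)" "psi (1 / (R * z)) / psi (1 / R) \<le> 1 / z"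
      using p assms by (simp_all add: divide_le_eq le_divide_eq mult.commute)
    then show ?thesis by (simp add: le_max_iff_disj min_le_iff_disj)
  qed
  then show "psi (1 / (R * z)) / psi (1 / R) \<le> max 1 (1 / z)" "min 1 (1 / z) \<le> psi (1 / (R * z)) / psi (1 / R)" by auto
qed

text \<open>Laplace's method around the saddle point \<open>R t\<close>: in the variable \<open>r = R t * (1 + w / sqrt (T t))\<close> the
  exponent \<open>- u r - t / r\<close> becomes \<open>- 2 T t - w\<^sup>2 / (1 + w / sqrt (T t))\<close>.\<close>
lemma laplace_method:
  fixes u :: real
  assumes u: "0 < u"
  defines "R \<equiv> \<lambda>t. sqrt (t / u)" and "T \<equiv> \<lambda>t. sqrt (u * t)"
  shows "((\<lambda>t. (LINT r:{a0..}|lborel. exp (- (u * r) - t / r) * dens cPhi r) / (R t / sqrt (T t) * exp (- 2 * T t) * psi (1 / R t)))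
     \<longlongrightarrow> dens (stab (\<gamma> + 1)) 1 * sqrt pi) at_top"
proof -
  define K where "K = dens (stab (\<gamma> + 1)) 1"
  obtain D1 where D1: "\<And>r. a0 \<le> r \<Longrightarrow> 0 \<le> D r \<and> D r \<le> D1" using D_bounded by auto
  define z where "z t w = 1 + w / sqrt (T t)" for t w
  define h where "h t w = indicator {a0..} (R t * z t w) * (exp (- (w^2 / z t w)) * (dens cPhi (R t * z t w) / psi (1 / R t)))" for t w
  have RT: "0 < R t" "0 < T t" "u * R t = T t" "t / R t = T t" "T t * T t = u * t" if t: "0 < t" for t
  proof -
    show "0 < R t" "0 < T t" using u t by (auto simp: R_def T_def)
    define a b where ab: "a = sqrt u" "b = sqrt t"
    have nz: "a \<noteq> 0" "b \<noteq> 0" and su: "u = a * a" "t = b * b" using u t by (auto simp: ab)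
    have Rt: "R t = b / a" and Tt: "T t = a * b" by (auto simp: R_def T_def ab real_sqrt_divide real_sqrt_mult)
    show "u * R t = T t" unfolding Rt Tt su(1) using nz by simp
    show "t / R t = T t" unfolding Rt Tt by (subst su(2)) (simp add: nz)
    show "T t * T t = u * t" using u t by (simp add: T_def)
  qed
  have Tlim: "filterlim (\<lambda>t. sqrt (T t)) at_top at_top" unfolding T_def using u by real_asymp
  have Rlim: "filterlim R at_top at_top" unfolding R_def using u by real_asymp
  have eq: "(LINT r:{a0..}|lborel. exp (- (u * r) - t / r) * dens cPhi r) / (R t / sqrt (T t) * exp (- 2 * T t) * psi (1 / R t)) = (\<integral>w. h t w \<partial>lborel)"
    if t: "0 < t" for t
  proof -
    note rt = RT[OF t]
    define k where "k = R t / sqrt (T t)"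
    have k: "0 < k" using rt by (simp add: k_def)
    have p: "0 < psi (1 / R t)" using rt by (intro psi_pos) simp
    have rz: "R t + k * w = R t * z t w" for w by (simp add: k_def z_def distrib_left)
    have "(LINT r:{a0..}|lborel. exp (- (u * r) - t / r) * dens cPhi r)
      = \<bar>k\<bar> *\<^sub>R (\<integral>w. indicator {a0..} (R t + k * w) *\<^sub>R (exp (- (u * (R t + k * w)) - t / (R t + k * w)) * dens cPhi (R t + k * w)) \<partial>lborel)"
      unfolding set_lebesgue_integral_def using k by (intro lborel_integral_real_affine) auto
    also have "(\<lambda>w. indicator {a0..} (R t + k * w) *\<^sub>R (exp (- (u * (R t + k * w)) - t / (R t + k * w)) * dens cPhi (R t + k * w)))
      = (\<lambda>w. exp (- 2 * T t) * psi (1 / R t) * h t w)"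
    proof (rule ext)
      fix w
      show "indicator {a0..} (R t + k * w) *\<^sub>R (exp (- (u * (R t + k * w)) - t / (R t + k * w)) * dens cPhi (R t + k * w)) = exp (- 2 * T t) * psi (1 / R t) * h t w"
      proof (cases "a0 \<le> R t * z t w")
        case True
        then have "0 < R t * z t w" using a0_pos by simp
        then have zp: "0 < z t w" using rt(1) by (simp add: zero_less_mult_iff)
        have st: "sqrt (T t) * sqrt (T t) = T t" "sqrt (T t) \<noteq> 0" using rt by auto
        \<comment> \<open>Completing the square: with this form of \<open>w\<close>, the exponent is
          T (z + 1/z) = 2 T + w^2 / z.\<close>
        have wz: "w = sqrt (T t) * (z t w - 1)" using st by (simp add: z_def)
        have "w^2 = T t * (z t w - 1)^2"
          using st(1) by (subst wz) (simp add: power_mult_distrib power2_eq_square)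
        also have "(z t w - 1)^2 = z t w * z t w + 1 - 2 * z t w" by (simp add: power2_eq_square algebra_simps)
        finally have A: "w^2 / z t w = T t * (z t w + 1 / z t w - 2)"
          using zp by (simp add: field_simps)
        have B: "u * (R t * z t w) = T t * z t w" using rt(3) by (simp add: mult.assoc[symmetric])
        have C: "t / (R t * z t w) = T t * (1 / z t w)" using rt(4) by (simp add: divide_divide_eq_left[symmetric])
        have ex: "- (u * (R t * z t w)) - t / (R t * z t w) = - 2 * T t + - (w^2 / z t w)"
          unfolding A B C by (simp add: algebra_simps)
        show ?thesis unfolding rz ex exp_add using True p by (simp add: h_def)
      qed (simp add: rz h_def)
    qed
    finally have "(LINT r:{a0..}|lborel. exp (- (u * r) - t / r) * dens cPhi r) = k * (exp (- 2 * T t) * psi (1 / R t) * (\<integral>w. h t w \<partial>lborel))"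
      using k by simp
    then show ?thesis unfolding k_def[symmetric] using k p by simp
  qed
  have "((\<lambda>t. \<integral>w. h t w \<partial>lborel) \<longlongrightarrow> (\<integral>w. K * exp (- (w^2)) \<partial>lborel)) at_top"
  proof (rule integral_dominated_convergence_at_top[where w = "\<lambda>w. D1 * (8 * exp (1 / 4) * exp (- (1 / 4 * \<bar>w\<bar>)))"])
    show "(\<lambda>w. K * exp (- (w^2))) \<in> borel_measurable lborel" by measurable
    show "h t \<in> borel_measurable lborel" for t unfolding h_def z_def by measurable
    show "integrable lborel (\<lambda>w. D1 * (8 * exp (1 / 4) * exp (- (1 / 4 * \<bar>w\<bar>))))"
      by (intro integrable_mult_right integrable_exp_abs) simp
    have evT: "eventually (\<lambda>t. 1 \<le> sqrt (T t)) at_top" using Tlim unfolding filterlim_at_top by blast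
    show "eventually (\<lambda>t. AE w in lborel. norm (h t w) \<le> D1 * (8 * exp (1 / 4) * exp (- (1 / 4 * \<bar>w\<bar>)))) at_top"
      using evT eventually_gt_at_top[of 0]
    proof eventually_elim
      case (elim t)
      note rt = RT[OF elim(2)]
      have D10: "0 \<le> D1" using D1[of a0] by linarith
      show ?case
      proof (rule AE_I2)
        fix w :: real
        show "norm (h t w) \<le> D1 * (8 * exp (1 / 4) * exp (- (1 / 4 * \<bar>w\<bar>)))"
        proof (cases "a0 \<le> R t * z t w")
          case True
          then have rz: "0 < R t * z t w" using a0_pos by simp
          then have zp: "0 < z t w" using rt(1) by (simp add: zero_less_mult_iff)
          have pp: "0 < psi (1 / (R t * z t w))" "0 < psi (1 / R t)" using rz rt by (auto intro!: psi_pos)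
          have d: "dens cPhi (R t * z t w) / psi (1 / R t) = D (R t * z t w) * (psi (1 / (R t * z t w)) / psi (1 / R t))"
            using pp by (simp add: D_def)
          have "dens cPhi (R t * z t w) / psi (1 / R t) \<le> D1 * max 1 (1 / z t w)"
            unfolding d using D1[OF True] psi_ratio_bounds(1)[OF rt(1) zp] pp D10 by (intro mult_mono) auto
          moreover have "0 \<le> dens cPhi (R t * z t w) / psi (1 / R t)" using dens_nonneg_a0[OF True] pp by simp
          moreover have "h t w = exp (- (w^2 / z t w)) * (dens cPhi (R t * z t w) / psi (1 / R t))"
            using True by (simp add: h_def)
          ultimately have "norm (h t w) \<le> exp (- (w^2 / z t w)) * (D1 * max 1 (1 / z t w))"
            by (simp only: real_norm_def abs_mult abs_exp_cancel abs_of_nonneg) (intro mult_left_mono, auto)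
          also have "\<dots> = D1 * (max 1 (1 / z t w) * exp (- (w^2 / z t w)))" by (simp only: mult_ac)
          also have "\<dots> \<le> D1 * (8 * exp (1 / 4) * exp (- (1 / 4 * \<bar>w\<bar>)))"
            using D10 zp by (intro mult_left_mono laplace_kernel_bound[OF elim(1) z_def]) auto
          finally show ?thesis .
        qed (use D10 in \<open>simp add: h_def\<close>)
      qed
    qed
    show "AE w in lborel. ((\<lambda>t. h t w) \<longlongrightarrow> K * exp (- (w^2))) at_top"
    proof (rule AE_I2)
      fix w :: real
      have "((\<lambda>t. 1 + w / sqrt (T t)) \<longlongrightarrow> 1 + 0) at_top"
        by (intro tendsto_add tendsto_const real_tendsto_divide_at_top[OF tendsto_const Tlim])
      then have zlim: "((\<lambda>t. z t w) \<longlongrightarrow> 1) at_top" by (simp add: z_def)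
      have rzlim: "filterlim (\<lambda>t. R t * z t w) at_top at_top"
        by (rule filterlim_at_top_mult_tendsto_pos[OF zlim _ Rlim, unfolded mult.commute[of "z _ w"]]) simp
      have Dl: "((\<lambda>t. D (R t * z t w)) \<longlongrightarrow> K) at_top" unfolding K_def by (rule filterlim_compose[OF D_tendsto rzlim])
      have evz: "eventually (\<lambda>t. 0 < z t w) at_top" using zlim by (rule order_tendstoD) simp
      have iz: "((\<lambda>t. 1 / z t w) \<longlongrightarrow> 1 / 1) at_top" by (intro tendsto_divide tendsto_const zlim) simp
      \<comment> \<open>The argument moves with \<open>t\<close>, so pointwise regular variation
        does not apply; the bounds in \<open>z\<close> squeeze the ratio instead.\<close>
      have pl: "((\<lambda>t. psi (1 / (R t * z t w)) / psi (1 / R t)) \<longlongrightarrow> 1) at_top"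
      proof (rule tendsto_sandwich[where f = "\<lambda>t. min 1 (1 / z t w)" and h = "\<lambda>t. max 1 (1 / z t w)"])
        show "((\<lambda>t. min 1 (1 / z t w)) \<longlongrightarrow> 1) at_top" using tendsto_min[OF tendsto_const[of 1] iz] by simp
        show "((\<lambda>t. max 1 (1 / z t w)) \<longlongrightarrow> 1) at_top" using tendsto_max[OF tendsto_const[of 1] iz] by simp
        show "eventually (\<lambda>t. min 1 (1 / z t w) \<le> psi (1 / (R t * z t w)) / psi (1 / R t)) at_top"
          using evz eventually_gt_at_top[of 0] by eventually_elim (intro psi_ratio_bounds(2) RT)
        show "eventually (\<lambda>t. psi (1 / (R t * z t w)) / psi (1 / R t) \<le> max 1 (1 / z t w)) at_top"
          using evz eventually_gt_at_top[of 0] by eventually_elim (intro psi_ratio_bounds(1) RT)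
      qed
      have "((\<lambda>t. exp (- (w^2 / z t w)) * (D (R t * z t w) * (psi (1 / (R t * z t w)) / psi (1 / R t)))) \<longlongrightarrow> exp (- (w^2 / 1)) * (K * 1)) at_top"
        by (intro tendsto_mult tendsto_exp tendsto_minus tendsto_divide tendsto_const zlim Dl pl) simp
      then have l: "((\<lambda>t. exp (- (w^2 / z t w)) * (D (R t * z t w) * (psi (1 / (R t * z t w)) / psi (1 / R t)))) \<longlongrightarrow> K * exp (- (w^2))) at_top"
        by (simp add: mult.commute)
      have "eventually (\<lambda>t. a0 \<le> R t * z t w) at_top" using rzlim unfolding filterlim_at_top by blast
      then have "eventually (\<lambda>t. exp (- (w^2 / z t w)) * (D (R t * z t w) * (psi (1 / (R t * z t w)) / psi (1 / R t))) = h t w) at_top"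
      proof eventually_elim
        case (elim t)
        then have "0 < R t * z t w" using a0_pos by simp
        then have "0 < psi (1 / (R t * z t w))" by (intro psi_pos) simp
        then show ?case using elim by (simp add: h_def D_def)
      qed
      from Lim_transform_eventually[OF l this] show "((\<lambda>t. h t w) \<longlongrightarrow> K * exp (- (w^2))) at_top" .
    qed
  qed
  also have "(\<integral>w. K * exp (- (w^2)) \<partial>lborel) = K * sqrt pi" using gaussian_integral by simp
  finally have "((\<lambda>t. \<integral>w. h t w \<partial>lborel) \<longlongrightarrow> K * sqrt pi) at_top" .
  moreover have "eventually (\<lambda>t. (\<integral>w. h t w \<partial>lborel) = (LINT r:{a0..}|lborel. exp (- (u * r) - t / r) * dens cPhi r) / (R t / sqrt (T t) * exp (- 2 * T t) * psi (1 / R t))) at_top"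
    using eventually_gt_at_top[of 0] by eventually_elim (simp only: eq)
  ultimately show ?thesis unfolding K_def by (rule Lim_transform_eventually)
qed

end

section \<open>The asymptotics in closed form\<close>

context levy_asymp
begin

text \<open>The width \<open>R t / sqrt (T t)\<close> of the saddle equals
  \<open>t powr (1 / 4) * u powr (- 3 / 4)\<close>, and replacing
  \<open>psi (sqrt u * t powr (- 1 / 2))\<close> by \<open>psi (t powr (- 1 / 2))\<close> costs
  \<open>u powr (1 / (2 * (\<gamma> + 1)))\<close> by \<open>psi_rv\<close>; together these make up
  the power of Phi(q) in \<open>b_coeff\<close>.\<close>

lemma asymptotics:
  assumes q: "0 < q" and F: "\<And>t. 0 < t \<Longrightarrow> G q t \<le> F t" "\<And>t. 0 < t \<Longrightarrow> F t \<le> G q t + exp (- (t / a0))"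
  shows "F \<sim>[at_top] (\<lambda>t. sqrt pi / ((\<gamma> + 1) * Gamma (\<gamma> / (\<gamma> + 1))) * rphi q * rPhi q powr (1 / (2 * (\<gamma> + 1)) - 3 / 4)
    * t powr (1 / 4) * psi (t powr (- 1 / 2)) * exp (- 2 * sqrt (rPhi q * t)))"
proof -
  define u where "u = rPhi q"
  have u: "0 < u" unfolding u_def using q by (rule rPhi_pos)
  define K where "K = dens (stab (\<gamma> + 1)) 1"
  have "1 - 1 / (\<gamma> + 1) = \<gamma> / (\<gamma> + 1)" using gamma by (simp add: field_simps)
  then have K: "K = 1 / ((\<gamma> + 1) * Gamma (\<gamma> / (\<gamma> + 1)))"
    unfolding K_def using stab_constant[of "\<gamma> + 1"] gamma by simp
  define J where "J t = (LINT r:{a0..}|lborel. exp (- (u * r) - t / r) * dens cPhi r)" for t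
  define N where "N t = sqrt (t / u) / sqrt (sqrt (u * t)) * exp (- 2 * sqrt (u * t)) * psi (1 / sqrt (t / u))" for t
  define v where "v t = t powr (- 1 / 2)" for t :: real
  define g where "g t = t powr (1 / 4) * psi (v t) * exp (- 2 * sqrt (u * t))" for t
  define e where "e = u powr (1 / (2 * (\<gamma> + 1)) - 3 / 4)"
  have e: "0 < e" using u by (simp add: e_def)
  have Gq: "G q t = rphi q * J t" for t by (simp add: G_def J_def u_def)
  have Kp: "0 < K" unfolding K using gamma by (intro divide_pos_pos mult_pos_pos Gamma_real_pos) auto
  have vp: "0 < v t" if "0 < t" for t using that by (simp add: v_def)
  have gp: "0 < g t" if "0 < t" for t using that psi_pos[OF vp[OF that]] by (simp add: g_def)
  have N1: "((\<lambda>t. J t / N t) \<longlongrightarrow> K * sqrt pi) at_top"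
    using laplace_method[OF u] by (simp only: K_def J_def N_def)
  have Ng: "u powr (- 3 / 4) * (psi (sqrt u * v t) / psi (v t)) = N t / g t" if t: "0 < t" for t
  proof -
    have "sqrt (t / u) / sqrt (sqrt (u * t)) = t powr (1 / 4) * u powr (- 3 / 4)"
    proof -
      have "sqrt (t / u) / sqrt (sqrt (u * t)) = (t powr (1 / 2) / u powr (1 / 2)) / (u powr (1 / 4) * t powr (1 / 4))"
        using t u by (simp add: powr_half_sqrt[symmetric] powr_divide powr_mult powr_powr)
      also have "\<dots> = (t powr (1 / 2) / t powr (1 / 4)) / (u powr (1 / 2) * u powr (1 / 4))" by (simp add: mult_ac)
      also have "\<dots> = t powr (1 / 4) / u powr (3 / 4)"
        by (simp add: powr_diff[symmetric] powr_add[symmetric])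
      also have "\<dots> = t powr (1 / 4) * u powr (- 3 / 4)" using powr_minus_divide[of u "3 / 4"] by simp
      finally show ?thesis .
    qed
    moreover have "1 / sqrt (t / u) = sqrt u * v t"
    proof -
      have "v t = 1 / sqrt t" unfolding v_def using powr_minus_divide[of t "1 / 2"] t by (simp add: powr_half_sqrt)
      then show ?thesis by (simp add: real_sqrt_divide)
    qed
    ultimately have "N t = t powr (1 / 4) * u powr (- 3 / 4) * exp (- 2 * sqrt (u * t)) * psi (sqrt u * v t)"
      by (simp only: N_def)
    moreover have "t powr (1 / 4) \<noteq> 0" "psi (v t) \<noteq> 0" using t psi_pos[OF vp[OF t]] by auto
    ultimately show ?thesis by (simp add: g_def)
  qed
  have "((\<lambda>t. psi (sqrt u * v t) / psi (v t)) \<longlongrightarrow> (sqrt u) powr (1 / (\<gamma> + 1))) at_top"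
  proof (rule tendsto_at_top_pos_sequentially)
    fix X :: "nat \<Rightarrow> real" assume X: "\<And>n. 0 < X n" "filterlim X at_top sequentially"
    have "(v \<longlongrightarrow> 0) at_top" unfolding v_def by real_asymp
    then have "(\<lambda>n. v (X n)) \<longlonglongrightarrow> 0" using X(2) by (rule filterlim_compose)
    then show "(\<lambda>n. psi (sqrt u * v (X n)) / psi (v (X n))) \<longlonglongrightarrow> (sqrt u) powr (1 / (\<gamma> + 1))"
      using X(1) u by (intro psi_rv vp) auto
  qed
  then have "((\<lambda>t. u powr (- 3 / 4) * (psi (sqrt u * v t) / psi (v t))) \<longlongrightarrow> u powr (- 3 / 4) * (sqrt u) powr (1 / (\<gamma> + 1))) at_top"
    by (intro tendsto_mult tendsto_const)
  moreover have "u powr (- 3 / 4) * (sqrt u) powr (1 / (\<gamma> + 1)) = e"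
  proof -
    have "(sqrt u) powr (1 / (\<gamma> + 1)) = u powr (1 / (2 * (\<gamma> + 1)))"
      using u by (simp add: powr_half_sqrt[symmetric] powr_powr)
    then show ?thesis by (simp add: e_def powr_add[symmetric])
  qed
  moreover have "eventually (\<lambda>t. u powr (- 3 / 4) * (psi (sqrt u * v t) / psi (v t)) = N t / g t) at_top"
    using eventually_gt_at_top[of 0] by eventually_elim (rule Ng)
  ultimately have N2: "((\<lambda>t. N t / g t) \<longlongrightarrow> e) at_top" by (simp only: tendsto_cong)
  define B where "B = sqrt pi / ((\<gamma> + 1) * Gamma (\<gamma> / (\<gamma> + 1))) * rphi q * e"
  have BK: "B = rphi q * (K * sqrt pi * e)" by (simp add: B_def K)
  have B0: "B \<noteq> 0" unfolding BK using Kp e rphi_pos[OF q] by simp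
  have NJ: "rphi q * (J t / N t * (N t / g t)) = G q t / g t" if t: "0 < t" for t
  proof -
    have "0 < N t" unfolding N_def using t u by (intro mult_pos_pos psi_pos divide_pos_pos) auto
    then show ?thesis by (simp add: Gq)
  qed
  have "((\<lambda>t. rphi q * (J t / N t * (N t / g t))) \<longlongrightarrow> B) at_top"
    unfolding BK by (intro tendsto_mult tendsto_const N1 N2)
  moreover have "eventually (\<lambda>t. rphi q * (J t / N t * (N t / g t)) = G q t / g t) at_top"
    using eventually_gt_at_top[of 0] by eventually_elim (rule NJ)
  ultimately have G1: "((\<lambda>t. G q t / g t) \<longlongrightarrow> B) at_top" by (simp only: tendsto_cong)
  \<comment> \<open>Concavity bounds \<open>psi (v t)\<close> below by a multiple of
    \<open>t powr (- 1 / 2)\<close>, so \<open>g\<close> decays no faster than a power of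
    \<open>t\<close> times exp(-2 sqrt(u t)), and exp(-t/a0) is negligible against it.\<close>
  have E: "((\<lambda>t. exp (- (t / a0)) / g t) \<longlongrightarrow> 0) at_top"
  proof (rule tendsto_sandwich[where f = "\<lambda>_. 0" and h = "\<lambda>t. exp (- (t / a0)) / (t powr (1 / 4) * (t powr (- 1 / 2) * psi 1) * exp (- 2 * sqrt (u * t)))"])
    have p1: "0 < psi 1" by (rule psi_pos) simp
    show "((\<lambda>t. exp (- (t / a0)) / (t powr (1 / 4) * (t powr (- 1 / 2) * psi 1) * exp (- 2 * sqrt (u * t)))) \<longlongrightarrow> 0) at_top"
      using p1 a0_pos u by real_asymp
    show "eventually (\<lambda>t. 0 \<le> exp (- (t / a0)) / g t) at_top"
      using eventually_gt_at_top[of 0] by eventually_elim (simp add: gp less_imp_le)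
    show "eventually (\<lambda>t. exp (- (t / a0)) / g t \<le> exp (- (t / a0)) / (t powr (1 / 4) * (t powr (- 1 / 2) * psi 1) * exp (- 2 * sqrt (u * t)))) at_top"
      using eventually_ge_at_top[of 1]
    proof eventually_elim
      case (elim t)
      have "v t \<le> 1" unfolding v_def using elim powr_mono[of "- 1 / 2" 0 t] by simp
      then have "v t * psi 1 \<le> psi (v t)" using psi_concave[of "v t" 1] vp[of t] elim by simp
      then have "t powr (1 / 4) * (v t * psi 1) * exp (- 2 * sqrt (u * t)) \<le> g t"
        unfolding g_def by (intro mult_right_mono mult_left_mono) auto
      moreover have "0 < t powr (1 / 4) * (v t * psi 1) * exp (- 2 * sqrt (u * t))" using elim p1 vp[of t] by simp
      ultimately show ?case unfolding v_def by (intro divide_left_mono) auto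
    qed
  qed simp
  have F1: "((\<lambda>t. F t / g t) \<longlongrightarrow> B) at_top"
  proof (rule tendsto_sandwich[where f = "\<lambda>t. G q t / g t" and h = "\<lambda>t. G q t / g t + exp (- (t / a0)) / g t"])
    show "((\<lambda>t. G q t / g t + exp (- (t / a0)) / g t) \<longlongrightarrow> B) at_top" using tendsto_add[OF G1 E] by simp
    show "eventually (\<lambda>t. G q t / g t \<le> F t / g t) at_top"
      using eventually_gt_at_top[of 0] by eventually_elim (intro divide_right_mono F(1) less_imp_le[OF gp])
    show "eventually (\<lambda>t. F t / g t \<le> G q t / g t + exp (- (t / a0)) / g t) at_top"
      using eventually_gt_at_top[of 0]
      by eventually_elim (unfold add_divide_distrib[symmetric], intro divide_right_mono F(2) less_imp_le[OF gp])
  qed (rule G1)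
  have "((\<lambda>t. F t / g t / B) \<longlongrightarrow> B / B) at_top" by (intro tendsto_divide F1 tendsto_const B0)
  then have "((\<lambda>t. F t / (B * g t)) \<longlongrightarrow> 1) at_top" using B0 by (simp add: mult.commute)
  then have "F \<sim>[at_top] (\<lambda>t. B * g t)" by (rule asymp_equivI')
  then show ?thesis by (simp only: B_def g_def v_def e_def u_def mult.assoc)
qed

end

section \<open>From the stated hypotheses to the working ones\<close>

context levy_data
begin

lemma rphi_tendsto_0:
  assumes s: "s \<longlonglongrightarrow> 0" "\<And>n. 0 \<le> s n" "\<And>n. s n \<le> S"
  shows "(\<lambda>n. rphi (s n)) \<longlonglongrightarrow> 0"
proof -
  have "(\<lambda>n. \<integral>y. (1 - exp (- s n * y)) \<partial>\<pi>) \<longlonglongrightarrow> (\<integral>y. 0 \<partial>\<pi>)"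
  proof (rule integral_dominated_convergence[where w = "\<lambda>y. 1 - exp (- S * y)"])
    show "integrable \<pi> (\<lambda>y. 1 - exp (- S * y))"
      using order_trans[OF s(2,3)] by (rule integrable_one_minus_exp_real)
    show "AE y in \<pi>. (\<lambda>n. 1 - exp (- s n * y)) \<longlonglongrightarrow> 0"
    proof (rule AE_I2)
      fix y
      have "(\<lambda>n. 1 - exp (- s n * y)) \<longlonglongrightarrow> 1 - exp (- 0 * y)"
        by (intro tendsto_diff tendsto_const tendsto_exp tendsto_mult tendsto_minus s(1))
      then show "(\<lambda>n. 1 - exp (- s n * y)) \<longlonglongrightarrow> 0" by simp
    qed
    show "AE y in \<pi>. norm (1 - exp (- s n * y)) \<le> 1 - exp (- S * y)" for n
      using AE_pos
    proof eventually_elim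
      case (elim y)
      have "s n * y \<le> S * y" using elim s(3) by (intro mult_right_mono) auto
      moreover have "0 \<le> s n * y" using elim s(2) by simp
      ultimately show ?case by simp
    qed
  qed measurable
  from tendsto_add[OF tendsto_mult[OF tendsto_const[of c] s(1)] this] show ?thesis by (simp add: rphi_def)
qed

text \<open>As \<open>rphi\<close> tends to 0 at 0, a positive \<open>\<kappa>\<close> would force
  the ratio for the scaling factor 2 to converge to 1, which is less than
  \<open>2 powr \<gamma>\<close>.\<close>

lemma regular_variation_no_killing:
  assumes "0 \<le> \<kappa>" "0 < \<gamma>" and rv: "((\<lambda>x. (\<kappa> + rphi (2 * x)) / (\<kappa> + rphi x)) \<longlongrightarrow> 2 powr \<gamma>) (at_right 0)"
  shows "\<kappa> = 0"
proof (rule ccontr)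
  assume "\<kappa> \<noteq> 0"
  have l0: "(\<lambda>n. 1 / real (Suc n)) \<longlonglongrightarrow> 0" by real_asymp
  have fl: "filterlim (\<lambda>n. 1 / real (Suc n)) (at_right 0) sequentially" by real_asymp
  have a: "(\<lambda>n. rphi (1 / real (Suc n))) \<longlonglongrightarrow> 0" by (rule rphi_tendsto_0[where S = 1, OF l0]) auto
  have b: "(\<lambda>n. rphi (2 * (1 / real (Suc n)))) \<longlonglongrightarrow> 0"
    by (rule rphi_tendsto_0[where S = 2]) (use tendsto_mult[OF tendsto_const[of 2] l0] in \<open>auto simp: divide_le_eq\<close>)
  have "(\<lambda>n. (\<kappa> + rphi (2 * (1 / real (Suc n)))) / (\<kappa> + rphi (1 / real (Suc n)))) \<longlonglongrightarrow> (\<kappa> + 0) / (\<kappa> + 0)"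
    using \<open>\<kappa> \<noteq> 0\<close> by (intro tendsto_divide tendsto_add tendsto_const a b) simp
  moreover have "(\<lambda>n. (\<kappa> + rphi (2 * (1 / real (Suc n)))) / (\<kappa> + rphi (1 / real (Suc n)))) \<longlonglongrightarrow> 2 powr \<gamma>"
    using filterlim_compose[OF rv fl] .
  ultimately have "(\<kappa> + 0) / (\<kappa> + 0) = 2 powr \<gamma>" by (rule LIMSEQ_unique)
  moreover have "2 powr 0 < 2 powr \<gamma>" using assms(2) by (intro powr_less_mono) auto
  ultimately show False using \<open>\<kappa> \<noteq> 0\<close> by simp
qed

text \<open>The decay function is even and nonnegative, so the tail beyond 1 controls its mirror
  image and the integrand is at most 1 in between.\<close>

lemma integrable_exp_imag_decay:
  assumes "0 \<le> a" and fin: "(\<integral>\<^sup>+x\<in>{1..}. ennreal (exp (- (a * imag_decay x))) \<partial>lborel) < \<infinity>"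
  shows "integrable lborel (\<lambda>x. exp (- (a * imag_decay x)))"
proof -
  define f where "f x = exp (- (a * imag_decay x))" for x
  have [measurable]: "f \<in> borel_measurable borel"
    unfolding f_def[abs_def]
    by (intro borel_measurable_continuous_onI continuous_on_exp continuous_on_minus continuous_on_mult continuous_on_const continuous_imag_decay)
  have f: "0 \<le> f x" "f x \<le> 1" "f (- x) = f x" for x
    using assms(1) imag_decay_nonneg[of x] by (auto simp: f_def imag_decay_even)
  have i1: "integrable lborel (\<lambda>x. indicator {1..} x * f x)"
  proof (rule integrableI_bounded)
    have "(\<integral>\<^sup>+x. ennreal (norm (indicator {1..} x * f x)) \<partial>lborel) = (\<integral>\<^sup>+x\<in>{1..}. ennreal (exp (- (a * imag_decay x))) \<partial>lborel)"
      by (intro nn_integral_cong) (auto simp: f_def split: split_indicator)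
    then show "(\<integral>\<^sup>+x. ennreal (norm (indicator {1..} x * f x)) \<partial>lborel) < \<infinity>" using fin by simp
  qed measurable
  have i2: "integrable lborel (\<lambda>x. indicator {1..} (- x) * f (- x))"
    using lborel_integrable_real_affine[OF i1, of "-1" 0] by simp
  have i3: "integrable lborel (indicator {-1..1} :: real \<Rightarrow> real)"
    by (rule integrable_real_indicator) auto
  have i: "integrable lborel (\<lambda>x. indicator {-1..1} x + (indicator {1..} x * f x + indicator {1..} (- x) * f (- x)))"
    by (intro Bochner_Integration.integrable_add i1 i2 i3)
  have "integrable lborel f"
  proof (rule Bochner_Integration.integrable_bound[OF i], measurable, rule AE_I2)
    fix x :: real
    show "norm (f x) \<le> norm (indicator {-1..1} x + (indicator {1..} x * f x + indicator {1..} (- x) * f (- x)))"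
      using f[of x] by (auto split: split_indicator)
  qed
  then show ?thesis by (simp only: f_def[abs_def])
qed

end

text \<open>\<open>exp_neg_mult 0\<close> is the indicator of survival, so the exponent at 0 says
  that the logarithm of the survival probability vanishes. As \<open>ln 0 = 0\<close>, probability 0
  has to be excluded separately: the exponent at \<open>s\<close> would then vanish as well.\<close>

lemma (in subordinator) AE_finite_of_laplace_exponent:
  assumes "laplace_exponent M \<xi> 0 = 0" "0 \<le> s" "laplace_exponent M \<xi> s \<noteq> 0"
  shows "AE \<omega> in M. \<xi> 1 \<omega> < \<infinity>"
proof -
  have [measurable]: "\<xi> 1 \<in> borel_measurable M" by (rule measurable_process) simp
  define f where "f \<omega> = exp_neg_mult 0 (\<xi> 1 \<omega>)" for \<omega>
  have [measurable]: "f \<in> borel_measurable M" unfolding f_def by measurable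
  have f: "0 \<le> f \<omega> \<and> f \<omega> \<le> 1" for \<omega> unfolding f_def by (rule exp_neg_mult_bounds) simp
  have i: "integrable M f" using f by (intro integrable_const_bound[where B = 1]) auto
  have "0 \<le> expectation f" using f by (intro Bochner_Integration.integral_nonneg) auto
  moreover have "ln (expectation f) = 0" using assms(1) by (simp add: laplace_exponent_def f_def[abs_def])
  moreover have "expectation f \<noteq> 0"
  proof
    assume "expectation f = 0"
    then have "AE \<omega> in M. f \<omega> = 0" using integral_nonneg_eq_0_iff_AE[OF i] f by auto
    then have "AE \<omega> in M. exp_neg_mult s (\<xi> 1 \<omega>) = 0"
      by eventually_elim (simp add: f_def exp_neg_mult_def split: if_splits)
    then have "expectation (\<lambda>\<omega>. exp_neg_mult s (\<xi> 1 \<omega>)) = 0" by (rule integral_eq_zero_AE)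
    then show False using assms(3) by (simp add: laplace_exponent_def)
  qed
  ultimately have "expectation f = 1" using ln_eq_zero_iff[of "expectation f"] by linarith
  then have "expectation (\<lambda>\<omega>. 1 - f \<omega>) = 0" using i by (simp add: Bochner_Integration.integral_diff prob_space)
  moreover have "integrable M (\<lambda>\<omega>. 1 - f \<omega>)" using i by simp
  ultimately have "AE \<omega> in M. 1 - f \<omega> = 0" using f integral_nonneg_eq_0_iff_AE[of M "\<lambda>\<omega>. 1 - f \<omega>"] by auto
  then show ?thesis by eventually_elim (auto simp: f_def exp_neg_mult_def less_top split: if_splits)
qed

theorem theorem1p5:
  fixes M :: "'a measure" and \<xi> :: "real \<Rightarrow> 'a \<Rightarrow> ennreal"
    and \<phi> \<Phi> :: "real \<Rightarrow> real" and \<kappa> c \<gamma> q :: real and \<pi> :: "real measure"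
  assumes "subordinator M \<xi>"
    and "\<And>s. 0 \<le> s \<Longrightarrow> \<phi> s = laplace_exponent M \<xi> s"
    and "levy_khintchine \<phi> \<kappa> c \<pi>"
    and "emeasure \<pi> {0<..} > 0"
    and "\<And>s. 0 \<le> s \<Longrightarrow> \<Phi> s = integral {0..s} \<phi>"
    and "0 < \<gamma>" and "\<gamma> \<le> 1"
    and "regularly_varying_at_0 \<phi> \<gamma>"
    and "(\<integral>\<^sup>+x. ennreal (1 / x) \<partial>\<pi>) = \<infinity>"
    and "\<exists>a\<^sub>0>0. (\<integral>\<^sup>+x\<in>{1..}. ennreal (exp (a\<^sub>0 * Re (Phi_imag \<kappa> c \<pi> x))) \<partial>lborel) < \<infinity>"
    and "Limsup at_top (\<lambda>x. ereal (Re (Phi_imag \<kappa> c \<pi> x))) < 0"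
    and "0 < q"
  shows "(\<lambda>t. \<integral>\<omega>. exp_neg_mult q (time_changed \<xi> t \<omega>) \<partial>M) \<sim>[at_top]
         (\<lambda>t. b_coeff \<phi> \<Phi> \<gamma> q * t powr (1 / 4) * inv_into {0..} \<Phi> (t powr (- 1 / 2))
               * exp (- 2 * sqrt (\<Phi> q * t)))"
proof -
  interpret subordinator M \<xi> by fact
  have lk: "0 \<le> \<kappa>" "0 \<le> c" "sets \<pi> = sets borel" "emeasure \<pi> {..0} = 0" "(\<integral>\<^sup>+x. ennreal (min 1 x) \<partial>\<pi>) < \<infinity>"
    "\<And>s. 0 \<le> s \<Longrightarrow> \<phi> s = \<kappa> + c * s + (\<integral>x. (1 - exp (- s * x)) \<partial>\<pi>)"
    using assms(3) by (auto simp: levy_khintchine_def)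
  interpret P: levy_data c \<pi> using lk(2-5) assms(4) by unfold_locales
  have phi_k: "\<phi> s = \<kappa> + P.rphi s" if "0 \<le> s" for s using lk(6)[OF that] by (simp add: P.rphi_def)
  have rv_k: "((\<lambda>x. (\<kappa> + P.rphi (l * x)) / (\<kappa> + P.rphi x)) \<longlongrightarrow> l powr \<gamma>) (at_right 0)" if l: "0 < l" for l
  proof (rule Lim_transform_eventually)
    show "((\<lambda>x. \<phi> (l * x) / \<phi> x) \<longlongrightarrow> l powr \<gamma>) (at_right 0)" using assms(8) l by (simp add: regularly_varying_at_0_def)
    show "eventually (\<lambda>x. \<phi> (l * x) / \<phi> x = (\<kappa> + P.rphi (l * x)) / (\<kappa> + P.rphi x)) (at_right 0)"
      using eventually_at_right_less[of 0] by eventually_elim (use l in \<open>simp add: phi_k\<close>)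
  qed
  have k0: "\<kappa> = 0" by (rule P.regular_variation_no_killing[OF lk(1) assms(6) rv_k]) simp
  have phi: "\<phi> s = P.rphi s" if "0 \<le> s" for s using phi_k[OF that] k0 by simp
  have Re_Phi: "Re (Phi_imag \<kappa> c \<pi> x) = - P.imag_decay x" for x unfolding k0 P.Phi_imag_eq P.Re_cPhi_imag ..
  obtain a0 where a0: "0 < a0" "(\<integral>\<^sup>+x\<in>{1..}. ennreal (exp (a0 * Re (Phi_imag \<kappa> c \<pi> x))) \<partial>lborel) < \<infinity>"
    using assms(10) by auto
  interpret A: levy_asymp c \<pi> \<gamma> a0
  proof unfold_locales
    show "((\<lambda>x. P.rphi (l * x) / P.rphi x) \<longlongrightarrow> l powr \<gamma>) (at_right 0)" if "0 < l" for l using rv_k[OF that] k0 by simp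
    show "integrable lborel (\<lambda>x. exp (- (a0 * P.imag_decay x)))"
      using a0 by (intro P.integrable_exp_imag_decay) (simp_all add: Re_Phi)
    \<comment> \<open>A real strictly between the limsup and 0; its negative serves as the lower
      bound of the decay.\<close>
    obtain y where y: "Limsup at_top (\<lambda>x. ereal (Re (Phi_imag \<kappa> c \<pi> x))) < ereal y" "ereal y < 0"
      using ereal_dense2[OF assms(11)] by auto
    from y(1) have "eventually (\<lambda>x. ereal (Re (Phi_imag \<kappa> c \<pi> x)) < ereal y) at_top" by (rule Limsup_lessD)
    then obtain X where X: "\<And>x. X \<le> x \<Longrightarrow> - P.imag_decay x < y" by (auto simp: eventually_at_top_linorder Re_Phi)
    have "- y \<le> P.imag_decay x" if "X \<le> x" for x using X[OF that] by simp
    moreover have "0 < - y" using y(2) by simp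
    ultimately show "\<exists>\<eta>>0. \<exists>X. \<forall>x\<ge>X. \<eta> \<le> P.imag_decay x" by blast
  qed (use assms(6,7) a0(1) in auto)
  interpret S: levy_subordinator M \<xi> \<phi> c \<pi>
  proof unfold_locales
    show "AE \<omega> in M. \<xi> 1 \<omega> < \<infinity>"
    proof (rule AE_finite_of_laplace_exponent[of 1])
      show "laplace_exponent M \<xi> 0 = 0" using phi[of 0] assms(2)[of 0] by (simp add: P.rphi_def)
      show "laplace_exponent M \<xi> 1 \<noteq> 0" using phi[of 1] assms(2)[of 1] P.rphi_pos[of 1] by simp
    qed simp
  qed (use assms(2) phi in auto)
  have lap: "ennreal a * (\<integral>\<^sup>+t. ennreal (exp (- a * t) * S.F q t) * indicator {0..} t \<partial>lborel) + ennreal (P.rphi q) * P.lapN q a = 1"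
    if "0 < a" for a
    unfolding S.laplace_F[OF that assms(12)] by (rule P.laplace_identity[OF assms(12) that])
  have sandwich: "A.G q t \<le> S.F q t" "S.F q t \<le> A.G q t + exp (- (t / a0))" if "0 < t" for t
    using A.laplace_sandwich[OF assms(12) S.F_measurable _ _ lap that] S.F_bounds[of q] S.F_antimono[of q] assms(12)
    by (auto intro: less_imp_le)
  have Phi: "\<Phi> s = P.rPhi s" if s: "0 \<le> s" for s
  proof -
    have "integral {0..s} \<phi> = integral {0..s} P.rphi" by (rule integral_cong) (simp add: phi)
    then show ?thesis using assms(5)[OF s] integral_unique[OF P.integral_rphi[of 0 s]] s by simp
  qed
  \<comment> \<open>\<open>inv_into {0..}\<close> only looks at values on \<open>{0..}\<close>,
    where \<open>\<Phi>\<close> and \<open>rPhi\<close> agree.\<close>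
  have inv: "inv_into {0..} \<Phi> v = A.psi v" for v
    unfolding A.psi_def inv_into_def using Phi by (intro arg_cong[where f = Eps] ext) auto
  have b: "b_coeff \<phi> \<Phi> \<gamma> q = sqrt pi / ((\<gamma> + 1) * Gamma (\<gamma> / (\<gamma> + 1))) * P.rphi q * P.rPhi q powr (1 / (2 * (\<gamma> + 1)) - 3 / 4)"
    using assms(12) by (simp add: b_coeff_def phi Phi)
  have "S.F q \<sim>[at_top] (\<lambda>t. sqrt pi / ((\<gamma> + 1) * Gamma (\<gamma> / (\<gamma> + 1))) * P.rphi q * P.rPhi q powr (1 / (2 * (\<gamma> + 1)) - 3 / 4)
    * t powr (1 / 4) * A.psi (t powr (- 1 / 2)) * exp (- 2 * sqrt (P.rPhi q * t)))"
    by (rule A.asymptotics[OF assms(12) sandwich])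
  then show ?thesis using assms(12) by (simp only: S.F_def[abs_def] inv b Phi less_imp_le)
qed

end
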